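(* Let $\sigma\in\{1,-1\}$, let $q\in\langle\cdot\rangle^{-2}H^s(\mathbb{C})$ for some $s\in\,]1,2]$, and fix $\epsilon\in\,]0,1]$. With $h=1/|k|$ and the operators $A,B,\mathcal{K}$ (depending on $k\in\mathbb{C}\setminus\{0\}$) defined in the context, one has, as $h\to0$, $$\mathcal{K}=\mathcal{O}(1):\ (\langle\cdot\rangle^{\epsilon}L^2)^2\to(\langle\cdot\rangle^{\epsilon}L^2)^2,\qquad \mathcal{K}^2=\mathcal{O}(h^{s-1}):\ (\langle\cdot\rangle^{\epsilon}L^2)^2\to(\langle\cdot\rangle^{\epsilon}L^2)^2 .$$ For $h_0>0$ small enough and all $k$ with $0<h\le h_0$, the operator $1-\mathcal{K}:(\langle\cdot\rangle^{\epsilon}L^2)^2\to(\langle\cdot\rangle^{\epsilon}L^2)^2$ has a uniformly bounded inverse, $$(1-\mathcal{K})^{-1}=(1-\mathcal{K}^2)^{-1}(1+\mathcal{K})=\begin{pmatrix} (1-AB)^{-1} & 0 \\ 0 & (1-BA)^{-1} \end{pmatrix}\begin{pmatrix} 1 & A \\ B & 1 \end{pmatrix},$$ and for every $(f_1,f_2)\in(\langle\cdot\rangle^{\epsilon-2}L^2)^2$ the system $$\begin{cases}h\overline{\partial}\phi_1-\widehat{\tau}_{-\omega}\frac{hq}{2}\phi_2=f_1,\\ h\partial\phi_2-\sigma\widehat{\tau}_{\omega}\frac{h\overline{q}}{2}\phi_1=f_2\end{cases}$$ has a unique solution $(\phi_1,\phi_2)\in(\langle\cdot\rangle^{\epsilon}L^2)^2$,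 which also satisfies $$\begin{cases}\phi_1-E\widehat{\tau}_{-\omega}\frac{hq}{2}\phi_2=Ef_1,\\ \phi_2-\sigma F\widehat{\tau}_{\omega}\frac{h\overline{q}}{2}\phi_1=Ff_2,\end{cases}$$ and the uniform a priori estimate $$\|(\phi_1,\phi_2)\|_{(\langle\cdot\rangle^{\epsilon}L^2)^2}\le\mathcal{O}(1/h)\,\|(f_1,f_2)\|_{(\langle\cdot\rangle^{\epsilon-2}L^2)^2}.$$
   Context: Notation: $z=x+iy\in\mathbb{C}\simeq\mathbb{R}^2$, $\partial=\frac12(\partial_x-i\partial_y)$, $\overline\partial=\frac12(\partial_x+i\partial_y)$ (in the sense of distributions), $\langle z\rangle=(1+|z|^2)^{1/2}$. For $\theta\in\mathbb{R}$, $\langle\cdot\rangle^\theta L^2=\{\langle z\rangle^\theta u:\ u\in L^2(\mathbb{C})\}$ with norm $\|v\|_{\langle\cdot\rangle^\theta L^2}=\|\langle\cdot\rangle^{-\theta}v\|_{L^2}$. $q\in\langle\cdot\rangle^{-2}H^s(\mathbb{C})$ means that $\langle z\rangle^2q$ belongs to the Sobolev space $H^s(\mathbb{C})=H^s(\mathbb{R}^2)$. For $k\in\mathbb{C}\setminus\{0\}$ put $h=1/|k|$ and $\omega=2i\overline{k}/|k|$, so that $|\omega|=2$ and $kz-\overline{kz}=\frac{i}{h}\mathrm{Re}(z\overline\omega)$. Define $\widehat\tau_{\pm\omega}u(z)=e^{\pm\frac ih\mathrm{Re}(z\overline\omega)}u(z)$. For $v\in\langle\cdot\rangle^{-1}L^2$,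 let $u=Ev$ and $\widetilde u=Fv$ be the unique solutions in $\langle\cdot\rangle L^2$ of $h\overline\partial u=v$ and $h\partial\widetilde u=v$ respectively; explicitly $Ev(z)=\frac{1}{\pi h}\int\frac{v(w)}{z-w}L(dw)$, $Fv(z)=\frac1{\pi h}\int\frac{v(w)}{\overline z-\overline w}L(dw)$. For every $\epsilon\in\,]0,1]$, $E$ and $F$ are bounded from $\langle\cdot\rangle^{\epsilon-2}L^2$ to $\langle\cdot\rangle^{\epsilon}L^2$. Set $$A=E\,\widehat\tau_{-\omega}\frac{hq}{2},\qquad B=\sigma F\,\widehat\tau_{\omega}\frac{h\overline q}{2},\qquad \mathcal K=\begin{pmatrix} 0 & A \\ B & 0 \end{pmatrix},$$ where $q,\overline q$ act as multiplication operators. $\mathcal{O}(\cdot)$ for an operator refers to its operator norm between the indicated spaces; all bounds are uniform in $k$ (i.e. depend only on $q,s,\epsilon$). *)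

theory Defs
  imports "HOL-Analysis.Analysis" "HOL-Library.Function_Algebras"
begin

text \<open>
  Elements of \<open>L\<^sup>2\<close>-type spaces are represented by Borel functions on the complex plane (with
  two-dimensional Lebesgue measure \<open>lborel\<close>); equality of elements is equality almost everywhere.
  Sums and differences of functions, pairs of functions and operators are the pointwise ones
  (\<open>Function_Algebras\<close>, \<open>Product_Plus\<close>).  The \<open>1\<close> of \<open>Function_Algebras\<close> is a constant function, so
  the identity operator is always written \<open>id\<close>; the zero operator is \<open>0\<close>.
\<close>

section \<open>Spaces of classes of functions and operators on them\<close>

record 'a fspace =
  elems :: "'a set"
  nrm :: "'a \<Rightarrow> real"
  eqv :: "'a \<Rightarrow> 'a \<Rightarrow> bool"
  smul :: "complex \<Rightarrow> 'a \<Rightarrow> 'a"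

definition square :: "'a fspace \<Rightarrow> ('a \<times> 'a) fspace" where
  "square X = \<lparr> elems = elems X \<times> elems X,
     nrm = (\<lambda>(u, v). sqrt ((nrm X u)\<^sup>2 + (nrm X v)\<^sup>2)),
     eqv = (\<lambda>(u, v) (u', v'). eqv X u u' \<and> eqv X v v'),
     smul = (\<lambda>c (u, v). (smul X c u, smul X c v)) \<rparr>"

text \<open>A well-defined linear operator on the classes of \<open>X\<close>, of operator norm at most \<open>C\<close>.\<close>

definition bounded_operator :: "('a::plus) fspace \<Rightarrow> ('a \<Rightarrow> 'a) \<Rightarrow> real \<Rightarrow> bool" where
  "bounded_operator X T C \<longleftrightarrow>
     (\<forall>u\<in>elems X. T u \<in> elems X) \<and>
     (\<forall>u\<in>elems X. \<forall>v\<in>elems X. eqv X u v \<longrightarrow> eqv X (T u) (T v)) \<and>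
     (\<forall>u\<in>elems X. \<forall>v\<in>elems X. eqv X (T (u + v)) (T u + T v)) \<and>
     (\<forall>c. \<forall>u\<in>elems X. eqv X (T (smul X c u)) (smul X c (T u))) \<and>
     (\<forall>u\<in>elems X. nrm X (T u) \<le> C * nrm X u)"

definition operator_eq :: "'a fspace \<Rightarrow> ('a \<Rightarrow> 'a) \<Rightarrow> ('a \<Rightarrow> 'a) \<Rightarrow> bool" where
  "operator_eq X S T \<longleftrightarrow> (\<forall>u\<in>elems X. eqv X (S u) (T u))"

definition is_inverse :: "('a::plus) fspace \<Rightarrow> ('a \<Rightarrow> 'a) \<Rightarrow> ('a \<Rightarrow> 'a) \<Rightarrow> bool" where
  "is_inverse X T R \<longleftrightarrow>
     (\<exists>C. bounded_operator X R C) \<and>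
     operator_eq X (T \<circ> R) id \<and> operator_eq X (R \<circ> T) id"

definition op_matrix ::
  "('a \<Rightarrow> 'a) \<Rightarrow> ('a \<Rightarrow> 'a) \<Rightarrow> ('a \<Rightarrow> 'a) \<Rightarrow> ('a \<Rightarrow> 'a) \<Rightarrow> 'a \<times> 'a \<Rightarrow> ('a::plus) \<times> 'a" where
  "op_matrix T11 T12 T21 T22 = (\<lambda>(u, v). (T11 u + T12 v, T21 u + T22 v))"

section \<open>Weighted \<open>L\<^sup>2\<close> spaces\<close>

definition jbracket :: "complex \<Rightarrow> real" where
  "jbracket z = sqrt (1 + (cmod z)\<^sup>2)"

definition L2 :: "(complex \<Rightarrow> complex) set" where
  "L2 = {u \<in> borel_measurable lborel. integrable lborel (\<lambda>z. (cmod (u z))\<^sup>2)}"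

definition L2norm :: "(complex \<Rightarrow> complex) \<Rightarrow> real" where
  "L2norm u = sqrt (LINT z|lborel. (cmod (u z))\<^sup>2)"

definition weight :: "real \<Rightarrow> (complex \<Rightarrow> complex) \<Rightarrow> complex \<Rightarrow> complex" where
  "weight \<theta> u = (\<lambda>z. of_real (jbracket z powr \<theta>) * u z)"

definition wL2 :: "real \<Rightarrow> (complex \<Rightarrow> complex) fspace" where
  "wL2 \<theta> = \<lparr> elems = weight \<theta> ` L2,
     nrm = (\<lambda>v. L2norm (weight (-\<theta>) v)),
     eqv = (\<lambda>u v. AE z in lborel. u z = v z),
     smul = (\<lambda>c u z. c * u z) \<rparr>"

section \<open>Smooth functions, distributional derivatives\<close>

definition dx :: "(complex \<Rightarrow> complex) \<Rightarrow> complex \<Rightarrow> complex" where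
  "dx f z = frechet_derivative f (at z) 1"

definition dy :: "(complex \<Rightarrow> complex) \<Rightarrow> complex \<Rightarrow> complex" where
  "dy f z = frechet_derivative f (at z) \<i>"

definition del :: "(complex \<Rightarrow> complex) \<Rightarrow> complex \<Rightarrow> complex" where
  "del f z = (dx f z - \<i> * dy f z) / 2"

definition delbar :: "(complex \<Rightarrow> complex) \<Rightarrow> complex \<Rightarrow> complex" where
  "delbar f z = (dx f z + \<i> * dy f z) / 2"

text \<open>Differentiability is over the reals (\<open>differentiable_on\<close> is real Frechet differentiability).\<close>

primrec Ck :: "nat \<Rightarrow> (complex \<Rightarrow> complex) \<Rightarrow> bool" where
  "Ck 0 f \<longleftrightarrow> continuous_on UNIV f"
| "Ck (Suc n) f \<longleftrightarrow> f differentiable_on UNIV \<and> Ck n (dx f) \<and> Ck n (dy f)"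

definition Cinf :: "(complex \<Rightarrow> complex) set" where
  "Cinf = {f. \<forall>n. Ck n f}"

definition test_functions :: "(complex \<Rightarrow> complex) set" where
  "test_functions = {\<eta> \<in> Cinf. compact (closure (support_on UNIV \<eta>))}"

type_synonym functional = "(complex \<Rightarrow> complex) \<Rightarrow> complex"

definition distr :: "(complex \<Rightarrow> complex) \<Rightarrow> functional" where
  "distr u \<eta> = (LINT z|lborel. u z * \<eta> z)"

definition distr_del :: "functional \<Rightarrow> functional" where
  "distr_del T \<eta> = - T (del \<eta>)"

definition distr_delbar :: "functional \<Rightarrow> functional" where
  "distr_delbar T \<eta> = - T (delbar \<eta>)"

section \<open>Sobolev spaces\<close>

definition schwartz :: "(complex \<Rightarrow> complex) set" where
  "schwartz = {\<phi> \<in> Cinf. \<forall>N m n. \<exists>C. \<forall>z. jbracket z ^ N * cmod ((dx ^^ m) ((dy ^^ n) \<phi>) z) \<le> C}"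

definition fourier :: "(complex \<Rightarrow> complex) \<Rightarrow> complex \<Rightarrow> complex" where
  "fourier \<phi> \<zeta> = (LINT z|lborel. exp (- \<i> * of_real (z \<bullet> \<zeta>)) * \<phi> z)"

text \<open>
  For \<open>s \<ge> 0\<close> the elements of \<open>H\<^sup>s\<close> are \<open>L\<^sup>2\<close> functions \<open>u\<close>; \<open>g\<close> below is the Fourier transform
  of \<open>u\<close> as a tempered distribution, and \<open>g \<in> \<langle>\<cdot>\<rangle>\<^bsup>-s\<^esup> L\<^sup>2\<close>.
\<close>

definition sobolev :: "real \<Rightarrow> (complex \<Rightarrow> complex) set" where
  "sobolev s = {u \<in> L2. \<exists>g \<in> elems (wL2 (-s)).
     \<forall>\<phi>\<in>schwartz. (LINT \<zeta>|lborel. u \<zeta> * fourier \<phi> \<zeta>) = (LINT \<zeta>|lborel. g \<zeta> * \<phi> \<zeta>)}"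

section \<open>The operators\<close>

definition hpar :: "complex \<Rightarrow> real" where
  "hpar k = 1 / cmod k"

definition omega :: "complex \<Rightarrow> complex" where
  "omega k = 2 * \<i> * cnj k / of_real (cmod k)"

definition tau_plus :: "complex \<Rightarrow> (complex \<Rightarrow> complex) \<Rightarrow> complex \<Rightarrow> complex" where
  "tau_plus k u z = exp (\<i> / of_real (hpar k) * of_real (Re (z * cnj (omega k)))) * u z"

definition tau_minus :: "complex \<Rightarrow> (complex \<Rightarrow> complex) \<Rightarrow> complex \<Rightarrow> complex" where
  "tau_minus k u z = exp (- (\<i> / of_real (hpar k) * of_real (Re (z * cnj (omega k))))) * u z"

text \<open>
  On \<open>\<langle>\<cdot>\<rangle>\<^bsup>-1\<^esup> L\<^sup>2\<close> the integrals below converge absolutely for almost every \<open>z\<close>; on the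
  remaining null set the library integral has the irrelevant value \<open>0\<close>.
\<close>

definition opE :: "complex \<Rightarrow> (complex \<Rightarrow> complex) \<Rightarrow> complex \<Rightarrow> complex" where
  "opE k v z = 1 / of_real (pi * hpar k) * (LINT w|lborel. v w / (z - w))"

definition opF :: "complex \<Rightarrow> (complex \<Rightarrow> complex) \<Rightarrow> complex \<Rightarrow> complex" where
  "opF k v z = 1 / of_real (pi * hpar k) * (LINT w|lborel. v w / (cnj z - cnj w))"

definition potA :: "(complex \<Rightarrow> complex) \<Rightarrow> complex \<Rightarrow> (complex \<Rightarrow> complex) \<Rightarrow> complex \<Rightarrow> complex" where
  "potA q k u = tau_minus k (\<lambda>z. of_real (hpar k) * q z / 2 * u z)"

definition potB :: "(complex \<Rightarrow> complex) \<Rightarrow> complex \<Rightarrow> (complex \<Rightarrow> complex) \<Rightarrow> complex \<Rightarrow> complex" where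
  "potB q k u = tau_plus k (\<lambda>z. of_real (hpar k) * cnj (q z) / 2 * u z)"

definition opA :: "(complex \<Rightarrow> complex) \<Rightarrow> complex \<Rightarrow> (complex \<Rightarrow> complex) \<Rightarrow> complex \<Rightarrow> complex" where
  "opA q k u = opE k (potA q k u)"

definition opB ::
  "complex \<Rightarrow> (complex \<Rightarrow> complex) \<Rightarrow> complex \<Rightarrow> (complex \<Rightarrow> complex) \<Rightarrow> complex \<Rightarrow> complex" where
  "opB \<sigma> q k u = (\<lambda>z. \<sigma> * opF k (potB q k u) z)"

definition opK ::
  "complex \<Rightarrow> (complex \<Rightarrow> complex) \<Rightarrow> complex \<Rightarrow>
   (complex \<Rightarrow> complex) \<times> (complex \<Rightarrow> complex) \<Rightarrow> (complex \<Rightarrow> complex) \<times> (complex \<Rightarrow> complex)" where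
  "opK \<sigma> q k = op_matrix 0 (opA q k) (opB \<sigma> q k) 0"

text \<open>\<open>T k = O(g(h))\<close> on \<open>X\<close> as \<open>h = 1/|k| \<rightarrow> 0\<close>, uniformly in \<open>k\<close>.\<close>

definition op_bigo :: "('a::plus) fspace \<Rightarrow> (complex \<Rightarrow> 'a \<Rightarrow> 'a) \<Rightarrow> (real \<Rightarrow> real) \<Rightarrow> bool" where
  "op_bigo X T g \<longleftrightarrow> (\<exists>C. \<exists>h1>0. \<forall>k. 0 < hpar k \<and> hpar k \<le> h1 \<longrightarrow>
     bounded_operator X (T k) (C * g (hpar k)))"

section \<open>The systems\<close>

text \<open>The differential system, in the sense of distributions.\<close>

definition solves_system ::
  "complex \<Rightarrow> (complex \<Rightarrow> complex) \<Rightarrow> complex \<Rightarrow>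
   (complex \<Rightarrow> complex) \<times> (complex \<Rightarrow> complex) \<Rightarrow> (complex \<Rightarrow> complex) \<times> (complex \<Rightarrow> complex) \<Rightarrow> bool" where
  "solves_system \<sigma> q k = (\<lambda>(f1, f2) (\<phi>1, \<phi>2). \<forall>\<eta>\<in>test_functions.
     of_real (hpar k) * distr_delbar (distr \<phi>1) \<eta> - distr (potA q k \<phi>2) \<eta> = distr f1 \<eta> \<and>
     of_real (hpar k) * distr_del (distr \<phi>2) \<eta> - \<sigma> * distr (potB q k \<phi>1) \<eta> = distr f2 \<eta>)"

definition solves_integral_system ::
  "complex \<Rightarrow> (complex \<Rightarrow> complex) \<Rightarrow> complex \<Rightarrow>
   (complex \<Rightarrow> complex) \<times> (complex \<Rightarrow> complex) \<Rightarrow> (complex \<Rightarrow> complex) \<times> (complex \<Rightarrow> complex) \<Rightarrow> bool" where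
  "solves_integral_system \<sigma> q k = (\<lambda>(f1, f2) (\<phi>1, \<phi>2).
     (AE z in lborel. \<phi>1 z - opA q k \<phi>2 z = opE k f1 z) \<and>
     (AE z in lborel. \<phi>2 z - opB \<sigma> q k \<phi>1 z = opF k f2 z))"

end

theory Submission
  imports Defs "HOL-Probability.Probability"
begin

text \<open>
  Up to a constant \<open>A B u\<close> is \<open>\<partial>\<bar>\<^sup>-\<^sup>1 (e q \<partial>\<^sup>-\<^sup>1 w)\<close>, where \<open>e\<close> is unimodular with frequency of modulus \<open>2 / h\<close>
  and \<open>w\<close> is bounded by \<open>u\<close>.  Since \<open>s > 1\<close>, the Fourier transform \<open>g\<close> of \<open>\<langle>z\<rangle>\<^sup>2 q\<close> is integrable, and the
  part of \<open>\<langle>z\<rangle>\<^sup>2 q\<close> with frequencies above \<open>1 / h\<close> has sup norm \<open>O(h\<^bsup>s - 1\<^esup>)\<close>.  The part with frequencies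
  at most \<open>1 / h\<close>, multiplied by \<open>e\<close>, equals \<open>\<partial>\<bar> V\<close> with \<open>sup |V| = O(h)\<close>, and
  \<open>\<partial>\<bar>\<^sup>-\<^sup>1 ((\<partial>\<bar> V) f) = V f - \<partial>\<bar>\<^sup>-\<^sup>1 (V \<partial>\<bar> f)\<close> for \<open>f = \<langle>z\<rangle>\<^sup>-\<^sup>2 \<partial>\<^sup>-\<^sup>1 w\<close>, where \<open>\<partial>\<bar> f\<close> is controlled by an
  energy identity.  Hence \<open>A B\<close> and, by complex conjugation, \<open>B A\<close> have norm \<open>O(h\<^bsup>s - 1\<^esup>)\<close>, and Neumann
  series invert \<open>1 - A B\<close>, \<open>1 - B A\<close> and \<open>1 - K\<close>.  The differential and the integral system have the
  same solutions because \<open>\<partial>\<bar> W = 0\<close> has only the zero solution in \<open>\<langle>z\<rangle> L\<^sup>2\<close>.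
\<close>

section \<open>Integration in the plane\<close>

text \<open>Neither \<open>A\<close> nor \<open>B\<close> becomes small by itself: the factor h of
  the potential cancels the 1 / h of \<open>E\<close> and \<open>F\<close>, and \<open>u\<close> may
  oscillate so as to undo the phase. In A B the inner transform supplies the one derivative that an
  integration by parts against the phase consumes. The cut at 1 / h is half the frequency 2 / h of
  the phase, so low frequencies never cancel it. The rate s - 1 is the Cauchy-Schwarz tail of <z>^-s
  in two dimensions, and s <= 2 makes the O(h) of the low part no worse. The obstacle is the
  Beurling transform, an isometry of L2 without weight, while the estimate lives in <z>^(\<epsilon>
  - 2) L2. Measuring <z>^-2 times a derivative there is measuring <z>^-\<epsilon> times it in L2,
  which dictates the weight in the energy identity; the commutators are bounded by the Cauchy
  transform itself. The identity is applied to test functions, and density suffices because the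
  final bound contains sup |V| but no derivative of V. Spaces are kept as sets of functions with an
  equivalence, so operator laws, including those of the Neumann series, are proved up to null
  functions.\<close>

lemma distr_lborel_reflect:
  fixes z :: "'a::euclidean_space"
  shows "Measure_Space.distr lborel borel (\<lambda>w. z - w) = lborel"
proof -
  have "density (Measure_Space.distr lborel borel (\<lambda>x. z + (-1) *\<^sub>R x)) (\<lambda>_. \<bar>-1::real\<bar>^DIM('a)) = (lborel :: 'a measure)"
    by (rule lborel_affine[symmetric]) simp
  then show ?thesis by (simp add: density_1)
qed

lemma distr_lborel_translate:
  fixes z :: "'a::euclidean_space"
  shows "Measure_Space.distr lborel borel (\<lambda>w. w + z) = lborel"
proof -
  have "(\<lambda>w. w + z) = (+) z" by (simp add: fun_eq_iff add.commute)
  then show ?thesis using lborel_distr_plus[of z] by simp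
qed

lemma nn_integral_reflect:
  fixes z :: "'a::euclidean_space"
  assumes [measurable]: "f \<in> borel_measurable borel"
  shows "(\<integral>\<^sup>+w. f (z - w) \<partial>lborel) = (\<integral>\<^sup>+w. f w \<partial>lborel)"
proof -
  have "(\<integral>\<^sup>+w. f w \<partial>Measure_Space.distr lborel borel (\<lambda>w. z - w)) = (\<integral>\<^sup>+w. f (z - w) \<partial>lborel)"
    by (rule nn_integral_distr) auto
  then show ?thesis by (simp add: distr_lborel_reflect)
qed

text \<open>The discs {|z|^2 < s} have area pi s, linear in s; hence the squared radius has the
  constant density pi and radial integrals acquire no Jacobian. The half-lines \<open>{..<s}\<close>
  generate the Borel sets and are stable under intersection, so agreement on them suffices.\<close>

lemma distr_norm_square:
  "Measure_Space.distr lborel borel (\<lambda>z::complex. (cmod z)\<^sup>2) = density lborel (\<lambda>s. ennreal pi * indicator {0..} s)"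
    (is "?M = ?N")
proof (rule measure_eqI_generator_eq)
  let ?E = "range (\<lambda>s::real. {..<s})"
  have em: "emeasure ?M {..<s} = ennreal (pi * max 0 s)" for s
  proof -
    have "emeasure ?M {..<s} = emeasure lborel {z::complex. (cmod z)\<^sup>2 < s}"
      by (subst emeasure_distr) (simp_all add: vimage_def)
    also have "\<dots> = ennreal (pi * max 0 s)"
    proof (cases "s > 0")
      case True
      then have "(cmod z)\<^sup>2 < s \<longleftrightarrow> cmod z < sqrt s" for z
        using real_sqrt_less_iff[of "(cmod z)\<^sup>2" s] by simp
      then have "{z. (cmod z)\<^sup>2 < s} = {z. cmod z < sqrt s}"
        by (simp only:)
      also have "\<dots> = ball 0 (sqrt s)"
        by (simp add: ball_def)
      finally have "{z. (cmod z)\<^sup>2 < s} = ball 0 (sqrt s)" .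
      then show ?thesis using True by (simp add: emeasure_ball unit_ball_vol_2)
    next
      case False
      have "\<not> (cmod z)\<^sup>2 < s" for z
        using False zero_le_power2[of "cmod z"] by linarith
      then have "{z::complex. (cmod z)\<^sup>2 < s} = {}"
        by simp
      then show ?thesis using False by simp
    qed
    finally show ?thesis .
  qed
  have en: "emeasure ?N {..<s} = ennreal (pi * max 0 s)" for s
  proof -
    have "emeasure ?N {..<s} = (\<integral>\<^sup>+x. ennreal pi * indicator {0..<s} x \<partial>lborel)"
      by (subst emeasure_density) (auto intro!: nn_integral_cong split: split_indicator)
    also have "\<dots> = ennreal pi * emeasure lborel {0..<s}"
      by (simp add: nn_integral_cmult)
    also have "\<dots> = ennreal (pi * max 0 s)"
      by (cases "s \<ge> 0") (auto simp: ennreal_mult max_def)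
    finally show ?thesis .
  qed
  show "Int_stable ?E"
  proof (rule Int_stableI)
    fix X Y assume "X \<in> ?E" "Y \<in> ?E"
    then obtain a b where "X = {..<a}" "Y = {..<b}" by auto
    then have "X \<inter> Y = {..<min a b}" by auto
    then show "X \<inter> Y \<in> ?E" by simp
  qed
  show "?E \<subseteq> Pow UNIV" by simp
  show "emeasure ?M X = emeasure ?N X" if "X \<in> ?E" for X
    using that em en by auto
  show "sets ?M = sigma_sets UNIV ?E"
    by (simp add: borel_Iio)
  show "sets ?N = sigma_sets UNIV ?E"
    by (simp add: borel_Iio)
  show "range (\<lambda>n::nat. {..<real n}) \<subseteq> ?E" by auto
  show "(\<Union>n::nat. {..<real n}) = UNIV"
    by (simp add: set_eq_iff reals_Archimedean2)
  show "emeasure ?M {..<real i} \<noteq> \<infinity>" for i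
    using em by simp
qed

lemma nn_integral_radial:
  assumes [measurable]: "f \<in> borel_measurable borel"
  shows "(\<integral>\<^sup>+z. f ((cmod z)\<^sup>2) \<partial>lborel) = ennreal pi * (\<integral>\<^sup>+s. f s * indicator {0..} s \<partial>lborel)"
proof -
  have "(\<integral>\<^sup>+z. f ((cmod z)\<^sup>2) \<partial>lborel) = (\<integral>\<^sup>+s. f s \<partial>Measure_Space.distr lborel borel (\<lambda>z::complex. (cmod z)\<^sup>2))"
    by (rule nn_integral_distr[symmetric]) auto
  also have "\<dots> = (\<integral>\<^sup>+s. ennreal pi * indicator {0..} s * f s \<partial>lborel)"
    unfolding distr_norm_square by (rule nn_integral_density) auto
  also have "\<dots> = ennreal pi * (\<integral>\<^sup>+s. f s * indicator {0..} s \<partial>lborel)"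
    by (subst nn_integral_cmult[symmetric]) (auto intro!: nn_integral_cong simp: mult_ac)
  finally show ?thesis .
qed

section \<open>The weight <z> and integrals of its powers\<close>

lemma jbracket_ge_1: "1 \<le> jbracket z"
  by (simp add: jbracket_def)

lemma jbracket_pos [simp]: "0 < jbracket z"
  using jbracket_ge_1[of z] by linarith

lemma jbracket_nonneg [simp]: "0 \<le> jbracket z"
  using jbracket_pos[of z] by linarith

lemma jbracket_nonzero [simp]: "jbracket z \<noteq> 0"
  using jbracket_pos[of z] by linarith

lemma jbracket_square: "(jbracket z)\<^sup>2 = 1 + (cmod z)\<^sup>2"
  by (simp add: jbracket_def)

lemma jbracket_powr: "jbracket z powr a = (1 + (cmod z)\<^sup>2) powr (a / 2)"
proof -
  have "0 < 1 + (cmod z)\<^sup>2" by (simp add: add_pos_nonneg)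
  then show ?thesis
    unfolding jbracket_def by (simp add: powr_half_sqrt[symmetric] powr_powr)
qed

lemma continuous_jbracket [continuous_intros]: "continuous_on S jbracket"
  unfolding jbracket_def by (intro continuous_intros)

lemma measurable_jbracket [measurable]: "jbracket \<in> borel_measurable borel"
  by (intro borel_measurable_continuous_onI continuous_intros)

lemma norm_le_jbracket: "cmod z \<le> jbracket z"
  by (simp add: jbracket_def real_le_rsqrt)

lemma jbracket_le: "jbracket z \<le> 1 + cmod z"
  unfolding jbracket_def by (rule real_le_lsqrt) (auto simp: power2_eq_square algebra_simps)

lemma jbracket_cnj [simp]: "jbracket (cnj z) = jbracket z"
  and jbracket_uminus [simp]: "jbracket (- z) = jbracket z"
  by (simp_all add: jbracket_def)

lemma jbracket_triangle: "jbracket z \<le> jbracket w + cmod (z - w)"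
proof -
  have "jbracket z = norm (1::real, z)" "jbracket w = norm (1::real, w)"
    by (simp_all add: jbracket_def norm_Pair)
  moreover have "cmod (z - w) = norm ((1::real, z) - (1, w))"
    by (simp add: norm_Pair)
  ultimately show ?thesis
    by (metis norm_triangle_sub)
qed

text \<open>Both brackets on the right are at least 1, so their sum is at most twice their
  product.\<close>

lemma jbracket_Peetre: "jbracket z \<le> 2 * jbracket w * jbracket (z - w)"
proof -
  have "jbracket z \<le> jbracket w + jbracket (z - w)"
    using jbracket_triangle[of z w] norm_le_jbracket[of "z - w"] by linarith
  also have "\<dots> \<le> 2 * (jbracket w * jbracket (z - w))"
  proof -
    have "jbracket w * 1 \<le> jbracket w * jbracket (z - w)" "1 * jbracket (z - w) \<le> jbracket w * jbracket (z - w)"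
      by (intro mult_mono; simp add: jbracket_ge_1)+
    then show ?thesis by linarith
  qed
  finally show ?thesis by simp
qed

lemma jbracket_powr_le_1: "a \<le> 0 \<Longrightarrow> jbracket z powr a \<le> 1"
  using powr_mono[of a 0 "jbracket z"] jbracket_ge_1[of z] by simp

lemma jbracket_powr_mono: "a \<le> b \<Longrightarrow> jbracket z powr a \<le> jbracket z powr b"
  by (rule powr_mono) (simp_all add: jbracket_ge_1)

lemma nn_integral_jbracket_powr:
  assumes "a > 2"
  shows "(\<integral>\<^sup>+z. ennreal (jbracket z powr (- a)) \<partial>lborel) < \<infinity>"
proof -
  let ?b = "- a / 2"
  have b: "?b < -1" using assms by simp
  have "(\<integral>\<^sup>+z. ennreal (jbracket z powr (- a)) \<partial>lborel) =
      (\<integral>\<^sup>+z. (\<lambda>s. ennreal (\<bar>1 + s\<bar> powr ?b)) ((cmod z)\<^sup>2) \<partial>lborel)"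
    by (intro nn_integral_cong) (simp add: jbracket_powr)
  also have "\<dots> = ennreal pi * (\<integral>\<^sup>+s. ennreal (\<bar>1 + s\<bar> powr ?b) * indicator {0..} s \<partial>lborel)"
    by (rule nn_integral_radial) measurable
  also have "(\<integral>\<^sup>+s. ennreal (\<bar>1 + s\<bar> powr ?b) * indicator {0..} s \<partial>lborel) =
      ennreal (0 - (1 + 0) powr (?b + 1) / (?b + 1))"
  proof (rule nn_integral_FTC_atLeast)
    fix x :: real assume x: "0 \<le> x"
    have "((\<lambda>s. (1 + s) powr (?b + 1) / (?b + 1)) has_real_derivative
        (?b + 1) * (1 + x) powr (?b + 1 - 1) * 1 / (?b + 1)) (at x)"
      using x b by (auto intro!: derivative_eq_intros)
    moreover have "(?b + 1) * (1 + x) powr (?b + 1 - 1) * 1 / (?b + 1) = \<bar>1 + x\<bar> powr ?b"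
      using x b by simp
    ultimately show "((\<lambda>s. (1 + s) powr (?b + 1) / (?b + 1)) has_real_derivative \<bar>1 + x\<bar> powr ?b) (at x)"
      by (rule DERIV_cong)
  next
    show "((\<lambda>s. (1 + s) powr (?b + 1) / (?b + 1)) \<longlongrightarrow> 0) at_top"
      using b by real_asymp
  qed auto
  finally show ?thesis by (simp add: ennreal_mult_less_top)
qed

lemma integrable_jbracket_powr:
  assumes "a > 2"
  shows "integrable lborel (\<lambda>z. jbracket z powr (- a))"
proof (rule integrableI_nonneg)
  show "(\<integral>\<^sup>+z. ennreal (jbracket z powr (- a)) \<partial>lborel) < \<infinity>"
    by (rule nn_integral_jbracket_powr[OF assms])
qed auto

lemma nn_integral_norm_powr_ball:
  assumes "0 \<le> c" "c < 2"
  shows "(\<integral>\<^sup>+z. ennreal (if cmod z < 1 then cmod z powr (- c) else 0) \<partial>lborel) < \<infinity>"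
proof -
  let ?f = "\<lambda>s::real. ennreal (s powr (- c / 2)) * indicator {..1} s"
  have eq: "cmod z powr (- c) = (cmod z)\<^sup>2 powr (- c / 2)" for z
  proof (cases "z = 0")
    case False
    then have "(cmod z)\<^sup>2 = cmod z powr 2" by simp
    then show ?thesis by (simp only: powr_powr)  simp
  qed simp
  have "(\<integral>\<^sup>+z. ennreal (if cmod z < 1 then cmod z powr (- c) else 0) \<partial>lborel) \<le>
      (\<integral>\<^sup>+z. ?f ((cmod z)\<^sup>2) \<partial>lborel)"
  proof (intro nn_integral_mono)
    show "ennreal (if cmod z < 1 then cmod z powr (- c) else 0) \<le> ?f ((cmod z)\<^sup>2)" for z
      using power_le_one[of "cmod z" 2] eq[of z] by simp
  qed
  also have "\<dots> = ennreal pi * (\<integral>\<^sup>+s. ?f s * indicator {0..} s \<partial>lborel)"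
    by (rule nn_integral_radial) measurable
  also have "(\<integral>\<^sup>+s. ?f s * indicator {0..} s \<partial>lborel) =
      (\<integral>\<^sup>+s. ennreal (s powr (- c / 2) * indicator {0..1} s) \<partial>lborel)"
    by (intro nn_integral_cong) (auto split: split_indicator)
  also have "\<dots> = ennreal (1 powr (- c / 2 + 1) / (- c / 2 + 1))"
  proof (rule nn_integral_has_integral_lborel)
    have "((\<lambda>x. x powr (- c / 2)) has_integral 1 powr (- c / 2 + 1) / (- c / 2 + 1)) {0..1}"
      using assms by (intro has_integral_powr_from_0) auto
    moreover have "(\<lambda>s. s powr (- c / 2) * indicator {0..1} s) =
        (\<lambda>s::real. if s \<in> {0..1} then s powr (- c / 2) else 0)"
      by (simp add: fun_eq_iff indicator_def)
    ultimately show "((\<lambda>s. s powr (- c / 2) * indicator {0..1} s) has_integral 1 powr (- c / 2 + 1) / (- c / 2 + 1)) UNIV"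
      by (simp only: has_integral_restrict_UNIV)
  qed auto
  finally show ?thesis by (rule order_le_less_trans) (simp add: ennreal_mult_less_top)
qed

text \<open>Separates a product of two weights into single powers of the total exponent, which can
  then be integrated one at a time, independently of their centres.\<close>

lemma powr_prod_le_sum:
  fixes x y :: real
  assumes "0 < x" "0 < y" "0 \<le> a" "0 \<le> c"
  shows "x powr a * y powr c \<le> x powr (a + c) + y powr (a + c)"
proof (cases "x \<le> y")
  case True
  then have "x powr a * y powr c \<le> y powr a * y powr c"
    using assms by (intro mult_right_mono powr_mono2) auto
  then show ?thesis by (simp add: powr_add add_increasing)
next
  case False
  then have "x powr a * y powr c \<le> x powr a * x powr c"
    using assms by (intro mult_left_mono powr_mono2) auto
  then show ?thesis by (simp add: powr_add add_increasing2)
qed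

text \<open>For |z - w| < 1 the bracket is at most 1 and the singularity is integrable because c <
  2. For |z - w| >= 1 the distance is comparable with <z - w>, and the product of two brackets is at
  most a sum of brackets with exponent a + c > 2. Reflection removes z from each of these integrals,
  whence the uniformity.\<close>

lemma riesz_jbracket_bound:
  assumes "0 \<le> a" "0 \<le> c" "c < 2" "2 < a + c"
  obtains C where "C > 0"
    "\<And>z. (\<integral>\<^sup>+w. ennreal (jbracket w powr (- a) * cmod (z - w) powr (- c)) \<partial>lborel) \<le> ennreal C"
proof -
  let ?p = "a + c"
  define N where "N = (\<integral>\<^sup>+z. ennreal (if cmod z < 1 then cmod z powr (- c) else 0) \<partial>lborel)"
  define J where "J = (\<integral>\<^sup>+z. ennreal (jbracket z powr (- ?p)) \<partial>lborel)"
  have fin: "N + 2 powr c * J + 2 powr c * J < \<infinity>"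
    using nn_integral_norm_powr_ball[of c] nn_integral_jbracket_powr[of ?p] assms
    unfolding N_def J_def by (simp add: ennreal_mult_less_top)
  have "(\<integral>\<^sup>+w. ennreal (jbracket w powr (- a) * cmod (z - w) powr (- c)) \<partial>lborel)
      \<le> N + 2 powr c * J + 2 powr c * J" for z
  proof -
    have pt: "ennreal (jbracket w powr (- a) * cmod (z - w) powr (- c)) \<le>
        ennreal (if cmod (z - w) < 1 then cmod (z - w) powr (- c) else 0) +
        (ennreal (2 powr c) * ennreal (jbracket w powr (- ?p)) +
         ennreal (2 powr c) * ennreal (jbracket (z - w) powr (- ?p)))" for w
    proof (cases "cmod (z - w) < 1")
      case True
      have "jbracket w powr (- a) * cmod (z - w) powr (- c) \<le> 1 * cmod (z - w) powr (- c)"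
        using assms by (intro mult_right_mono jbracket_powr_le_1) auto
      then show ?thesis using True by (simp add: add_increasing2 ennreal_leI)
    next
      case False
      then have ge: "1 \<le> cmod (z - w)" by simp
      have "jbracket (z - w) \<le> 2 * cmod (z - w)"
        using jbracket_le[of "z - w"] ge by linarith
      then have "(2 * cmod (z - w)) powr (- c) \<le> jbracket (z - w) powr (- c)"
        using assms by (intro powr_mono2') auto
      then have "2 powr c * ((2 * cmod (z - w)) powr (- c)) \<le> 2 powr c * jbracket (z - w) powr (- c)"
        by (intro mult_left_mono) auto
      moreover have "2 powr c * ((2 * cmod (z - w)) powr (- c)) = cmod (z - w) powr (- c)"
        by (simp add: powr_mult powr_minus)
      ultimately have "jbracket w powr (- a) * cmod (z - w) powr (- c) \<le>
          jbracket w powr (- a) * (2 powr c * jbracket (z - w) powr (- c))"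
        by (intro mult_left_mono) auto
      also have "\<dots> = 2 powr c * ((inverse (jbracket w)) powr a * (inverse (jbracket (z - w))) powr c)"
        by (simp add: powr_minus inverse_powr)
      also have "\<dots> \<le> 2 powr c * ((inverse (jbracket w)) powr ?p + (inverse (jbracket (z - w))) powr ?p)"
        using assms by (intro mult_left_mono powr_prod_le_sum) auto
      also have "\<dots> = 2 powr c * jbracket w powr (- ?p) + 2 powr c * jbracket (z - w) powr (- ?p)"
        using inverse_powr[of "jbracket w" ?p] inverse_powr[of "jbracket (z - w)" ?p]
        by (simp only: distrib_left powr_minus)
      finally have "ennreal (jbracket w powr (- a) * cmod (z - w) powr (- c)) \<le>
         ennreal (2 powr c * jbracket w powr (- ?p) + 2 powr c * jbracket (z - w) powr (- ?p))"
        by (rule ennreal_leI)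
      then show ?thesis
        using False by (simp add: ennreal_plus ennreal_mult)
    qed
    have "(\<integral>\<^sup>+w. ennreal (jbracket w powr (- a) * cmod (z - w) powr (- c)) \<partial>lborel) \<le>
       (\<integral>\<^sup>+w. ennreal (if cmod (z - w) < 1 then cmod (z - w) powr (- c) else 0) +
        (ennreal (2 powr c) * ennreal (jbracket w powr (- ?p)) +
         ennreal (2 powr c) * ennreal (jbracket (z - w) powr (- ?p))) \<partial>lborel)"
      by (intro nn_integral_mono pt)
    also have "\<dots> = (\<integral>\<^sup>+w. ennreal (if cmod (z - w) < 1 then cmod (z - w) powr (- c) else 0) \<partial>lborel) +
        (ennreal (2 powr c) * J + ennreal (2 powr c) * (\<integral>\<^sup>+w. ennreal (jbracket (z - w) powr (- ?p)) \<partial>lborel))"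
      unfolding J_def by (simp add: nn_integral_add nn_integral_cmult)
    also have "(\<integral>\<^sup>+w. ennreal (jbracket (z - w) powr (- ?p)) \<partial>lborel) = J"
      unfolding J_def by (rule nn_integral_reflect) measurable
    also have "(\<integral>\<^sup>+w. ennreal (if cmod (z - w) < 1 then cmod (z - w) powr (- c) else 0) \<partial>lborel) = N"
      unfolding N_def by (rule nn_integral_reflect[where f="\<lambda>z. ennreal (if cmod z < 1 then cmod z powr (- c) else 0)"]) measurable
    finally show ?thesis by (simp add: add.assoc)
  qed
  \<comment> \<open>The 1 added to the finite total only makes the constant strictly
    positive.\<close>
  then have le: "(\<integral>\<^sup>+w. ennreal (jbracket w powr (- a) * cmod (z - w) powr (- c)) \<partial>lborel)
      \<le> ennreal (enn2real (N + 2 powr c * J + 2 powr c * J) + 1)" for z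
  proof (rule order_trans)
    have "N + 2 powr c * J + 2 powr c * J = ennreal (enn2real (N + 2 powr c * J + 2 powr c * J))"
      using fin by (intro ennreal_enn2real[symmetric]) simp
    also have "\<dots> \<le> ennreal (enn2real (N + 2 powr c * J + 2 powr c * J) + 1)"
      by (intro ennreal_leI) simp
    finally show "N + 2 powr c * J + 2 powr c * J \<le> ennreal (enn2real (N + 2 powr c * J + 2 powr c * J) + 1)" .
  qed
  show ?thesis
    by (rule that[OF _ le]) (rule add_nonneg_pos, simp_all)
qed

section \<open>Weighted bounds for the Cauchy transform\<close>

text \<open>Normalised without 1 / pi, so it inverts dbar up to the factor pi. Where the integral
  does not converge absolutely it has the default value 0.\<close>

definition cauchy :: "(complex \<Rightarrow> complex) \<Rightarrow> complex \<Rightarrow> complex" where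
  "cauchy v z = (LINT w|lborel. v w / (z - w))"

text \<open>The absolute version of \<open>cauchy\<close>. For measurable \<open>v\<close> its
  finiteness at z is the absolute convergence of the Cauchy integral at z.\<close>

definition riesz :: "(complex \<Rightarrow> complex) \<Rightarrow> complex \<Rightarrow> ennreal" where
  "riesz v z = (\<integral>\<^sup>+w. ennreal (cmod (v w) / cmod (z - w)) \<partial>lborel)"

text \<open>The squared norm of <z>^\<theta> L2, valued in \<open>ennreal\<close> so that an
  estimate can be stated before membership is known and then prove it.\<close>

definition wnorm2 :: "real \<Rightarrow> (complex \<Rightarrow> complex) \<Rightarrow> ennreal" where
  "wnorm2 \<theta> v = (\<integral>\<^sup>+z. ennreal (jbracket z powr (- 2 * \<theta>) * (cmod (v z))\<^sup>2) \<partial>lborel)"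

text \<open>From <z>^\<beta> <= 2 (<w>^\<beta> + |z - w|^\<beta>) the decay in z is bought either
  from the bracket or from the kernel. Both resulting integrals have total exponent b + 1 - \<beta>,
  which exceeds 2 exactly when b > 1 + \<beta>.\<close>

lemma cauchy_jbracket_bound:
  assumes "0 \<le> \<beta>" "\<beta> \<le> 1" "1 + \<beta> < b"
  obtains C where "C > 0"
    "\<And>z. (\<integral>\<^sup>+w. ennreal (jbracket w powr (- b) / cmod (z - w)) \<partial>lborel) \<le> ennreal (C * jbracket z powr (- \<beta>))"
proof -
  obtain C1 where C1: "C1 > 0"
    "\<And>z. (\<integral>\<^sup>+w. ennreal (jbracket w powr (- (b - \<beta>)) * cmod (z - w) powr (- 1)) \<partial>lborel) \<le> ennreal C1"
    using riesz_jbracket_bound[of "b - \<beta>" 1] assms by auto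
  obtain C2 where C2: "C2 > 0"
    "\<And>z. (\<integral>\<^sup>+w. ennreal (jbracket w powr (- b) * cmod (z - w) powr (- (1 - \<beta>))) \<partial>lborel) \<le> ennreal C2"
    using riesz_jbracket_bound[of b "1 - \<beta>"] assms by auto
  have le: "(\<integral>\<^sup>+w. ennreal (jbracket w powr (- b) / cmod (z - w)) \<partial>lborel)
      \<le> ennreal ((2 * (C1 + C2)) * jbracket z powr (- \<beta>))" for z
  proof -
    have pt: "jbracket w powr (- b) / cmod (z - w) \<le> 2 * jbracket z powr (- \<beta>) *
       (jbracket w powr (- (b - \<beta>)) * cmod (z - w) powr (- 1) + jbracket w powr (- b) * cmod (z - w) powr (- (1 - \<beta>)))" for w
    proof (cases "w = z")
      case False
      then have pos: "cmod (z - w) > 0" by simp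
      have "jbracket z powr \<beta> \<le> (2 * max (jbracket w) (cmod (z - w))) powr \<beta>"
        using jbracket_triangle[of z w] assms by (intro powr_mono2) auto
      also have "\<dots> = 2 powr \<beta> * (max (jbracket w) (cmod (z - w))) powr \<beta>"
        by (simp add: powr_mult)
      also have "\<dots> \<le> 2 * (jbracket w powr \<beta> + cmod (z - w) powr \<beta>)"
      proof (rule mult_mono)
        show "2 powr \<beta> \<le> (2::real)"
          using powr_mono[of \<beta> 1 2] assms by simp
      qed (auto simp: max_def)
      finally have 1: "jbracket z powr \<beta> \<le> 2 * (jbracket w powr \<beta> + cmod (z - w) powr \<beta>)" .
      have "jbracket w powr (- b) / cmod (z - w) =
          jbracket z powr (- \<beta>) * (jbracket w powr (- b) * cmod (z - w) powr (- 1)) * jbracket z powr \<beta>"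
        using pos by (simp add: powr_minus field_simps)
      also have "\<dots> \<le> jbracket z powr (- \<beta>) * (jbracket w powr (- b) * cmod (z - w) powr (- 1)) *
          (2 * (jbracket w powr \<beta> + cmod (z - w) powr \<beta>))"
        by (intro mult_left_mono 1) auto
      also have "\<dots> = 2 * jbracket z powr (- \<beta>) *
        ((jbracket w powr (- b) * jbracket w powr \<beta>) * cmod (z - w) powr (- 1) +
         jbracket w powr (- b) * (cmod (z - w) powr \<beta> * cmod (z - w) powr (- 1)))"
        by (simp add: algebra_simps)
      also have "jbracket w powr (- b) * jbracket w powr \<beta> = jbracket w powr (- (b - \<beta>))"
        by (simp flip: powr_add)
      also have "cmod (z - w) powr \<beta> * cmod (z - w) powr (- 1) = cmod (z - w) powr (- (1 - \<beta>))"
        by (simp only: powr_add[symmetric]) simp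
      finally show ?thesis .
    qed simp
    have "(\<integral>\<^sup>+w. ennreal (jbracket w powr (- b) / cmod (z - w)) \<partial>lborel) \<le>
      (\<integral>\<^sup>+w. ennreal (2 * jbracket z powr (- \<beta>)) *
       (ennreal (jbracket w powr (- (b - \<beta>)) * cmod (z - w) powr (- 1)) +
        ennreal (jbracket w powr (- b) * cmod (z - w) powr (- (1 - \<beta>)))) \<partial>lborel)"
      using pt by (intro nn_integral_mono)
        (simp add: ennreal_leI flip: ennreal_plus ennreal_mult'')
    also have "\<dots> = ennreal (2 * jbracket z powr (- \<beta>)) *
       ((\<integral>\<^sup>+w. ennreal (jbracket w powr (- (b - \<beta>)) * cmod (z - w) powr (- 1)) \<partial>lborel) +
        (\<integral>\<^sup>+w. ennreal (jbracket w powr (- b) * cmod (z - w) powr (- (1 - \<beta>))) \<partial>lborel))"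
      by (subst nn_integral_cmult) (auto simp: nn_integral_add)
    also have "\<dots> \<le> ennreal (2 * jbracket z powr (- \<beta>)) * (ennreal C1 + ennreal C2)"
      by (intro mult_left_mono add_mono C1 C2) auto
    also have "\<dots> = ennreal ((2 * (C1 + C2)) * jbracket z powr (- \<beta>))"
      using C1 C2 by (simp add: mult_ac flip: ennreal_plus ennreal_mult'')
    finally show ?thesis .
  qed
  show ?thesis
    by (rule that[OF _ le]) (use C1(1) C2(1) in simp)
qed

lemma measurable_riesz [measurable]:
  assumes [measurable]: "v \<in> borel_measurable borel"
  shows "riesz v \<in> borel_measurable borel"
  unfolding riesz_def by measurable

lemma measurable_cauchy [measurable]:
  assumes [measurable]: "v \<in> borel_measurable borel"
  shows "cauchy v \<in> borel_measurable borel"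
  unfolding cauchy_def by measurable

text \<open>A Schur test: Cauchy-Schwarz with <w>^b on the side of |v|^2 and <w>^-b on the other
  half of the kernel, then Tonelli, so that the z-integral hits only the kernel and the remaining
  weight.\<close>

lemma riesz_bound:
  assumes "0 < \<epsilon>" "\<epsilon> \<le> 1"
  obtains C where "C > 0"
    "\<And>v. v \<in> borel_measurable borel \<Longrightarrow>
      (\<integral>\<^sup>+z. ennreal (jbracket z powr (- 2 * \<epsilon>)) * (riesz v z)\<^sup>2 \<partial>lborel) \<le> ennreal C * wnorm2 (\<epsilon> - 2) v"
proof -
  \<comment> \<open>The exponents have to satisfy 0 <= \<beta> <= 1, 1 + \<beta> < b for the inner
    integral, 1 < 2 \<epsilon> + \<beta> for the outer one, and b <= 4 - 2 \<epsilon> to return to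
    the norm of exponent \<epsilon> - 2. These choices meet all four for 0 < \<epsilon> <=
    1.\<close>
  define b where "b = 2 - \<epsilon> / 2"
  define \<beta> where "\<beta> = 1 - 3 * \<epsilon> / 4"
  obtain C1 where C1: "C1 > 0"
    "\<And>z. (\<integral>\<^sup>+w. ennreal (jbracket w powr (- b) / cmod (z - w)) \<partial>lborel) \<le> ennreal (C1 * jbracket z powr (- \<beta>))"
    using cauchy_jbracket_bound[of \<beta> b] assms unfolding b_def \<beta>_def by auto
  obtain C2 where C2: "C2 > 0"
    "\<And>z. (\<integral>\<^sup>+w. ennreal (jbracket w powr (- (2 * \<epsilon> + \<beta>)) / cmod (z - w)) \<partial>lborel) \<le> ennreal (C2 * jbracket z powr (- 0))"
    using cauchy_jbracket_bound[of 0 "2 * \<epsilon> + \<beta>"] assms unfolding \<beta>_def by auto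
  have le: "(\<integral>\<^sup>+z. ennreal (jbracket z powr (- 2 * \<epsilon>)) * (riesz v z)\<^sup>2 \<partial>lborel) \<le> ennreal (C1 * C2) * wnorm2 (\<epsilon> - 2) v"
    if [measurable]: "v \<in> borel_measurable borel" for v
  proof -
    let ?F = "\<lambda>z w. ennreal ((cmod (v w))\<^sup>2 * jbracket w powr b / cmod (z - w))"
    have pt: "(riesz v z)\<^sup>2 \<le> (\<integral>\<^sup>+w. ?F z w \<partial>lborel) * ennreal (C1 * jbracket z powr (- \<beta>))" for z
    proof -
      let ?f = "\<lambda>w. ennreal (sqrt ((cmod (v w))\<^sup>2 * jbracket w powr b / cmod (z - w)))"
      let ?g = "\<lambda>w. ennreal (sqrt (jbracket w powr (- b) / cmod (z - w)))"
      have "riesz v z = (\<integral>\<^sup>+w. ?f w * ?g w \<partial>lborel)"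
        unfolding riesz_def
      proof (intro nn_integral_cong)
        fix w
        have "(cmod (v w))\<^sup>2 * jbracket w powr b / cmod (z - w) * (jbracket w powr (- b) / cmod (z - w)) =
            (cmod (v w) / cmod (z - w))\<^sup>2 * (jbracket w powr b * jbracket w powr (- b))"
          by (simp add: power2_eq_square)
        also have "\<dots> = (cmod (v w) / cmod (z - w))\<^sup>2"
          by (simp flip: powr_add)
        finally show "ennreal (cmod (v w) / cmod (z - w)) = ?f w * ?g w"
          by (simp flip: ennreal_mult'' real_sqrt_mult)
      qed
      also have "(\<dots>)\<^sup>2 \<le> (\<integral>\<^sup>+w. (?f w)\<^sup>2 \<partial>lborel) * (\<integral>\<^sup>+w. (?g w)\<^sup>2 \<partial>lborel)"
        by (rule Cauchy_Schwarz_nn_integral) auto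
      also have "\<dots> = (\<integral>\<^sup>+w. ?F z w \<partial>lborel) * (\<integral>\<^sup>+w. ennreal (jbracket w powr (- b) / cmod (z - w)) \<partial>lborel)"
        by (intro arg_cong2[where f="(*)"] nn_integral_cong) (auto simp: ennreal_power)
      also have "\<dots> \<le> (\<integral>\<^sup>+w. ?F z w \<partial>lborel) * ennreal (C1 * jbracket z powr (- \<beta>))"
        by (intro mult_left_mono C1) auto
      finally show ?thesis .
    qed
    have "(\<integral>\<^sup>+z. ennreal (jbracket z powr (- 2 * \<epsilon>)) * (riesz v z)\<^sup>2 \<partial>lborel) \<le>
        (\<integral>\<^sup>+z. ennreal (jbracket z powr (- 2 * \<epsilon>)) * ((\<integral>\<^sup>+w. ?F z w \<partial>lborel) * ennreal (C1 * jbracket z powr (- \<beta>))) \<partial>lborel)"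
      by (intro nn_integral_mono mult_left_mono pt) auto
    also have "\<dots> = (\<integral>\<^sup>+z. (\<integral>\<^sup>+w. ennreal (C1 * ((cmod (v w))\<^sup>2 * jbracket w powr b)) *
        ennreal (jbracket z powr (- (2 * \<epsilon> + \<beta>)) / cmod (w - z)) \<partial>lborel) \<partial>lborel)"
    proof (intro nn_integral_cong)
      fix z
      have "ennreal (jbracket z powr (- 2 * \<epsilon>)) * ((\<integral>\<^sup>+w. ?F z w \<partial>lborel) * ennreal (C1 * jbracket z powr (- \<beta>))) =
          ennreal (C1 * jbracket z powr (- (2 * \<epsilon> + \<beta>))) * (\<integral>\<^sup>+w. ?F z w \<partial>lborel)"
        using C1 powr_add[of "jbracket z" "- 2 * \<epsilon>" "- \<beta>"]
        by (simp add: mult_ac ennreal_mult)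
      also have "\<dots> = (\<integral>\<^sup>+w. ennreal (C1 * ((cmod (v w))\<^sup>2 * jbracket w powr b)) *
        ennreal (jbracket z powr (- (2 * \<epsilon> + \<beta>)) / cmod (w - z)) \<partial>lborel)"
        using C1 by (subst nn_integral_cmult[symmetric])
          (auto intro!: nn_integral_cong simp: norm_minus_commute mult_ac simp flip: ennreal_mult'')
      finally show "ennreal (jbracket z powr (- 2 * \<epsilon>)) * ((\<integral>\<^sup>+w. ?F z w \<partial>lborel) * ennreal (C1 * jbracket z powr (- \<beta>))) = \<dots>" .
    qed
    also have "\<dots> = (\<integral>\<^sup>+w. (\<integral>\<^sup>+z. ennreal (C1 * ((cmod (v w))\<^sup>2 * jbracket w powr b)) *
        ennreal (jbracket z powr (- (2 * \<epsilon> + \<beta>)) / cmod (w - z)) \<partial>lborel) \<partial>lborel)"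
      by (rule lborel_pair.Fubini') measurable
    also have "\<dots> = (\<integral>\<^sup>+w. ennreal (C1 * ((cmod (v w))\<^sup>2 * jbracket w powr b)) *
        (\<integral>\<^sup>+z. ennreal (jbracket z powr (- (2 * \<epsilon> + \<beta>)) / cmod (w - z)) \<partial>lborel) \<partial>lborel)"
      by (intro nn_integral_cong nn_integral_cmult) auto
    also have "\<dots> \<le> (\<integral>\<^sup>+w. ennreal (C1 * C2) * ennreal (jbracket w powr (- 2 * (\<epsilon> - 2)) * (cmod (v w))\<^sup>2) \<partial>lborel)"
    proof (intro nn_integral_mono)
      fix w
      have "ennreal (C1 * ((cmod (v w))\<^sup>2 * jbracket w powr b)) *
          (\<integral>\<^sup>+z. ennreal (jbracket z powr (- (2 * \<epsilon> + \<beta>)) / cmod (w - z)) \<partial>lborel) \<le>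
          ennreal (C1 * ((cmod (v w))\<^sup>2 * jbracket w powr b)) * ennreal C2"
        using C2(2)[of w] by (intro mult_left_mono) auto
      also have "\<dots> = ennreal (C1 * C2 * (jbracket w powr b * (cmod (v w))\<^sup>2))"
        using C2 by (subst ennreal_mult''[symmetric]) (simp_all add: mult_ac)
      also have "\<dots> \<le> ennreal (C1 * C2 * (jbracket w powr (- 2 * (\<epsilon> - 2)) * (cmod (v w))\<^sup>2))"
        using C1 C2 assms by (intro ennreal_leI mult_left_mono mult_right_mono jbracket_powr_mono) (auto simp: b_def)
      also have "\<dots> = ennreal (C1 * C2) * ennreal (jbracket w powr (- 2 * (\<epsilon> - 2)) * (cmod (v w))\<^sup>2)"
        using C1 C2 by (simp flip: ennreal_mult'')
      finally show "ennreal (C1 * ((cmod (v w))\<^sup>2 * jbracket w powr b)) *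
          (\<integral>\<^sup>+z. ennreal (jbracket z powr (- (2 * \<epsilon> + \<beta>)) / cmod (w - z)) \<partial>lborel) \<le>
          ennreal (C1 * C2) * ennreal (jbracket w powr (- 2 * (\<epsilon> - 2)) * (cmod (v w))\<^sup>2)" .
    qed
    also have "\<dots> = ennreal (C1 * C2) * wnorm2 (\<epsilon> - 2) v"
      unfolding wnorm2_def by (rule nn_integral_cmult) auto
    finally show ?thesis .
  qed
  show ?thesis
    by (rule that[OF _ le]) (use C1(1) C2(1) in simp)
qed

text \<open>Valid at every z: where the kernel is not integrable the default value makes the left
  side 0.\<close>

lemma cmod_cauchy_le_riesz:
  assumes "v \<in> borel_measurable borel"
  shows "ennreal (cmod (cauchy v z)) \<le> riesz v z"
proof (cases "integrable lborel (\<lambda>w. v w / (z - w))")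
  case True
  have "ennreal (cmod (cauchy v z)) \<le> ennreal (LINT w|lborel. cmod (v w / (z - w)))"
    unfolding cauchy_def by (intro ennreal_leI integral_norm_bound)
  also have "\<dots> = riesz v z"
    unfolding riesz_def using integrable_norm[OF True]
    by (subst nn_integral_eq_integral[symmetric]) (auto simp: norm_divide)
  finally show ?thesis .
next
  case False
  then show ?thesis by (simp add: cauchy_def not_integrable_integral_eq)
qed

lemma integrable_cauchy_kernel:
  assumes [measurable]: "v \<in> borel_measurable borel" and "riesz v z < \<infinity>"
  shows "integrable lborel (\<lambda>w. v w / (z - w))"
  using assms(2) by (intro integrableI_bounded) (auto simp: riesz_def norm_divide)

lemma wnorm2_cauchy:
  assumes "0 < \<epsilon>" "\<epsilon> \<le> 1"
  obtains C where "C > 0"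
    "\<And>v. v \<in> borel_measurable borel \<Longrightarrow> wnorm2 \<epsilon> (cauchy v) \<le> ennreal C * wnorm2 (\<epsilon> - 2) v"
proof -
  obtain C where C: "C > 0"
    "\<And>v. v \<in> borel_measurable borel \<Longrightarrow>
      (\<integral>\<^sup>+z. ennreal (jbracket z powr (- 2 * \<epsilon>)) * (riesz v z)\<^sup>2 \<partial>lborel) \<le> ennreal C * wnorm2 (\<epsilon> - 2) v"
    using riesz_bound assms by blast
  have "wnorm2 \<epsilon> (cauchy v) \<le> ennreal C * wnorm2 (\<epsilon> - 2) v" if v: "v \<in> borel_measurable borel" for v
  proof -
    have "wnorm2 \<epsilon> (cauchy v) \<le> (\<integral>\<^sup>+z. ennreal (jbracket z powr (- 2 * \<epsilon>)) * (riesz v z)\<^sup>2 \<partial>lborel)"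
      unfolding wnorm2_def
      by (intro nn_integral_mono)
        (auto simp: ennreal_mult simp flip: ennreal_power intro!: mult_left_mono power_mono cmod_cauchy_le_riesz v)
    also have "\<dots> \<le> ennreal C * wnorm2 (\<epsilon> - 2) v" by (rule C(2)[OF v])
    finally show ?thesis .
  qed
  then show ?thesis using C(1) that by blast
qed

text \<open>\<open>riesz_bound\<close> gives \<open>riesz v\<close> a finite weighted integral,
  hence finite values almost everywhere. Pointwise convergence cannot be expected of a weighted L2
  function, which is why additivity of the Cauchy transform is stated almost everywhere later
  on.\<close>

lemma AE_integrable_cauchy_kernel:
  assumes "0 < \<epsilon>" "\<epsilon> \<le> 1" and v [measurable]: "v \<in> borel_measurable borel" and fin: "wnorm2 (\<epsilon> - 2) v < \<infinity>"
  shows "AE z in lborel. integrable lborel (\<lambda>w. v w / (z - w))"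
proof -
  obtain C where C: "C > 0"
    "(\<integral>\<^sup>+z. ennreal (jbracket z powr (- 2 * \<epsilon>)) * (riesz v z)\<^sup>2 \<partial>lborel) \<le> ennreal C * wnorm2 (\<epsilon> - 2) v"
    using riesz_bound[OF assms(1,2)] v by blast
  have "ennreal C * wnorm2 (\<epsilon> - 2) v < \<infinity>"
    using fin by (simp add: ennreal_mult_less_top)
  then have "(\<integral>\<^sup>+z. ennreal (jbracket z powr (- 2 * \<epsilon>)) * (riesz v z)\<^sup>2 \<partial>lborel) \<noteq> \<infinity>"
    using C(2) by auto
  then have "AE z in lborel. ennreal (jbracket z powr (- 2 * \<epsilon>)) * (riesz v z)\<^sup>2 \<noteq> \<infinity>"
    by (intro nn_integral_PInf_AE) auto
  then show ?thesis
  proof eventually_elim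
    case (elim z)
    have "riesz v z < \<infinity>"
    proof (rule ccontr)
      assume "\<not> riesz v z < \<infinity>"
      then have "riesz v z = \<infinity>" by (simp add: not_less top_unique)
      then show False using elim by (simp add: ennreal_mult_top power_eq_top_ennreal)
    qed
    then show ?case by (rule integrable_cauchy_kernel[OF v])
  qed
qed

section \<open>Derivatives and regularised kernels\<close>

lemma differentiable_Ck: "Ck (Suc n) f \<Longrightarrow> f differentiable (at z)"
  by (simp add: differentiable_on_def)

lemma has_derivative_frechet: "f differentiable (at z) \<Longrightarrow> (f has_derivative frechet_derivative f (at z)) (at z)"
  by (simp add: frechet_derivative_works)

lemma frechet_derivative_dx_dy:
  assumes "f differentiable (at z)"
  shows "frechet_derivative f (at z) h = of_real (Re h) * dx f z + of_real (Im h) * dy f z"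
proof -
  have lin: "linear (frechet_derivative f (at z))"
    using has_derivative_frechet[OF assms] has_derivative_linear by blast
  have "h = Re h *\<^sub>R 1 + Im h *\<^sub>R \<i>"
    by (simp add: complex_eq_iff)
  then have "frechet_derivative f (at z) h = frechet_derivative f (at z) (Re h *\<^sub>R 1 + Im h *\<^sub>R \<i>)"
    by simp
  also have "\<dots> = Re h *\<^sub>R dx f z + Im h *\<^sub>R dy f z"
    unfolding dx_def dy_def by (simp only: linear_add[OF lin] linear_scale[OF lin])
  finally show ?thesis by (simp add: scaleR_conv_of_real)
qed

lemma has_derivative_dx_dy:
  assumes "f differentiable (at z)"
  shows "(f has_derivative (\<lambda>h. of_real (Re h) * dx f z + of_real (Im h) * dy f z)) (at z)"
proof -
  have "(\<lambda>h. of_real (Re h) * dx f z + of_real (Im h) * dy f z) = frechet_derivative f (at z)"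
    using frechet_derivative_dx_dy[OF assms] by (simp add: fun_eq_iff)
  then show ?thesis using has_derivative_frechet[OF assms] by metis
qed

lemma has_derivative_imp_dx_dy:
  assumes "(f has_derivative D) (at z)"
  shows "dx f z = D 1" "dy f z = D \<i>"
  unfolding dx_def dy_def using frechet_derivative_at[OF assms] by simp_all

lemma dx_dy_mult:
  assumes "f differentiable (at z)" "g differentiable (at z)"
  shows "dx (\<lambda>z. f z * g z) z = dx f z * g z + f z * dx g z"
    and "dy (\<lambda>z. f z * g z) z = dy f z * g z + f z * dy g z"
proof -
  have "((\<lambda>z. f z * g z) has_derivative
      (\<lambda>h. f z * frechet_derivative g (at z) h + frechet_derivative f (at z) h * g z)) (at z)"
    by (intro has_derivative_mult has_derivative_frechet assms)
  from has_derivative_imp_dx_dy[OF this]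
  show "dx (\<lambda>z. f z * g z) z = dx f z * g z + f z * dx g z"
    and "dy (\<lambda>z. f z * g z) z = dy f z * g z + f z * dy g z"
    by (simp_all add: dx_def dy_def)
qed

lemma norm_diff_le_directional:
  fixes f :: "complex \<Rightarrow> complex"
  assumes f: "\<And>z. f differentiable (at z)" and "0 \<le> t"
    and B: "\<And>s. 0 \<le> s \<Longrightarrow> s \<le> t \<Longrightarrow> cmod (frechet_derivative f (at (z + of_real s * e)) e) \<le> B"
  shows "cmod (f (z + of_real t * e) - f z) \<le> B * t"
proof -
  let ?g = "\<lambda>s. f (z + of_real s * e)"
  have der: "(?g has_derivative (\<lambda>h. h *\<^sub>R frechet_derivative f (at (z + of_real s * e)) e)) (at s within {0..t})" for s
  proof -
    have "((\<lambda>s. z + of_real s * e) has_derivative (\<lambda>h. of_real h * e)) (at s within {0..t})"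
      by (auto intro!: derivative_eq_intros)
    from has_derivative_compose[OF this has_derivative_frechet[OF f]]
    have "(?g has_derivative (\<lambda>h. frechet_derivative f (at (z + of_real s * e)) (of_real h * e))) (at s within {0..t})" .
    moreover have "frechet_derivative f (at (z + of_real s * e)) (of_real h * e) =
        h *\<^sub>R frechet_derivative f (at (z + of_real s * e)) e" for h
      using linear_scale[OF has_derivative_linear[OF has_derivative_frechet[OF f]]]
      by (simp add: scaleR_conv_of_real)
    ultimately show ?thesis by simp
  qed
  have "norm (?g t - ?g 0) \<le> B * norm (t - 0)"
  proof (rule differentiable_bound[of "{0..t}" ?g])
    show "onorm (\<lambda>h. h *\<^sub>R frechet_derivative f (at (z + of_real s * e)) e) \<le> B" if "s \<in> {0..t}" for s
    proof (rule onorm_le)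
      show "norm (h *\<^sub>R frechet_derivative f (at (z + of_real s * e)) e) \<le> B * norm h" for h
        using mult_right_mono[OF B[of s], of "norm h"] that by (simp add: mult.commute)
    qed
  qed (use der \<open>0 \<le> t\<close> in auto)
  then show ?thesis using \<open>0 \<le> t\<close> by simp
qed

lemma jbracket_powr_shift:
  assumes "cmod (z - w) \<le> r" "0 \<le> p"
  shows "jbracket w powr (- p) \<le> (2 * (1 + r)) powr p * jbracket z powr (- p)"
proof -
  have "jbracket z \<le> 2 * jbracket w * jbracket (z - w)" by (rule jbracket_Peetre)
  also have "\<dots> \<le> 2 * jbracket w * (1 + r)"
    using jbracket_le[of "z - w"] assms by (intro mult_left_mono) auto
  finally have "jbracket z powr p \<le> ((2 * (1 + r)) * jbracket w) powr p"
    using assms by (intro powr_mono2) (auto simp: mult_ac)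
  also have "\<dots> = (2 * (1 + r)) powr p * jbracket w powr p"
    by (rule powr_mult)
  finally show ?thesis by (simp add: powr_minus field_simps)
qed

text \<open>The segment from z to z + t e stays within distance 1 of z, so the decay at z is lost
  only by the factor (2 (1 + 1))^p. This is the dominating function used when derivatives are taken
  as limits under an integral.\<close>

lemma difference_quotient_bound:
  fixes f :: "complex \<Rightarrow> complex"
  assumes f: "\<And>z. f differentiable (at z)" and "0 < t" "t \<le> 1" "0 \<le> p" "cmod e \<le> 1"
    and B: "\<And>z. cmod (frechet_derivative f (at z) e) \<le> C * jbracket z powr (- p)"
  shows "cmod ((f (z + of_real t * e) - f z) / of_real t) \<le> C * 4 powr p * jbracket z powr (- p)"
proof -
  have C: "0 \<le> C"
    using order_trans[OF norm_ge_zero B[of 0]] by (simp add: zero_le_mult_iff)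
  have "cmod (f (z + of_real t * e) - f z) \<le> (C * 4 powr p * jbracket z powr (- p)) * t"
  proof (rule norm_diff_le_directional[OF f])
    fix s :: real assume s: "0 \<le> s" "s \<le> t"
    have "cmod (z - (z + of_real s * e)) = s * cmod e"
      using s by (simp add: norm_mult)
    also have "\<dots> \<le> 1 * 1"
      using s assms by (intro mult_mono) auto
    finally have "jbracket (z + of_real s * e) powr (- p) \<le> 4 powr p * jbracket z powr (- p)"
      using jbracket_powr_shift[of z "z + of_real s * e" 1 p] assms by simp
    then have "C * jbracket (z + of_real s * e) powr (- p) \<le> C * (4 powr p * jbracket z powr (- p))"
      using C by (rule mult_left_mono)
    with B[of "z + of_real s * e"]
    show "cmod (frechet_derivative f (at (z + of_real s * e)) e) \<le> C * 4 powr p * jbracket z powr (- p)"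
      by simp
  qed (use assms in auto)
  then show ?thesis
    using \<open>0 < t\<close> by (simp add: norm_divide field_simps)
qed

lemma difference_quotient_tendsto:
  fixes f :: "complex \<Rightarrow> complex"
  assumes f: "f differentiable (at z)"
  shows "(\<lambda>n. (f (z + of_real (1 / real (Suc n)) * e) - f z) / of_real (1 / real (Suc n)))
    \<longlonglongrightarrow> frechet_derivative f (at z) e"
proof -
  have "((\<lambda>s. f (z + of_real s * e)) has_vector_derivative frechet_derivative f (at z) e) (at 0)"
  proof -
    have 1: "((\<lambda>s::real. z + of_real s * e) has_derivative (\<lambda>h. of_real h * e)) (at 0)"
      by (auto intro!: derivative_eq_intros)
    have 2: "(f has_derivative frechet_derivative f (at z)) (at (z + of_real 0 * e))"
      using has_derivative_frechet[OF f] by simp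
    have "frechet_derivative f (at z) (of_real h * e) = h *\<^sub>R frechet_derivative f (at z) e" for h
      using linear_scale[OF has_derivative_linear[OF has_derivative_frechet[OF f]]]
      by (simp add: scaleR_conv_of_real)
    with has_derivative_compose[OF 1 2] show ?thesis
      by (simp add: has_vector_derivative_def)
  qed
  then have lim: "((\<lambda>h. (f (z + of_real h * e) - f z) /\<^sub>R h) \<longlongrightarrow> frechet_derivative f (at z) e) (at 0)"
  proof -
    let ?g = "\<lambda>h::real. f (z + of_real h * e)" and ?v = "frechet_derivative f (at z) e"
    assume "(?g has_vector_derivative ?v) (at 0)"
    then have "(\<lambda>h. norm (?g (0 + h) - ?g 0 - h *\<^sub>R ?v) / norm h) \<midarrow>0\<rightarrow> 0"
      unfolding has_vector_derivative_def has_derivative_at by blast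
    then have "(\<lambda>h. norm ((?g h - f z) /\<^sub>R h - ?v)) \<midarrow>0\<rightarrow> 0"
    proof (rule Lim_transform_eventually)
      show "\<forall>\<^sub>F h in at 0. norm (?g (0 + h) - ?g 0 - h *\<^sub>R ?v) / norm h = norm ((?g h - f z) /\<^sub>R h - ?v)"
      proof (rule eventually_at_filter[THEN iffD2], rule always_eventually, intro allI impI)
        fix h :: real assume "h \<noteq> 0"
        then have "(?g h - f z) /\<^sub>R h - ?v = (?g (0 + h) - ?g 0 - h *\<^sub>R ?v) /\<^sub>R h"
          by (simp add: scaleR_diff_right)
        then show "norm (?g (0 + h) - ?g 0 - h *\<^sub>R ?v) / norm h = norm ((?g h - f z) /\<^sub>R h - ?v)"
          by (simp only: norm_scaleR) (simp add: divide_inverse mult.commute)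
      qed
    qed
    then show ?thesis
      by (simp only: tendsto_norm_zero_iff LIM_zero_iff)
  qed
  have "(\<lambda>n. 1 / real (Suc n)) \<longlonglongrightarrow> 0" using LIMSEQ_inverse_real_of_nat by (simp add: inverse_eq_divide)
  then have "filterlim (\<lambda>n. 1 / real (Suc n)) (at 0) sequentially"
    by (simp add: filterlim_at)
  from filterlim_compose[OF lim this] show ?thesis
    by (simp add: scaleR_conv_of_real divide_inverse mult.commute)
qed

lemma integrable_jbracket_bound:
  assumes [measurable]: "f \<in> borel_measurable borel" and "\<And>z. cmod (f z) \<le> C * jbracket z powr (- p)" "p > 2"
  shows "integrable lborel f"
proof (rule Bochner_Integration.integrable_bound[of _ "\<lambda>z. C * jbracket z powr (- p)"])
  show "integrable lborel (\<lambda>z. C * jbracket z powr (- p))"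
    using assms by (intro integrable_mult_right integrable_jbracket_powr)
  show "AE z in lborel. cmod (f z) \<le> norm (C * jbracket z powr (- p))"
    using order_trans[OF assms(2) abs_ge_self] by (simp only: real_norm_def AE_I2)
qed simp

lemma continuous_imp_borel: "continuous_on UNIV (f :: complex \<Rightarrow> complex) \<Longrightarrow> f \<in> borel_measurable borel"
  by (rule borel_measurable_continuous_onI)

lemma continuous_differentiable: "(\<And>z. f differentiable (at z)) \<Longrightarrow> continuous_on UNIV (f :: complex \<Rightarrow> complex)"
  by (simp add: continuous_on_eq_continuous_at differentiable_imp_continuous_within)

lemma integral_translate:
  fixes f :: "complex \<Rightarrow> complex"
  assumes [measurable]: "f \<in> borel_measurable borel"
  shows "(LINT z|lborel. f (z + a)) = (LINT z|lborel. f z)"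
proof -
  have "(LINT z|Measure_Space.distr lborel borel (\<lambda>w. w + a). f z) = (LINT z|lborel. f (z + a))"
    by (rule integral_distr) auto
  then show ?thesis by (simp add: distr_lborel_translate)
qed

lemma integrable_translate:
  fixes f :: "complex \<Rightarrow> complex"
  assumes "integrable lborel f"
  shows "integrable lborel (\<lambda>z. f (z + a))"
proof -
  have [measurable]: "f \<in> borel_measurable borel" using assms by auto
  have "integrable (Measure_Space.distr lborel borel (\<lambda>w. w + a)) f \<longleftrightarrow> integrable lborel (\<lambda>z. f (z + a))"
    by (rule integrable_distr_eq) auto
  then show ?thesis using assms by (simp add: distr_lborel_translate)
qed

text \<open>The difference quotients integrate to 0 by translation invariance, and dominated
  convergence carries this to the derivative. It takes the place of the divergence theorem, with no
  boundary terms.\<close>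

lemma integral_directional_derivative:
  fixes f :: "complex \<Rightarrow> complex"
  assumes f: "\<And>z. f differentiable (at z)" and int: "integrable lborel f" and e: "cmod e \<le> 1"
    and cont: "continuous_on UNIV (\<lambda>z. frechet_derivative f (at z) e)"
    and B: "\<And>z. cmod (frechet_derivative f (at z) e) \<le> C * jbracket z powr (- p)" and "2 < p"
  shows "(LINT z|lborel. frechet_derivative f (at z) e) = 0"
proof -
  have [measurable]: "f \<in> borel_measurable borel"
    using f by (intro continuous_imp_borel continuous_differentiable)
  have [measurable]: "(\<lambda>z. frechet_derivative f (at z) e) \<in> borel_measurable borel"
    using cont by (rule continuous_imp_borel)
  let ?g = "\<lambda>n z. (f (z + of_real (1 / real (Suc n)) * e) - f z) / of_real (1 / real (Suc n))"
  have "(\<lambda>n. LINT z|lborel. ?g n z) \<longlonglongrightarrow> (LINT z|lborel. frechet_derivative f (at z) e)"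
  proof (rule integral_dominated_convergence[where w="\<lambda>z. C * 4 powr p * jbracket z powr (- p)"])
    show "integrable lborel (\<lambda>z. C * 4 powr p * jbracket z powr (- p))"
      using \<open>2 < p\<close> by (intro integrable_mult_right integrable_jbracket_powr)
    show "AE z in lborel. (\<lambda>n. ?g n z) \<longlonglongrightarrow> frechet_derivative f (at z) e"
      by (intro AE_I2 difference_quotient_tendsto f)
    show "AE z in lborel. cmod (?g n z) \<le> C * 4 powr p * jbracket z powr (- p)" for n
      by (intro AE_I2 difference_quotient_bound f B e) (use \<open>2 < p\<close> in auto)
  qed auto
  moreover have "(LINT z|lborel. ?g n z) = 0" for n
    using int integrable_translate[OF int] integral_translate[of f]
    by simp
  ultimately have "(\<lambda>n. 0) \<longlonglongrightarrow> (LINT z|lborel. frechet_derivative f (at z) e)"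
    by (simp only:)
  then show ?thesis by (simp only: LIMSEQ_const_iff)
qed

lemma integral_delbar:
  assumes f: "Ck 1 f" and int: "integrable lborel f"
    and B: "\<And>z. cmod (dx f z) \<le> C * jbracket z powr (- p)" "\<And>z. cmod (dy f z) \<le> C * jbracket z powr (- p)" and "2 < p"
  shows "(LINT z|lborel. dx f z) = 0" "(LINT z|lborel. dy f z) = 0" "(LINT z|lborel. delbar f z) = 0"
proof -
  have d: "f differentiable (at z)" for z using f differentiable_Ck by (metis One_nat_def)
  have c: "continuous_on UNIV (dx f)" "continuous_on UNIV (dy f)" using f by simp_all
  show 1: "(LINT z|lborel. dx f z) = 0" "(LINT z|lborel. dy f z) = 0"
    using integral_directional_derivative[OF d int, of 1 C p] integral_directional_derivative[OF d int, of \<i> C p] c B \<open>2 < p\<close>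
    by (simp_all add: dx_def[abs_def] dy_def[abs_def])
  have i: "integrable lborel (dx f)" "integrable lborel (dy f)"
    using B \<open>2 < p\<close> by (auto intro!: integrable_jbracket_bound continuous_imp_borel c)
  show "(LINT z|lborel. delbar f z) = 0"
    using 1 i by (simp add: delbar_def[abs_def])
qed

text \<open>conj(w) / (|w|^2 + d), the smooth version of 1 / w = conj(w) / |w|^2.\<close>

definition reg_kernel :: "real \<Rightarrow> complex \<Rightarrow> complex" where
  "reg_kernel d w = (1 / (w \<bullet> w + d)) *\<^sub>R cnj w"

lemma reg_kernel_has_derivative:
  assumes "d > 0"
  shows "(reg_kernel d has_derivative
    (\<lambda>h. (1 / (w \<bullet> w + d)) *\<^sub>R cnj h - (2 * (w \<bullet> h) / (w \<bullet> w + d)\<^sup>2) *\<^sub>R cnj w)) (at w)"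
proof -
  have pos: "w \<bullet> w + d > 0" using assms by (simp add: add_nonneg_pos)
  have D: "((\<lambda>w. w \<bullet> w + d) has_derivative (\<lambda>h. 2 * (w \<bullet> h))) (at w)"
    by (rule has_derivative_eq_rhs[OF has_derivative_add[OF
          has_derivative_inner[OF has_derivative_ident has_derivative_ident] has_derivative_const]])
      (simp add: inner_commute fun_eq_iff)
  have "((\<lambda>w. inverse (w \<bullet> w + d)) has_derivative (\<lambda>h. - (inverse (w \<bullet> w + d) * (2 * (w \<bullet> h)) * inverse (w \<bullet> w + d)))) (at w)"
    using pos by (intro Deriv.has_derivative_inverse[OF _ D]) simp
  from has_derivative_scaleR[OF this has_derivative_cnj[OF has_derivative_ident]]
  show ?thesis
    unfolding reg_kernel_def[abs_def]
    by (simp add: divide_inverse power2_eq_square mult_ac)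
qed

lemma reg_kernel_dx_dy:
  assumes "d > 0"
  shows "dx (reg_kernel d) w = of_real (1 / (w \<bullet> w + d)) - of_real (2 * Re w / (w \<bullet> w + d)\<^sup>2) * cnj w"
    and "dy (reg_kernel d) w = - \<i> * of_real (1 / (w \<bullet> w + d)) - of_real (2 * Im w / (w \<bullet> w + d)\<^sup>2) * cnj w"
  using has_derivative_imp_dx_dy[OF reg_kernel_has_derivative[OF assms, of w]]
  by (simp_all add: scaleR_conv_of_real inner_complex_def mult.commute)

text \<open>This is the approximate delta function, of total mass pi, that produces the point value
  in the Cauchy-Pompeiu formula as d tends to 0.\<close>

lemma reg_kernel_delbar:
  assumes "d > 0"
  shows "delbar (reg_kernel d) w = of_real (d / ((cmod w)\<^sup>2 + d)\<^sup>2)"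
proof -
  define N where "N = w \<bullet> w + d"
  have N: "N > 0" using assms by (simp add: N_def add_nonneg_pos)
  have Nw: "N = (cmod w)\<^sup>2 + d" by (simp add: N_def power2_norm_eq_inner)
  have "delbar (reg_kernel d) w = of_real (1 / N) - of_real (1 / N\<^sup>2) * (cnj w * (of_real (Re w) + \<i> * of_real (Im w)))"
    unfolding delbar_def reg_kernel_dx_dy[OF assms] N_def[symmetric]
    by (simp add: field_simps, simp add: add_divide_distrib)
  also have "of_real (Re w) + \<i> * of_real (Im w) = w"
    by (simp add: complex_eq_iff)
  also have "cnj w * w = of_real ((cmod w)\<^sup>2)"
    unfolding complex_norm_square by (rule mult.commute)
  also have "of_real (1 / N) - of_real (1 / N\<^sup>2) * complex_of_real ((cmod w)\<^sup>2) = of_real (1 / N - (cmod w)\<^sup>2 / N\<^sup>2)"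
    by simp
  also have "1 / N - (cmod w)\<^sup>2 / N\<^sup>2 = d / N\<^sup>2"
  proof -
    have "1 / N = N / N\<^sup>2" using N by (simp add: power2_eq_square)
    then show ?thesis by (simp add: Nw flip: diff_divide_distrib)
  qed
  finally show ?thesis by (simp add: Nw)
qed

text \<open>The constants blow up as d tends to 0. This is harmless: they only justify an
  integration by parts at fixed d.\<close>

lemma reg_kernel_bounds:
  assumes "d > 0"
  shows "cmod (reg_kernel d w) \<le> (1 + 1 / d) * jbracket w powr (- 1)"
    and "cmod (dx (reg_kernel d) w) \<le> 3 * (1 + 1 / d) * jbracket w powr (- 2)"
    and "cmod (dy (reg_kernel d) w) \<le> 3 * (1 + 1 / d) * jbracket w powr (- 2)"
proof -
  define N where "N = w \<bullet> w + d"
  have N: "N > 0" using assms by (simp add: N_def add_nonneg_pos)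
  have Nw: "N = (cmod w)\<^sup>2 + d" by (simp add: N_def power2_norm_eq_inner)
  have "(jbracket w)\<^sup>2 \<le> (1 + 1 / d) * N"
    using assms by (simp add: jbracket_square Nw field_simps)
  then have le: "1 / N \<le> (1 + 1 / d) * jbracket w powr (- 2)"
    using N by (simp add: powr_minus field_simps)
  have le3: "3 * (1 / N) \<le> 3 * (1 + 1 / d) * jbracket w powr (- 2)"
    unfolding mult.assoc by (rule mult_left_mono[OF le]) simp
  have "cmod (reg_kernel d w) = cmod w * (1 / N)"
    using N unfolding reg_kernel_def N_def[symmetric] by simp
  also have "\<dots> \<le> jbracket w * ((1 + 1 / d) * jbracket w powr (- 2))"
    using N by (intro mult_mono le norm_le_jbracket) auto
  also have "\<dots> = (1 + 1 / d) * (jbracket w powr 1 * jbracket w powr (- 2))"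
    by (simp add: mult_ac)
  also have "jbracket w powr 1 * jbracket w powr (- 2) = jbracket w powr (- 1)"
    by (simp only: powr_add[symmetric]) simp
  finally show "cmod (reg_kernel d w) \<le> (1 + 1 / d) * jbracket w powr (- 1)" .
  have aux: "cmod (of_real (2 * x / N\<^sup>2) * cnj w) \<le> 2 * (1 / N)" if "\<bar>x\<bar> \<le> cmod w" for x
  proof -
    have "cmod (of_real (2 * x / N\<^sup>2) * cnj w) = 2 * (\<bar>x\<bar> * cmod w) / N\<^sup>2"
      by (simp add: norm_mult norm_divide abs_mult power2_eq_square)
    also have "\<dots> \<le> 2 * (cmod w * cmod w) / N\<^sup>2"
      using that by (intro divide_right_mono mult_left_mono mult_right_mono) auto
    also have "\<dots> \<le> 2 * N / N\<^sup>2"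
      using assms by (intro divide_right_mono mult_left_mono) (auto simp: Nw power2_eq_square)
    also have "\<dots> = 2 * (1 / N)" using N by (simp add: power2_eq_square)
    finally show ?thesis .
  qed
  have "cmod (dx (reg_kernel d) w) \<le> cmod (of_real (1 / N)) + cmod (of_real (2 * Re w / N\<^sup>2) * cnj w)"
    unfolding reg_kernel_dx_dy[OF assms] N_def[symmetric] by (rule norm_triangle_ineq4)
  also have "\<dots> \<le> 1 / N + 2 * (1 / N)"
    using N abs_Re_le_cmod[of w] by (intro add_mono aux) (auto simp: norm_divide)
  also have "\<dots> = 3 * (1 / N)" by simp
  also note le3
  finally show "cmod (dx (reg_kernel d) w) \<le> 3 * (1 + 1 / d) * jbracket w powr (- 2)" .
  have "cmod (dy (reg_kernel d) w) \<le> cmod (- \<i> * of_real (1 / N)) + cmod (of_real (2 * Im w / N\<^sup>2) * cnj w)"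
    unfolding reg_kernel_dx_dy[OF assms] N_def[symmetric] by (rule norm_triangle_ineq4)
  also have "\<dots> \<le> 1 / N + 2 * (1 / N)"
    using N abs_Im_le_cmod[of w] by (intro add_mono aux) (auto simp: norm_divide norm_mult)
  also have "\<dots> = 3 * (1 / N)" by simp
  also note le3
  finally show "cmod (dy (reg_kernel d) w) \<le> 3 * (1 + 1 / d) * jbracket w powr (- 2)" .
qed

section \<open>Neumann series on spaces of classes\<close>

text \<open>The algebra of functions holds on the nose, while operators respect it only up to
  \<open>eqv\<close>; the latter is therefore reduced to null elements. Completeness is demanded
  only for geometrically dominated series, the kind a Neumann series produces, and includes the tail
  bound because sums are identified through it.\<close>

locale class_space =
  fixes X :: "('a::ab_group_add) fspace"
  assumes zero_mem: "0 \<in> elems X"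
    and add_mem: "u \<in> elems X \<Longrightarrow> v \<in> elems X \<Longrightarrow> u + v \<in> elems X"
    and smul_mem: "u \<in> elems X \<Longrightarrow> smul X c u \<in> elems X"
    and smul_minus_one: "smul X (- 1) u = - u"
    and smul_diff: "smul X c (u - v) = smul X c u - smul X c v"
    and eqv_iff: "eqv X u v \<longleftrightarrow> eqv X (u - v) 0"
    and eqv_zero: "eqv X 0 0"
    and eqv_null_diff: "eqv X u 0 \<Longrightarrow> eqv X v 0 \<Longrightarrow> eqv X (u - v) 0"
    and eqv_null_iff: "u \<in> elems X \<Longrightarrow> eqv X u 0 \<longleftrightarrow> nrm X u = 0"
    and nrm_nonneg: "0 \<le> nrm X u"
    and nrm_triangle: "u \<in> elems X \<Longrightarrow> v \<in> elems X \<Longrightarrow> nrm X (u + v) \<le> nrm X u + nrm X v"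
    and nrm_smul: "u \<in> elems X \<Longrightarrow> nrm X (smul X c u) = cmod c * nrm X u"
    and complete: "\<And>f K c. (\<And>n. f n \<in> elems X) \<Longrightarrow> (\<And>n. nrm X (f n) \<le> K * c ^ n) \<Longrightarrow> 0 < c \<Longrightarrow> c < 1 \<Longrightarrow>
       \<exists>S\<in>elems X. \<forall>N. nrm X (S - (\<Sum>n<N. f n)) \<le> K * c ^ N / (1 - c)"
begin

lemma uminus_mem: "u \<in> elems X \<Longrightarrow> - u \<in> elems X"
  using smul_mem[of u "- 1"] by (simp add: smul_minus_one)

lemma diff_mem: "u \<in> elems X \<Longrightarrow> v \<in> elems X \<Longrightarrow> u - v \<in> elems X"
  using add_mem[of u "- v"] uminus_mem[of v] by simp

lemma sum_mem: "(\<And>n. n \<in> I \<Longrightarrow> f n \<in> elems X) \<Longrightarrow> sum f I \<in> elems X"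
  by (induction I rule: infinite_finite_induct) (auto simp: zero_mem add_mem)

lemma null_uminus: "eqv X u 0 \<Longrightarrow> eqv X (- u) 0"
  using eqv_null_diff[OF eqv_zero, of u] by simp

lemma null_add: "eqv X u 0 \<Longrightarrow> eqv X v 0 \<Longrightarrow> eqv X (u + v) 0"
  using eqv_null_diff[of u "- v"] null_uminus[of v] by simp

lemma eqvD: "eqv X u v \<Longrightarrow> eqv X (u - v) 0"
  using eqv_iff by blast

lemma eqvI: "eqv X (u - v) 0 \<Longrightarrow> eqv X u v"
  using eqv_iff by blast

lemma eqv_refl [simp]: "eqv X u u"
  by (rule eqvI) (simp add: eqv_zero)

lemma eqv_sym: "eqv X u v \<Longrightarrow> eqv X v u"
  using null_uminus[OF eqvD, of u v] by (subst eqv_iff) simp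

lemma eqv_trans [trans]: "eqv X u v \<Longrightarrow> eqv X v w \<Longrightarrow> eqv X u w"
  using null_add[OF eqvD eqvD, of u v v w] by (subst eqv_iff) simp

lemma eqv_add: "eqv X u u' \<Longrightarrow> eqv X v v' \<Longrightarrow> eqv X (u + v) (u' + v')"
  using null_add[OF eqvD eqvD, of u u' v v'] by (subst eqv_iff) (simp add: algebra_simps)

lemma eqv_diff: "eqv X u u' \<Longrightarrow> eqv X v v' \<Longrightarrow> eqv X (u - v) (u' - v')"
  using eqv_null_diff[OF eqvD eqvD, of u u' v v'] by (subst eqv_iff) (simp add: algebra_simps)

lemma nrm_uminus: "u \<in> elems X \<Longrightarrow> nrm X (- u) = nrm X u"
  using nrm_smul[of u "- 1"] by (simp add: smul_minus_one)

lemma nrm_triangle_diff: "u \<in> elems X \<Longrightarrow> v \<in> elems X \<Longrightarrow> nrm X (u - v) \<le> nrm X u + nrm X v"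
  using nrm_triangle[of u "- v"] by (simp add: uminus_mem nrm_uminus)

lemma nrm_cong:
  assumes "u \<in> elems X" "v \<in> elems X" "eqv X u v"
  shows "nrm X u = nrm X v"
proof (rule antisym)
  have *: "nrm X u \<le> nrm X v" if "u \<in> elems X" "v \<in> elems X" "eqv X u v" for u v
    using nrm_triangle[of "u - v" v] diff_mem[of u v] eqv_null_iff[of "u - v"] eqvD[of u v] that by simp
  show "nrm X u \<le> nrm X v" "nrm X v \<le> nrm X u"
    using * assms eqv_sym by blast+
qed

lemma eqv_of_small:
  assumes "u \<in> elems X" "v \<in> elems X" and c: "0 \<le> c" "c < 1"
    and le: "\<And>N. nrm X (u - v) \<le> K * c ^ N"
  shows "eqv X u v"
proof -
  have "(\<lambda>N. K * c ^ N) \<longlonglongrightarrow> K * 0"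
    using c by (intro tendsto_mult tendsto_const LIMSEQ_power_zero) auto
  then have "nrm X (u - v) \<le> 0"
    using le by (intro LIMSEQ_le_const[of "\<lambda>N. K * c ^ N"]) auto
  then have "nrm X (u - v) = 0" using nrm_nonneg[of "u - v"] by simp
  then show ?thesis
    using eqv_null_iff[of "u - v"] diff_mem assms by (subst eqv_iff) simp
qed

section \<open>Laws of bounded operators up to null elements\<close>

context
  fixes T C assumes T: "bounded_operator X T C"
begin

lemma bo_mem: "u \<in> elems X \<Longrightarrow> T u \<in> elems X"
  and bo_cong: "u \<in> elems X \<Longrightarrow> v \<in> elems X \<Longrightarrow> eqv X u v \<Longrightarrow> eqv X (T u) (T v)"
  and bo_add: "u \<in> elems X \<Longrightarrow> v \<in> elems X \<Longrightarrow> eqv X (T (u + v)) (T u + T v)"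
  and bo_smul: "u \<in> elems X \<Longrightarrow> eqv X (T (smul X c u)) (smul X c (T u))"
  and bo_nrm: "u \<in> elems X \<Longrightarrow> nrm X (T u) \<le> C * nrm X u"
  using T unfolding bounded_operator_def by blast+

lemma bo_diff:
  assumes "u \<in> elems X" "v \<in> elems X"
  shows "eqv X (T (u - v)) (T u - T v)"
proof -
  have "eqv X (T (u + - v)) (T u + T (- v))"
    using assms by (intro bo_add uminus_mem)
  moreover have "eqv X (T (- v)) (- T v)"
    using bo_smul[OF assms(2), of "- 1"] by (simp add: smul_minus_one)
  ultimately have "eqv X (T (u + - v)) (T u + - T v)"
    using eqv_trans[OF _ eqv_add[OF eqv_refl]] by blast
  then show ?thesis by simp
qed

lemma bo_zero: "eqv X (T 0) 0"
  using bo_diff[OF zero_mem zero_mem] by simp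

lemma bo_sum:
  assumes "finite I" "\<And>n. n \<in> I \<Longrightarrow> f n \<in> elems X"
  shows "eqv X (T (sum f I)) (\<Sum>n\<in>I. T (f n))"
  using assms
proof (induction I)
  case (insert i I)
  then have "eqv X (T (f i + sum f I)) (T (f i) + T (sum f I))"
    by (intro bo_add sum_mem) auto
  also have "eqv X \<dots> (T (f i) + (\<Sum>n\<in>I. T (f n)))"
    using insert by (intro eqv_add) auto
  finally show ?case using insert by simp
qed (simp add: bo_zero)

end

lemma bo_comp:
  assumes "bounded_operator X S C" "bounded_operator X T D" "0 \<le> C"
  shows "bounded_operator X (S \<circ> T) (C * D)"
  unfolding bounded_operator_def
proof (intro conjI ballI allI impI)
  note S = bo_mem[OF assms(1)] bo_cong[OF assms(1)] bo_add[OF assms(1)] bo_smul[OF assms(1)] bo_nrm[OF assms(1)]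
  note T = bo_mem[OF assms(2)] bo_cong[OF assms(2)] bo_add[OF assms(2)] bo_smul[OF assms(2)] bo_nrm[OF assms(2)]
  fix u v c assume u: "u \<in> elems X"
  show "(S \<circ> T) u \<in> elems X" using S(1) T(1) u by simp
  show "eqv X ((S \<circ> T) (smul X c u)) (smul X c ((S \<circ> T) u))"
    using eqv_trans[OF S(2)[OF T(1)[OF smul_mem[OF u]] smul_mem[OF T(1)[OF u]] T(4)[OF u]] S(4)[OF T(1)[OF u]]] by simp
  show "nrm X ((S \<circ> T) u) \<le> C * D * nrm X u"
    using order_trans[OF S(5)[OF T(1)[OF u]] mult_left_mono[OF T(5)[OF u] assms(3)]] by (simp add: mult_ac)
  assume v: "v \<in> elems X"
  show "eqv X ((S \<circ> T) u) ((S \<circ> T) v)" if "eqv X u v"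
    using S(2)[OF T(1)[OF u] T(1)[OF v] T(2)[OF u v that]] by simp
  show "eqv X ((S \<circ> T) (u + v)) ((S \<circ> T) u + (S \<circ> T) v)"
    using eqv_trans[OF S(2)[OF T(1)[OF add_mem[OF u v]] add_mem[OF T(1)[OF u] T(1)[OF v]] T(3)[OF u v]]
        S(3)[OF T(1)[OF u] T(1)[OF v]]] by simp
qed

lemma bo_mono: "bounded_operator X T C \<Longrightarrow> C \<le> D \<Longrightarrow> bounded_operator X T D"
  unfolding bounded_operator_def by (meson mult_right_mono nrm_nonneg order_trans)

lemma bo_null: "bounded_operator X 0 0"
proof -
  have s0: "smul X c 0 = 0" for c using smul_diff[of c 0 0] by simp
  have "nrm X 0 = 0" using eqv_null_iff[OF zero_mem] eqv_zero by simp
  then show ?thesis by (simp add: bounded_operator_def zero_mem s0)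
qed

text \<open>The powers of T are linear only up to null elements, so no law of the limit R can be
  read off directly. Each is obtained by showing that the candidate is approximated by the right
  partial sums at a geometric rate.\<close>

lemma neumann_inverse:
  assumes T: "bounded_operator X T c" and c: "0 < c" "c < 1"
  obtains R where "bounded_operator X R (1 / (1 - c))" "is_inverse X (id - T) R"
proof -
  note Tm = bo_mem[OF T] and Tn = bo_nrm[OF T] and Td = bo_diff[OF T] and Tc = bo_cong[OF T]
  have pm: "(T ^^ n) u \<in> elems X" if "u \<in> elems X" for n u
    by (induction n) (auto simp: that Tm)
  have pn: "nrm X ((T ^^ n) u) \<le> nrm X u * c ^ n" if "u \<in> elems X" for n u
  proof (induction n)
    case (Suc n)
    have "nrm X (T ((T ^^ n) u)) \<le> c * nrm X ((T ^^ n) u)" by (rule Tn[OF pm[OF that]])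
    also have "\<dots> \<le> c * (nrm X u * c ^ n)" using Suc c by (intro mult_left_mono) auto
    finally show ?case by (simp add: mult_ac)
  qed simp
  have pc: "eqv X ((T ^^ n) u) ((T ^^ n) v)" if "u \<in> elems X" "v \<in> elems X" "eqv X u v" for n u v
  proof (induction n)
    case (Suc n)
    then show ?case using Tc[OF pm[OF that(1)] pm[OF that(2)]] by simp
  qed (simp add: that)
  have pa: "eqv X ((T ^^ n) (u + v)) ((T ^^ n) u + (T ^^ n) v)" if "u \<in> elems X" "v \<in> elems X" for n u v
  proof (induction n)
    case (Suc n)
    then have "eqv X (T ((T ^^ n) (u + v))) (T ((T ^^ n) u + (T ^^ n) v))"
      using that by (intro Tc pm add_mem)
    also have "eqv X \<dots> (T ((T ^^ n) u) + T ((T ^^ n) v))"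
      using that by (intro bo_add[OF T] pm)
    finally show ?case by simp
  qed simp
  have ps: "eqv X ((T ^^ n) (smul X a u)) (smul X a ((T ^^ n) u))" if "u \<in> elems X" for n u a
  proof (induction n)
    case (Suc n)
    then have "eqv X (T ((T ^^ n) (smul X a u))) (T (smul X a ((T ^^ n) u)))"
      using that by (intro Tc pm smul_mem)
    also have "eqv X \<dots> (smul X a (T ((T ^^ n) u)))"
      using that by (intro bo_smul[OF T] pm)
    finally show ?case by simp
  qed simp
  define G where "G N u = (\<Sum>n<N. (T ^^ n) u)" for N u
  have Gm: "G N u \<in> elems X" if "u \<in> elems X" for N u
    unfolding G_def using that by (intro sum_mem pm)
  \<comment> \<open>The sum of the series is determined only up to null elements, so a
    representative is chosen for each u; compatibility of these choices is proved
    afterwards.\<close>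
  define R where "R u = (SOME S. S \<in> elems X \<and> (\<forall>N. nrm X (S - G N u) \<le> nrm X u * c ^ N / (1 - c)))" for u
  have R: "R u \<in> elems X \<and> (\<forall>N. nrm X (R u - G N u) \<le> nrm X u * c ^ N / (1 - c))" if "u \<in> elems X" for u
    unfolding R_def G_def
    by (rule someI_ex) (use complete[of "\<lambda>n. (T ^^ n) u" "nrm X u" c] pm pn that c in auto)
  then have Rm: "R u \<in> elems X" and Rn: "nrm X (R u - G N u) \<le> nrm X u / (1 - c) * c ^ N" if "u \<in> elems X" for u N
    using that by (simp_all add: mult_ac)
  \<comment> \<open>Two elements approximated by the same partial sums at the rate c^N differ by
    O(c^N) for every N, hence are equivalent. In \<open>uniq'\<close> the remainder may itself be
    replaced by an equivalent D N.\<close>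
  have uniq: "eqv X S (R u)" if u: "u \<in> elems X" and S: "S \<in> elems X" and le: "\<And>N. nrm X (S - G N u) \<le> K * c ^ N" for S u K
  proof (rule eqv_of_small[of _ _ c "K + nrm X u / (1 - c)"])
    fix N
    have "nrm X (S - R u) = nrm X ((S - G N u) - (R u - G N u))" by simp
    also have "\<dots> \<le> nrm X (S - G N u) + nrm X (R u - G N u)"
      by (intro nrm_triangle_diff diff_mem Rm Gm u S)
    also have "\<dots> \<le> K * c ^ N + nrm X u / (1 - c) * c ^ N"
      by (intro add_mono le Rn u)
    finally show "nrm X (S - R u) \<le> (K + nrm X u / (1 - c)) * c ^ N" by (simp add: algebra_simps)
  qed (use c Rm u S in auto)
  have uniq': "eqv X S (R u)" if u: "u \<in> elems X" and S: "S \<in> elems X"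
    and D: "\<And>N. D N \<in> elems X" "\<And>N. eqv X (S - G N u) (D N)" "\<And>N. nrm X (D N) \<le> K * c ^ N" for S u K D
    by (rule uniq[OF u S, of K]) (use nrm_cong[OF diff_mem[OF S Gm[OF u]] D(1) D(2)] D(3) in simp)
  have sum_cong: "eqv X (sum f I) (sum g I)" if "\<And>n. eqv X (f n) (g n)" for f g :: "nat \<Rightarrow> 'a" and I
    by (induction I rule: infinite_finite_induct) (auto intro: eqv_add that)
  have Rc: "eqv X (R u) (R v)" if "u \<in> elems X" "v \<in> elems X" "eqv X u v" for u v
  proof (rule uniq'[of _ _ "\<lambda>N. R u - G N u" "nrm X u / (1 - c)"])
    show "eqv X (R u - G N v) (R u - G N u)" for N
      unfolding G_def using that by (intro eqv_diff sum_cong eqv_refl pc eqv_sym[OF that(3)])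
    show "nrm X (R u - G N u) \<le> nrm X u / (1 - c) * c ^ N" for N
      by (rule Rn[OF that(1)])
  qed (use that in \<open>auto intro: Rm Gm diff_mem Rn\<close>)
  have Ra: "eqv X (R (u + v)) (R u + R v)" if "u \<in> elems X" "v \<in> elems X" for u v
  proof (rule eqv_sym, rule uniq'[of _ _ "\<lambda>N. (R u - G N u) + (R v - G N v)" "nrm X u / (1 - c) + nrm X v / (1 - c)"])
    fix N
    have "eqv X (G N (u + v)) (G N u + G N v)"
      unfolding G_def sum.distrib[symmetric] using that by (intro sum_cong pa)
    then have "eqv X (R u + R v - G N (u + v)) (R u + R v - (G N u + G N v))"
      by (intro eqv_diff eqv_refl)
    then show "eqv X (R u + R v - G N (u + v)) ((R u - G N u) + (R v - G N v))"
      by (simp add: algebra_simps)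
    have "nrm X ((R u - G N u) + (R v - G N v)) \<le> nrm X (R u - G N u) + nrm X (R v - G N v)"
      using that by (intro nrm_triangle diff_mem Rm Gm)
    also have "\<dots> \<le> nrm X u / (1 - c) * c ^ N + nrm X v / (1 - c) * c ^ N"
      using that by (intro add_mono Rn)
    finally show "nrm X ((R u - G N u) + (R v - G N v)) \<le> (nrm X u / (1 - c) + nrm X v / (1 - c)) * c ^ N"
      by (simp add: distrib_right)
  qed (use that in \<open>auto intro!: Rm Gm diff_mem add_mem\<close>)
  have Rs: "eqv X (R (smul X a u)) (smul X a (R u))" if u: "u \<in> elems X" for u a
  proof (rule eqv_sym, rule uniq'[of _ _ "\<lambda>N. smul X a (R u - G N u)" "cmod a * (nrm X u / (1 - c))"])
    fix N
    have z: "smul X a 0 = 0" using smul_diff[of a 0 0] by simp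
    have sa: "smul X a (x + y) = smul X a x + smul X a y" for x y
      using smul_diff[of a "x + y" y] by (simp add: algebra_simps)
    have "smul X a (sum f I) = (\<Sum>n\<in>I. smul X a (f n))" for f :: "nat \<Rightarrow> 'a" and I
      by (induction I rule: infinite_finite_induct) (auto simp: z sa)
    then have "eqv X (G N (smul X a u)) (smul X a (G N u))"
      unfolding G_def using u by (auto intro: sum_cong ps)
    then show "eqv X (smul X a (R u) - G N (smul X a u)) (smul X a (R u - G N u))"
      unfolding smul_diff by (intro eqv_diff eqv_refl)
    show "nrm X (smul X a (R u - G N u)) \<le> cmod a * (nrm X u / (1 - c)) * c ^ N"
      using mult_left_mono[OF Rn[OF u, of N], of "cmod a"] nrm_smul[OF diff_mem[OF Rm Gm], OF u u]
      by (simp add: mult.assoc)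
  qed (use u in \<open>auto intro!: Rm Gm diff_mem smul_mem\<close>)
  have Rb: "bounded_operator X R (1 / (1 - c))"
    unfolding bounded_operator_def
  proof (intro conjI ballI allI impI)
    show "nrm X (R u) \<le> 1 / (1 - c) * nrm X u" if "u \<in> elems X" for u
      using Rn[OF that, of 0] by (simp add: G_def)
  qed (fact Rm Rc Ra Rs)+
  \<comment> \<open>Telescoping: (1 + T + ... + T^(N-1)) (1 - T) = 1 - T^N.\<close>
  have tel: "eqv X (G N (u - T u)) (u - (T ^^ N) u)" if u: "u \<in> elems X" for N u
  proof (induction N)
    case (Suc N)
    have "eqv X ((T ^^ N) (u - T u)) ((T ^^ N) u - (T ^^ N) (T u))"
    proof -
      have "eqv X ((T ^^ N) (u + - T u)) ((T ^^ N) u + (T ^^ N) (- T u))"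
        using u by (intro pa uminus_mem Tm)
      also have "eqv X \<dots> ((T ^^ N) u + - (T ^^ N) (T u))"
        using ps[OF Tm[OF u], of N "- 1"] by (intro eqv_add eqv_refl) (simp add: smul_minus_one)
      finally show ?thesis by simp
    qed
    from eqv_add[OF Suc this] show ?case
      by (simp add: G_def funpow_swap1)
  qed (simp add: G_def)
  have left: "eqv X (R (u - T u)) u" if u: "u \<in> elems X" for u
  proof (rule eqv_sym, rule uniq'[of _ _ "\<lambda>N. (T ^^ N) u" "nrm X u"])
    fix N
    have "eqv X (u - G N (u - T u)) (u - (u - (T ^^ N) u))"
      by (intro eqv_diff eqv_refl tel u)
    then show "eqv X (u - G N (u - T u)) ((T ^^ N) u)" by simp
  qed (use u in \<open>auto intro!: pm pn diff_mem Tm\<close>)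
  \<comment> \<open>R commutes with T because the partial sums do; the right inverse property then
    follows from the left one.\<close>
  have comm: "eqv X (T (R u)) (R (T u))" if u: "u \<in> elems X" for u
  proof (rule uniq'[of _ _ "\<lambda>N. T (R u - G N u)" "c * (nrm X u / (1 - c))"])
    fix N
    have "eqv X (T (G N u)) (G N (T u))"
      using bo_sum[OF T, of "{..<N}" "\<lambda>n. (T ^^ n) u"] pm[OF u] by (simp add: G_def funpow_swap1)
    then have "eqv X (T (R u) - G N (T u)) (T (R u) - T (G N u))"
      by (rule eqv_diff[OF eqv_refl eqv_sym])
    also have "eqv X \<dots> (T (R u - G N u))"
      using u by (intro eqv_sym[OF Td] Rm Gm)
    finally show "eqv X (T (R u) - G N (T u)) (T (R u - G N u))" .
    show "nrm X (T (R u - G N u)) \<le> c * (nrm X u / (1 - c)) * c ^ N"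
      using order_trans[OF Tn[OF diff_mem[OF Rm[OF u] Gm[OF u]]] mult_left_mono[OF Rn[OF u, of N]]] c
      by (simp add: mult.assoc)
  qed (use u in \<open>auto intro!: Rm Gm diff_mem Tm\<close>)
  have right: "eqv X (R u - T (R u)) u" if u: "u \<in> elems X" for u
  proof -
    have "eqv X (R u - T (R u)) (R u - R (T u))"
      by (intro eqv_diff eqv_refl comm u)
    also have "eqv X \<dots> (R (u - T u))"
      using u by (intro eqv_sym[OF bo_diff[OF Rb]] Tm)
    also have "eqv X \<dots> u" by (rule left[OF u])
    finally show ?thesis .
  qed
  have "is_inverse X (id - T) R"
    unfolding is_inverse_def operator_eq_def
  proof (intro conjI ballI exI)
    show "bounded_operator X R (1 / (1 - c))" by (rule Rb)
    fix u assume "u \<in> elems X"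
    then show "eqv X (((id - T) \<circ> R) u) (id u)" "eqv X ((R \<circ> (id - T)) u) (id u)"
      using right left by simp_all
  qed
  with Rb show ?thesis by (rule that)
qed

end

section \<open>Two-by-two operator matrices\<close>

lemma op_matrix_square:
  fixes A B :: "'a::ab_group_add \<Rightarrow> 'a"
  shows "op_matrix 0 A B 0 \<circ> op_matrix 0 A B 0 = op_matrix (A \<circ> B) 0 0 (B \<circ> A)"
  by (auto simp: fun_eq_iff op_matrix_def)

context class_space
begin

text \<open>By sqrt(x^2 + y^2) <= x + y the sum of the four entry norms is a bound. It is not sharp,
  but only orders of magnitude are at stake.\<close>

lemma bounded_op_matrix:
  assumes "bounded_operator X T11 C11" "bounded_operator X T12 C12"
    "bounded_operator X T21 C21" "bounded_operator X T22 C22"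
    and C: "0 \<le> C11" "0 \<le> C12" "0 \<le> C21" "0 \<le> C22"
  shows "bounded_operator (square X) (op_matrix T11 T12 T21 T22) (C11 + C12 + C21 + C22)"
proof -
  note M = assms(1-4)[THEN bo_mem] and N = assms(1-4)[THEN bo_nrm] and A = assms(1-4)[THEN bo_add]
    and S = assms(1-4)[THEN bo_smul] and G = assms(1-4)[THEN bo_cong]
  have sa: "smul X c (x + y) = smul X c x + smul X c y" for c x y
    using smul_diff[of c "x + y" y] by (simp add: algebra_simps)
  have row: "nrm X (S u + T v) \<le> (C + D) * sqrt ((nrm X u)\<^sup>2 + (nrm X v)\<^sup>2)"
    if "bounded_operator X S C" "bounded_operator X T D" "0 \<le> C" "0 \<le> D" "u \<in> elems X" "v \<in> elems X" for S T C D u v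
  proof -
    have "nrm X (S u + T v) \<le> nrm X (S u) + nrm X (T v)"
      by (rule nrm_triangle[OF bo_mem[OF that(1,5)] bo_mem[OF that(2,6)]])
    also have "\<dots> \<le> C * nrm X u + D * nrm X v"
      by (rule add_mono[OF bo_nrm[OF that(1,5)] bo_nrm[OF that(2,6)]])
    also have "\<dots> \<le> C * sqrt ((nrm X u)\<^sup>2 + (nrm X v)\<^sup>2) + D * sqrt ((nrm X u)\<^sup>2 + (nrm X v)\<^sup>2)"
      using that(3,4) real_sqrt_ge_abs1[of "nrm X u" "nrm X v"] real_sqrt_ge_abs2[of "nrm X v" "nrm X u"] nrm_nonneg
      by (intro add_mono mult_left_mono) auto
    finally show ?thesis by (simp add: distrib_right)
  qed
  have rowadd: "eqv X (S (u + u') + T (v + v')) ((S u + T v) + (S u' + T v'))"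
    if "bounded_operator X S C" "bounded_operator X T D" "u \<in> elems X" "v \<in> elems X" "u' \<in> elems X" "v' \<in> elems X" for S T C D u v u' v'
    using eqv_add[OF bo_add[OF that(1,3,5)] bo_add[OF that(2,4,6)]] by (simp add: algebra_simps)
  have rowsmul: "eqv X (S (smul X c u) + T (smul X c v)) (smul X c (S u + T v))"
    if "bounded_operator X S C" "bounded_operator X T D" "u \<in> elems X" "v \<in> elems X" for S T C D u v c
    using eqv_add[OF bo_smul[OF that(1,3)] bo_smul[OF that(2,4)]] by (simp add: sa)
  show ?thesis
    unfolding bounded_operator_def
  proof (intro conjI ballI allI impI)
    fix p assume "p \<in> elems (square X)"
    then obtain u v where p: "p = (u, v)" "u \<in> elems X" "v \<in> elems X" by (auto simp: square_def)
    show "op_matrix T11 T12 T21 T22 p \<in> elems (square X)"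
      using p M by (simp add: square_def op_matrix_def add_mem)
    show "eqv (square X) (op_matrix T11 T12 T21 T22 (smul (square X) c p)) (smul (square X) c (op_matrix T11 T12 T21 T22 p))" for c
      using p rowsmul[OF assms(1,2)] rowsmul[OF assms(3,4)] by (simp add: square_def op_matrix_def)
    show "nrm (square X) (op_matrix T11 T12 T21 T22 p) \<le> (C11 + C12 + C21 + C22) * nrm (square X) p"
    proof -
      have "nrm (square X) (op_matrix T11 T12 T21 T22 p) \<le> nrm X (T11 u + T12 v) + nrm X (T21 u + T22 v)"
        using p by (simp add: square_def op_matrix_def sqrt_sum_squares_le_sum nrm_nonneg)
      also have "\<dots> \<le> (C11 + C12) * sqrt ((nrm X u)\<^sup>2 + (nrm X v)\<^sup>2) + (C21 + C22) * sqrt ((nrm X u)\<^sup>2 + (nrm X v)\<^sup>2)"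
        by (intro add_mono row[OF assms(1,2)] row[OF assms(3,4)] C p)
      finally show ?thesis using p by (simp add: square_def algebra_simps)
    qed
    fix p' assume "p' \<in> elems (square X)"
    then obtain u' v' where p': "p' = (u', v')" "u' \<in> elems X" "v' \<in> elems X" by (auto simp: square_def)
    show "eqv (square X) (op_matrix T11 T12 T21 T22 (p + p')) (op_matrix T11 T12 T21 T22 p + op_matrix T11 T12 T21 T22 p')"
      using p p' rowadd[OF assms(1,2)] rowadd[OF assms(3,4)] by (simp add: square_def op_matrix_def)
    show "eqv (square X) (op_matrix T11 T12 T21 T22 p) (op_matrix T11 T12 T21 T22 p')" if "eqv (square X) p p'"
      using that p p' G by (simp add: square_def op_matrix_def eqv_add)
  qed
qed

text \<open>With P = (1 - A B)^-1 and Q = (1 - B A)^-1 the inverse of 1 - K is diag(P, Q) (1 + K),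
  with entries P, P A, Q B, Q. From c <= 1/2 the norms of P and Q are at most 2, and the four entry
  bounds 2, 2 a, 2 b, 2 add up to the stated constant.\<close>

lemma antidiagonal_inverse:
  assumes A: "bounded_operator X A a" and B: "bounded_operator X B b" and ab: "0 \<le> a" "0 \<le> b"
    and AB: "bounded_operator X (A \<circ> B) c" and BA: "bounded_operator X (B \<circ> A) c" and c: "0 < c" "c \<le> 1 / 2"
  defines "K \<equiv> op_matrix 0 A B 0"
  shows "\<exists>R S P Q. is_inverse (square X) (id - K) R \<and>
        bounded_operator (square X) R (4 + 2 * a + 2 * b) \<and>
        is_inverse (square X) (id - (K \<circ> K)) S \<and>
        is_inverse X (id - (A \<circ> B)) P \<and>
        is_inverse X (id - (B \<circ> A)) Q \<and>
        operator_eq (square X) R (S \<circ> (id + K)) \<and>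
        operator_eq (square X) R (op_matrix P 0 0 Q \<circ> op_matrix id A B id)"
proof -
  have c1: "c < 1" "1 / (1 - c) \<le> 2" using c by (auto simp: field_simps)
  obtain P where P: "bounded_operator X P 2" and Pi: "is_inverse X (id - (A \<circ> B)) P"
    using neumann_inverse[OF AB c(1) c1(1)] bo_mono[OF _ c1(2)] by metis
  obtain Q where Q: "bounded_operator X Q 2" and Qi: "is_inverse X (id - (B \<circ> A)) Q"
    using neumann_inverse[OF BA c(1) c1(1)] bo_mono[OF _ c1(2)] by metis
  define R where "R = op_matrix P (P \<circ> A) (Q \<circ> B) Q"
  define S where "S = op_matrix P 0 0 Q"
  have Rb: "bounded_operator (square X) R (4 + 2 * a + 2 * b)"
    using bounded_op_matrix[OF P bo_comp[OF P A] bo_comp[OF Q B] Q] ab by (simp add: R_def algebra_simps)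
  have Sb: "bounded_operator (square X) S 4"
    using bounded_op_matrix[OF P bo_null bo_null Q] by (simp add: S_def)
  note m = bo_mem[OF A] bo_mem[OF B] bo_mem[OF P] bo_mem[OF Q] add_mem diff_mem
  have Pl: "eqv X (P (u - A (B u))) u" and Pr: "eqv X (P u - A (B (P u))) u"
    and Ql: "eqv X (Q (u - B (A u))) u" and Qr: "eqv X (Q u - B (A (Q u))) u" if "u \<in> elems X" for u
    using Pi Qi that by (simp_all add: is_inverse_def operator_eq_def)
  have Pd: "eqv X (P u - P (A (B u))) u" and Qd: "eqv X (Q u - Q (B (A u))) u" if "u \<in> elems X" for u
    using eqv_trans[OF eqv_sym[OF bo_diff[OF P that m(1)[OF m(2)[OF that]]]] Pl[OF that]]
      eqv_trans[OF eqv_sym[OF bo_diff[OF Q that m(2)[OF m(1)[OF that]]]] Ql[OF that]] by simp_all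
  \<comment> \<open>The intertwining P A = A Q: for y = Q w one has w = y - B A y, hence A w = (1 -
    A B) A y, and P removes the first factor. Generic names allow the same argument to give Q B = B
    P.\<close>
  have inter: "eqv X (P' (A' w)) (A' (Q' w))"
    if P': "bounded_operator X P' p" and A': "bounded_operator X A' a'" and w: "w \<in> elems X"
      and B': "bounded_operator X B' b'" and Q': "bounded_operator X Q' q"
      and Pl': "\<And>u. u \<in> elems X \<Longrightarrow> eqv X (P' (u - A' (B' u))) u"
      and Qr': "\<And>u. u \<in> elems X \<Longrightarrow> eqv X (Q' u - B' (A' (Q' u))) u" for P' A' B' Q' p a' b' q w
  proof -
    note m' = bo_mem[OF P'] bo_mem[OF A'] bo_mem[OF B'] bo_mem[OF Q'] diff_mem
    define y where "y = Q' w"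
    have y: "y \<in> elems X" using w m' by (simp add: y_def)
    have "eqv X w (y - B' (A' y))" using eqv_sym[OF Qr'[OF w]] by (simp add: y_def)
    then have "eqv X (A' w) (A' (y - B' (A' y)))"
      by (intro bo_cong[OF A'] w m' y)
    also have "eqv X \<dots> (A' y - A' (B' (A' y)))" by (intro bo_diff[OF A'] y m')
    finally have "eqv X (P' (A' w)) (P' (A' y - A' (B' (A' y))))"
      by (intro bo_cong[OF P'] w m' y)
    also have "eqv X \<dots> (A' y)" by (intro Pl' m' y)
    finally show ?thesis by (simp add: y_def)
  qed
  have PA: "eqv X (P (A w)) (A (Q w))" and QB: "eqv X (Q (B w)) (B (P w))" if "w \<in> elems X" for w
    using inter[OF P A that B Q Pl Qr] inter[OF Q B that A P Ql Pr] by blast+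
  \<comment> \<open>One row of (1 - K) R = 1. Intertwining turns A Q B u into P A B u and A Q v into
    P A v, after which the v terms cancel. The other row is the same with the roles of A, B and P, Q
    exchanged.\<close>
  have inv: "eqv X ((P u + P (A v)) - A (Q (B u) + Q v)) u"
    if P: "bounded_operator X P p" and A: "bounded_operator X A a'" and B: "bounded_operator X B b'" and Q: "bounded_operator X Q q"
      and u: "u \<in> elems X" and v: "v \<in> elems X"
      and PA: "\<And>w. w \<in> elems X \<Longrightarrow> eqv X (P (A w)) (A (Q w))"
      and Pd: "\<And>u. u \<in> elems X \<Longrightarrow> eqv X (P u - P (A (B u))) u" for P A B Q p a' b' q u v
  proof -
    note m = bo_mem[OF A] bo_mem[OF B] bo_mem[OF P] bo_mem[OF Q] add_mem diff_mem
    have "eqv X (A (Q (B u) + Q v)) (A (Q (B u)) + A (Q v))" by (intro bo_add[OF A] m u v)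
    also have "eqv X \<dots> (P (A (B u)) + P (A v))"
      by (rule eqv_add[OF eqv_sym[OF PA] eqv_sym[OF PA]]) (intro m u v)+
    finally have "eqv X ((P u + P (A v)) - A (Q (B u) + Q v)) ((P u + P (A v)) - (P (A (B u)) + P (A v)))"
      by (rule eqv_diff[OF eqv_refl])
    also have "(P u + P (A v)) - (P (A (B u)) + P (A v)) = P u - P (A (B u))" by simp
    also have "eqv X \<dots> u" by (rule Pd[OF u])
    finally show ?thesis .
  qed
  have inv': "eqv X (P (u - A v) + P (A (v - B u))) u"
    if P: "bounded_operator X P p" and A: "bounded_operator X A a'" and B: "bounded_operator X B b'"
      and u: "u \<in> elems X" and v: "v \<in> elems X"
      and Pd: "\<And>u. u \<in> elems X \<Longrightarrow> eqv X (P u - P (A (B u))) u" for P A B p a' b' u v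
  proof -
    note m = bo_mem[OF A] bo_mem[OF B] bo_mem[OF P] add_mem diff_mem
    have 1: "eqv X (P (u - A v)) (P u - P (A v))" by (intro bo_diff[OF P] m u v)
    have "eqv X (A (v - B u)) (A v - A (B u))" by (intro bo_diff[OF A] m u v)
    then have "eqv X (P (A (v - B u))) (P (A v - A (B u)))" by (intro bo_cong[OF P] m u v)
    also have "eqv X \<dots> (P (A v) - P (A (B u)))" by (intro bo_diff[OF P] m u v)
    finally have "eqv X (P (u - A v) + P (A (v - B u))) ((P u - P (A v)) + (P (A v) - P (A (B u))))"
      by (rule eqv_add[OF 1])
    also have "(P u - P (A v)) + (P (A v) - P (A (B u))) = P u - P (A (B u))" by simp
    also have "eqv X \<dots> u" by (rule Pd[OF u])
    finally show ?thesis .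
  qed
  have sq: "eqv (square X) (x, y) (x', y') \<longleftrightarrow> eqv X x x' \<and> eqv X y y'" for x y x' y'
    by (simp add: square_def)
  have el: "(\<forall>p\<in>elems (square X). \<Phi> p) \<longleftrightarrow> (\<forall>u\<in>elems X. \<forall>v\<in>elems X. \<Phi> (u, v))" for \<Phi>
    by (auto simp: square_def)
  have "is_inverse (square X) (id - K) R"
    unfolding is_inverse_def operator_eq_def el
  proof (intro conjI exI ballI)
    show "bounded_operator (square X) R (4 + 2 * a + 2 * b)" by (rule Rb)
    fix u v assume u: "u \<in> elems X" and v: "v \<in> elems X"
    show "eqv (square X) (((id - K) \<circ> R) (u, v)) (id (u, v))"
      using inv[OF P A B Q u v PA Pd] inv[OF Q B A P v u QB Qd]
      by (simp add: R_def K_def op_matrix_def sq add.commute)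
    show "eqv (square X) ((R \<circ> (id - K)) (u, v)) (id (u, v))"
      using inv'[OF P A B u v Pd] inv'[OF Q B A v u Qd]
      by (simp add: R_def K_def op_matrix_def sq add.commute)
  qed
  moreover have "is_inverse (square X) (id - (K \<circ> K)) S"
    unfolding is_inverse_def operator_eq_def el
  proof (intro conjI exI ballI)
    show "bounded_operator (square X) S 4" by (rule Sb)
    fix u v assume u: "u \<in> elems X" and v: "v \<in> elems X"
    show "eqv (square X) (((id - (K \<circ> K)) \<circ> S) (u, v)) (id (u, v))"
      using Pr[OF u] Qr[OF v] by (simp add: S_def K_def op_matrix_def sq)
    show "eqv (square X) ((S \<circ> (id - (K \<circ> K))) (u, v)) (id (u, v))"
      using Pl[OF u] Ql[OF v] by (simp add: S_def K_def op_matrix_def sq)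
  qed
  moreover have "operator_eq (square X) R (S \<circ> (id + K))"
    "operator_eq (square X) R (op_matrix P 0 0 Q \<circ> op_matrix id A B id)"
    unfolding operator_eq_def el
    using eqv_sym[OF bo_add[OF P _ m(1)]] eqv_sym[OF bo_add[OF Q m(2)]] eqv_sym[OF bo_add[OF Q _ m(2)]]
    by (auto simp: R_def S_def K_def op_matrix_def sq add.commute)
  ultimately show ?thesis
    using Rb Pi Qi by blast
qed

end

section \<open>The Cauchy--Pompeiu formula\<close>

lemma measurable_cnj [measurable]: "cnj \<in> borel_measurable borel"
  by (intro borel_measurable_continuous_onI continuous_intros)

lemma dx_fun_mult:
  assumes "\<And>z. f differentiable (at z)" "\<And>z. g differentiable (at z)"
  shows "dx (\<lambda>z. f z * g z) = (\<lambda>z. dx f z * g z + f z * dx g z)"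
    and "dy (\<lambda>z. f z * g z) = (\<lambda>z. dy f z * g z + f z * dy g z)"
    and "del (\<lambda>z. f z * g z) = (\<lambda>z. del f z * g z + f z * del g z)"
    and "delbar (\<lambda>z. f z * g z) = (\<lambda>z. delbar f z * g z + f z * delbar g z)"
  using dx_dy_mult[OF assms] by (auto simp: fun_eq_iff del_def delbar_def field_simps)

lemma dx_fun_add:
  assumes "\<And>z. f differentiable (at z)" "\<And>z. g differentiable (at z)"
  shows "dx (\<lambda>z. f z + g z) = (\<lambda>z. dx f z + dx g z)"
    and "dy (\<lambda>z. f z + g z) = (\<lambda>z. dy f z + dy g z)"
proof -
  have "((\<lambda>z. f z + g z) has_derivative
      (\<lambda>h. frechet_derivative f (at z) h + frechet_derivative g (at z) h)) (at z)" for z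
    by (intro has_derivative_add has_derivative_frechet assms)
  from has_derivative_imp_dx_dy[OF this]
  show "dx (\<lambda>z. f z + g z) = (\<lambda>z. dx f z + dx g z)"
    and "dy (\<lambda>z. f z + g z) = (\<lambda>z. dy f z + dy g z)"
    by (simp_all add: dx_def[abs_def] dy_def[abs_def] fun_eq_iff)
qed

lemma dx_fun_cnj:
  assumes "\<And>z. f differentiable (at z)"
  shows "dx (\<lambda>z. cnj (f z)) = (\<lambda>z. cnj (dx f z))"
    and "dy (\<lambda>z. cnj (f z)) = (\<lambda>z. cnj (dy f z))"
    and "del (\<lambda>z. cnj (f z)) = (\<lambda>z. cnj (delbar f z))"
    and "delbar (\<lambda>z. cnj (f z)) = (\<lambda>z. cnj (del f z))"
proof -
  have "((\<lambda>z. cnj (f z)) has_derivative (\<lambda>h. cnj (frechet_derivative f (at z) h))) (at z)" for z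
    by (intro has_derivative_cnj has_derivative_frechet assms)
  from has_derivative_imp_dx_dy[OF this]
  show "dx (\<lambda>z. cnj (f z)) = (\<lambda>z. cnj (dx f z))"
    and "dy (\<lambda>z. cnj (f z)) = (\<lambda>z. cnj (dy f z))"
    by (simp_all add: dx_def[abs_def] dy_def[abs_def] fun_eq_iff)
  then show "del (\<lambda>z. cnj (f z)) = (\<lambda>z. cnj (delbar f z))"
    and "delbar (\<lambda>z. cnj (f z)) = (\<lambda>z. cnj (del f z))"
    by (simp_all add: del_def delbar_def fun_eq_iff)
qed

lemma dx_fun_shift:
  assumes "\<And>z. f differentiable (at z)"
  shows "dx (\<lambda>w. f (w + a)) = (\<lambda>w. dx f (w + a))" "dy (\<lambda>w. f (w + a)) = (\<lambda>w. dy f (w + a))"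
    "delbar (\<lambda>w. f (w + a)) = (\<lambda>w. delbar f (w + a))"
    "(\<lambda>w. f (w + a)) differentiable (at z)"
proof -
  have D: "((\<lambda>w. f (w + a)) has_derivative frechet_derivative f (at (w + a))) (at w)" for w
    by (rule has_derivative_compose[OF _ has_derivative_frechet[OF assms], of _ "\<lambda>h. h" _ UNIV, unfolded o_def, simplified])
      (auto intro!: derivative_eq_intros)
  from has_derivative_imp_dx_dy[OF D]
  show "dx (\<lambda>w. f (w + a)) = (\<lambda>w. dx f (w + a))" "dy (\<lambda>w. f (w + a)) = (\<lambda>w. dy f (w + a))"
    by (simp_all add: dx_def[abs_def] dy_def[abs_def] fun_eq_iff)
  then show "delbar (\<lambda>w. f (w + a)) = (\<lambda>w. delbar f (w + a))"
    by (simp add: delbar_def fun_eq_iff)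
  show "(\<lambda>w. f (w + a)) differentiable (at z)"
    using D differentiable_def by blast
qed

lemma Ck_differentiable: "Ck n f \<Longrightarrow> 0 < n \<Longrightarrow> f differentiable (at z)"
  by (cases n) (auto simp: differentiable_on_def)

lemma Ck_continuous: "Ck n f \<Longrightarrow> continuous_on UNIV f"
  by (cases n) (auto intro: differentiable_imp_continuous_on)

lemma Ck_Suc: "Ck (Suc n) f \<Longrightarrow> Ck n f"
proof (induction n arbitrary: f)
  case 0
  show ?case using Ck_continuous[OF 0] by simp
next
  case (Suc n)
  have a: "f differentiable_on UNIV" "Ck (Suc n) (dx f)" "Ck (Suc n) (dy f)"
    using Suc.prems by (simp_all only: Ck.simps)
  show ?case
    unfolding Ck.simps(2)[of n] by (intro conjI a Suc.IH[OF a(2)] Suc.IH[OF a(3)])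
qed

lemma Ck_add: "Ck n f \<Longrightarrow> Ck n g \<Longrightarrow> Ck n (\<lambda>z. f z + g z)"
proof (induction n arbitrary: f g)
  case (Suc n)
  then have d: "\<And>z. f differentiable (at z)" "\<And>z. g differentiable (at z)"
    using Ck_differentiable by blast+
  show ?case
    using Suc by (auto simp: dx_fun_add[OF d] differentiable_on_def)
qed (auto intro: continuous_intros)

lemma Ck_mult: "Ck n f \<Longrightarrow> Ck n g \<Longrightarrow> Ck n (\<lambda>z. f z * g z)"
proof (induction n arbitrary: f g)
  case (Suc n)
  then have d: "\<And>z. f differentiable (at z)" "\<And>z. g differentiable (at z)"
    using Ck_differentiable by blast+
  have "Ck n f" "Ck n g" using Suc.prems Ck_Suc by blast+
  then show ?case
    using Suc by (auto simp: dx_fun_mult[OF d] differentiable_on_def intro!: Ck_add)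
qed (auto intro: continuous_intros)

lemma Ck_cnj: "Ck n f \<Longrightarrow> Ck n (\<lambda>z. cnj (f z))"
proof (induction n arbitrary: f)
  case (Suc n)
  then have d: "\<And>z. f differentiable (at z)"
    using Ck_differentiable by blast
  have "(\<lambda>z. cnj (f z)) differentiable (at z)" for z
    using has_derivative_cnj[OF has_derivative_frechet[OF d]] differentiable_def by blast
  then show ?case
    using Suc by (auto simp: dx_fun_cnj[OF d] differentiable_on_def)
qed (auto intro: continuous_intros)

lemma Ck_shift: "Ck n f \<Longrightarrow> Ck n (\<lambda>z. f (z + a))"
proof (induction n arbitrary: f)
  case 0
  then have "continuous_on UNIV f" by simp
  then have "continuous_on UNIV (\<lambda>z. f (z + a))"
    by (rule continuous_on_compose2) (auto intro!: continuous_intros)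
  then show ?case by simp
next
  case (Suc n)
  then have d: "\<And>z. f differentiable (at z)"
    using Ck_differentiable by blast
  show ?case
    using Suc dx_fun_shift(4)[OF d] by (simp add: dx_fun_shift[OF d] differentiable_on_def)
qed

section \<open>From the regularised kernel to the Cauchy kernel\<close>

lemma integral_scale:
  fixes g :: "complex \<Rightarrow> complex"
  assumes [measurable]: "g \<in> borel_measurable borel" and "0 < r"
  shows "(LINT w|lborel. g w) = (LINT t|lborel. of_real (r\<^sup>2) * g (of_real r * t))"
proof -
  have "(LINT w|lborel. g w) =
      (LINT w|density (Measure_Space.distr lborel borel (\<lambda>x::complex. 0 + r *\<^sub>R x)) (\<lambda>_. \<bar>r\<bar> ^ DIM(complex)). g w)"
    using lborel_affine[of r "0::complex"] assms by simp
  also have "\<dots> = (LINT w|Measure_Space.distr lborel borel (\<lambda>x::complex. 0 + r *\<^sub>R x). (\<bar>r\<bar> ^ DIM(complex)) *\<^sub>R g w)"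
    by (rule integral_density) auto
  also have "\<dots> = (LINT t|lborel. (\<bar>r\<bar> ^ DIM(complex)) *\<^sub>R g (0 + r *\<^sub>R t))"
    by (rule integral_distr) auto
  finally show ?thesis using assms by (simp add: scaleR_conv_of_real)
qed

text \<open>In the squared radius this is pi times the integral of (1 + s)^-2 over s >= 0. The value
  is the factor pi in every inversion of dbar below.\<close>

lemma integral_poisson_kernel:
  "integrable lborel (\<lambda>t::complex. 1 / ((cmod t)\<^sup>2 + 1)\<^sup>2)" "(LINT t::complex|lborel. 1 / ((cmod t)\<^sup>2 + 1)\<^sup>2) = pi"
proof -
  have *: "(\<integral>\<^sup>+t. ennreal (1 / ((cmod t)\<^sup>2 + 1)\<^sup>2) \<partial>lborel) = ennreal pi"
  proof -
    have "(\<integral>\<^sup>+t. ennreal (1 / ((cmod t)\<^sup>2 + 1)\<^sup>2) \<partial>lborel) = ennreal pi * (\<integral>\<^sup>+s. ennreal (1 / (s + 1)\<^sup>2) * indicator {0..} s \<partial>lborel)"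
      by (rule nn_integral_radial[of "\<lambda>s. ennreal (1 / (s + 1)\<^sup>2)"]) measurable
    also have "(\<integral>\<^sup>+s. ennreal (1 / (s + 1)\<^sup>2) * indicator {0..} s \<partial>lborel) = ennreal (0 - (- 1 / (0 + 1)))"
    proof (rule nn_integral_FTC_atLeast)
      show "((\<lambda>s. - 1 / (s + 1)) has_real_derivative 1 / (x + 1)\<^sup>2) (at x)" if "0 \<le> x" for x :: real
        using that by (auto intro!: derivative_eq_intros simp: power2_eq_square)
      show "((\<lambda>s::real. - 1 / (s + 1)) \<longlongrightarrow> 0) at_top" by real_asymp
    qed auto
    finally show ?thesis by simp
  qed
  show "integrable lborel (\<lambda>t::complex. 1 / ((cmod t)\<^sup>2 + 1)\<^sup>2)"
    by (rule integrableI_nonneg) (use * in auto)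
  show "(LINT t::complex|lborel. 1 / ((cmod t)\<^sup>2 + 1)\<^sup>2) = pi"
    by (subst integral_eq_nn_integral) (use * in auto)
qed

lemma Ck_reg_kernel:
  assumes "d > 0"
  shows "Ck 1 (reg_kernel d)"
proof -
  have pos: "w \<bullet> w + d \<noteq> 0" for w :: complex
    using assms inner_ge_zero[of w] by linarith
  have "continuous_on UNIV (\<lambda>w. of_real (1 / (w \<bullet> w + d)) - of_real (2 * Re w / (w \<bullet> w + d)\<^sup>2) * cnj w)"
    by (intro continuous_intros) (auto simp: pos)
  moreover have "continuous_on UNIV (\<lambda>w. - \<i> * of_real (1 / (w \<bullet> w + d)) - of_real (2 * Im w / (w \<bullet> w + d)\<^sup>2) * cnj w)"
    by (intro continuous_intros) (auto simp: pos)
  ultimately have "continuous_on UNIV (dx (reg_kernel d))" "continuous_on UNIV (dy (reg_kernel d))"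
    unfolding reg_kernel_dx_dy[OF assms, abs_def] by simp_all
  moreover have "reg_kernel d differentiable (at z)" for z
    using reg_kernel_has_derivative[OF assms] differentiable_def by blast
  ultimately show ?thesis by (simp add: differentiable_on_def)
qed

lemma cmod_delbar_le:
  assumes "cmod (dx f z) \<le> C" "cmod (dy f z) \<le> C"
  shows "cmod (delbar f z) \<le> C" "cmod (del f z) \<le> C"
proof -
  have "cmod (dx f z + \<i> * dy f z) \<le> C + C" "cmod (dx f z - \<i> * dy f z) \<le> C + C"
    using assms by (intro order_trans[OF norm_triangle_ineq] order_trans[OF norm_triangle_ineq4] add_mono; simp add: norm_mult)+
  then show "cmod (delbar f z) \<le> C" "cmod (del f z) \<le> C"
    by (simp_all add: delbar_def del_def norm_divide)
qed

lemma continuous_delbar: "Ck (Suc 0) f \<Longrightarrow> continuous_on UNIV (delbar f)" "Ck (Suc 0) f \<Longrightarrow> continuous_on UNIV (del f)"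
  by (auto simp: delbar_def[abs_def] del_def[abs_def] intro!: continuous_intros)

lemma jbracket_powr_add: "jbracket z powr a * jbracket z powr b = jbracket z powr (a + b)"
  by (simp add: powr_add)

lemma norm_mult_jbracket:
  assumes "cmod x \<le> C * jbracket z powr a" "cmod y \<le> D * jbracket z powr b" "a + b \<le> c"
  shows "cmod (x * y) \<le> C * D * jbracket z powr c"
proof -
  have C: "0 \<le> C" and D: "0 \<le> D"
    using order_trans[OF norm_ge_zero assms(1)] order_trans[OF norm_ge_zero assms(2)]
    by (auto simp: zero_le_mult_iff)
  have "cmod (x * y) \<le> (C * jbracket z powr a) * (D * jbracket z powr b)"
    unfolding norm_mult using assms C by (intro mult_mono) auto
  also have "\<dots> = C * D * jbracket z powr (a + b)"
    by (simp add: jbracket_powr_add[symmetric] mult_ac)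
  also have "\<dots> \<le> C * D * jbracket z powr c"
    using C D assms(3) by (intro mult_left_mono jbracket_powr_mono) auto
  finally show ?thesis .
qed

text \<open>The integral of dbar(f K) vanishes and the Leibniz rule splits it. Decay <z>^-2 of f and
  <z>^-1 of the kernel give <z>^-3, which is integrable in the plane.\<close>

lemma cauchy_pompeiu_regularized:
  assumes f: "Ck 1 f" and B: "\<And>z. cmod (f z) \<le> C * jbracket z powr (- 2)"
    "\<And>z. cmod (dx f z) \<le> C * jbracket z powr (- 2)" "\<And>z. cmod (dy f z) \<le> C * jbracket z powr (- 2)" and "d > 0"
  shows "(LINT w|lborel. delbar f w * reg_kernel d w) = - (LINT w|lborel. f w * of_real (d / ((cmod w)\<^sup>2 + d)\<^sup>2))"
proof -
  let ?K = "reg_kernel d" and ?c = "3 * (1 + 1 / d)"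
  have K: "Ck 1 ?K" by (rule Ck_reg_kernel[OF \<open>d > 0\<close>])
  have fd: "\<And>z. f differentiable (at z)" and Kd: "\<And>z. ?K differentiable (at z)"
    using f K Ck_differentiable[of 1] by simp_all
  have KB: "cmod (?K z) \<le> ?c * jbracket z powr (- 1)" "cmod (dx ?K z) \<le> ?c * jbracket z powr (- 2)"
    "cmod (dy ?K z) \<le> ?c * jbracket z powr (- 2)" for z
  proof -
    have "(1 + 1 / d) * jbracket z powr (- 1) \<le> ?c * jbracket z powr (- 1)"
      using \<open>d > 0\<close> by (intro mult_right_mono) (auto simp: field_simps)
    then show "cmod (?K z) \<le> ?c * jbracket z powr (- 1)"
      using reg_kernel_bounds(1)[OF \<open>d > 0\<close>, of z] by linarith
  qed (use reg_kernel_bounds[OF \<open>d > 0\<close>] in blast)+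
  have b: "cmod (f z * ?K z) \<le> C * ?c * jbracket z powr (- 3)"
    "cmod (delbar f z * ?K z) \<le> C * ?c * jbracket z powr (- 3)"
    "cmod (f z * delbar ?K z) \<le> C * ?c * jbracket z powr (- 3)" for z
    by (rule norm_mult_jbracket[OF B(1) KB(1)], simp)
      (rule norm_mult_jbracket[OF cmod_delbar_le(1)[OF B(2,3)] KB(1)], simp,
       rule norm_mult_jbracket[OF B(1) cmod_delbar_le(1)[OF KB(2,3)]], simp)
  let ?F = "\<lambda>w. f w * ?K w"
  have m: "continuous_on UNIV f" "continuous_on UNIV ?K" "continuous_on UNIV (delbar f)" "continuous_on UNIV (delbar ?K)"
    using f K by (auto intro: Ck_continuous[of "Suc 0"] continuous_delbar)
  have F: "Ck 1 ?F" using f K by (rule Ck_mult)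
  have i1: "integrable lborel ?F"
    by (rule integrable_jbracket_bound[OF _ b(1)])
      (intro continuous_imp_borel continuous_on_mult m, simp)
  have "(LINT w|lborel. delbar ?F w) = 0"
  proof (rule integral_delbar(3)[OF F i1, of "C * ?c + C * ?c" 3])
    have "cmod (dx f z * ?K z + f z * dx ?K z) \<le> C * ?c * jbracket z powr (- 3) + C * ?c * jbracket z powr (- 3)"
      "cmod (dy f z * ?K z + f z * dy ?K z) \<le> C * ?c * jbracket z powr (- 3) + C * ?c * jbracket z powr (- 3)" for z
      by (intro order_trans[OF norm_triangle_ineq] add_mono norm_mult_jbracket[OF B(2) KB(1)]
        norm_mult_jbracket[OF B(1) KB(2)] norm_mult_jbracket[OF B(3) KB(1)] norm_mult_jbracket[OF B(1) KB(3)]; simp)+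
    then show "cmod (dx ?F z) \<le> (C * ?c + C * ?c) * jbracket z powr (- 3)"
      "cmod (dy ?F z) \<le> (C * ?c + C * ?c) * jbracket z powr (- 3)" for z
      unfolding dx_fun_mult[OF fd Kd] by (simp_all only: distrib_right)
  qed simp
  moreover have "integrable lborel (\<lambda>w. delbar f w * ?K w)"
    by (rule integrable_jbracket_bound[OF _ b(2)])
      (intro continuous_imp_borel continuous_on_mult m, simp)
  moreover have "integrable lborel (\<lambda>w. f w * delbar ?K w)"
    by (rule integrable_jbracket_bound[OF _ b(3)])
      (intro continuous_imp_borel continuous_on_mult m, simp)
  ultimately have "(LINT w|lborel. delbar f w * ?K w) + (LINT w|lborel. f w * delbar ?K w) = 0"
    unfolding dx_fun_mult[OF fd Kd] by (simp only: Bochner_Integration.integral_add)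
  then show ?thesis
    unfolding reg_kernel_delbar[OF \<open>d > 0\<close>] by (simp add: eq_neg_iff_add_eq_0)
qed

lemma riesz_jbracket_finite:
  assumes "\<And>z. cmod (f z) \<le> C * jbracket z powr (- 2)"
  shows "riesz f z < \<infinity>"
proof -
  obtain D where D: "(\<integral>\<^sup>+w. ennreal (jbracket w powr (- 2) / cmod (z - w)) \<partial>lborel) \<le> ennreal (D * jbracket z powr (- 0))"
    using cauchy_jbracket_bound[of 0 2] by auto
  have C: "0 \<le> C"
    using order_trans[OF norm_ge_zero assms[of 0]] by (simp add: zero_le_mult_iff)
  have "riesz f z \<le> (\<integral>\<^sup>+w. ennreal C * ennreal (jbracket w powr (- 2) / cmod (z - w)) \<partial>lborel)"
    unfolding riesz_def using C assms
    by (intro nn_integral_mono) (auto intro!: ennreal_leI divide_right_mono simp flip: ennreal_mult)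
  also have "\<dots> = ennreal C * (\<integral>\<^sup>+w. ennreal (jbracket w powr (- 2) / cmod (z - w)) \<partial>lborel)"
    by (rule nn_integral_cmult) measurable
  also have "\<dots> \<le> ennreal C * ennreal (D * jbracket z powr (- 0))"
    by (intro mult_left_mono D) simp
  also have "\<dots> < \<infinity>" by (simp add: ennreal_mult_less_top)
  finally show ?thesis .
qed

text \<open>The left side of the regularised identity is dominated by |dbar f(w) / w|, integrable at
  the origin and at infinity; on the right a dilation freezes the kernel and moves the limit into
  the argument of the continuous function f.\<close>

lemma cauchy_pompeiu_0:
  assumes f: "Ck 1 f" and B: "\<And>z. cmod (f z) \<le> C * jbracket z powr (- 2)"
    "\<And>z. cmod (dx f z) \<le> C * jbracket z powr (- 2)" "\<And>z. cmod (dy f z) \<le> C * jbracket z powr (- 2)"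
  shows "(LINT w|lborel. delbar f w / w) = - (of_real pi * f 0)"
proof -
  \<comment> \<open>The regularisation is d = (r n)^2, so that the substitution w = r n * t, whose
    Jacobian is (r n)^2, turns the kernel into the fixed 1 / (|t|^2 + 1)^2.\<close>
  define r where "r n = 1 / real (Suc n)" for n
  have r: "r n > 0" for n by (simp add: r_def)
  have r0: "r \<longlonglongrightarrow> 0"
    unfolding r_def using LIMSEQ_inverse_real_of_nat by (simp add: inverse_eq_divide)
  have cont: "continuous_on UNIV f" "continuous_on UNIV (delbar f)"
    using f by (auto intro: Ck_continuous[of "Suc 0"] continuous_delbar)
  have [measurable]: "f \<in> borel_measurable borel" "delbar f \<in> borel_measurable borel"
    by (intro continuous_imp_borel cont)+
  have [measurable]: "reg_kernel d \<in> borel_measurable borel" for d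
    unfolding reg_kernel_def[abs_def] by measurable
  have Kle: "cmod (reg_kernel d w) \<le> 1 / cmod w" if "d > 0" for d w
  proof (cases "w = 0")
    case False
    have ww: "w \<bullet> w > 0" using False by simp
    then have pos: "w \<bullet> w + d > 0" using that by linarith
    have "cmod w / (w \<bullet> w + d) \<le> cmod w / (w \<bullet> w)"
      using that by (intro divide_left_mono mult_pos_pos pos ww) auto
    also have "\<dots> = 1 / cmod w"
      using False by (simp add: power2_norm_eq_inner[symmetric] power2_eq_square)
    finally show ?thesis
      using pos by (simp add: reg_kernel_def abs_of_pos)
  qed (simp add: reg_kernel_def)
  have L1: "(\<lambda>n. LINT w|lborel. delbar f w * reg_kernel ((r n)\<^sup>2) w) \<longlonglongrightarrow> (LINT w|lborel. delbar f w / w)"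
  proof (rule integral_dominated_convergence[where w="\<lambda>w. cmod (delbar f w / (0 - w))"])
    show "integrable lborel (\<lambda>w. cmod (delbar f w / (0 - w)))"
      by (intro integrable_norm integrable_cauchy_kernel riesz_jbracket_finite[OF cmod_delbar_le(1)[OF B(2,3)]]) measurable
    show "AE w in lborel. (\<lambda>n. delbar f w * reg_kernel ((r n)\<^sup>2) w) \<longlonglongrightarrow> delbar f w / w"
    proof (rule AE_I2)
      fix w :: complex
      \<comment> \<open>At w = 0 the regularised kernel vanishes and so does the limit, since
        division by 0 yields 0.\<close>
      show "(\<lambda>n. delbar f w * reg_kernel ((r n)\<^sup>2) w) \<longlonglongrightarrow> delbar f w / w"
      proof (cases "w = 0")
        case False
        then have ww: "w \<bullet> w \<noteq> 0" by simp
        have "(\<lambda>n. delbar f w * reg_kernel ((r n)\<^sup>2) w) \<longlonglongrightarrow> delbar f w * ((1 / (w \<bullet> w + 0\<^sup>2)) *\<^sub>R cnj w)"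
          unfolding reg_kernel_def by (intro tendsto_intros r0) (use ww in simp)
        also have "(1 / (w \<bullet> w + 0\<^sup>2)) *\<^sub>R cnj w = 1 / w"
        proof -
          have "of_real (w \<bullet> w) = w * cnj w"
            by (simp only: power2_norm_eq_inner[symmetric] complex_norm_square)
          moreover have "cnj w \<noteq> 0" using False by simp
          ultimately show ?thesis using False
            by (simp add: scaleR_conv_of_real)
        qed
        finally show ?thesis by simp
      qed (simp add: reg_kernel_def)
    qed
    show "AE w in lborel. cmod (delbar f w * reg_kernel ((r n)\<^sup>2) w) \<le> cmod (delbar f w / (0 - w))" for n
    proof (rule AE_I2)
      fix w
      have "cmod (delbar f w) * cmod (reg_kernel ((r n)\<^sup>2) w) \<le> cmod (delbar f w) * (1 / cmod w)"
        using r[of n] by (intro mult_left_mono Kle) auto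
      then show "cmod (delbar f w * reg_kernel ((r n)\<^sup>2) w) \<le> cmod (delbar f w / (0 - w))"
        by (simp add: norm_mult norm_divide)
    qed
  qed measurable
  have eq: "(LINT w|lborel. delbar f w * reg_kernel ((r n)\<^sup>2) w) =
      - (LINT t|lborel. f (of_real (r n) * t) * of_real (1 / ((cmod t)\<^sup>2 + 1)\<^sup>2))" for n
  proof -
    have rn: "(r n)\<^sup>2 > 0" using r[of n] by simp
    have "(LINT w|lborel. delbar f w * reg_kernel ((r n)\<^sup>2) w) =
       - (LINT w|lborel. f w * of_real ((r n)\<^sup>2 / ((cmod w)\<^sup>2 + (r n)\<^sup>2)\<^sup>2))"
      by (rule cauchy_pompeiu_regularized[OF f B rn])
    also have "(LINT w|lborel. f w * of_real ((r n)\<^sup>2 / ((cmod w)\<^sup>2 + (r n)\<^sup>2)\<^sup>2)) =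
        (LINT t|lborel. of_real ((r n)\<^sup>2) * (f (of_real (r n) * t) *
           of_real ((r n)\<^sup>2 / ((cmod (of_real (r n) * t))\<^sup>2 + (r n)\<^sup>2)\<^sup>2)))"
      by (rule integral_scale[OF _ r]) measurable
    also have "\<dots> = (LINT t|lborel. f (of_real (r n) * t) * of_real (1 / ((cmod t)\<^sup>2 + 1)\<^sup>2))"
    proof (intro Bochner_Integration.integral_cong refl)
      fix t
      have "(cmod (of_real (r n) * t))\<^sup>2 + (r n)\<^sup>2 = (r n)\<^sup>2 * ((cmod t)\<^sup>2 + 1)"
        by (simp add: norm_mult power_mult_distrib distrib_left)
      then have "(r n)\<^sup>2 * ((r n)\<^sup>2 / ((cmod (of_real (r n) * t))\<^sup>2 + (r n)\<^sup>2)\<^sup>2) =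
          ((r n)\<^sup>2 * (r n)\<^sup>2) / (((r n)\<^sup>2 * (r n)\<^sup>2) * ((cmod t)\<^sup>2 + 1)\<^sup>2)"
        by (simp add: power2_eq_square mult_ac)
      also have "\<dots> = 1 / ((cmod t)\<^sup>2 + 1)\<^sup>2"
        using r[of n] by simp
      finally have e: "(r n)\<^sup>2 * ((r n)\<^sup>2 / ((cmod (of_real (r n) * t))\<^sup>2 + (r n)\<^sup>2)\<^sup>2) = 1 / ((cmod t)\<^sup>2 + 1)\<^sup>2" .
      show "of_real ((r n)\<^sup>2) * (f (of_real (r n) * t) *
           of_real ((r n)\<^sup>2 / ((cmod (of_real (r n) * t))\<^sup>2 + (r n)\<^sup>2)\<^sup>2)) =
           f (of_real (r n) * t) * of_real (1 / ((cmod t)\<^sup>2 + 1)\<^sup>2)"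
        unfolding e[symmetric] of_real_mult by (simp only: mult_ac)
    qed
    finally show ?thesis .
  qed
  have L2: "(\<lambda>n. LINT t|lborel. f (of_real (r n) * t) * of_real (1 / ((cmod t)\<^sup>2 + 1)\<^sup>2)) \<longlonglongrightarrow>
      (LINT t::complex|lborel. f 0 * of_real (1 / ((cmod t)\<^sup>2 + 1)\<^sup>2))"
  proof (rule integral_dominated_convergence[where w="\<lambda>t. C * (1 / ((cmod t)\<^sup>2 + 1)\<^sup>2)"])
    show "integrable lborel (\<lambda>t::complex. C * (1 / ((cmod t)\<^sup>2 + 1)\<^sup>2))"
      by (intro integrable_mult_right integral_poisson_kernel)
    show "AE t in lborel. (\<lambda>n. f (of_real (r n) * t) * of_real (1 / ((cmod t)\<^sup>2 + 1)\<^sup>2)) \<longlonglongrightarrow> f 0 * of_real (1 / ((cmod t)\<^sup>2 + 1)\<^sup>2)"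
    proof (intro AE_I2 tendsto_mult tendsto_const)
      fix t
      have "(\<lambda>n. complex_of_real (r n) * t) \<longlonglongrightarrow> of_real 0 * t"
        by (intro tendsto_intros r0)
      moreover have "isCont f 0" using cont by (simp add: continuous_on_eq_continuous_at)
      ultimately show "(\<lambda>n. f (of_real (r n) * t)) \<longlonglongrightarrow> f 0"
        by (intro isCont_tendsto_compose[of 0 f]) simp_all
    qed
    show "AE t in lborel. cmod (f (of_real (r n) * t) * of_real (1 / ((cmod t)\<^sup>2 + 1)\<^sup>2)) \<le> C * (1 / ((cmod t)\<^sup>2 + 1)\<^sup>2)" for n
    proof (rule AE_I2)
      fix t
      have C: "0 \<le> C"
        using order_trans[OF norm_ge_zero B(1)[of 0]] by (simp add: zero_le_mult_iff)
      have "cmod (f (of_real (r n) * t)) \<le> C * 1"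
        using order_trans[OF B(1) mult_left_mono[OF jbracket_powr_le_1 C]] by simp
      then have "cmod (f (of_real (r n) * t)) * (1 / ((cmod t)\<^sup>2 + 1)\<^sup>2) \<le> C * (1 / ((cmod t)\<^sup>2 + 1)\<^sup>2)"
        by (intro mult_right_mono) auto
      then show "cmod (f (of_real (r n) * t) * of_real (1 / ((cmod t)\<^sup>2 + 1)\<^sup>2)) \<le> C * (1 / ((cmod t)\<^sup>2 + 1)\<^sup>2)"
        unfolding norm_mult norm_of_real by simp
    qed
  qed measurable
  have val: "(LINT t::complex|lborel. f 0 * of_real (1 / ((cmod t)\<^sup>2 + 1)\<^sup>2)) = f 0 * of_real pi"
    using integral_poisson_kernel by (simp only: integral_mult_right_zero integral_complex_of_real)
  have "(\<lambda>n. LINT w|lborel. delbar f w * reg_kernel ((r n)\<^sup>2) w) \<longlonglongrightarrow> - (f 0 * of_real pi)"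
    unfolding eq using tendsto_minus[OF L2] unfolding val .
  from LIMSEQ_unique[OF L1 this] show ?thesis by (simp add: mult.commute)
qed

text \<open>Translation of the formula at the origin. The decay constant of the translated function
  depends on z, which is harmless because the formula is pointwise. The sign changes as the kernel
  becomes 1 / (z - w).\<close>

lemma cauchy_delbar:
  assumes f: "Ck 1 f" and B: "\<And>z. cmod (f z) \<le> C * jbracket z powr (- 2)"
    "\<And>z. cmod (dx f z) \<le> C * jbracket z powr (- 2)" "\<And>z. cmod (dy f z) \<le> C * jbracket z powr (- 2)"
  shows "cauchy (delbar f) z = of_real pi * f z"
proof -
  have fd: "\<And>z. f differentiable (at z)"
    using f Ck_differentiable[of 1] by simp
  have C: "0 \<le> C"
    using order_trans[OF norm_ge_zero B(1)[of 0]] by (simp add: zero_le_mult_iff)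
  have [measurable]: "delbar f \<in> borel_measurable borel"
    using f by (auto intro!: continuous_imp_borel continuous_delbar)
  have le: "C * jbracket (w + z) powr (- 2) \<le> C * (2 * (1 + cmod z)) powr 2 * jbracket w powr (- 2)" for w
    using mult_left_mono[OF jbracket_powr_shift[of w "w + z" "cmod z" 2] C] by (simp add: mult.assoc)
  have "(LINT w|lborel. delbar (\<lambda>w. f (w + z)) w / w) = - (of_real pi * f (0 + z))"
  proof (rule cauchy_pompeiu_0)
    show "Ck 1 (\<lambda>w. f (w + z))" by (rule Ck_shift[OF f])
    show "cmod (f (w + z)) \<le> C * (2 * (1 + cmod z)) powr 2 * jbracket w powr (- 2)"
      "cmod (dx (\<lambda>w. f (w + z)) w) \<le> C * (2 * (1 + cmod z)) powr 2 * jbracket w powr (- 2)"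
      "cmod (dy (\<lambda>w. f (w + z)) w) \<le> C * (2 * (1 + cmod z)) powr 2 * jbracket w powr (- 2)" for w
      unfolding dx_fun_shift[OF fd] by (rule order_trans[OF B(1) le] order_trans[OF B(2) le] order_trans[OF B(3) le])+
  qed
  also have "(LINT w|lborel. delbar (\<lambda>w. f (w + z)) w / w) = (LINT w|lborel. delbar f (w + z) / ((w + z) - z))"
    unfolding dx_fun_shift[OF fd] by simp
  also have "\<dots> = (LINT w|lborel. delbar f w / (w - z))"
    by (rule integral_translate[of "\<lambda>w. delbar f w / (w - z)"]) measurable
  also have "\<dots> = - cauchy (delbar f) z"
  proof -
    have "delbar f w / (w - z) = - (delbar f w / (z - w))" for w
      by (metis minus_diff_eq minus_divide_right)
    then show ?thesis by (simp add: cauchy_def)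
  qed
  finally show ?thesis by simp
qed

section \<open>Weighted \<open>L\<^sup>2\<close> spaces\<close>

lemma cmod_weight_square: "(cmod (weight a v z))\<^sup>2 = jbracket z powr (2 * a) * (cmod (v z))\<^sup>2"
proof -
  have "(jbracket z powr a)\<^sup>2 = jbracket z powr (2 * a)"
    by (simp add: power2_eq_square flip: powr_add)
  then show ?thesis by (simp add: weight_def norm_mult power_mult_distrib)
qed

lemma measurable_weight [measurable]: "v \<in> borel_measurable borel \<Longrightarrow> weight a v \<in> borel_measurable borel"
  unfolding weight_def[abs_def] by measurable

lemma weight_weight: "weight a (weight b v) = weight (a + b) v"
  by (simp add: weight_def fun_eq_iff powr_add)

lemma weight_0 [simp]: "weight 0 v = v"
  by (simp add: weight_def fun_eq_iff)

lemma wnorm2_weight: "wnorm2 \<theta> (weight a v) = wnorm2 (\<theta> - a) v"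
  unfolding wnorm2_def
proof (intro nn_integral_cong arg_cong[where f=ennreal])
  fix z
  have "jbracket z powr (- 2 * \<theta>) * jbracket z powr (2 * a) = jbracket z powr (- 2 * (\<theta> - a))"
    by (simp add: algebra_simps flip: powr_add)
  then show "jbracket z powr (- 2 * \<theta>) * (cmod (weight a v z))\<^sup>2 = jbracket z powr (- 2 * (\<theta> - a)) * (cmod (v z))\<^sup>2"
    unfolding cmod_weight_square by (simp add: mult.assoc[symmetric])
qed

lemma L2_iff: "u \<in> L2 \<longleftrightarrow> u \<in> borel_measurable borel \<and> wnorm2 0 u < \<infinity>"
  by (auto simp: L2_def wnorm2_def integrable_iff_bounded)

lemma wL2_mem_iff: "v \<in> elems (wL2 \<theta>) \<longleftrightarrow> v \<in> borel_measurable borel \<and> wnorm2 \<theta> v < \<infinity>"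
proof
  assume "v \<in> elems (wL2 \<theta>)"
  then obtain u where "v = weight \<theta> u" "u \<in> L2" by (auto simp: wL2_def)
  then show "v \<in> borel_measurable borel \<and> wnorm2 \<theta> v < \<infinity>"
    by (simp add: L2_iff wnorm2_weight measurable_weight)
next
  assume v: "v \<in> borel_measurable borel \<and> wnorm2 \<theta> v < \<infinity>"
  then have "weight (- \<theta>) v \<in> L2" by (simp add: L2_iff wnorm2_weight measurable_weight)
  moreover have "v = weight \<theta> (weight (- \<theta>) v)" by (simp add: weight_weight)
  ultimately show "v \<in> elems (wL2 \<theta>)" by (auto simp: wL2_def)
qed

lemma wL2_nrm_eq: "v \<in> borel_measurable borel \<Longrightarrow> nrm (wL2 \<theta>) v = sqrt (enn2real (wnorm2 \<theta> v))"
proof -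
  assume [measurable]: "v \<in> borel_measurable borel"
  have "nrm (wL2 \<theta>) v = sqrt (enn2real (wnorm2 0 (weight (- \<theta>) v)))"
    unfolding wL2_def L2norm_def wnorm2_def by (simp add: integral_eq_nn_integral)
  then show ?thesis by (simp add: wnorm2_weight)
qed

lemma wL2_nrm_nonneg: "0 \<le> nrm (wL2 \<theta>) v"
  by (simp add: wL2_def L2norm_def)

lemma wnorm2_eq_nrm:
  assumes "v \<in> elems (wL2 \<theta>)"
  shows "wnorm2 \<theta> v = ennreal ((nrm (wL2 \<theta>) v)\<^sup>2)"
proof -
  have "wnorm2 \<theta> v = ennreal (enn2real (wnorm2 \<theta> v))"
    using assms by (intro ennreal_enn2real[symmetric]) (simp add: wL2_mem_iff)
  then show ?thesis
    using assms by (simp add: wL2_mem_iff wL2_nrm_eq)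
qed

lemma wL2_leI:
  assumes "v \<in> borel_measurable borel" "wnorm2 \<theta> v \<le> ennreal (D\<^sup>2)" "0 \<le> D"
  shows "v \<in> elems (wL2 \<theta>)" "nrm (wL2 \<theta>) v \<le> D"
proof -
  show "v \<in> elems (wL2 \<theta>)"
    using assms le_less_trans[OF assms(2) ennreal_less_top] by (simp add: wL2_mem_iff)
  have "enn2real (wnorm2 \<theta> v) \<le> D\<^sup>2"
    using assms by (intro enn2real_leI) auto
  then show "nrm (wL2 \<theta>) v \<le> D"
    using assms by (simp add: wL2_nrm_eq real_le_lsqrt)
qed

lemma wnorm2_mono:
  assumes "AE z in lborel. cmod (u z) \<le> cmod (v z)"
  shows "wnorm2 \<theta> u \<le> wnorm2 \<theta> v"
  unfolding wnorm2_def
  by (rule nn_integral_mono_AE, use assms in eventually_elim) (auto intro!: ennreal_leI mult_left_mono power_mono)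

lemma wnorm2_cmult:
  assumes [measurable]: "u \<in> borel_measurable borel"
  shows "wnorm2 \<theta> (\<lambda>z. c * u z) = ennreal ((cmod c)\<^sup>2) * wnorm2 \<theta> u"
proof -
  have "wnorm2 \<theta> (\<lambda>z. c * u z) = (\<integral>\<^sup>+z. ennreal ((cmod c)\<^sup>2) * ennreal (jbracket z powr (- 2 * \<theta>) * (cmod (u z))\<^sup>2) \<partial>lborel)"
    unfolding wnorm2_def by (intro nn_integral_cong) (simp add: norm_mult power_mult_distrib mult_ac flip: ennreal_mult)
  also have "\<dots> = ennreal ((cmod c)\<^sup>2) * wnorm2 \<theta> u"
    unfolding wnorm2_def by (rule nn_integral_cmult) measurable
  finally show ?thesis .
qed

text \<open>The inequality 2 x y <= t x^2 + y^2 / t with free t, so that the triangle inequality can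
  be recovered by optimising t while everything stays in squared, possibly infinite, form.\<close>

lemma wnorm2_add_le:
  assumes [measurable]: "u \<in> borel_measurable borel" "v \<in> borel_measurable borel" and "0 < t"
  shows "wnorm2 \<theta> (\<lambda>z. u z + v z) \<le> ennreal (1 + t) * wnorm2 \<theta> u + ennreal (1 + 1 / t) * wnorm2 \<theta> v"
proof -
  have pt: "(cmod (x + y))\<^sup>2 \<le> (1 + t) * (cmod x)\<^sup>2 + (1 + 1 / t) * (cmod y)\<^sup>2" for x y
  proof -
    have "0 \<le> (t * cmod x - cmod y)\<^sup>2 / t" using \<open>0 < t\<close> by simp
    also have "\<dots> = t * (cmod x)\<^sup>2 + (cmod y)\<^sup>2 / t - 2 * cmod x * cmod y"
      using \<open>0 < t\<close> by (simp add: power2_eq_square field_simps)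
    finally have "2 * cmod x * cmod y \<le> t * (cmod x)\<^sup>2 + (cmod y)\<^sup>2 / t" by simp
    moreover have "(cmod (x + y))\<^sup>2 \<le> (cmod x + cmod y)\<^sup>2"
      by (intro power_mono norm_triangle_ineq) simp
    ultimately show ?thesis by (simp add: power2_sum algebra_simps)
  qed
  have "wnorm2 \<theta> (\<lambda>z. u z + v z) \<le> (\<integral>\<^sup>+z. ennreal (1 + t) * ennreal (jbracket z powr (- 2 * \<theta>) * (cmod (u z))\<^sup>2) +
      ennreal (1 + 1 / t) * ennreal (jbracket z powr (- 2 * \<theta>) * (cmod (v z))\<^sup>2) \<partial>lborel)"
    unfolding wnorm2_def
  proof (intro nn_integral_mono)
    fix z
    have "jbracket z powr (- 2 * \<theta>) * (cmod (u z + v z))\<^sup>2 \<le>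
        jbracket z powr (- 2 * \<theta>) * ((1 + t) * (cmod (u z))\<^sup>2 + (1 + 1 / t) * (cmod (v z))\<^sup>2)"
      by (intro mult_left_mono pt) simp
    also have "\<dots> = (1 + t) * (jbracket z powr (- 2 * \<theta>) * (cmod (u z))\<^sup>2) + (1 + 1 / t) * (jbracket z powr (- 2 * \<theta>) * (cmod (v z))\<^sup>2)"
      by (simp only: distrib_left mult_ac)
    finally have "ennreal (jbracket z powr (- 2 * \<theta>) * (cmod (u z + v z))\<^sup>2) \<le> ennreal \<dots>"
      by (rule ennreal_leI)
    also have "\<dots> = ennreal (1 + t) * ennreal (jbracket z powr (- 2 * \<theta>) * (cmod (u z))\<^sup>2) +
      ennreal (1 + 1 / t) * ennreal (jbracket z powr (- 2 * \<theta>) * (cmod (v z))\<^sup>2)"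
      using \<open>0 < t\<close> by (subst ennreal_plus) (auto simp: ennreal_mult simp del: ennreal_plus)
    finally show "ennreal (jbracket z powr (- 2 * \<theta>) * (cmod (u z + v z))\<^sup>2) \<le> \<dots>" .
  qed
  also have "\<dots> = ennreal (1 + t) * wnorm2 \<theta> u + ennreal (1 + 1 / t) * wnorm2 \<theta> v"
    unfolding wnorm2_def by (subst nn_integral_add) (auto simp: nn_integral_cmult)
  finally show ?thesis .
qed

lemma wnorm2_zero_iff:
  assumes [measurable]: "u \<in> borel_measurable borel"
  shows "wnorm2 \<theta> u = 0 \<longleftrightarrow> (AE z in lborel. u z = 0)"
proof -
  have "wnorm2 \<theta> u = 0 \<longleftrightarrow> (AE z in lborel. ennreal (jbracket z powr (- 2 * \<theta>) * (cmod (u z))\<^sup>2) = 0)"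
    unfolding wnorm2_def by (rule nn_integral_0_iff_AE) measurable
  also have "\<dots> \<longleftrightarrow> (AE z in lborel. u z = 0)"
    by (intro AE_cong) (simp add: ennreal_eq_0_iff mult_le_0_iff not_less)
  finally show ?thesis .
qed

lemma wL2_add:
  assumes "u \<in> elems (wL2 \<theta>)" "v \<in> elems (wL2 \<theta>)"
  shows "(\<lambda>z. u z + v z) \<in> elems (wL2 \<theta>)" "nrm (wL2 \<theta>) (\<lambda>z. u z + v z) \<le> nrm (wL2 \<theta>) u + nrm (wL2 \<theta>) v"
proof -
  define a where "a = nrm (wL2 \<theta>) u"
  define b where "b = nrm (wL2 \<theta>) v"
  have ab: "0 \<le> a" "0 \<le> b" by (simp_all add: a_def b_def wL2_nrm_nonneg)
  have m [measurable]: "u \<in> borel_measurable borel" "v \<in> borel_measurable borel"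
    using assms by (simp_all add: wL2_mem_iff)
  have le: "wnorm2 \<theta> (\<lambda>z. u z + v z) \<le> ennreal ((a + b + 2 * d)\<^sup>2)" if "d > 0" for d
  proof -
    \<comment> \<open>The optimal parameter is the quotient of the two norms; the slack d keeps it
      defined and positive when a norm is 0, and is sent to 0 at the end.\<close>
    define t where "t = (b + d) / (a + d)"
    have t: "t > 0" using that ab by (simp add: t_def)
    have "wnorm2 \<theta> (\<lambda>z. u z + v z) \<le> ennreal (1 + t) * ennreal (a\<^sup>2) + ennreal (1 + 1 / t) * ennreal (b\<^sup>2)"
      using wnorm2_add_le[OF m t, of \<theta>] unfolding wnorm2_eq_nrm[OF assms(1)] wnorm2_eq_nrm[OF assms(2)] a_def b_def .
    also have "\<dots> = ennreal ((1 + t) * a\<^sup>2 + (1 + 1 / t) * b\<^sup>2)"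
      using t ab by (subst ennreal_plus) (auto simp: ennreal_mult simp del: ennreal_plus)
    also have "\<dots> \<le> ennreal ((1 + t) * (a + d)\<^sup>2 + (1 + 1 / t) * (b + d)\<^sup>2)"
      using t ab that by (intro ennreal_leI add_mono mult_left_mono power_mono) auto
    also have "(1 + t) * (a + d)\<^sup>2 + (1 + 1 / t) * (b + d)\<^sup>2 = (a + b + 2 * d)\<^sup>2"
    proof -
      have p: "a + d > 0" "b + d > 0" using that ab by auto
      have "(1 + t) * (a + d)\<^sup>2 = (a + b + 2 * d) * (a + d)"
        using p by (simp add: t_def power2_eq_square field_simps)
      moreover have "(1 + 1 / t) * (b + d)\<^sup>2 = (a + b + 2 * d) * (b + d)"
        using p by (simp add: t_def power2_eq_square field_simps)
      ultimately show ?thesis by (simp add: power2_eq_square algebra_simps)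
    qed
    finally show ?thesis .
  qed
  have m2: "(\<lambda>z. u z + v z) \<in> borel_measurable borel" by measurable
  show "(\<lambda>z. u z + v z) \<in> elems (wL2 \<theta>)"
    using wL2_leI(1)[OF m2 le[of 1]] ab by simp
  have "nrm (wL2 \<theta>) (\<lambda>z. u z + v z) \<le> a + b + e" if "e > 0" for e
    using wL2_leI(2)[OF m2 le[of "e / 2"]] ab that by simp
  then show "nrm (wL2 \<theta>) (\<lambda>z. u z + v z) \<le> nrm (wL2 \<theta>) u + nrm (wL2 \<theta>) v"
    unfolding a_def[symmetric] b_def[symmetric] by (rule field_le_epsilon)
qed

lemma wL2_cmult:
  assumes "u \<in> elems (wL2 \<theta>)"
  shows "(\<lambda>z. c * u z) \<in> elems (wL2 \<theta>)" "nrm (wL2 \<theta>) (\<lambda>z. c * u z) = cmod c * nrm (wL2 \<theta>) u"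
proof -
  have m [measurable]: "u \<in> borel_measurable borel"
    using assms by (simp add: wL2_mem_iff)
  show "(\<lambda>z. c * u z) \<in> elems (wL2 \<theta>)"
    using assms by (simp add: wL2_mem_iff wnorm2_cmult ennreal_mult_less_top)
  show "nrm (wL2 \<theta>) (\<lambda>z. c * u z) = cmod c * nrm (wL2 \<theta>) u"
    by (simp add: wL2_nrm_eq wnorm2_cmult enn2real_mult real_sqrt_mult)
qed

text \<open>Fatou's lemma.\<close>

lemma wnorm2_limit:
  assumes [measurable]: "\<And>n. g n \<in> borel_measurable borel" "S \<in> borel_measurable borel"
    and lim: "AE z in lborel. (\<lambda>n. g n z) \<longlonglongrightarrow> S z" and le: "\<And>n. wnorm2 \<theta> (g n) \<le> D"
  shows "wnorm2 \<theta> S \<le> D"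
proof -
  have "wnorm2 \<theta> S \<le> (\<integral>\<^sup>+z. liminf (\<lambda>n. ennreal (jbracket z powr (- 2 * \<theta>) * (cmod (g n z))\<^sup>2)) \<partial>lborel)"
    unfolding wnorm2_def
  proof (rule nn_integral_mono_AE, use lim in eventually_elim)
    case (elim z)
    have "(\<lambda>n. ennreal (jbracket z powr (- 2 * \<theta>) * (cmod (g n z))\<^sup>2)) \<longlonglongrightarrow> ennreal (jbracket z powr (- 2 * \<theta>) * (cmod (S z))\<^sup>2)"
      by (intro tendsto_ennrealI tendsto_intros elim)
    then show ?case by (intro eq_refl lim_imp_Liminf[symmetric]) simp_all
  qed
  also have "\<dots> \<le> liminf (\<lambda>n. wnorm2 \<theta> (g n))"
    unfolding wnorm2_def by (rule nn_integral_liminf) measurable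
  also have "\<dots> \<le> liminf (\<lambda>n::nat. D)"
    by (intro Liminf_mono always_eventually allI le)
  also have "\<dots> = D" by (simp add: Liminf_const)
  finally show ?thesis .
qed

lemma wL2_sum:
  assumes "\<And>n. n \<in> I \<Longrightarrow> f n \<in> elems (wL2 \<theta>)" "finite I"
  shows "(\<lambda>z. \<Sum>n\<in>I. f n z) \<in> elems (wL2 \<theta>)" "nrm (wL2 \<theta>) (\<lambda>z. \<Sum>n\<in>I. f n z) \<le> (\<Sum>n\<in>I. nrm (wL2 \<theta>) (f n))"
proof -
  have "(\<lambda>z. \<Sum>n\<in>I. f n z) \<in> elems (wL2 \<theta>) \<and> nrm (wL2 \<theta>) (\<lambda>z. \<Sum>n\<in>I. f n z) \<le> (\<Sum>n\<in>I. nrm (wL2 \<theta>) (f n))"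
    using assms(2,1)
  proof (induction I)
    case empty
    have "wnorm2 \<theta> (\<lambda>z. 0) = 0" by (simp add: wnorm2_def)
    then show ?case by (simp add: wL2_mem_iff wL2_nrm_eq)
  next
    case (insert i I)
    then have "f i \<in> elems (wL2 \<theta>)" and I: "(\<lambda>z. \<Sum>n\<in>I. f n z) \<in> elems (wL2 \<theta>)"
      "nrm (wL2 \<theta>) (\<lambda>z. \<Sum>n\<in>I. f n z) \<le> (\<Sum>n\<in>I. nrm (wL2 \<theta>) (f n))"
      by simp_all
    from wL2_add[OF this(1,2)] insert(1,2) I(2) show ?case by simp
  qed
  then show "(\<lambda>z. \<Sum>n\<in>I. f n z) \<in> elems (wL2 \<theta>)" "nrm (wL2 \<theta>) (\<lambda>z. \<Sum>n\<in>I. f n z) \<le> (\<Sum>n\<in>I. nrm (wL2 \<theta>) (f n))"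
    by blast+
qed

text \<open>Weighting |f n|^2 by c^-n still leaves a geometric series K^2 c^n of integrals, so
  almost everywhere |f n z|^2 <= B c^n with B depending on z. Hence the series is dominated by a
  geometric one of ratio sqrt c.\<close>

lemma AE_summable_wL2:
  assumes f: "\<And>n. f n \<in> elems (wL2 \<theta>)" and K: "\<And>n. nrm (wL2 \<theta>) (f n) \<le> K * c ^ n" and c: "0 < c" "c < 1"
  shows "AE z in lborel. summable (\<lambda>n. f n z)"
proof -
  have [measurable]: "f n \<in> borel_measurable borel" for n
    using f by (simp add: wL2_mem_iff)
  let ?j = "\<lambda>z. jbracket z powr (- 2 * \<theta>)"
  have bd: "ennreal ((1 / c) ^ n) * wnorm2 \<theta> (f n) \<le> ennreal (K\<^sup>2 * c ^ n)" for n
  proof -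
    have "ennreal ((1 / c) ^ n) * wnorm2 \<theta> (f n) = ennreal ((1 / c) ^ n * (nrm (wL2 \<theta>) (f n))\<^sup>2)"
      using c by (simp add: wnorm2_eq_nrm[OF f] ennreal_mult)
    also have "\<dots> \<le> ennreal ((1 / c) ^ n * (K * c ^ n)\<^sup>2)"
      using c by (intro ennreal_leI mult_left_mono power_mono K wL2_nrm_nonneg) auto
    also have "(1 / c) ^ n * (K * c ^ n)\<^sup>2 = K\<^sup>2 * c ^ n"
      using c by (simp add: power_mult_distrib power_divide power2_eq_square)
    finally show ?thesis .
  qed
  have "(\<integral>\<^sup>+z. (\<Sum>n. ennreal ((1 / c) ^ n) * ennreal (?j z * (cmod (f n z))\<^sup>2)) \<partial>lborel) =
      (\<Sum>n. \<integral>\<^sup>+z. ennreal ((1 / c) ^ n) * ennreal (?j z * (cmod (f n z))\<^sup>2) \<partial>lborel)"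
    by (rule nn_integral_suminf) measurable
  also have "\<dots> = (\<Sum>n. ennreal ((1 / c) ^ n) * wnorm2 \<theta> (f n))"
    unfolding wnorm2_def by (intro arg_cong[where f=suminf] ext nn_integral_cmult) measurable
  also have "\<dots> \<le> (\<Sum>n. ennreal (K\<^sup>2 * c ^ n))"
    by (intro suminf_le bd) auto
  also have "\<dots> = ennreal (\<Sum>n. K\<^sup>2 * c ^ n)"
    using c by (intro suminf_ennreal2 summable_mult summable_geometric) auto
  finally have "(\<integral>\<^sup>+z. (\<Sum>n. ennreal ((1 / c) ^ n) * ennreal (?j z * (cmod (f n z))\<^sup>2)) \<partial>lborel) \<noteq> \<infinity>"
    by (metis ennreal_neq_top infinity_ennreal_def top_unique)
  then have "AE z in lborel. (\<Sum>n. ennreal ((1 / c) ^ n) * ennreal (?j z * (cmod (f n z))\<^sup>2)) \<noteq> \<infinity>"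
    by (rule nn_integral_PInf_AE[rotated]) measurable
  then show ?thesis
  proof eventually_elim
    case (elim z)
    define T where "T = (\<Sum>n. ennreal ((1 / c) ^ n) * ennreal (?j z * (cmod (f n z))\<^sup>2))"
    define B where "B = enn2real T / ?j z"
    have j: "?j z > 0" by simp
    have T: "T = ennreal (enn2real T)" using elim by (simp add: T_def top.not_eq_extremum)
    have B: "0 \<le> B" unfolding B_def by (intro divide_nonneg_nonneg) auto
    have sq: "(cmod (f n z))\<^sup>2 \<le> B * c ^ n" for n
    proof -
      have "ennreal ((1 / c) ^ n) * ennreal (?j z * (cmod (f n z))\<^sup>2) \<le> T"
        unfolding T_def using sum_le_suminf[of "\<lambda>n. ennreal ((1 / c) ^ n) * ennreal (?j z * (cmod (f n z))\<^sup>2)" "{n}"] by simp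
      then have "ennreal ((1 / c) ^ n * (?j z * (cmod (f n z))\<^sup>2)) \<le> ennreal (enn2real T)"
        using c T by (subst ennreal_mult) auto
      then have "(1 / c) ^ n * (?j z * (cmod (f n z))\<^sup>2) \<le> enn2real T"
        by (simp add: ennreal_le_iff)
      then show ?thesis
        unfolding B_def using c j by (simp add: power_divide field_simps)
    qed
    have b: "cmod (f n z) \<le> sqrt B * (sqrt c) ^ n" for n
      using real_le_rsqrt[OF sq[of n]] by (simp add: real_sqrt_mult real_sqrt_power)
    have s: "summable (\<lambda>n. sqrt B * (sqrt c) ^ n)"
      using c by (intro summable_mult summable_geometric) (auto simp: real_sqrt_lt_1_iff)
    show ?case by (rule summable_comparison_test'[OF s b])
  qed
qed

text \<open>The pointwise sum is measurable everywhere, with a default value on the null set of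
  divergence. Its tails are limits of finite blocks, whose norms are at most the geometric tail, and
  Fatou's lemma passes this bound on.\<close>

lemma wL2_complete:
  assumes f: "\<And>n. f n \<in> elems (wL2 \<theta>)" and K: "\<And>n. nrm (wL2 \<theta>) (f n) \<le> K * c ^ n" and c: "0 < c" "c < 1"
  shows "\<exists>S\<in>elems (wL2 \<theta>). \<forall>N. nrm (wL2 \<theta>) (S - (\<Sum>n<N. f n)) \<le> K * c ^ N / (1 - c)"
proof -
  have [measurable]: "f n \<in> borel_measurable borel" for n
    using f by (simp add: wL2_mem_iff)
  have K0: "0 \<le> K" using order_trans[OF wL2_nrm_nonneg K[of 0]] by simp
  define S where "S z = (\<Sum>n. f n z)" for z
  have [measurable]: "S \<in> borel_measurable borel" unfolding S_def by measurable
  let ?D = "\<lambda>N. K * c ^ N / (1 - c)"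
  have D0: "0 \<le> ?D N" for N using K0 c by simp
  have tail: "wnorm2 \<theta> (\<lambda>z. S z - (\<Sum>n<N. f n z)) \<le> ennreal ((?D N)\<^sup>2)" for N
  proof (rule wnorm2_limit[where g="\<lambda>M z. \<Sum>n\<in>{N..<N+M}. f n z"])
    show "AE z in lborel. (\<lambda>M. \<Sum>n\<in>{N..<N+M}. f n z) \<longlonglongrightarrow> S z - (\<Sum>n<N. f n z)"
      using AE_summable_wL2[OF f K c]
    proof eventually_elim
      case (elim z)
      then have "(\<lambda>M. \<Sum>n<M. f n z) \<longlonglongrightarrow> S z" unfolding S_def by (rule summable_LIMSEQ)
      then have "(\<lambda>M. (\<Sum>n<M+N. f n z) - (\<Sum>n<N. f n z)) \<longlonglongrightarrow> S z - (\<Sum>n<N. f n z)"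
        by (intro tendsto_diff tendsto_const) (rule LIMSEQ_ignore_initial_segment)
      moreover have "(\<Sum>n<M+N. f n z) - (\<Sum>n<N. f n z) = (\<Sum>n\<in>{N..<N+M}. f n z)" for M
        using sum_diff_nat_ivl[of 0 N "N + M" "\<lambda>n. f n z"] by (simp add: lessThan_atLeast0 add.commute)
      ultimately show ?case by simp
    qed
    fix M
    let ?g = "\<lambda>z. \<Sum>n\<in>{N..<N+M}. f n z"
    have "nrm (wL2 \<theta>) ?g \<le> (\<Sum>n\<in>{N..<N+M}. nrm (wL2 \<theta>) (f n))"
      by (rule wL2_sum(2)) (auto simp: f)
    also have "\<dots> \<le> (\<Sum>n\<in>{N..<N+M}. K * c ^ n)" by (intro sum_mono K)
    also have "\<dots> = (\<Sum>m<M. K * c ^ N * c ^ m)"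
      by (rule sum.reindex_bij_witness[of _ "\<lambda>m. m + N" "\<lambda>n. n - N"]) (auto simp flip: power_add)
    also have "\<dots> = K * c ^ N * (\<Sum>m<M. c ^ m)" by (simp add: sum_distrib_left)
    also have "\<dots> \<le> K * c ^ N * (1 / (1 - c))"
    proof (intro mult_left_mono)
      have "(\<Sum>m<M. c ^ m) \<le> (\<Sum>m. c ^ m)"
        using c by (intro sum_le_suminf summable_geometric) auto
      also have "\<dots> = 1 / (1 - c)" using c by (intro suminf_geometric) auto
      finally show "(\<Sum>m<M. c ^ m) \<le> 1 / (1 - c)" .
    qed (use K0 c in auto)
    finally have "nrm (wL2 \<theta>) ?g \<le> ?D N" by simp
    then have "(nrm (wL2 \<theta>) ?g)\<^sup>2 \<le> (?D N)\<^sup>2"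
      by (intro power_mono wL2_nrm_nonneg)
    then show "wnorm2 \<theta> ?g \<le> ennreal ((?D N)\<^sup>2)"
      using wnorm2_eq_nrm[OF wL2_sum(1)[of "{N..<N+M}" f \<theta>]] f by (simp add: ennreal_leI)
  qed measurable
  have "S \<in> elems (wL2 \<theta>)" using wL2_leI(1)[OF _ _ D0, of S \<theta> 0] tail[of 0] by simp
  moreover have "nrm (wL2 \<theta>) (S - (\<Sum>n<N. f n)) \<le> ?D N" for N
  proof -
    have "S - (\<Sum>n<N. f n) = (\<lambda>z. S z - (\<Sum>n<N. f n z))"
    proof -
      have "(\<Sum>n<N. f n) = (\<lambda>z. \<Sum>n<N. f n z)"
        by (induction N) (simp_all add: fun_eq_iff)
      then show ?thesis by (simp add: fun_eq_iff)
    qed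
    moreover have "(\<lambda>z. S z - (\<Sum>n<N. f n z)) \<in> borel_measurable borel" by measurable
    ultimately show ?thesis
      using wL2_leI(2)[OF _ tail D0] by simp
  qed
  ultimately show ?thesis by blast
qed

lemma wL2_record [simp]: "eqv (wL2 \<theta>) u v \<longleftrightarrow> (AE z in lborel. u z = v z)" "smul (wL2 \<theta>) c u = (\<lambda>z. c * u z)"
  by (simp_all add: wL2_def)

lemma wL2_null_iff:
  assumes "u \<in> elems (wL2 \<theta>)"
  shows "(AE z in lborel. u z = 0) \<longleftrightarrow> nrm (wL2 \<theta>) u = 0"
proof -
  have m: "u \<in> borel_measurable borel" using assms by (simp add: wL2_mem_iff)
  show ?thesis
    unfolding wnorm2_zero_iff[OF m, of \<theta>, symmetric] wnorm2_eq_nrm[OF assms] by (simp add: ennreal_eq_0_iff)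
qed

lemma class_space_wL2: "class_space (wL2 \<theta>)"
proof
  show "0 \<in> elems (wL2 \<theta>)"
    using wL2_sum(1)[of "{}" "\<lambda>_ _. 0" \<theta>] by (simp add: zero_fun_def)
  show "u + v \<in> elems (wL2 \<theta>)" "nrm (wL2 \<theta>) (u + v) \<le> nrm (wL2 \<theta>) u + nrm (wL2 \<theta>) v"
    if "u \<in> elems (wL2 \<theta>)" "v \<in> elems (wL2 \<theta>)" for u v
    using wL2_add[OF that] by (simp_all add: plus_fun_def)
  show "smul (wL2 \<theta>) c u \<in> elems (wL2 \<theta>)" "nrm (wL2 \<theta>) (smul (wL2 \<theta>) c u) = cmod c * nrm (wL2 \<theta>) u"
    if "u \<in> elems (wL2 \<theta>)" for u c
    using wL2_cmult[OF that] by simp_all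
  show "smul (wL2 \<theta>) (- 1) u = - u" for u by (simp add: fun_eq_iff)
  show "smul (wL2 \<theta>) c (u - v) = smul (wL2 \<theta>) c u - smul (wL2 \<theta>) c v" for c u v
    by (simp add: fun_eq_iff right_diff_distrib)
  show "eqv (wL2 \<theta>) u v \<longleftrightarrow> eqv (wL2 \<theta>) (u - v) 0" for u v by simp
  show "eqv (wL2 \<theta>) 0 0" by simp
  show "eqv (wL2 \<theta>) (u - v) 0" if "eqv (wL2 \<theta>) u 0" "eqv (wL2 \<theta>) v 0" for u v
    using that unfolding wL2_record by eventually_elim simp
  show "eqv (wL2 \<theta>) u 0 \<longleftrightarrow> nrm (wL2 \<theta>) u = 0" if "u \<in> elems (wL2 \<theta>)" for u
    using wL2_null_iff[OF that] by simp
  show "0 \<le> nrm (wL2 \<theta>) u" for u by (rule wL2_nrm_nonneg)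
qed (rule wL2_complete)

section \<open>The Cauchy transform of smooth functions\<close>

lemma frechet_neg_one:
  assumes "f differentiable (at z)"
  shows "frechet_derivative f (at z) (- 1) = - dx f z"
  using frechet_derivative_dx_dy[OF assms, of "- 1"] by simp

text \<open>Two integrations by parts would use the mixed second derivative, but H is only C^1. The
  x-derivative is therefore kept as a difference quotient, whose adjoint is the quotient in the
  opposite direction, and only the y-derivative is integrated by parts; the limit restores dx. Decay
  of order p > 1 makes the products integrable.\<close>

lemma integral_dx_cnj_dy:
  assumes H: "Ck 1 H" and B: "\<And>z. cmod (H z) \<le> C * jbracket z powr (- p)"
    "\<And>z. cmod (dx H z) \<le> C * jbracket z powr (- p)" "\<And>z. cmod (dy H z) \<le> C * jbracket z powr (- p)" and "1 < p"
  shows "(LINT z|lborel. dx H z * cnj (dy H z)) = (LINT z|lborel. dy H z * cnj (dx H z))"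
proof -
  have d: "\<And>z. H differentiable (at z)" using H Ck_differentiable[of 1] by simp
  have cont: "continuous_on UNIV H" "continuous_on UNIV (dx H)" "continuous_on UNIV (dy H)"
    using H by (auto intro: Ck_continuous[of "Suc 0"])
  have m [measurable]: "H \<in> borel_measurable borel" "dx H \<in> borel_measurable borel" "dy H \<in> borel_measurable borel"
    by (intro continuous_imp_borel cont)+
  have C: "0 \<le> C"
    using order_trans[OF norm_ge_zero B(1)[of 0]] by (simp add: zero_le_mult_iff)
  \<comment> \<open>Integration by parts in y for the product of a translate of H with conj(H),
    followed by a translation that moves the shift onto the other factor. It is used with c = 1 / (n
    + 1) and with c = 0.\<close>
  have ibp: "integrable lborel (\<lambda>z. H (z + c) * cnj (dy H z)) \<and>
      (LINT z|lborel. H (z + c) * cnj (dy H z)) = - (LINT z|lborel. dy H z * cnj (H (z - c))) \<and>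
      integrable lborel (\<lambda>z. dy H z * cnj (H (z - c)))" for c
  proof -
    define k where "k = (2 * (1 + cmod c)) powr p"
    have sh: "C * jbracket (z + c) powr (- p) \<le> (C * k) * jbracket z powr (- p)" for z
      using mult_left_mono[OF jbracket_powr_shift[of z "z + c" "cmod c" p] C] \<open>1 < p\<close> by (simp add: k_def mult.assoc)
    have Bs: "cmod (H (z + c)) \<le> (C * k) * jbracket z powr (- p)" "cmod (dx H (z + c)) \<le> (C * k) * jbracket z powr (- p)"
      "cmod (dy H (z + c)) \<le> (C * k) * jbracket z powr (- p)" for z
      by (rule order_trans[OF B(1) sh] order_trans[OF B(2) sh] order_trans[OF B(3) sh])+
    have Bc: "cmod (cnj (H z)) \<le> C * jbracket z powr (- p)" "cmod (cnj (dx H z)) \<le> C * jbracket z powr (- p)"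
      "cmod (cnj (dy H z)) \<le> C * jbracket z powr (- p)" for z
      using B by simp_all
    let ?G = "\<lambda>z. H (z + c) * cnj (H z)" and ?D = "C * k * C"
    have G: "Ck 1 ?G" by (intro Ck_mult Ck_shift Ck_cnj H)
    have b: "cmod (H (z + c) * cnj (H z)) \<le> ?D * jbracket z powr (- (2 * p))"
        "cmod (dy H (z + c) * cnj (H z)) \<le> ?D * jbracket z powr (- (2 * p))"
        "cmod (H (z + c) * cnj (dy H z)) \<le> ?D * jbracket z powr (- (2 * p))"
        "cmod (dx H (z + c) * cnj (H z)) \<le> ?D * jbracket z powr (- (2 * p))"
        "cmod (H (z + c) * cnj (dx H z)) \<le> ?D * jbracket z powr (- (2 * p))" for z
      by (rule norm_mult_jbracket[OF Bs(1) Bc(1)] norm_mult_jbracket[OF Bs(3) Bc(1)] norm_mult_jbracket[OF Bs(1) Bc(3)]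
        norm_mult_jbracket[OF Bs(2) Bc(1)] norm_mult_jbracket[OF Bs(1) Bc(2)], simp)+
    have p2: "2 < 2 * p" using \<open>1 < p\<close> by simp
    have dG: "dx ?G = (\<lambda>z. dx H (z + c) * cnj (H z) + H (z + c) * cnj (dx H z))"
      "dy ?G = (\<lambda>z. dy H (z + c) * cnj (H z) + H (z + c) * cnj (dy H z))"
      using dx_fun_mult(1,2)[of "\<lambda>z. H (z + c)" "\<lambda>z. cnj (H z)"] dx_fun_shift[OF d, of c] dx_fun_cnj[OF d]
        Ck_differentiable[OF Ck_cnj[OF H]] by simp_all
    have i: "integrable lborel ?G" "integrable lborel (\<lambda>z. dy H (z + c) * cnj (H z))" "integrable lborel (\<lambda>z. H (z + c) * cnj (dy H z))"
      by (rule integrable_jbracket_bound[OF _ b(1) p2] integrable_jbracket_bound[OF _ b(2) p2] integrable_jbracket_bound[OF _ b(3) p2], measurable)+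
    have "(LINT z|lborel. dy ?G z) = 0"
    proof (rule integral_delbar(2)[OF G i(1) _ _ p2])
      show "cmod (dx ?G z) \<le> (?D + ?D) * jbracket z powr (- (2 * p))" "cmod (dy ?G z) \<le> (?D + ?D) * jbracket z powr (- (2 * p))" for z
        unfolding dG distrib_right by (intro order_trans[OF norm_triangle_ineq] add_mono b)+
    qed
    then have z: "(LINT z|lborel. dy H (z + c) * cnj (H z)) + (LINT z|lborel. H (z + c) * cnj (dy H z)) = 0"
      unfolding dG using i by (simp only: Bochner_Integration.integral_add)
    have t: "(LINT z|lborel. dy H (z + c) * cnj (H ((z + c) - c))) = (LINT z|lborel. dy H z * cnj (H (z - c)))"
      by (rule integral_translate[of "\<lambda>z. dy H z * cnj (H (z - c))"]) measurable
    have "integrable lborel (\<lambda>z. dy H (z + - c + c) * cnj (H (z + - c)))"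
      by (rule integrable_translate[OF i(2)])
    then show ?thesis using z t i(3) by (simp add: eq_neg_iff_add_eq_0 add.commute)
  qed
  let ?r = "\<lambda>n. complex_of_real (1 / real (Suc n))"
  let ?X = "\<lambda>n z. (H (z + ?r n * 1) - H z) / ?r n" and ?Y = "\<lambda>n z. (H (z + ?r n * (- 1)) - H z) / ?r n"
  \<comment> \<open>\<open>?Y\<close> is the quotient in direction -1 and tends to - dx H, so the
    minus sign here disappears in the limit.\<close>
  have eq: "(LINT z|lborel. ?X n z * cnj (dy H z)) = - (LINT z|lborel. dy H z * cnj (?Y n z))" for n
  proof -
    have r: "?r n \<noteq> 0" "cnj (?r n) = ?r n" by (simp_all del: of_nat_Suc)
    have "(LINT z|lborel. ?X n z * cnj (dy H z)) = (LINT z|lborel. (H (z + ?r n) * cnj (dy H z) - H (z + 0) * cnj (dy H z)) / ?r n)"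
      by (intro Bochner_Integration.integral_cong refl) (simp add: left_diff_distrib)
    also have "\<dots> = ((LINT z|lborel. H (z + ?r n) * cnj (dy H z)) - (LINT z|lborel. H (z + 0) * cnj (dy H z))) / ?r n"
      using ibp[of "?r n"] ibp[of 0] by (simp only: integral_divide_zero Bochner_Integration.integral_diff)
    also have "\<dots> = - (((LINT z|lborel. dy H z * cnj (H (z - ?r n))) - (LINT z|lborel. dy H z * cnj (H (z - 0)))) / ?r n)"
      using ibp[of "?r n"] ibp[of 0] by (simp only: minus_divide_left) simp
    also have "\<dots> = - (LINT z|lborel. (dy H z * cnj (H (z - ?r n)) - dy H z * cnj (H (z - 0))) / ?r n)"
      using ibp[of "?r n"] ibp[of 0] by (simp only: integral_divide_zero Bochner_Integration.integral_diff)
    also have "(LINT z|lborel. (dy H z * cnj (H (z - ?r n)) - dy H z * cnj (H (z - 0))) / ?r n) = (LINT z|lborel. dy H z * cnj (?Y n z))"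
      using r by (intro Bochner_Integration.integral_cong refl) (simp add: right_diff_distrib diff_divide_distrib)
    finally show ?thesis .
  qed
  let ?w = "\<lambda>z. C * 4 powr p * C * jbracket z powr (- (2 * p))"
  have wi: "integrable lborel ?w"
    using \<open>1 < p\<close> by (intro integrable_mult_right integrable_jbracket_powr) simp
  have Xb: "cmod (?X n z) \<le> C * 4 powr p * jbracket z powr (- p)" and Yb: "cmod (?Y n z) \<le> C * 4 powr p * jbracket z powr (- p)" for n z
    using B(2) frechet_neg_one[OF d] \<open>1 < p\<close>
    by (intro difference_quotient_bound d; simp add: dx_def)+
  have L1: "(\<lambda>n. LINT z|lborel. ?X n z * cnj (dy H z)) \<longlonglongrightarrow> (LINT z|lborel. dx H z * cnj (dy H z))"
  proof (rule integral_dominated_convergence[OF _ _ wi])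
    show "AE z in lborel. (\<lambda>n. ?X n z * cnj (dy H z)) \<longlonglongrightarrow> dx H z * cnj (dy H z)"
      using difference_quotient_tendsto[OF d, of _ 1] by (intro AE_I2 tendsto_mult tendsto_const) (simp only: dx_def)
    show "AE z in lborel. cmod (?X n z * cnj (dy H z)) \<le> ?w z" for n
    proof (rule AE_I2)
      fix z
      have "cmod (cnj (dy H z)) \<le> C * jbracket z powr (- p)" using B(3) by simp
      from norm_mult_jbracket[OF Xb this] show "cmod (?X n z * cnj (dy H z)) \<le> ?w z" by simp
    qed
  qed measurable
  have L2: "(\<lambda>n. LINT z|lborel. dy H z * cnj (?Y n z)) \<longlonglongrightarrow> (LINT z|lborel. dy H z * cnj (- dx H z))"
  proof (rule integral_dominated_convergence[OF _ _ wi])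
    show "AE z in lborel. (\<lambda>n. dy H z * cnj (?Y n z)) \<longlonglongrightarrow> dy H z * cnj (- dx H z)"
      using difference_quotient_tendsto[OF d, of _ "- 1"] by (intro AE_I2 tendsto_mult tendsto_cnj tendsto_const) (simp only: frechet_neg_one[OF d])
    show "AE z in lborel. cmod (dy H z * cnj (?Y n z)) \<le> ?w z" for n
    proof (rule AE_I2)
      fix z
      have "cmod (cnj (dy H z)) \<le> C * jbracket z powr (- p)" using B(3) by simp
      from norm_mult_jbracket[OF Yb this, of "- (2 * p)" n] show "cmod (dy H z * cnj (?Y n z)) \<le> ?w z"
        by (simp only: norm_mult complex_mod_cnj mult.commute)
    qed
  qed measurable
  have "(LINT z|lborel. dx H z * cnj (dy H z)) = - (LINT z|lborel. dy H z * cnj (- dx H z))"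
    using LIMSEQ_unique[OF L1] tendsto_minus[OF L2] unfolding eq by blast
  then show ?thesis by simp
qed

text \<open>|del H|^2 - |delbar H|^2 equals (i / 2) (dx H conj(dy H) - dy H conj(dx H)), the
  Jacobian of H, whose integral vanishes. It expresses the isometry of the Beurling transform
  without the Fourier transform.\<close>

lemma integral_del_delbar:
  assumes H: "Ck 1 H" and B: "\<And>z. cmod (H z) \<le> C * jbracket z powr (- p)"
    "\<And>z. cmod (dx H z) \<le> C * jbracket z powr (- p)" "\<And>z. cmod (dy H z) \<le> C * jbracket z powr (- p)" and "1 < p"
  shows "integrable lborel (\<lambda>z. (cmod (del H z))\<^sup>2)" "integrable lborel (\<lambda>z. (cmod (delbar H z))\<^sup>2)"
    "(LINT z|lborel. (cmod (del H z))\<^sup>2) = (LINT z|lborel. (cmod (delbar H z))\<^sup>2)"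
proof -
  have cont: "continuous_on UNIV (dx H)" "continuous_on UNIV (dy H)"
    using H by simp_all
  have m [measurable]: "dx H \<in> borel_measurable borel" "dy H \<in> borel_measurable borel"
    by (intro continuous_imp_borel cont)+
  have [measurable]: "del H \<in> borel_measurable borel" "delbar H \<in> borel_measurable borel"
    unfolding del_def[abs_def] delbar_def[abs_def] by measurable
  have p2: "2 < 2 * p" using \<open>1 < p\<close> by simp
  have sqi: "integrable lborel (\<lambda>z. (cmod (f z))\<^sup>2)"
    if [measurable]: "f \<in> borel_measurable borel" and f: "\<And>z. cmod (f z) \<le> C * jbracket z powr (- p)" for f
  proof -
    have "cmod (f z * cnj (f z)) \<le> C * C * jbracket z powr (- (2 * p))" for z
    proof (rule norm_mult_jbracket[OF f])
      show "cmod (cnj (f z)) \<le> C * jbracket z powr (- p)" using f by simp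
    qed simp
    then have "integrable lborel (\<lambda>z. f z * cnj (f z))"
      by (intro integrable_jbracket_bound[OF _ _ p2]) measurable
    then have "integrable lborel (\<lambda>z. cmod (f z * cnj (f z)))" by (rule integrable_norm)
    then show ?thesis by (simp add: norm_mult power2_eq_square)
  qed
  show i1: "integrable lborel (\<lambda>z. (cmod (del H z))\<^sup>2)" and i2: "integrable lborel (\<lambda>z. (cmod (delbar H z))\<^sup>2)"
    by (intro sqi cmod_delbar_le B; measurable)+
  have ab: "integrable lborel (\<lambda>z. dx H z * cnj (dy H z))" "integrable lborel (\<lambda>z. dy H z * cnj (dx H z))"
  proof -
    have c: "cmod (cnj (dx H z)) \<le> C * jbracket z powr (- p)" "cmod (cnj (dy H z)) \<le> C * jbracket z powr (- p)" for z
      using B by simp_all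
    have "cmod (dx H z * cnj (dy H z)) \<le> C * C * jbracket z powr (- (2 * p))"
      "cmod (dy H z * cnj (dx H z)) \<le> C * C * jbracket z powr (- (2 * p))" for z
      by (rule norm_mult_jbracket[OF B(2) c(2)] norm_mult_jbracket[OF B(3) c(1)], simp)+
    then show "integrable lborel (\<lambda>z. dx H z * cnj (dy H z))" "integrable lborel (\<lambda>z. dy H z * cnj (dx H z))"
      by (intro integrable_jbracket_bound[OF _ _ p2]; measurable)+
  qed
  have pt: "complex_of_real ((cmod (del H z))\<^sup>2 - (cmod (delbar H z))\<^sup>2) = (\<i> / 2) * (dx H z * cnj (dy H z) - dy H z * cnj (dx H z))" for z
    by (simp only: of_real_diff complex_norm_square del_def delbar_def) (simp add: field_simps)
  have "complex_of_real (LINT z|lborel. (cmod (del H z))\<^sup>2 - (cmod (delbar H z))\<^sup>2) =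
      (LINT z|lborel. (\<i> / 2) * (dx H z * cnj (dy H z) - dy H z * cnj (dx H z)))"
    unfolding integral_complex_of_real[symmetric] pt ..
  also have "\<dots> = (\<i> / 2) * ((LINT z|lborel. dx H z * cnj (dy H z)) - (LINT z|lborel. dy H z * cnj (dx H z)))"
    using ab by simp
  also have "\<dots> = 0"
    using integral_dx_cnj_dy[OF H B \<open>1 < p\<close>] by simp
  finally show "(LINT z|lborel. (cmod (del H z))\<^sup>2) = (LINT z|lborel. (cmod (delbar H z))\<^sup>2)"
    using i1 i2 by simp
qed

section \<open>Differentiation of the Cauchy transform\<close>

lemma integrable_reflect:
  fixes f :: "complex \<Rightarrow> 'b::{banach, second_countable_topology}"
  assumes "integrable lborel f"
  shows "integrable lborel (\<lambda>t. f (z - t))"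
proof -
  have [measurable]: "f \<in> borel_measurable borel" using assms by auto
  have "integrable (Measure_Space.distr lborel borel (\<lambda>w. z - w)) f \<longleftrightarrow> integrable lborel (\<lambda>t. f (z - t))"
    by (rule integrable_distr_eq) auto
  then show ?thesis using assms by (simp add: distr_lborel_reflect)
qed

lemma integral_reflect:
  fixes f :: "complex \<Rightarrow> 'b::{banach, second_countable_topology}"
  assumes [measurable]: "f \<in> borel_measurable borel"
  shows "(LINT t|lborel. f (z - t)) = (LINT t|lborel. f t)"
proof -
  have "(LINT t|Measure_Space.distr lborel borel (\<lambda>w. z - w). f t) = (LINT t|lborel. f (z - t))"
    by (rule integral_distr) auto
  then show ?thesis by (simp add: distr_lborel_reflect)
qed

text \<open>In this form z sits in the differentiable factor instead of the singular one.\<close>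

lemma cauchy_convolution:
  assumes [measurable]: "f \<in> borel_measurable borel"
  shows "cauchy f z = (LINT t|lborel. f (z - t) / t)"
  using integral_reflect[of "\<lambda>w. f w / (z - w)" z] by (simp add: cauchy_def)

lemma integrable_convolution_kernel:
  assumes [measurable]: "f \<in> borel_measurable borel" and B: "\<And>z. cmod (f z) \<le> C * jbracket z powr (- 2)"
  shows "integrable lborel (\<lambda>t. f (z - t) / t)"
  using integrable_reflect[OF integrable_cauchy_kernel[OF assms(1) riesz_jbracket_finite[OF B], of z], of z] by simp

text \<open>The whole remainder quotient, kernel included, is one integrand \<open>q h t\<close>
  that tends to 0 pointwise and is dominated for |h| <= 1; dominated convergence along sequences h
  -> 0 gives the Frechet derivative.\<close>

lemma cauchy_has_derivative:
  assumes f: "Ck 1 f" and B: "\<And>z. cmod (f z) \<le> C * jbracket z powr (- 2)"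
    "\<And>z. cmod (dx f z) \<le> C * jbracket z powr (- 2)" "\<And>z. cmod (dy f z) \<le> C * jbracket z powr (- 2)"
  shows "(cauchy f has_derivative (\<lambda>h. of_real (Re h) * cauchy (dx f) z + of_real (Im h) * cauchy (dy f) z)) (at z)"
proof -
  have d: "\<And>z. f differentiable (at z)" using f Ck_differentiable[of 1] by simp
  have cont: "continuous_on UNIV f" "continuous_on UNIV (dx f)" "continuous_on UNIV (dy f)"
    using f by (auto intro: Ck_continuous[of "Suc 0"])
  have m [measurable]: "f \<in> borel_measurable borel" "dx f \<in> borel_measurable borel" "dy f \<in> borel_measurable borel"
    by (intro continuous_imp_borel cont)+
  have C: "0 \<le> C"
    using order_trans[OF norm_ge_zero B(1)[of 0]] by (simp add: zero_le_mult_iff)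
  note i = integrable_convolution_kernel[OF m(1) B(1)] integrable_convolution_kernel[OF m(2) B(2)] integrable_convolution_kernel[OF m(3) B(3)]
  let ?L = "\<lambda>h. of_real (Re h) * cauchy (dx f) z + of_real (Im h) * cauchy (dy f) z"
  have bl: "bounded_linear ?L"
    by (intro bounded_linear_add bounded_linear_mult_left bounded_linear_compose[OF bounded_linear_of_real]
      bounded_linear_compose[OF bounded_linear_mult_left] bounded_linear_Re bounded_linear_Im)
  define q where "q h t = (f (z - t + h) - f (z - t) - (of_real (Re h) * dx f (z - t) + of_real (Im h) * dy f (z - t))) / of_real (cmod h) / t" for h t
  have qint: "(cauchy f (z + h) - cauchy f z - ?L h) / of_real (cmod h) = (LINT t|lborel. q h t)" for h
  proof -
    have "(LINT t|lborel. q h t) = (LINT t|lborel. (f (z + h - t) / t - f (z - t) / t -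
        (of_real (Re h) * (dx f (z - t) / t) + of_real (Im h) * (dy f (z - t) / t))) / of_real (cmod h))"
      by (intro Bochner_Integration.integral_cong refl) (simp add: q_def diff_divide_distrib add_divide_distrib algebra_simps)
    also have "\<dots> = (cauchy f (z + h) - cauchy f z - ?L h) / of_real (cmod h)"
      unfolding cauchy_convolution[OF m(1)] cauchy_convolution[OF m(2)] cauchy_convolution[OF m(3)] using i
      by (simp only: integral_divide_zero Bochner_Integration.integral_diff Bochner_Integration.integral_add
        integral_mult_right_zero integrable_mult_right Bochner_Integration.integrable_add Bochner_Integration.integrable_diff)
    finally show ?thesis by simp
  qed
  let ?w = "\<lambda>t. (2 * C * 4 powr 2 + 2 * C) * cmod (complex_of_real (jbracket (z - t) powr (- 2)) / t)"
  have "integrable lborel (\<lambda>t. complex_of_real (jbracket (z - t) powr (- 2)) / t)"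
    by (rule integrable_convolution_kernel[of "\<lambda>z. complex_of_real (jbracket z powr (- 2))" 1 z]) auto
  then have wi: "integrable lborel ?w"
    by (intro integrable_mult_right integrable_norm)
  have lin: "cmod (of_real (Re h) * dx f x + of_real (Im h) * dy f x) \<le> 2 * C * jbracket x powr (- 2) * cmod h" for h x
  proof -
    have "cmod (of_real (Re h) * dx f x + of_real (Im h) * dy f x) \<le> \<bar>Re h\<bar> * cmod (dx f x) + \<bar>Im h\<bar> * cmod (dy f x)"
      by (rule order_trans[OF norm_triangle_ineq]) (simp add: norm_mult)
    also have "\<dots> \<le> cmod h * (C * jbracket x powr (- 2)) + cmod h * (C * jbracket x powr (- 2))"
      using B abs_Re_le_cmod abs_Im_le_cmod by (intro add_mono mult_mono) auto
    finally show ?thesis by (simp add: algebra_simps)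
  qed
  \<comment> \<open>The increment is a step of length |h| in the unit direction h / |h|, in which
    the derivative of f is at most 2 C <x>^-2. The two terms of the constant in \<open>?w\<close>
    belong to the quotient and to the linear part.\<close>
  have qb: "cmod (q h t) \<le> ?w t" if h: "h \<noteq> 0" "cmod h \<le> 1" for h t
  proof -
    let ?x = "z - t" and ?e = "h / of_real (cmod h)"
    have e: "cmod ?e = 1" using h by (simp add: norm_divide)
    have "cmod ((f (?x + of_real (cmod h) * ?e) - f ?x) / of_real (cmod h)) \<le> (2 * C) * 4 powr 2 * jbracket ?x powr (- 2)"
    proof (rule difference_quotient_bound[OF d])
      show "cmod (frechet_derivative f (at z) ?e) \<le> 2 * C * jbracket z powr (- 2)" for z
        using lin[of ?e z] e by (simp only: frechet_derivative_dx_dy[OF d])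
    qed (use h e in auto)
    then have 1: "cmod ((f (?x + h) - f ?x) / of_real (cmod h)) \<le> (2 * C) * 4 powr 2 * jbracket ?x powr (- 2)"
      using h by simp
    have 2: "cmod ((of_real (Re h) * dx f ?x + of_real (Im h) * dy f ?x) / of_real (cmod h)) \<le> 2 * C * jbracket ?x powr (- 2)"
      using lin[of h ?x] h by (simp add: norm_divide field_simps)
    have "q h t = ((f (?x + h) - f ?x) / of_real (cmod h) - (of_real (Re h) * dx f ?x + of_real (Im h) * dy f ?x) / of_real (cmod h)) / t"
      by (simp add: q_def diff_divide_distrib)
    then have "cmod (q h t) = cmod ((f (?x + h) - f ?x) / of_real (cmod h) - (of_real (Re h) * dx f ?x + of_real (Im h) * dy f ?x) / of_real (cmod h)) / cmod t"
      by (simp only: norm_divide)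
    also have "\<dots> \<le> ((2 * C) * 4 powr 2 * jbracket ?x powr (- 2) + 2 * C * jbracket ?x powr (- 2)) / cmod t"
      by (intro divide_right_mono order_trans[OF norm_triangle_ineq4] add_mono 1 2) simp
    also have "\<dots> = ?w t" by (simp add: norm_divide field_simps)
    finally show ?thesis .
  qed
  have "((\<lambda>h. LINT t|lborel. q h t) \<longlongrightarrow> 0) (at 0)"
    unfolding tendsto_at_iff_sequentially
  proof (intro allI impI)
    fix X :: "nat \<Rightarrow> complex"
    assume X: "\<forall>i. X i \<in> UNIV - {0}" and X0: "X \<longlonglongrightarrow> 0"
    have "\<forall>\<^sub>F n in sequentially. cmod (X n) < 1"
      using tendstoD[OF X0, of 1] by simp
    then obtain n0 where n0: "\<And>n. n0 \<le> n \<Longrightarrow> cmod (X n) < 1"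
      by (auto simp: eventually_sequentially)
    \<comment> \<open>Dropping the first n0 terms ensures |X n| < 1, under which the domination
      \<open>qb\<close> holds.\<close>
    have "(\<lambda>n. LINT t|lborel. q (X (n + n0)) t) \<longlonglongrightarrow> (LINT t::complex|lborel. 0)"
    proof (rule integral_dominated_convergence[OF _ _ wi])
      show "(\<lambda>t. q (X (n + n0)) t) \<in> borel_measurable lborel" for n
        unfolding q_def by measurable
      show "AE t in lborel. cmod (q (X (n + n0)) t) \<le> ?w t" for n
        using X n0[of "n + n0"] by (intro AE_I2 qb) auto
      show "AE t in lborel. (\<lambda>n. q (X (n + n0)) t) \<longlonglongrightarrow> 0"
      proof (rule AE_I2)
        fix t
        let ?x = "z - t"
        have "((\<lambda>h. cmod (f (?x + h) - f ?x - (of_real (Re h) * dx f ?x + of_real (Im h) * dy f ?x)) / cmod h) \<longlongrightarrow> 0) (at 0)"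
          using has_derivative_dx_dy[OF d[of ?x]] unfolding has_derivative_at by blast
        then have "(\<lambda>n. cmod (f (?x + X n) - f ?x - (of_real (Re (X n)) * dx f ?x + of_real (Im (X n)) * dy f ?x)) / cmod (X n)) \<longlonglongrightarrow> 0"
          using X X0 unfolding tendsto_at_iff_sequentially comp_def by blast
        then have "(\<lambda>n. cmod (f (?x + X n) - f ?x - (of_real (Re (X n)) * dx f ?x + of_real (Im (X n)) * dy f ?x)) / cmod (X n) / cmod t) \<longlonglongrightarrow> 0"
          by (rule tendsto_divide_zero)
        then have "(\<lambda>n. cmod (q (X n) t)) \<longlonglongrightarrow> 0"
          by (simp add: q_def norm_divide norm_mult)
        then have "(\<lambda>n. q (X n) t) \<longlonglongrightarrow> 0" by (rule tendsto_norm_zero_cancel)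
        then show "(\<lambda>n. q (X (n + n0)) t) \<longlonglongrightarrow> 0" by (rule LIMSEQ_ignore_initial_segment)
      qed
    qed auto
    then have "(\<lambda>n. LINT t|lborel. q (X n) t) \<longlonglongrightarrow> 0"
      using LIMSEQ_offset[of "\<lambda>n. LINT t|lborel. q (X n) t" n0] by simp
    then show "((\<lambda>h. LINT t|lborel. q h t) \<circ> X) \<longlonglongrightarrow> 0" by (simp add: comp_def)
  qed
  then have "((\<lambda>h. norm ((cauchy f (z + h) - cauchy f z - ?L h) / of_real (cmod h))) \<longlongrightarrow> 0) (at 0)"
    unfolding qint by (rule tendsto_norm_zero)
  then show ?thesis
    unfolding has_derivative_at using bl by (simp add: norm_divide)
qed

section \<open>Test functions\<close>

lemma CinfD: "f \<in> Cinf \<Longrightarrow> Ck n f"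
  by (simp add: Cinf_def)

lemma Cinf_differentiable: "f \<in> Cinf \<Longrightarrow> f differentiable (at z)"
  using Ck_differentiable[OF CinfD[of f 1]] by simp

lemma Cinf_continuous: "f \<in> Cinf \<Longrightarrow> continuous_on UNIV f"
  using Ck_continuous[OF CinfD[of f 0]] by simp

lemma Cinf_borel: "f \<in> Cinf \<Longrightarrow> f \<in> borel_measurable borel"
  by (intro continuous_imp_borel Cinf_continuous)

lemma Cinf_dx: "f \<in> Cinf \<Longrightarrow> dx f \<in> Cinf" and Cinf_dy: "f \<in> Cinf \<Longrightarrow> dy f \<in> Cinf"
proof -
  assume "f \<in> Cinf"
  then have "Ck (Suc n) f" for n by (rule CinfD)
  then show "dx f \<in> Cinf" "dy f \<in> Cinf" by (simp_all add: Cinf_def)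
qed

lemma Cinf_mult: "f \<in> Cinf \<Longrightarrow> g \<in> Cinf \<Longrightarrow> (\<lambda>z. f z * g z) \<in> Cinf"
  and Cinf_add: "f \<in> Cinf \<Longrightarrow> g \<in> Cinf \<Longrightarrow> (\<lambda>z. f z + g z) \<in> Cinf"
  and Cinf_cnj: "f \<in> Cinf \<Longrightarrow> (\<lambda>z. cnj (f z)) \<in> Cinf"
  by (auto simp: Cinf_def intro: Ck_mult Ck_add Ck_cnj)

lemma dx_const: "dx (\<lambda>z. c) = (\<lambda>z. 0)" "dy (\<lambda>z. c) = (\<lambda>z. 0)"
  using has_derivative_imp_dx_dy[OF has_derivative_const] by (simp_all add: fun_eq_iff)

lemma Ck_const: "Ck n (\<lambda>z. c)"
  by (induction n arbitrary: c) (simp_all add: dx_const)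

lemma Cinf_const: "(\<lambda>z. c) \<in> Cinf"
  by (simp add: Cinf_def Ck_const)

lemma Cinf_minus: "f \<in> Cinf \<Longrightarrow> g \<in> Cinf \<Longrightarrow> (\<lambda>z. f z - g z) \<in> Cinf"
  using Cinf_add[OF _ Cinf_mult[OF Cinf_const[of "- 1"]], of f g] by simp

lemma Cinf_del: "f \<in> Cinf \<Longrightarrow> del f \<in> Cinf" and Cinf_delbar: "f \<in> Cinf \<Longrightarrow> delbar f \<in> Cinf"
proof -
  assume f: "f \<in> Cinf"
  have "(\<lambda>z. (1 / 2) * (dx f z - \<i> * dy f z)) \<in> Cinf" "(\<lambda>z. (1 / 2) * (dx f z + \<i> * dy f z)) \<in> Cinf"
    by (intro Cinf_mult Cinf_minus Cinf_add Cinf_const Cinf_dx Cinf_dy f)+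
  then show "del f \<in> Cinf" "delbar f \<in> Cinf"
    by (simp_all add: del_def[abs_def] delbar_def[abs_def])
qed

lemma CinfI:
  assumes "\<And>z. f differentiable (at z)" "dx f \<in> Cinf" "dy f \<in> Cinf"
  shows "f \<in> Cinf"
proof -
  have "Ck n f" for n
  proof (cases n)
    case 0
    then show ?thesis using continuous_differentiable[OF assms(1)] by simp
  next
    case (Suc m)
    then show ?thesis using assms by (simp add: differentiable_on_def CinfD)
  qed
  then show ?thesis by (simp add: Cinf_def)
qed

lemma Cinf_Re: "(\<lambda>z. of_real (Re z)) \<in> Cinf" and Cinf_Im: "(\<lambda>z. of_real (Im z)) \<in> Cinf"
proof -
  have D: "((\<lambda>z. complex_of_real (Re z)) has_derivative (\<lambda>h. of_real (Re h))) (at z)"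
    "((\<lambda>z. complex_of_real (Im z)) has_derivative (\<lambda>h. of_real (Im h))) (at z)" for z
    by (auto intro!: derivative_eq_intros)
  have "dx (\<lambda>z. of_real (Re z)) = (\<lambda>z. 1)" "dy (\<lambda>z. of_real (Re z)) = (\<lambda>z. 0)"
    "dx (\<lambda>z. of_real (Im z)) = (\<lambda>z. 0)" "dy (\<lambda>z. of_real (Im z)) = (\<lambda>z. 1)"
    using has_derivative_imp_dx_dy[OF D(1)] has_derivative_imp_dx_dy[OF D(2)] by (simp_all add: fun_eq_iff)
  note e = this
  have "(\<lambda>z. complex_of_real (Re z)) differentiable (at z)" "(\<lambda>z. complex_of_real (Im z)) differentiable (at z)" for z
    using D unfolding differentiable_def by blast+
  from CinfI[OF this(1)] CinfI[OF this(2)]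
  show "(\<lambda>z. of_real (Re z)) \<in> Cinf" "(\<lambda>z. of_real (Im z)) \<in> Cinf"
    by (simp_all only: e Cinf_const)
qed

lemma Cinf_norm_square: "(\<lambda>z. of_real ((cmod z)\<^sup>2)) \<in> Cinf"
proof -
  have "(\<lambda>z. of_real (Re z) * of_real (Re z) + of_real (Im z) * of_real (Im z) :: complex) \<in> Cinf"
    by (intro Cinf_add Cinf_mult Cinf_Re Cinf_Im)
  moreover have "of_real ((cmod z)\<^sup>2) = (of_real (Re z) * of_real (Re z) + of_real (Im z) * of_real (Im z) :: complex)" for z
  proof -
    have "(cmod z)\<^sup>2 = Re z * Re z + Im z * Im z"
      unfolding cmod_power2 by (simp only: power2_eq_square)
    then show ?thesis by (simp only: of_real_add of_real_mult)
  qed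
  ultimately show ?thesis by simp
qed

text \<open>Carrying the whole sequence of derivatives closes the induction: differentiating g n (r
  z) gives g (Suc n) (r z) times a derivative of r. Differentiability is asked only on the range of
  r, so powers with a singularity outside that range are covered.\<close>

lemma Cinf_compose_real:
  fixes g :: "nat \<Rightarrow> real \<Rightarrow> real" and r :: "complex \<Rightarrow> real"
  assumes r: "(\<lambda>z. of_real (r z)) \<in> Cinf"
    and g: "\<And>n z. (g n has_real_derivative g (Suc n) (r z)) (at (r z))"
  shows "(\<lambda>z. of_real (g n (r z))) \<in> Cinf"
proof -
  let ?r = "\<lambda>z. complex_of_real (r z)"
  have D: "((\<lambda>z. complex_of_real (g n (r z))) has_derivative
      (\<lambda>h. of_real (g (Suc n) (r z)) * (of_real (Re h) * dx ?r z + of_real (Im h) * dy ?r z))) (at z)" for n z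
  proof -
    have dr: "(?r has_derivative (\<lambda>h. of_real (Re h) * dx ?r z + of_real (Im h) * dy ?r z)) (at z)"
      by (rule has_derivative_dx_dy[OF Cinf_differentiable[OF r]])
    have "((\<lambda>z. Re (?r z)) has_derivative (\<lambda>h. Re (of_real (Re h) * dx ?r z + of_real (Im h) * dy ?r z))) (at z)"
      by (rule bounded_linear.has_derivative[OF bounded_linear_Re dr])
    then have "(r has_derivative (\<lambda>h. Re (of_real (Re h) * dx ?r z + of_real (Im h) * dy ?r z))) (at z)"
      by simp
    from has_derivative_compose[OF this has_field_derivative_imp_has_derivative[OF g[of n z]]]
    have 1: "((\<lambda>z. g n (r z)) has_derivative (\<lambda>h. g (Suc n) (r z) * Re (of_real (Re h) * dx ?r z + of_real (Im h) * dy ?r z))) (at z)"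
      by simp
    have re: "complex_of_real (Re (dx ?r z)) = dx ?r z" "complex_of_real (Re (dy ?r z)) = dy ?r z"
    proof -
      have "((\<lambda>z. cnj (?r z)) has_derivative (\<lambda>h. cnj (of_real (Re h) * dx ?r z + of_real (Im h) * dy ?r z))) (at z)"
        by (rule has_derivative_cnj[OF dr])
      from has_derivative_imp_dx_dy[OF this]
      have "cnj (dx ?r z) = dx ?r z" "cnj (dy ?r z) = dy ?r z" by simp_all
      then show "complex_of_real (Re (dx ?r z)) = dx ?r z" "complex_of_real (Re (dy ?r z)) = dy ?r z"
        by (simp_all add: complex_eq_iff)
    qed
    from has_derivative_of_real[OF 1, where 'a=complex] show ?thesis
      by (simp add: re distrib_left)
  qed
  have e: "dx (\<lambda>z. complex_of_real (g n (r z))) = (\<lambda>z. of_real (g (Suc n) (r z)) * dx ?r z)"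
    "dy (\<lambda>z. complex_of_real (g n (r z))) = (\<lambda>z. of_real (g (Suc n) (r z)) * dy ?r z)" for n
    using has_derivative_imp_dx_dy[OF D] by (simp_all add: fun_eq_iff)
  have d: "(\<lambda>z. complex_of_real (g n (r z))) differentiable (at z)" for n z
    using D differentiable_def by blast
  have "Ck m (\<lambda>z. complex_of_real (g n (r z)))" for m n
  proof (induction m arbitrary: n)
    case 0
    show ?case using continuous_differentiable[OF d] by simp
  next
    case (Suc m)
    show ?case
      by (simp add: differentiable_on_def d e Ck_mult[OF Suc CinfD[OF Cinf_dx[OF r]]] Ck_mult[OF Suc CinfD[OF Cinf_dy[OF r]]])
  qed
  then show ?thesis by (simp add: Cinf_def)
qed

lemma Cinf_jbracket_powr: "(\<lambda>z. of_real (jbracket z powr a)) \<in> Cinf"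
proof -
  \<comment> \<open>The n-th derivative of (1 + x)^(a/2). The falling factorial (a/2) (a/2 - 1) ...
    (a/2 - n + 1) is written as a rising one from its smallest factor.\<close>
  define g where "g n x = pochhammer (a / 2 - real n + 1) n * (1 + x) powr (a / 2 - real n)" for n x
  have "(\<lambda>z. of_real (g 0 ((cmod z)\<^sup>2))) \<in> Cinf"
  proof (rule Cinf_compose_real[OF Cinf_norm_square])
    fix n z
    have p: "0 < 1 + (cmod z)\<^sup>2" by (simp add: add_pos_nonneg)
    have "((\<lambda>x. (1 + x) powr (a / 2 - real n)) has_real_derivative (a / 2 - real n) * (1 + (cmod z)\<^sup>2) powr (a / 2 - real n - 1) * 1) (at ((cmod z)\<^sup>2))"
      using p by (auto intro!: derivative_eq_intros)
    from DERIV_cmult[OF this, of "pochhammer (a / 2 - real n + 1) n"]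
    have "(g n has_real_derivative pochhammer (a / 2 - real n + 1) n * ((a / 2 - real n) * (1 + (cmod z)\<^sup>2) powr (a / 2 - real n - 1) * 1)) (at ((cmod z)\<^sup>2))"
      unfolding g_def[abs_def] .
    moreover have "pochhammer (a / 2 - real n + 1) n * ((a / 2 - real n) * (1 + (cmod z)\<^sup>2) powr (a / 2 - real n - 1) * 1) = g (Suc n) ((cmod z)\<^sup>2)"
    proof -
      have "a / 2 - real (Suc n) + 1 = a / 2 - real n" "a / 2 - real (Suc n) = a / 2 - real n - 1" by simp_all
      then show ?thesis unfolding g_def by (simp only: pochhammer_rec mult_1_right mult_ac)
    qed
    ultimately show "(g n has_real_derivative g (Suc n) ((cmod z)\<^sup>2)) (at ((cmod z)\<^sup>2))" by simp
  qed
  then show ?thesis by (simp add: g_def jbracket_powr)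
qed

lemma Cinf_inverse:
  assumes f: "f \<in> Cinf" and nz: "\<And>z. f z \<noteq> 0"
  shows "(\<lambda>z. inverse (f z)) \<in> Cinf"
proof -
  have D: "((\<lambda>z. inverse (f z)) has_derivative
      (\<lambda>h. - (inverse (f z) * (of_real (Re h) * dx f z + of_real (Im h) * dy f z) * inverse (f z)))) (at z)" for z
    by (rule Deriv.has_derivative_inverse[OF nz has_derivative_dx_dy[OF Cinf_differentiable[OF f]]])
  have e: "dx (\<lambda>z. inverse (f z)) = (\<lambda>z. (- 1) * (inverse (f z) * dx f z * inverse (f z)))"
    "dy (\<lambda>z. inverse (f z)) = (\<lambda>z. (- 1) * (inverse (f z) * dy f z * inverse (f z)))"
    using has_derivative_imp_dx_dy[OF D] by (simp_all add: fun_eq_iff)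
  have d: "(\<lambda>z. inverse (f z)) differentiable (at z)" for z
    using D differentiable_def by blast
  have "Ck m (\<lambda>z. inverse (f z))" for m
  proof (induction m)
    case 0
    show ?case using continuous_differentiable[OF d] by simp
  next
    case (Suc m)
    have "Ck m (dx (\<lambda>z. inverse (f z)))" "Ck m (dy (\<lambda>z. inverse (f z)))"
      unfolding e by (intro Ck_mult Ck_const Suc CinfD Cinf_dx Cinf_dy f)+
    then show ?case by (simp add: differentiable_on_def d)
  qed
  then show ?thesis by (simp add: Cinf_def)
qed

section \<open>A smooth cutoff\<close>

fun flat_poly :: "nat \<Rightarrow> real poly" where
  "flat_poly 0 = 1"
| "flat_poly (Suc n) = [:0, 0, 1:] * (flat_poly n - pderiv (flat_poly n))"

text \<open>The n-th derivative of exp(-1/x), extended by 0 to x <= 0. In y = 1/x the derivative of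
  p(y) exp(-y) is y^2 (p - p')(y) exp(-y), whence the recursion of \<open>flat_poly\<close>.\<close>

definition flat :: "nat \<Rightarrow> real \<Rightarrow> real" where
  "flat n x = (if 0 < x then poly (flat_poly n) (1 / x) * exp (- (1 / x)) else 0)"

lemma poly_exp_tendsto_0: "((\<lambda>y::real. poly p y * exp (- y)) \<longlongrightarrow> 0) at_top"
proof -
  have "((\<lambda>y::real. \<Sum>i\<le>degree p. coeff p i * (y ^ i / exp y)) \<longlongrightarrow> (\<Sum>i\<le>degree p. coeff p i * 0)) at_top"
    by (intro tendsto_sum tendsto_mult tendsto_const tendsto_power_div_exp_0)
  moreover have "poly p y * exp (- y) = (\<Sum>i\<le>degree p. coeff p i * (y ^ i / exp y))" for y :: real
    by (simp add: poly_altdef sum_distrib_right exp_minus divide_inverse mult.assoc)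
  ultimately show ?thesis by simp
qed

lemma flat_has_derivative: "(flat n has_real_derivative flat (Suc n) x) (at x)"
proof -
  consider "x > 0" | "x < 0" | "x = 0" by linarith
  then show ?thesis
  proof cases
    case 1
    have "((\<lambda>x. poly (flat_poly n) (1 / x) * exp (- (1 / x))) has_real_derivative
        poly (pderiv (flat_poly n)) (1 / x) * (- 1 / x\<^sup>2) * exp (- (1 / x)) + poly (flat_poly n) (1 / x) * (exp (- (1 / x)) * (1 / x\<^sup>2))) (at x)"
      using 1 by (auto intro!: derivative_eq_intros DERIV_chain2[OF poly_DERIV] simp: power2_eq_square)
    moreover have "poly (pderiv (flat_poly n)) (1 / x) * (- 1 / x\<^sup>2) * exp (- (1 / x)) + poly (flat_poly n) (1 / x) * (exp (- (1 / x)) * (1 / x\<^sup>2)) = flat (Suc n) x"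
      using 1 by (simp add: flat_def power2_eq_square field_simps)
    ultimately have "((\<lambda>x. poly (flat_poly n) (1 / x) * exp (- (1 / x))) has_real_derivative flat (Suc n) x) (at x)" by simp
    then show ?thesis
      by (rule has_field_derivative_transform_within_open[of _ _ _ "{0<..}"]) (use 1 in \<open>auto simp: flat_def\<close>)
  next
    case 2
    have "((\<lambda>x. 0) has_real_derivative 0) (at x)" by simp
    then have "(flat n has_real_derivative 0) (at x)"
      by (rule has_field_derivative_transform_within_open[of _ _ _ "{..<0}"]) (use 2 in \<open>auto simp: flat_def\<close>)
    then show ?thesis using 2 by (simp add: flat_def)
  next
    case 3
    \<comment> \<open>At 0 the quotient from the right is y p(y) exp(-y) with y = 1/h tending to
      infinity, and from the left it is identically 0.\<close>
    have "((\<lambda>h. flat n h / h) \<longlongrightarrow> 0) (at 0)"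
    proof (subst filterlim_at_split, rule conjI)
      have "((\<lambda>h::real. 0) \<longlongrightarrow> 0) (at_left (0::real))" by simp
      then show "((\<lambda>h. flat n h / h) \<longlongrightarrow> 0) (at_left 0)"
        by (rule Lim_transform_eventually) (auto simp: eventually_at_filter flat_def)
      have "((\<lambda>h::real. poly (pCons 0 (flat_poly n)) (inverse h) * exp (- inverse h)) \<longlongrightarrow> 0) (at_right 0)"
        by (rule filterlim_compose[OF poly_exp_tendsto_0 filterlim_inverse_at_top_right])
      then show "((\<lambda>h. flat n h / h) \<longlongrightarrow> 0) (at_right 0)"
        by (rule Lim_transform_eventually) (auto simp: eventually_at_filter flat_def divide_inverse)
    qed
    then have "((\<lambda>h. (flat n (0 + h) - flat n 0) / h) \<longlongrightarrow> flat (Suc n) 0) (at 0)"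
      by (simp add: flat_def)
    then show ?thesis using 3 by (simp add: DERIV_def)
  qed
qed

lemma flat_0_nonneg: "0 \<le> flat 0 x" and flat_0_pos: "0 < x \<Longrightarrow> 0 < flat 0 x" and flat_0_neg: "x \<le> 0 \<Longrightarrow> flat 0 x = 0"
  by (simp_all add: flat_def)

text \<open>The standard quotient that is 1 for |z| <= 1 and 0 for |z| >= 2. The arguments 4 - |z|^2
  and |z|^2 - 1 have sum 3, so one is positive and the denominator does not vanish.\<close>

definition cutoff :: "complex \<Rightarrow> complex" where
  "cutoff z = of_real (flat 0 (4 - (cmod z)\<^sup>2) / (flat 0 (4 - (cmod z)\<^sup>2) + flat 0 ((cmod z)\<^sup>2 - 1)))"

lemma cutoff_denominator: "0 < flat 0 (4 - x) + flat 0 (x - 1)"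
proof (cases "x < 4")
  case True
  then show ?thesis using flat_0_pos[of "4 - x"] flat_0_nonneg[of "x - 1"] by linarith
next
  case False
  then show ?thesis using flat_0_pos[of "x - 1"] flat_0_nonneg[of "4 - x"] by linarith
qed

lemma Cinf_cutoff: "cutoff \<in> Cinf"
proof -
  have s: "(\<lambda>z. of_real (a + c * (cmod z)\<^sup>2)) \<in> Cinf" for a c
    using Cinf_add[OF Cinf_const Cinf_mult[OF Cinf_const Cinf_norm_square], of "of_real a" "of_real c"] by simp
  have a: "(\<lambda>z. of_real (flat 0 (4 - (cmod z)\<^sup>2))) \<in> Cinf"
    using Cinf_compose_real[of "\<lambda>z. 4 - (cmod z)\<^sup>2" flat 0] s[of 4 "- 1"] flat_has_derivative by simp
  have b: "(\<lambda>z. of_real (flat 0 ((cmod z)\<^sup>2 - 1))) \<in> Cinf"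
    using Cinf_compose_real[of "\<lambda>z. (cmod z)\<^sup>2 - 1" flat 0] s[of "- 1" 1] flat_has_derivative by simp
  have "(\<lambda>z. of_real (flat 0 (4 - (cmod z)\<^sup>2)) * inverse (of_real (flat 0 (4 - (cmod z)\<^sup>2)) + of_real (flat 0 ((cmod z)\<^sup>2 - 1)))) \<in> Cinf"
    (is "(\<lambda>z. _ * inverse (?d z)) \<in> _")
  proof (intro Cinf_mult a Cinf_inverse Cinf_add b)
    show "?d z \<noteq> 0" for z
      using cutoff_denominator[of "(cmod z)\<^sup>2"] by (simp only: of_real_add[symmetric] of_real_eq_0_iff)
  qed
  then show ?thesis
    by (simp add: cutoff_def[abs_def] divide_inverse)
qed

lemma cutoff_1: "cmod z \<le> 1 \<Longrightarrow> cutoff z = 1"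
proof -
  assume "cmod z \<le> 1"
  then have "(cmod z)\<^sup>2 \<le> 1" by (simp add: power_le_one)
  then show ?thesis using flat_0_pos[of "4 - (cmod z)\<^sup>2"] by (simp add: cutoff_def flat_0_neg)
qed

lemma cutoff_0: "2 \<le> cmod z \<Longrightarrow> cutoff z = 0"
proof -
  assume "2 \<le> cmod z"
  then have "2\<^sup>2 \<le> (cmod z)\<^sup>2" by (intro power_mono) auto
  then show ?thesis by (simp add: cutoff_def flat_0_neg)
qed

lemma cmod_cutoff_le: "cmod (cutoff z) \<le> 1"
proof -
  let ?a = "flat 0 (4 - (cmod z)\<^sup>2)" and ?b = "flat 0 ((cmod z)\<^sup>2 - 1)"
  have "0 \<le> ?a" "?a \<le> ?a + ?b" "0 < ?a + ?b"
    using flat_0_nonneg[of "4 - (cmod z)\<^sup>2"] flat_0_nonneg[of "(cmod z)\<^sup>2 - 1"] cutoff_denominator[of "(cmod z)\<^sup>2"] by auto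
  then show ?thesis
    unfolding cutoff_def norm_of_real by simp
qed

lemma test_iff: "f \<in> test_functions \<longleftrightarrow> f \<in> Cinf \<and> (\<exists>R. \<forall>z. R < cmod z \<longrightarrow> f z = 0)"
proof -
  have "bounded (support_on UNIV f) \<longleftrightarrow> (\<exists>R. \<forall>z. R < cmod z \<longrightarrow> f z = 0)"
    by (auto simp: bounded_iff support_on_def) (meson not_le)+
  then show ?thesis by (simp add: test_functions_def compact_closure)
qed

lemma dx_eq_0_of_const_open:
  assumes "open S" "z \<in> S" "\<And>w. w \<in> S \<Longrightarrow> f w = c"
  shows "dx f z = 0" "dy f z = 0"
proof -
  have "((\<lambda>w. c) has_derivative (\<lambda>h. 0)) (at z)" by simp
  then have "(f has_derivative (\<lambda>h. 0)) (at z)"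
    by (rule has_derivative_transform_within_open[OF _ assms(1,2)]) (simp add: assms(3))
  from has_derivative_imp_dx_dy[OF this] show "dx f z = 0" "dy f z = 0" by simp_all
qed

lemma test_Cinf: "f \<in> test_functions \<Longrightarrow> f \<in> Cinf"
  by (simp add: test_iff)

lemma test_dx:
  assumes "f \<in> test_functions"
  shows "dx f \<in> test_functions" "dy f \<in> test_functions" "delbar f \<in> test_functions" "del f \<in> test_functions"
proof -
  obtain R where R: "\<And>z. R < cmod z \<Longrightarrow> f z = 0" using assms by (auto simp: test_iff)
  have f: "f \<in> Cinf" using assms by (rule test_Cinf)
  have "open {z. R < cmod z}" by (intro open_Collect_less continuous_intros)
  then have "dx f z = 0" "dy f z = 0" if "R < cmod z" for z
    using dx_eq_0_of_const_open[of "{z. R < cmod z}" z f 0] R that by auto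
  then have "\<forall>z. R < cmod z \<longrightarrow> dx f z = 0" "\<forall>z. R < cmod z \<longrightarrow> dy f z = 0"
    "\<forall>z. R < cmod z \<longrightarrow> delbar f z = 0" "\<forall>z. R < cmod z \<longrightarrow> del f z = 0"
    by (simp_all add: delbar_def del_def)
  then show "dx f \<in> test_functions" "dy f \<in> test_functions" "delbar f \<in> test_functions" "del f \<in> test_functions"
    unfolding test_iff using Cinf_dx[OF f] Cinf_dy[OF f] Cinf_delbar[OF f] Cinf_del[OF f] by blast+
qed

lemma test_mult: "g \<in> Cinf \<Longrightarrow> f \<in> test_functions \<Longrightarrow> (\<lambda>z. g z * f z) \<in> test_functions"
  unfolding test_iff using Cinf_mult[of g f] by auto

lemma test_cnj: "f \<in> test_functions \<Longrightarrow> (\<lambda>z. cnj (f z)) \<in> test_functions"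
  unfolding test_iff using Cinf_cnj[of f] by auto

text \<open>A compact support beats any power of <z>; \<open>dx f\<close> and \<open>dy f\<close>
  are test functions again, and adding the constants gives a common one.\<close>

lemma test_bound:
  assumes "f \<in> test_functions"
  obtains C where "C \<ge> 0" "\<And>z. cmod (f z) \<le> C * jbracket z powr (- N)"
    "\<And>z. cmod (dx f z) \<le> C * jbracket z powr (- N)" "\<And>z. cmod (dy f z) \<le> C * jbracket z powr (- N)"
proof -
  have one: "\<exists>C\<ge>0. \<forall>z. cmod (f z) \<le> C * jbracket z powr (- N)" if f: "f \<in> test_functions" for f
  proof -
    obtain R where R: "\<And>z. R < cmod z \<Longrightarrow> f z = 0" using f by (auto simp: test_iff)
    have cont: "continuous_on UNIV f" using f by (intro Cinf_continuous test_Cinf)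
    have "continuous_on UNIV (\<lambda>z. cmod (f z) * jbracket z powr N)"
      by (intro continuous_intros cont) auto
    then have "continuous_on (cball 0 R) (\<lambda>z. cmod (f z) * jbracket z powr N)"
      by (rule continuous_on_subset) simp
    then have "bounded ((\<lambda>z. cmod (f z) * jbracket z powr N) ` cball 0 R)"
      by (intro compact_imp_bounded compact_continuous_image compact_cball)
    then obtain M where "\<forall>z\<in>cball 0 R. cmod (f z) * jbracket z powr N \<le> M"
      by (auto simp: bounded_iff)
    then have M: "cmod (f z) * jbracket z powr N \<le> M" if "cmod z \<le> R" for z
      using that by simp
    have "cmod (f z) \<le> \<bar>M\<bar> * jbracket z powr (- N)" for z
    proof (cases "cmod z \<le> R")
      case True
      have "cmod (f z) = (cmod (f z) * jbracket z powr N) * jbracket z powr (- N)"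
        by (simp add: powr_minus)
      also have "\<dots> \<le> \<bar>M\<bar> * jbracket z powr (- N)"
        using order_trans[OF M[OF True] abs_ge_self] by (intro mult_right_mono) auto
      finally show ?thesis .
    qed (simp add: R)
    then show ?thesis using abs_ge_zero by blast
  qed
  obtain C1 C2 C3 where C: "C1 \<ge> 0" "C2 \<ge> 0" "C3 \<ge> 0" "\<And>z. cmod (f z) \<le> C1 * jbracket z powr (- N)"
    "\<And>z. cmod (dx f z) \<le> C2 * jbracket z powr (- N)" "\<And>z. cmod (dy f z) \<le> C3 * jbracket z powr (- N)"
    using one[OF assms] one[OF test_dx(1)[OF assms]] one[OF test_dx(2)[OF assms]] by blast
  show ?thesis
  proof (rule that[of "C1 + C2 + C3"])
    show "cmod (f z) \<le> (C1 + C2 + C3) * jbracket z powr (- N)" for z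
      using C by (intro order_trans[OF C(4)] mult_right_mono) auto
    show "cmod (dx f z) \<le> (C1 + C2 + C3) * jbracket z powr (- N)" for z
      using C by (intro order_trans[OF C(5)] mult_right_mono) auto
    show "cmod (dy f z) \<le> (C1 + C2 + C3) * jbracket z powr (- N)" for z
      using C by (intro order_trans[OF C(6)] mult_right_mono) auto
  qed (use C in auto)
qed

section \<open>Cauchy transforms of test functions\<close>

lemma test_borel: "f \<in> test_functions \<Longrightarrow> f \<in> borel_measurable borel"
  by (intro Cinf_borel test_Cinf)

lemma test_integrable_cauchy_kernel:
  assumes "f \<in> test_functions"
  shows "integrable lborel (\<lambda>w. f w / (z - w))"
proof -
  obtain C where C: "C \<ge> 0" "\<And>z. cmod (f z) \<le> C * jbracket z powr (- 2)"
    "\<And>z. cmod (dx f z) \<le> C * jbracket z powr (- 2)" "\<And>z. cmod (dy f z) \<le> C * jbracket z powr (- 2)"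
    using test_bound[OF assms, of 2] by blast
  show ?thesis by (rule integrable_cauchy_kernel[OF test_borel[OF assms] riesz_jbracket_finite[OF C(2)]])
qed

text \<open>The full decay \<beta> = 1 of the Cauchy transform needs an exponent b > 2 on the
  source, here 3.\<close>

lemma riesz_decay:
  assumes f: "\<And>z. cmod (f z) \<le> C * jbracket z powr (- 3)"
  obtains D where "D \<ge> 0" "\<And>z. riesz f z \<le> ennreal (D * jbracket z powr (- 1))"
proof -
  have C: "0 \<le> C"
    using order_trans[OF norm_ge_zero f[of 0]] by (simp add: zero_le_mult_iff)
  obtain D where D: "D > 0" "\<And>z. (\<integral>\<^sup>+w. ennreal (jbracket w powr (- 3) / cmod (z - w)) \<partial>lborel) \<le> ennreal (D * jbracket z powr (- 1))"
    using cauchy_jbracket_bound[of 1 3] by auto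
  have "riesz f z \<le> ennreal (C * D * jbracket z powr (- 1))" for z
  proof -
    have "riesz f z \<le> (\<integral>\<^sup>+w. ennreal C * ennreal (jbracket w powr (- 3) / cmod (z - w)) \<partial>lborel)"
      unfolding riesz_def using C f
      by (intro nn_integral_mono) (auto intro!: ennreal_leI divide_right_mono simp flip: ennreal_mult)
    also have "\<dots> = ennreal C * (\<integral>\<^sup>+w. ennreal (jbracket w powr (- 3) / cmod (z - w)) \<partial>lborel)"
      by (rule nn_integral_cmult) measurable
    also have "\<dots> \<le> ennreal C * ennreal (D * jbracket z powr (- 1))"
      by (intro mult_left_mono D) simp
    also have "\<dots> = ennreal (C * D * jbracket z powr (- 1))"
      using C D by (simp add: mult.assoc flip: ennreal_mult)
    finally show ?thesis .
  qed
  then show ?thesis by (rule that[rotated]) (use C D(1) in simp)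
qed

lemma cauchy_decay:
  assumes "f \<in> borel_measurable borel" "\<And>z. cmod (f z) \<le> C * jbracket z powr (- 3)"
  obtains D where "D \<ge> 0" "\<And>z. cmod (cauchy f z) \<le> D * jbracket z powr (- 1)"
proof -
  obtain D where D: "D \<ge> 0" "\<And>z. riesz f z \<le> ennreal (D * jbracket z powr (- 1))"
    using riesz_decay[OF assms(2)] by blast
  have "cmod (cauchy f z) \<le> D * jbracket z powr (- 1)" for z
    using order_trans[OF cmod_cauchy_le_riesz[OF assms(1)] D(2)] D(1) by (simp add: ennreal_le_iff)
  then show ?thesis by (rule that[OF D(1)])
qed

text \<open>Derivatives pass onto the compactly supported factor, whose derivatives are test
  functions again. By induction the transform is smooth, though no longer compactly
  supported.\<close>

lemma cauchy_test:
  assumes f: "f \<in> test_functions"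
  shows "cauchy f differentiable (at z)" "dx (cauchy f) = cauchy (dx f)" "dy (cauchy f) = cauchy (dy f)"
    "delbar (cauchy f) z = of_real pi * f z"
proof -
  obtain C where "C \<ge> 0" and C: "\<And>z. cmod (f z) \<le> C * jbracket z powr (- 2)"
    "\<And>z. cmod (dx f z) \<le> C * jbracket z powr (- 2)" "\<And>z. cmod (dy f z) \<le> C * jbracket z powr (- 2)"
    using test_bound[OF f, of 2] by blast
  have c1: "Ck 1 f" using f by (intro CinfD test_Cinf)
  note D = cauchy_has_derivative[OF c1 C]
  show "cauchy f differentiable (at z)" using D differentiable_def by blast
  show e: "dx (cauchy f) = cauchy (dx f)" "dy (cauchy f) = cauchy (dy f)"
    using has_derivative_imp_dx_dy[OF D] by (simp_all add: fun_eq_iff)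
  have i: "integrable lborel (\<lambda>w. dx f w / (z - w))" "integrable lborel (\<lambda>w. \<i> * (dy f w / (z - w)))"
    by (rule test_integrable_cauchy_kernel[OF test_dx(1)[OF f]] integrable_mult_right[OF test_integrable_cauchy_kernel[OF test_dx(2)[OF f]]])+
  have "cauchy (delbar f) z = (LINT w|lborel. (dx f w / (z - w) + \<i> * (dy f w / (z - w))) / 2)"
    unfolding cauchy_def by (intro Bochner_Integration.integral_cong refl) (simp add: delbar_def add_divide_distrib mult.commute)
  also have "\<dots> = (LINT w|lborel. dx f w / (z - w) + \<i> * (dy f w / (z - w))) / 2"
    by (rule integral_divide_zero)
  also have "\<dots> = delbar (cauchy f) z"
    unfolding delbar_def e unfolding cauchy_def
    by (simp only: Bochner_Integration.integral_add[OF i] integral_mult_right_zero)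
  finally show "delbar (cauchy f) z = of_real pi * f z"
    using cauchy_delbar[OF c1 C] by simp
qed

lemma Cinf_cauchy_test:
  assumes "f \<in> test_functions"
  shows "cauchy f \<in> Cinf"
proof -
  have "Ck n (cauchy f)" if "f \<in> test_functions" for n f
    using that
  proof (induction n arbitrary: f)
    case 0
    then show ?case using continuous_differentiable[OF cauchy_test(1)] by simp
  next
    case (Suc n)
    have "Ck n (cauchy (dx f))" "Ck n (cauchy (dy f))"
      using Suc.IH test_dx[OF Suc.prems] by blast+
    then show ?case using cauchy_test(1)[OF Suc.prems] by (simp add: differentiable_on_def cauchy_test(2,3)[OF Suc.prems])
  qed
  then show ?thesis using assms by (simp add: Cinf_def)
qed

section \<open>Dilated cutoffs\<close>

lemma dx_scale:
  assumes "\<And>z. f differentiable (at z)"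
  shows "(\<lambda>z. f (of_real c * z)) differentiable (at z)"
    "dx (\<lambda>z. f (of_real c * z)) = (\<lambda>z. of_real c * dx f (of_real c * z))"
    "dy (\<lambda>z. f (of_real c * z)) = (\<lambda>z. of_real c * dy f (of_real c * z))"
proof -
  have D: "((\<lambda>z. f (of_real c * z)) has_derivative (\<lambda>h. of_real (Re (of_real c * h)) * dx f (of_real c * z) + of_real (Im (of_real c * h)) * dy f (of_real c * z))) (at z)" for z
    by (rule has_derivative_compose[OF _ has_derivative_dx_dy[OF assms], of "\<lambda>z. of_real c * z"])
      (auto intro!: derivative_eq_intros)
  show "(\<lambda>z. f (of_real c * z)) differentiable (at z)" using D differentiable_def by blast
  show "dx (\<lambda>z. f (of_real c * z)) = (\<lambda>z. of_real c * dx f (of_real c * z))"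
    "dy (\<lambda>z. f (of_real c * z)) = (\<lambda>z. of_real c * dy f (of_real c * z))"
    using has_derivative_imp_dx_dy[OF D] by (simp_all add: fun_eq_iff)
qed

lemma Cinf_scale:
  assumes "f \<in> Cinf"
  shows "(\<lambda>z. f (of_real c * z)) \<in> Cinf"
proof -
  have "Ck n (\<lambda>z. f (of_real c * z))" if "f \<in> Cinf" for n f
    using that
  proof (induction n arbitrary: f)
    case 0
    have d: "\<And>z. f differentiable (at z)" using 0 Cinf_differentiable by blast
    show ?case using continuous_differentiable[OF dx_scale(1)[OF d]] by simp
  next
    case (Suc n)
    note d = Cinf_differentiable[OF Suc.prems]
    have "Ck n (\<lambda>z. of_real c * dx f (of_real c * z))" "Ck n (\<lambda>z. of_real c * dy f (of_real c * z))"
      by (intro Ck_mult Ck_const Suc.IH Cinf_dx Cinf_dy Suc.prems)+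
    then show ?case using dx_scale(1)[OF d] by (simp add: differentiable_on_def dx_scale(2,3)[OF d])
  qed
  then show ?thesis using assms by (simp add: Cinf_def)
qed

definition chi :: "real \<Rightarrow> complex \<Rightarrow> complex" where
  "chi R z = cutoff (of_real (1 / R) * z)"

lemma chi_properties:
  assumes "0 < R"
  shows "chi R \<in> test_functions" "cmod z \<le> R \<Longrightarrow> chi R z = 1" "2 * R \<le> cmod z \<Longrightarrow> chi R z = 0" "cmod (chi R z) \<le> 1"
proof -
  have n: "cmod (of_real (1 / R) * z) = cmod z / R" for z
    using assms by (simp add: norm_mult norm_divide)
  show 1: "2 * R \<le> cmod z \<Longrightarrow> chi R z = 0" for z
  proof -
    assume "2 * R \<le> cmod z"
    then have "2 \<le> cmod z / R" using assms by (simp add: field_simps)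
    then show ?thesis unfolding chi_def by (intro cutoff_0) (simp only: n)
  qed
  show "cmod z \<le> R \<Longrightarrow> chi R z = 1"
  proof -
    assume "cmod z \<le> R"
    then have "cmod z / R \<le> 1" using assms by (simp add: field_simps)
    then show ?thesis unfolding chi_def by (intro cutoff_1) (simp only: n)
  qed
  show "cmod (chi R z) \<le> 1" by (simp add: chi_def cmod_cutoff_le)
  have "chi R \<in> Cinf" unfolding chi_def[abs_def] by (rule Cinf_scale[OF Cinf_cutoff])
  then show "chi R \<in> test_functions" unfolding test_iff using 1 less_imp_le by blast
qed

text \<open>The gain 1 / R balances the area of the annulus: the L2 norm of this derivative is
  bounded in R, which is what the Liouville argument in <z> L2 relies on.\<close>

lemma delbar_chi_bound:
  obtains D where "0 \<le> D" "\<And>R z. 0 < R \<Longrightarrow> cmod (delbar (chi R) z) \<le> D / R * indicator {z. R \<le> cmod z \<and> cmod z \<le> 2 * R} z"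
proof -
  have "cutoff \<in> test_functions"
    unfolding test_iff using Cinf_cutoff cutoff_0 less_imp_le by blast
  then obtain D where D: "0 \<le> D" "\<And>z. cmod (cutoff z) \<le> D * jbracket z powr (- 0)"
    "\<And>z. cmod (dx cutoff z) \<le> D * jbracket z powr (- 0)" "\<And>z. cmod (dy cutoff z) \<le> D * jbracket z powr (- 0)"
    using test_bound[of cutoff 0] by blast
  have "cmod (delbar (chi R) z) \<le> D / R * indicator {z. R \<le> cmod z \<and> cmod z \<le> 2 * R} z" if R: "0 < R" for R z
  proof (cases "R \<le> cmod z \<and> cmod z \<le> 2 * R")
    case True
    have c: "chi R = (\<lambda>z. cutoff (of_real (1 / R) * z))" by (simp only: chi_def[abs_def])
    note e = dx_scale(2,3)[OF Cinf_differentiable[OF Cinf_cutoff], of "1 / R", folded c]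
    have b: "cmod (dx cutoff w) \<le> D" "cmod (dy cutoff w) \<le> D" for w
      using D by simp_all
    have r: "cmod (of_real (1 / R)) = 1 / R" using R by (simp add: norm_divide)
    have "cmod (dx (chi R) z) \<le> 1 / R * D"
      unfolding e(1) norm_mult r using R b by (intro mult_left_mono) auto
    moreover have "cmod (dy (chi R) z) \<le> 1 / R * D"
      unfolding e(2) norm_mult r using R b by (intro mult_left_mono) auto
    ultimately show ?thesis using cmod_delbar_le(1)[of "chi R" z "1 / R * D"] True by simp
  next
    case False
    then have "z \<in> {z. cmod z < R} \<or> z \<in> {z. 2 * R < cmod z}" by auto
    moreover have "open {z. cmod z < R}" "open {z. 2 * R < cmod z}"
      by (intro open_Collect_less continuous_intros)+
    ultimately have "dx (chi R) z = 0 \<and> dy (chi R) z = 0"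
      using dx_eq_0_of_const_open[of "{z. cmod z < R}" z "chi R" 1] dx_eq_0_of_const_open[of "{z. 2 * R < cmod z}" z "chi R" 0]
        chi_properties(2,3)[OF R] by fastforce
    then show ?thesis using False by (simp add: delbar_def)
  qed
  then show ?thesis by (rule that[OF D(1)])
qed

section \<open>Pairings with weighted L2 functions\<close>

lemma integrable_wL2_mult:
  assumes W: "W \<in> elems (wL2 \<theta>)" and [measurable]: "g \<in> borel_measurable borel"
    and g: "\<And>z. cmod (g z) \<le> C * jbracket z powr (- \<theta> - p)" and "1 < p"
  shows "integrable lborel (\<lambda>z. W z * g z)"
proof (rule Bochner_Integration.integrable_bound)
  have [measurable]: "W \<in> borel_measurable borel" using W by (simp add: wL2_mem_iff)
  have "wnorm2 \<theta> W < \<infinity>" using W by (simp add: wL2_mem_iff)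
  then have i1: "integrable lborel (\<lambda>z. jbracket z powr (- 2 * \<theta>) * (cmod (W z))\<^sup>2)"
    unfolding wnorm2_def by (intro integrableI_nonneg) auto
  have i2: "integrable lborel (\<lambda>z. C\<^sup>2 * jbracket z powr (- (2 * p)))"
    using \<open>1 < p\<close> by (intro integrable_mult_right integrable_jbracket_powr) simp
  show "integrable lborel (\<lambda>z. jbracket z powr (- 2 * \<theta>) * (cmod (W z))\<^sup>2 + C\<^sup>2 * jbracket z powr (- (2 * p)))"
    by (rule Bochner_Integration.integrable_add[OF i1 i2])
  show "AE z in lborel. cmod (W z * g z) \<le> norm (jbracket z powr (- 2 * \<theta>) * (cmod (W z))\<^sup>2 + C\<^sup>2 * jbracket z powr (- (2 * p)))"
  proof (rule AE_I2)
    fix z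
    define x where "x = jbracket z powr (- \<theta>) * cmod (W z)"
    define y where "y = C * jbracket z powr (- p)"
    have "cmod (W z * g z) \<le> cmod (W z) * (C * jbracket z powr (- \<theta> - p))"
      unfolding norm_mult by (intro mult_left_mono g) simp
    also have "\<dots> = x * y"
      unfolding x_def y_def using powr_add[of "jbracket z" "- \<theta>" "- p"] by (simp add: mult_ac)
    also have "\<dots> \<le> x\<^sup>2 + y\<^sup>2"
      using zero_le_power2[of "x - y"] zero_le_power2[of x] zero_le_power2[of y] unfolding power2_diff by linarith
    also have "x\<^sup>2 = jbracket z powr (- 2 * \<theta>) * (cmod (W z))\<^sup>2"
      by (simp add: x_def power_mult_distrib) (simp add: power2_eq_square flip: powr_add)
    also have "y\<^sup>2 = C\<^sup>2 * jbracket z powr (- (2 * p))"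
      by (simp add: y_def power_mult_distrib) (simp add: power2_eq_square flip: powr_add)
    finally show "cmod (W z * g z) \<le> norm (jbracket z powr (- 2 * \<theta>) * (cmod (W z))\<^sup>2 + C\<^sup>2 * jbracket z powr (- (2 * p)))"
      by simp
  qed
  show "(\<lambda>z. W z * g z) \<in> borel_measurable lborel" by measurable
qed

text \<open>dbar of the Cauchy transform in the sense of distributions: Fubini moves the kernel onto
  the test function, where the Cauchy-Pompeiu formula applies. The antisymmetry of 1 / (z - w) gives
  the minus sign. Absolute convergence rests on the decay <w>^-1 of
  \<open>riesz (delbar \<eta>)\<close>.\<close>

lemma integral_cauchy_delbar:
  assumes f: "f \<in> elems (wL2 (\<epsilon> - 2))" and "\<epsilon> \<le> 1" and \<eta>: "\<eta> \<in> test_functions"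
  shows "(LINT z|lborel. cauchy f z * delbar \<eta> z) = - of_real pi * (LINT w|lborel. f w * \<eta> w)"
proof -
  have [measurable]: "f \<in> borel_measurable borel" using f by (simp add: wL2_mem_iff)
  have e [measurable]: "delbar \<eta> \<in> borel_measurable borel" by (rule test_borel[OF test_dx(3)[OF \<eta>]])
  obtain C where "C \<ge> 0" and C: "\<And>z. cmod (\<eta> z) \<le> C * jbracket z powr (- 3)"
    "\<And>z. cmod (dx \<eta> z) \<le> C * jbracket z powr (- 3)" "\<And>z. cmod (dy \<eta> z) \<le> C * jbracket z powr (- 3)"
    using test_bound[OF \<eta>, of 3] by blast
  obtain D where D: "D \<ge> 0" "\<And>z. riesz (delbar \<eta>) z \<le> ennreal (D * jbracket z powr (- 1))"
    using riesz_decay[OF cmod_delbar_le(1)[OF C(2,3)]] by blast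
  let ?k = "\<lambda>w z. f w / (z - w) * delbar \<eta> z"
  have int: "integrable (lborel \<Otimes>\<^sub>M lborel) (\<lambda>(w, z). ?k w z)"
  proof (rule integrableI_bounded)
    show "(\<lambda>(w, z). ?k w z) \<in> borel_measurable (lborel \<Otimes>\<^sub>M lborel)" by measurable
    have "(\<integral>\<^sup>+x. ennreal (norm (case x of (w, z) \<Rightarrow> ?k w z)) \<partial>(lborel \<Otimes>\<^sub>M lborel)) =
        (\<integral>\<^sup>+w. \<integral>\<^sup>+z. ennreal (cmod (?k w z)) \<partial>lborel \<partial>lborel)"
      by (subst lborel.nn_integral_fst[symmetric]) (auto simp: case_prod_beta)
    also have "\<dots> = (\<integral>\<^sup>+w. ennreal (cmod (f w)) * riesz (delbar \<eta>) w \<partial>lborel)"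
    proof (rule nn_integral_cong)
      fix w
      have "(\<integral>\<^sup>+z. ennreal (cmod (?k w z)) \<partial>lborel) = (\<integral>\<^sup>+z. ennreal (cmod (f w)) * ennreal (cmod (delbar \<eta> z) / cmod (w - z)) \<partial>lborel)"
        by (intro nn_integral_cong) (simp add: norm_mult norm_divide norm_minus_commute mult_ac flip: ennreal_mult)
      also have "\<dots> = ennreal (cmod (f w)) * riesz (delbar \<eta>) w"
        unfolding riesz_def by (rule nn_integral_cmult) measurable
      finally show "(\<integral>\<^sup>+z. ennreal (cmod (?k w z)) \<partial>lborel) = ennreal (cmod (f w)) * riesz (delbar \<eta>) w" .
    qed
    also have "\<dots> \<le> (\<integral>\<^sup>+w. ennreal (cmod (f w * of_real (D * jbracket w powr (- 1)))) \<partial>lborel)"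
    proof (rule nn_integral_mono)
      fix w
      have "ennreal (cmod (f w)) * riesz (delbar \<eta>) w \<le> ennreal (cmod (f w)) * ennreal (D * jbracket w powr (- 1))"
        by (intro mult_left_mono D) simp
      also have "\<dots> = ennreal (cmod (f w * of_real (D * jbracket w powr (- 1))))"
        using D(1) by (simp add: norm_mult norm_divide flip: ennreal_mult)
      finally show "ennreal (cmod (f w)) * riesz (delbar \<eta>) w \<le> \<dots>" .
    qed
    also have "\<dots> < \<infinity>"
    proof -
      \<comment> \<open>The exponent -1 is -(\<epsilon> - 2) - p with p = 3 - \<epsilon>, and p > 1
        because \<epsilon> <= 1.\<close>
      have "integrable lborel (\<lambda>w. f w * of_real (D * jbracket w powr (- 1)))"
        by (rule integrable_wL2_mult[OF f, of _ D "3 - \<epsilon>"]) (use D(1) \<open>\<epsilon> \<le> 1\<close> in \<open>auto simp: norm_mult norm_divide\<close>)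
      then show ?thesis by (simp add: integrable_iff_bounded)
    qed
    finally show "(\<integral>\<^sup>+x. ennreal (norm (case x of (w, z) \<Rightarrow> ?k w z)) \<partial>(lborel \<Otimes>\<^sub>M lborel)) < \<infinity>" .
  qed
  have "(LINT z|lborel. cauchy f z * delbar \<eta> z) = (LINT z|lborel. LINT w|lborel. ?k w z)"
    unfolding cauchy_def by (simp only: integral_mult_left_zero)
  also have "\<dots> = (LINT w|lborel. LINT z|lborel. ?k w z)"
    by (rule lborel_pair.Fubini_integral[OF int])
  also have "\<dots> = (LINT w|lborel. - of_real pi * (f w * \<eta> w))"
  proof (intro Bochner_Integration.integral_cong refl)
    fix w
    have "(LINT z|lborel. ?k w z) = (LINT z|lborel. - f w * (delbar \<eta> z / (w - z)))"
    proof (intro Bochner_Integration.integral_cong refl)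
      fix z
      have "w - z = - (z - w)" by simp
      then show "?k w z = - f w * (delbar \<eta> z / (w - z))" by (simp only: divide_minus_right) simp
    qed
    also have "\<dots> = - f w * cauchy (delbar \<eta>) w"
      unfolding cauchy_def by (rule integral_mult_right_zero)
    also have "cauchy (delbar \<eta>) w = of_real pi * \<eta> w"
    proof (rule cauchy_delbar)
      show "Ck 1 \<eta>" using \<eta> by (intro CinfD test_Cinf)
      have "C * jbracket z powr (- 3) \<le> C * jbracket z powr (- 2)" for z
        using order_trans[OF norm_ge_zero C(1)[of 0]]
        by (intro mult_left_mono jbracket_powr_mono) (auto simp: zero_le_mult_iff)
      then show "cmod (\<eta> z) \<le> C * jbracket z powr (- 2)" "cmod (dx \<eta> z) \<le> C * jbracket z powr (- 2)"
        "cmod (dy \<eta> z) \<le> C * jbracket z powr (- 2)" for z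
        using C order_trans by blast+
    qed
    finally show "(LINT z|lborel. ?k w z) = - of_real pi * (f w * \<eta> w)" by (simp add: mult_ac)
  qed
  also have "\<dots> = - of_real pi * (LINT w|lborel. f w * \<eta> w)"
    by (rule integral_mult_right_zero)
  finally show ?thesis .
qed

section \<open>Density of test functions and a Liouville theorem\<close>

lemma Cinf_real_polynomial:
  fixes r :: "complex \<Rightarrow> real"
  assumes "real_polynomial_function r"
  shows "(\<lambda>z. of_real (r z)) \<in> Cinf"
  using assms
proof induction
  case (linear f)
  have "f z = Re z * f 1 + Im z * f \<i>" for z
  proof -
    have "z = Re z *\<^sub>R 1 + Im z *\<^sub>R \<i>" by (simp add: complex_eq_iff)
    then have "f z = f (Re z *\<^sub>R 1 + Im z *\<^sub>R \<i>)" by simp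
    also have "\<dots> = Re z *\<^sub>R f 1 + Im z *\<^sub>R f \<i>"
      by (simp only: linear_add[OF bounded_linear.linear[OF linear]] linear_scale[OF bounded_linear.linear[OF linear]])
    finally show ?thesis by simp
  qed
  then have "complex_of_real (f z) = of_real (Re z) * of_real (f 1) + of_real (Im z) * of_real (f \<i>)" for z
    by (metis of_real_add of_real_mult)
  then have e: "(\<lambda>z. complex_of_real (f z)) = (\<lambda>z. of_real (Re z) * of_real (f 1) + of_real (Im z) * of_real (f \<i>))"
    by (rule ext)
  show ?case unfolding e by (intro Cinf_add Cinf_mult Cinf_Re Cinf_Im Cinf_const)
next
  case (add f g)
  then show ?case using Cinf_add by simp
next
  case (mult f g)
  then show ?case using Cinf_mult by simp
qed (simp add: Cinf_const)

lemma wnorm2_dominated: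
  assumes [measurable]: "\<And>n. g n \<in> borel_measurable borel" "u \<in> borel_measurable borel" "B \<in> borel_measurable borel"
    and lim: "AE z in lborel. (\<lambda>n. g n z) \<longlonglongrightarrow> u z" and le: "\<And>n z. cmod (g n z) \<le> cmod (B z)" and fin: "wnorm2 \<theta> B < \<infinity>"
  shows "(\<lambda>n. wnorm2 \<theta> (\<lambda>z. u z - g n z)) \<longlonglongrightarrow> 0"
proof -
  have "(\<lambda>n. wnorm2 \<theta> (\<lambda>z. u z - g n z)) \<longlonglongrightarrow> integral\<^sup>N lborel (\<lambda>z::complex. 0)"
    unfolding wnorm2_def
  proof (rule nn_integral_dominated_convergence[where w="\<lambda>z. 4 * ennreal (jbracket z powr (- 2 * \<theta>) * (cmod (B z))\<^sup>2)"])
    show "AE z in lborel. ennreal (jbracket z powr (- 2 * \<theta>) * (cmod (u z - g n z))\<^sup>2) \<le> 4 * ennreal (jbracket z powr (- 2 * \<theta>) * (cmod (B z))\<^sup>2)" for n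
      using lim
    proof eventually_elim
      case (elim z)
      have "cmod (u z) \<le> cmod (B z)"
        by (rule LIMSEQ_le_const2[OF tendsto_norm[OF elim]]) (use le in auto)
      then have "cmod (u z - g n z) \<le> 2 * cmod (B z)"
        using norm_triangle_ineq4[of "u z" "g n z"] le[of n z] by linarith
      then have "(cmod (u z - g n z))\<^sup>2 \<le> (2 * cmod (B z))\<^sup>2" by (intro power_mono) auto
      then have "jbracket z powr (- 2 * \<theta>) * (cmod (u z - g n z))\<^sup>2 \<le> 4 * (jbracket z powr (- 2 * \<theta>) * (cmod (B z))\<^sup>2)"
        using mult_left_mono[of "(cmod (u z - g n z))\<^sup>2" "(2 * cmod (B z))\<^sup>2" "jbracket z powr (- 2 * \<theta>)"]
        by (simp add: power_mult_distrib mult_ac)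
      then have "ennreal (jbracket z powr (- 2 * \<theta>) * (cmod (u z - g n z))\<^sup>2) \<le> ennreal (4 * (jbracket z powr (- 2 * \<theta>) * (cmod (B z))\<^sup>2))"
        by (rule ennreal_leI)
      then show ?case by (subst (asm) ennreal_mult) auto
    qed
    show "(\<integral>\<^sup>+z. 4 * ennreal (jbracket z powr (- 2 * \<theta>) * (cmod (B z))\<^sup>2) \<partial>lborel) < \<infinity>"
      using fin unfolding wnorm2_def by (subst nn_integral_cmult) (auto simp: ennreal_mult_less_top)
    show "AE z in lborel. (\<lambda>n. ennreal (jbracket z powr (- 2 * \<theta>) * (cmod (u z - g n z))\<^sup>2)) \<longlonglongrightarrow> 0"
      using lim
    proof eventually_elim
      case (elim z)
      have "(\<lambda>n. ennreal (jbracket z powr (- 2 * \<theta>) * (cmod (u z - g n z))\<^sup>2)) \<longlonglongrightarrow> ennreal (jbracket z powr (- 2 * \<theta>) * (cmod (u z - u z))\<^sup>2)"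
        by (intro tendsto_ennrealI tendsto_intros elim)
      then show ?case by simp
    qed
  qed measurable
  then show ?thesis by simp
qed

lemma tendsto_0_obtain_less:
  fixes X :: "nat \<Rightarrow> ennreal"
  assumes "X \<longlonglongrightarrow> 0" "0 < e"
  obtains n where "n0 \<le> n" "X n < e"
proof -
  have "\<forall>\<^sub>F n in sequentially. X n < e" using order_tendstoD(2)[OF assms] .
  then have "\<forall>\<^sub>F n in sequentially. X n < e \<and> n0 \<le> n" using eventually_ge_at_top[of n0] by eventually_elim simp
  then obtain n where "X n < e \<and> n0 \<le> n"
    using eventually_happens'[OF sequentially_bot] by blast
  then show ?thesis by (intro that[of n]) simp_all
qed

lemma wnorm2_0_cball:
  assumes "\<And>z. cmod (f z) \<le> d * indicator (cball 0 R) z" "0 \<le> d"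
  shows "wnorm2 0 f \<le> ennreal (d\<^sup>2 * measure lborel (cball (0::complex) R))"
proof -
  have "wnorm2 0 f \<le> (\<integral>\<^sup>+z. ennreal (d\<^sup>2) * indicator (cball (0::complex) R) z \<partial>lborel)"
    unfolding wnorm2_def
  proof (rule nn_integral_mono)
    fix z
    have "(cmod (f z))\<^sup>2 \<le> (d * indicator (cball 0 R) z)\<^sup>2" by (intro power_mono assms) simp
    then show "ennreal (jbracket z powr (- 2 * 0) * (cmod (f z))\<^sup>2) \<le> ennreal (d\<^sup>2) * indicator (cball 0 R) z"
      by (auto simp: indicator_def intro: ennreal_leI split: if_splits)
  qed
  also have "\<dots> = ennreal (d\<^sup>2) * emeasure lborel (cball (0::complex) R)"
    by (rule nn_integral_cmult_indicator) simp
  also have "emeasure lborel (cball (0::complex) R) = ennreal (measure lborel (cball (0::complex) R))"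
    using emeasure_lborel_cball_finite[of "0::complex" R] by (intro emeasure_eq_ennreal_measure) simp
  finally show ?thesis by (simp add: ennreal_mult)
qed

lemma L2_truncation:
  assumes u: "u \<in> borel_measurable borel" "wnorm2 0 u < \<infinity>" and "0 < e"
  obtains v N where "v \<in> borel_measurable borel" "0 < N" "\<And>z. cmod (v z) \<le> N" "\<And>z. N < cmod z \<Longrightarrow> v z = 0"
    "wnorm2 0 (\<lambda>z. u z - v z) < ennreal e"
proof -
  have [measurable]: "u \<in> borel_measurable borel" by (rule u)
  define v where "v n z = (if cmod (u z) \<le> real n \<and> cmod z \<le> real n then u z else 0)" for n z
  have [measurable]: "v n \<in> borel_measurable borel" for n
    unfolding v_def[abs_def] by measurable
  have L: "(\<lambda>n. wnorm2 0 (\<lambda>z. u z - v n z)) \<longlonglongrightarrow> 0"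
  proof (rule wnorm2_dominated[where B=u])
    show "AE z in lborel. (\<lambda>n. v n z) \<longlonglongrightarrow> u z"
    proof (rule AE_I2)
      fix z
      have "\<forall>\<^sub>F n in sequentially. cmod (u z) \<le> real n \<and> cmod z \<le> real n"
        using eventually_conj[OF eventually_ge_at_top[of "nat \<lceil>cmod (u z)\<rceil>"] eventually_ge_at_top[of "nat \<lceil>cmod z\<rceil>"]]
        by eventually_elim linarith
      then have "\<forall>\<^sub>F n in sequentially. v n z = u z" by eventually_elim (simp add: v_def)
      then show "(\<lambda>n. v n z) \<longlonglongrightarrow> u z" by (rule tendsto_eventually)
    qed
  qed (use u in \<open>auto simp: v_def\<close>)
  have e0: "0 < ennreal e" using \<open>0 < e\<close> by simp
  obtain n where n: "1 \<le> n" "wnorm2 0 (\<lambda>z. u z - v n z) < ennreal e"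
    using tendsto_0_obtain_less[OF L e0, of 1] by blast
  show ?thesis
    by (rule that[of "v n" "real n"]) (use n in \<open>auto simp: v_def\<close>)
qed

text \<open>A measurable function is an almost everywhere limit of continuous ones, but without any
  domination. Retracting values to the disc of radius N and multiplying by \<open>chi N\<close>
  provides it; neither changes the limit, since v is bounded by N and lives in the disc of radius
  N.\<close>

lemma continuous_approximation:
  assumes v: "v \<in> borel_measurable borel" "0 < N" "\<And>z. cmod (v z) \<le> N" "\<And>z. N < cmod z \<Longrightarrow> v z = 0" and "0 < e"
  obtains h where "continuous_on UNIV h" "\<And>z. 2 * N \<le> cmod z \<Longrightarrow> h z = 0" "wnorm2 0 (\<lambda>z. v z - h z) < ennreal e"
proof -
  have "v \<in> borel_measurable lebesgue" using v(1) by (simp add: measurable_completion)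
  then have "v measurable_on UNIV"
    by (intro lebesgue_measurable_imp_measurable_on) auto
  then obtain S g where S: "negligible S" and g: "\<And>n. continuous_on UNIV (g n)" and lim: "\<And>x. x \<notin> S \<Longrightarrow> (\<lambda>n. g n x) \<longlonglongrightarrow> v x"
    unfolding measurable_on_def by auto
  have AE: "AE z in lborel. z \<notin> S"
    using S AE_not_in[of S lebesgue] by (simp add: negligible_iff_null_sets AE_completion_iff)
  \<comment> \<open>The radial retraction onto the closed disc of radius N, continuous and the
    identity on the values of v.\<close>
  define clip where "clip w = w / complex_of_real (max 1 (cmod w / N))" for w
  have mx: "max 1 (cmod w / N) \<noteq> 0" for w
    using max.cobounded1[of 1 "cmod w / N"] by linarith
  have cc: "continuous_on UNIV clip"
    unfolding clip_def[abs_def]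
  proof (rule continuous_on_divide[OF continuous_on_id])
    show "continuous_on UNIV (\<lambda>w. complex_of_real (max 1 (cmod w / N)))"
      using \<open>0 < N\<close> by (intro continuous_on_of_real continuous_on_max continuous_intros) auto
    show "\<forall>w\<in>UNIV. complex_of_real (max 1 (cmod w / N)) \<noteq> 0"
      unfolding of_real_eq_0_iff using mx by blast
  qed
  have cle: "cmod (clip w) \<le> N" for w
  proof -
    have "cmod w \<le> N * max 1 (cmod w / N)"
      using \<open>0 < N\<close> by (auto simp: max_def field_simps)
    moreover have "0 < max 1 (cmod w / N)" by (simp add: less_max_iff_disj)
    ultimately show ?thesis
      unfolding clip_def norm_divide norm_of_real by (simp add: pos_divide_le_eq abs_of_pos)
  qed
  have cid: "clip w = w" if "cmod w \<le> N" for w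
    using that \<open>0 < N\<close> by (simp add: clip_def max_def)
  define h where "h n z = chi N z * clip (g n z)" for n z
  have hc: "continuous_on UNIV (h n)" for n
    unfolding h_def[abs_def]
    by (intro continuous_on_mult Cinf_continuous test_Cinf chi_properties \<open>0 < N\<close> continuous_on_compose2[OF cc g]) auto
  have h0: "h n z = 0" if "2 * N \<le> cmod z" for n z
    using chi_properties(3)[OF \<open>0 < N\<close> that] by (simp add: h_def)
  have L: "(\<lambda>n. wnorm2 0 (\<lambda>z. v z - h n z)) \<longlonglongrightarrow> 0"
  proof (rule wnorm2_dominated[where B="\<lambda>z. of_real (N * indicator (cball 0 (2 * N)) z)"])
    show "h n \<in> borel_measurable borel" for n by (rule continuous_imp_borel[OF hc])
    show "v \<in> borel_measurable borel" by (rule v)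
    show "(\<lambda>z::complex. complex_of_real (N * indicator (cball 0 (2 * N)) z)) \<in> borel_measurable borel"
    proof -
      have eq: "(\<lambda>z. complex_of_real (N * indicator (cball 0 (2 * N)) z)) = (\<lambda>z. if cmod z \<le> 2 * N then of_real N else 0)"
        by (simp add: fun_eq_iff indicator_def)
      have "(\<lambda>z. if cmod z \<le> 2 * N then complex_of_real N else 0) \<in> borel_measurable borel"
        by measurable
      then show ?thesis by (simp only: eq)
    qed
    show "AE z in lborel. (\<lambda>n. h n z) \<longlonglongrightarrow> v z"
      using AE
    proof eventually_elim
      case (elim z)
      have "(\<lambda>n. clip (g n z)) \<longlonglongrightarrow> clip (v z)"
        using cc by (intro isCont_tendsto_compose[OF _ lim[OF elim]]) (simp add: continuous_on_eq_continuous_at)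
      then have "(\<lambda>n. h n z) \<longlonglongrightarrow> chi N z * clip (v z)"
        unfolding h_def by (intro tendsto_mult tendsto_const)
      moreover have "chi N z * clip (v z) = v z"
        using chi_properties(2)[OF \<open>0 < N\<close>, of z] v(4)[of z] cid[OF v(3), of z] by (cases "cmod z \<le> N") auto
      ultimately show ?case by simp
    qed
    show "cmod (h n z) \<le> cmod (of_real (N * indicator (cball 0 (2 * N)) z))" for n z
    proof (cases "2 * N \<le> cmod z")
      case False
      have "cmod (h n z) \<le> 1 * N"
        unfolding h_def norm_mult by (intro mult_mono chi_properties(4) cle \<open>0 < N\<close>) auto
      then show ?thesis using False \<open>0 < N\<close> by simp
    qed (simp add: h0)
    have "wnorm2 0 (\<lambda>z. of_real (N * indicator (cball 0 (2 * N)) z)) \<le> ennreal (N\<^sup>2 * measure lborel (cball (0::complex) (2 * N)))"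
      using \<open>0 < N\<close> by (intro wnorm2_0_cball) (auto simp: norm_mult)
    then show "wnorm2 0 (\<lambda>z. of_real (N * indicator (cball 0 (2 * N)) z)) < \<infinity>"
      by (rule le_less_trans) simp
  qed
  have e0: "0 < ennreal e" using \<open>0 < e\<close> by simp
  obtain n where n: "wnorm2 0 (\<lambda>z. v z - h n z) < ennreal e"
    using tendsto_0_obtain_less[OF L e0, of 1] by blast
  show ?thesis by (rule that[OF hc h0 n])
qed

text \<open>A Stone-Weierstrass polynomial on the disc of radius 2 R is multiplied by
  \<open>chi R\<close>. On the annulus, where the cutoff varies, h is 0, so there the polynomial
  itself is small and the cutoff does no damage.\<close>

lemma smooth_approximation:
  assumes h: "continuous_on UNIV h" "\<And>z. R \<le> cmod z \<Longrightarrow> h z = 0" and "0 < R" "0 < e"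
  obtains \<psi> where "\<psi> \<in> test_functions" "wnorm2 0 (\<lambda>z. h z - \<psi> z) < ennreal e"
proof -
  define M where "M = measure lborel (cball (0::complex) (2 * R))"
  have M: "0 \<le> M" by (simp add: M_def)
  \<comment> \<open>Chosen so that d^2 M = e M / (M + 1) < e, where M is the area of the disc of
    radius 2 R.\<close>
  define d where "d = sqrt (e / (M + 1))"
  have d: "0 < d" using M \<open>0 < e\<close> by (simp add: d_def)
  obtain p where p: "polynomial_function p" "\<And>z. z \<in> cball 0 (2 * R) \<Longrightarrow> cmod (h z - p z) < d"
    using Stone_Weierstrass_polynomial_function[of "cball 0 (2 * R)" h d] h(1) d continuous_on_subset by (metis compact_cball subset_UNIV)
  have "real_polynomial_function (Re \<circ> p)" "real_polynomial_function (Im \<circ> p)"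
    using p(1) bounded_linear_Re bounded_linear_Im unfolding polynomial_function_def by blast+
  from this[THEN Cinf_real_polynomial]
  have "(\<lambda>z. of_real (Re (p z)) + \<i> * of_real (Im (p z))) \<in> Cinf"
    by (intro Cinf_add Cinf_mult Cinf_const) simp_all
  then have pC: "p \<in> Cinf" by (simp add: complex_eq[symmetric])
  define \<psi> where "\<psi> z = p z * chi R z" for z
  have "\<psi> \<in> test_functions"
    unfolding \<psi>_def[abs_def] by (intro test_mult pC chi_properties \<open>0 < R\<close>)
  moreover have "wnorm2 0 (\<lambda>z. h z - \<psi> z) < ennreal e"
  proof -
    have "cmod (h z - \<psi> z) \<le> d * indicator (cball 0 (2 * R)) z" for z
    proof -
      consider "cmod z \<le> R" | "R \<le> cmod z" "cmod z \<le> 2 * R" | "2 * R < cmod z" by linarith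
      then show ?thesis
      proof cases
        case 1
        then show ?thesis using p(2)[of z] \<open>0 < R\<close> by (simp add: \<psi>_def chi_properties(2))
      next
        case 2
        then have "cmod (p z) < d" using p(2)[of z] h(2)[of z] by simp
        then have "cmod (p z) * cmod (chi R z) \<le> d * 1"
          using chi_properties(4)[OF \<open>0 < R\<close>, of z] d by (intro mult_mono) auto
        then show ?thesis using 2 h(2)[of z] by (simp add: \<psi>_def norm_mult)
      next
        case 3
        then show ?thesis using h(2)[of z] chi_properties(3)[OF \<open>0 < R\<close>, of z] \<open>0 < R\<close> by (simp add: \<psi>_def)
      qed
    qed
    then have "wnorm2 0 (\<lambda>z. h z - \<psi> z) \<le> ennreal (d\<^sup>2 * M)"
      unfolding M_def using d by (intro wnorm2_0_cball) auto
    also have "d\<^sup>2 * M = e * (M / (M + 1))" using M \<open>0 < e\<close> by (simp add: d_def)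
    also have "\<dots> < e * 1" using M \<open>0 < e\<close> by (intro mult_strict_left_mono) auto
    then have "ennreal (e * (M / (M + 1))) < ennreal e" using \<open>0 < e\<close> M by (intro ennreal_lessI) auto
    finally show ?thesis .
  qed
  ultimately show ?thesis by (rule that)
qed

lemma L2_dense:
  assumes u: "u \<in> borel_measurable borel" "wnorm2 0 u < \<infinity>" and "0 < e"
  obtains \<psi> where "\<psi> \<in> test_functions" "wnorm2 0 (\<lambda>z. u z - \<psi> z) \<le> ennreal e"
proof -
  \<comment> \<open>Squared norms of sums cost a factor 2 at each of two steps: 2 (e/16 + 2 (e/16 +
    e/16)) = 10 e / 16 <= e.\<close>
  have e: "0 < e / 16" using \<open>0 < e\<close> by simp
  obtain v N where v: "v \<in> borel_measurable borel" "0 < N" "\<And>z. cmod (v z) \<le> N" "\<And>z. N < cmod z \<Longrightarrow> v z = 0"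
    "wnorm2 0 (\<lambda>z. u z - v z) < ennreal (e / 16)"
    using L2_truncation[OF u e] by blast
  obtain h where h: "continuous_on UNIV h" "\<And>z. 2 * N \<le> cmod z \<Longrightarrow> h z = 0" "wnorm2 0 (\<lambda>z. v z - h z) < ennreal (e / 16)"
    using continuous_approximation[OF v(1-4) e] by blast
  obtain \<psi> where p: "\<psi> \<in> test_functions" "wnorm2 0 (\<lambda>z. h z - \<psi> z) < ennreal (e / 16)"
    using smooth_approximation[where R="2 * N", OF h(1) h(2) _ e] v(2) by auto
  note [measurable] = u(1) v(1) continuous_imp_borel[OF h(1)] test_borel[OF p(1)]
  have two: "wnorm2 0 (\<lambda>z. a z + b z) \<le> ennreal (2 * (s + t))"
    if "a \<in> borel_measurable borel" "b \<in> borel_measurable borel" "wnorm2 0 a \<le> ennreal s" "wnorm2 0 b \<le> ennreal t" "0 \<le> s" "0 \<le> t" for a b s t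
  proof -
    have "wnorm2 0 (\<lambda>z. a z + b z) \<le> ennreal (1 + 1) * wnorm2 0 a + ennreal (1 + 1 / 1) * wnorm2 0 b"
      by (rule wnorm2_add_le) (use that in auto)
    also have "\<dots> \<le> ennreal (1 + 1) * ennreal s + ennreal (1 + 1 / 1) * ennreal t"
      by (intro add_mono mult_left_mono that) auto
    also have "\<dots> = ennreal ((1 + 1) * s) + ennreal ((1 + 1) * t)"
      using that by (simp only: ennreal_mult[symmetric]) (simp add: ennreal_mult)
    also have "\<dots> = ennreal ((1 + 1) * s + (1 + 1) * t)"
      using that by (intro ennreal_plus[symmetric]) auto
    finally show ?thesis by simp
  qed
  have A: "wnorm2 0 (\<lambda>z. (v z - h z) + (h z - \<psi> z)) \<le> ennreal (2 * (e / 16 + e / 16))"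
    by (rule two) (use h p e in auto)
  have "wnorm2 0 (\<lambda>z. (u z - v z) + ((v z - h z) + (h z - \<psi> z))) \<le> ennreal (2 * (e / 16 + 2 * (e / 16 + e / 16)))"
  proof (rule two[OF _ _ _ A])
    show "wnorm2 0 (\<lambda>z. u z - v z) \<le> ennreal (e / 16)" using v(5) by (rule less_imp_le)
  qed (use e in auto)
  also have "\<dots> \<le> ennreal e" using e by (intro ennreal_leI) simp
  finally show ?thesis using that[OF p(1)] by simp
qed

text \<open>Powers of <z> are smooth and nowhere 0, so weighting maps test functions to test
  functions and the case without weight suffices.\<close>

lemma wL2_dense:
  assumes u: "u \<in> elems (wL2 \<theta>)" and "0 < e"
  obtains \<psi> where "\<psi> \<in> test_functions" "wnorm2 \<theta> (\<lambda>z. u z - \<psi> z) \<le> ennreal e"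
proof -
  obtain \<psi> where p: "\<psi> \<in> test_functions" "wnorm2 0 (\<lambda>z. weight (- \<theta>) u z - \<psi> z) \<le> ennreal e"
    using L2_dense[of "weight (- \<theta>) u" e] u \<open>0 < e\<close> by (auto simp: wL2_mem_iff measurable_weight wnorm2_weight)
  have "weight \<theta> \<psi> \<in> test_functions"
    unfolding weight_def using test_mult[OF Cinf_jbracket_powr p(1)] .
  moreover have "(\<lambda>z. u z - weight \<theta> \<psi> z) = weight \<theta> (\<lambda>z. weight (- \<theta>) u z - \<psi> z)"
    by (simp add: weight_def fun_eq_iff right_diff_distrib powr_minus)
  then have "wnorm2 \<theta> (\<lambda>z. u z - weight \<theta> \<psi> z) \<le> ennreal e"
    using p(2) by (simp add: wnorm2_weight)
  ultimately show ?thesis by (rule that)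
qed

section \<open>Duality and uniqueness\<close>

lemma pairing_bound:
  assumes [measurable]: "f \<in> borel_measurable borel" "g \<in> borel_measurable borel"
  shows "(\<integral>\<^sup>+z. ennreal (cmod (f z * g z)) \<partial>lborel)\<^sup>2 \<le> wnorm2 \<theta> f * wnorm2 (- \<theta>) g"
proof -
  let ?f = "\<lambda>z. ennreal (jbracket z powr (- \<theta>) * cmod (f z))" and ?g = "\<lambda>z. ennreal (jbracket z powr \<theta> * cmod (g z))"
  have "(\<integral>\<^sup>+z. ennreal (cmod (f z * g z)) \<partial>lborel) = (\<integral>\<^sup>+z. ?f z * ?g z \<partial>lborel)"
  proof (intro nn_integral_cong)
    fix z
    have "jbracket z powr (- \<theta>) * cmod (f z) * (jbracket z powr \<theta> * cmod (g z)) = (jbracket z powr (- \<theta>) * jbracket z powr \<theta>) * cmod (f z * g z)"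
      by (simp add: norm_mult mult_ac)
    also have "\<dots> = cmod (f z * g z)" by (simp flip: powr_add)
    finally show "ennreal (cmod (f z * g z)) = ?f z * ?g z" by (simp flip: ennreal_mult)
  qed
  also have "(\<dots>)\<^sup>2 \<le> (\<integral>\<^sup>+z. (?f z)\<^sup>2 \<partial>lborel) * (\<integral>\<^sup>+z. (?g z)\<^sup>2 \<partial>lborel)"
    by (rule Cauchy_Schwarz_nn_integral) measurable
  also have "\<dots> = wnorm2 \<theta> f * wnorm2 (- \<theta>) g"
  proof -
    have sq: "(jbracket z powr a)\<^sup>2 = jbracket z powr (2 * a)" for z a
      by (simp add: power2_eq_square flip: powr_add)
    show ?thesis unfolding wnorm2_def
      by (intro arg_cong2[where f="(*)"] nn_integral_cong) (simp_all add: ennreal_power power_mult_distrib sq)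
  qed
  finally show ?thesis .
qed

text \<open>W annihilates a dense subspace of the dual space <z>^-\<theta> L2, hence also the
  element of it that represents W, and that pairing is the squared norm of W.\<close>

lemma wL2_eq_0_of_test:
  assumes W: "W \<in> elems (wL2 \<theta>)" and 0: "\<And>\<psi>. \<psi> \<in> test_functions \<Longrightarrow> (LINT z|lborel. W z * \<psi> z) = 0"
  shows "AE z in lborel. W z = 0"
proof -
  have [measurable]: "W \<in> borel_measurable borel" and fin: "wnorm2 \<theta> W < \<infinity>" using W by (auto simp: wL2_mem_iff)
  \<comment> \<open>The Riesz representative of W: its pairing with W is the integrand of
    \<open>wnorm2 \<theta> W\<close>.\<close>
  define v where "v = weight (- 2 * \<theta>) (\<lambda>z. cnj (W z))"
  have vm [measurable]: "v \<in> borel_measurable borel" unfolding v_def by measurable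
  have "wnorm2 (- \<theta>) v = wnorm2 \<theta> (\<lambda>z. cnj (W z))" by (simp add: v_def wnorm2_weight)
  also have "\<dots> = wnorm2 \<theta> W" by (simp add: wnorm2_def)
  finally have v: "v \<in> elems (wL2 (- \<theta>))" using fin by (simp add: wL2_mem_iff)
  define w where "w = enn2real (wnorm2 \<theta> W)"
  have w: "wnorm2 \<theta> W = ennreal w" "0 \<le> w" using fin by (auto simp: w_def less_top[symmetric])
  have Wv: "W z * v z = of_real (jbracket z powr (- 2 * \<theta>) * (cmod (W z))\<^sup>2)" for z
    using complex_norm_square[of "W z"] by (simp add: v_def weight_def mult_ac)
  have iv: "integrable lborel (\<lambda>z. W z * v z)"
    unfolding Wv by (intro integrable_of_real integrableI_nonneg) (use fin in \<open>auto simp: wnorm2_def\<close>)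
  have small: "(cmod (LINT z|lborel. W z * v z))\<^sup>2 \<le> w * e" if "0 < e" for e
  proof -
    obtain \<psi> where p: "\<psi> \<in> test_functions" "wnorm2 (- \<theta>) (\<lambda>z. v z - \<psi> z) \<le> ennreal e"
      using wL2_dense[OF v \<open>0 < e\<close>] by blast
    have [measurable]: "\<psi> \<in> borel_measurable borel" by (rule test_borel[OF p(1)])
    obtain C where "C \<ge> 0" and C: "\<And>z. cmod (\<psi> z) \<le> C * jbracket z powr (- (\<theta> + 2))"
      "\<And>z. cmod (dx \<psi> z) \<le> C * jbracket z powr (- (\<theta> + 2))" "\<And>z. cmod (dy \<psi> z) \<le> C * jbracket z powr (- (\<theta> + 2))"
      using test_bound[OF p(1), of "\<theta> + 2"] by blast
    have ip: "integrable lborel (\<lambda>z. W z * \<psi> z)"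
      by (rule integrable_wL2_mult[OF W _ _, of _ C 2]) (use C in simp_all)
    have "(LINT z|lborel. W z * v z) = (LINT z|lborel. W z * v z - W z * \<psi> z)"
      using iv ip 0[OF p(1)] by simp
    also have "\<dots> = (LINT z|lborel. W z * (v z - \<psi> z))" by (simp add: right_diff_distrib)
    finally have "ennreal (cmod (LINT z|lborel. W z * v z)) \<le> (\<integral>\<^sup>+z. ennreal (cmod (W z * (v z - \<psi> z))) \<partial>lborel)"
      using integral_norm_bound_ennreal[of lborel "\<lambda>z. W z * (v z - \<psi> z)"] iv ip by (simp add: right_diff_distrib)
    then have "(ennreal (cmod (LINT z|lborel. W z * v z)))\<^sup>2 \<le> (\<integral>\<^sup>+z. ennreal (cmod (W z * (v z - \<psi> z))) \<partial>lborel)\<^sup>2"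
      by (rule power_mono) simp
    also have "\<dots> \<le> wnorm2 \<theta> W * wnorm2 (- \<theta>) (\<lambda>z. v z - \<psi> z)"
      by (rule pairing_bound) measurable
    also have "\<dots> \<le> ennreal w * ennreal e"
      unfolding w(1) by (intro mult_left_mono p) simp
    finally have "ennreal ((cmod (LINT z|lborel. W z * v z))\<^sup>2) \<le> ennreal (w * e)"
      using w(2) \<open>0 < e\<close> by (simp add: ennreal_power ennreal_mult)
    then show ?thesis using w(2) \<open>0 < e\<close> by (simp add: ennreal_le_iff)
  qed
  have "(cmod (LINT z|lborel. W z * v z))\<^sup>2 \<le> 0 + d" if "0 < d" for d
  proof -
    have "(cmod (LINT z|lborel. W z * v z))\<^sup>2 \<le> w * (d / (w + 1))" using small[of "d / (w + 1)"] w(2) that by simp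
    also have "\<dots> \<le> d" using w(2) that by (simp add: field_simps)
    finally show ?thesis by simp
  qed
  then have "(cmod (LINT z|lborel. W z * v z))\<^sup>2 \<le> 0" by (rule field_le_epsilon)
  then have "(LINT z|lborel. W z * v z) = 0" by simp
  then have "(LINT z|lborel. jbracket z powr (- 2 * \<theta>) * (cmod (W z))\<^sup>2) = 0"
    unfolding Wv integral_complex_of_real by simp
  moreover have "(LINT z|lborel. jbracket z powr (- 2 * \<theta>) * (cmod (W z))\<^sup>2) = w"
    unfolding w_def wnorm2_def by (rule integral_eq_nn_integral) auto
  ultimately have "wnorm2 \<theta> W = 0" using w by simp
  then show ?thesis by (simp add: wnorm2_zero_iff)
qed

text \<open>Testing with the cutoff of \<open>cauchy \<psi>\<close> gives pi times the pairing of W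
  with the cutoff of \<psi>, plus a term on the annulus where the cutoff varies. That term pairs the
  tail of W, of vanishing norm in <z> L2, with functions bounded in <z>^-1 L2. Hence W is orthogonal
  to every \<psi>.\<close>

lemma distributional_uniqueness:
  assumes W: "W \<in> elems (wL2 1)" and 0: "\<And>\<eta>. \<eta> \<in> test_functions \<Longrightarrow> (LINT z|lborel. W z * delbar \<eta> z) = 0"
  shows "AE z in lborel. W z = 0"
proof (rule wL2_eq_0_of_test[OF W])
  fix \<psi> assume p: "\<psi> \<in> test_functions"
  have [measurable]: "W \<in> borel_measurable borel" and fin: "wnorm2 1 W < \<infinity>" using W by (auto simp: wL2_mem_iff)
  have [measurable]: "\<psi> \<in> borel_measurable borel" by (rule test_borel[OF p])
  obtain C where "C \<ge> 0" and C: "\<And>z. cmod (\<psi> z) \<le> C * jbracket z powr (- 3)"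
    "\<And>z. cmod (dx \<psi> z) \<le> C * jbracket z powr (- 3)" "\<And>z. cmod (dy \<psi> z) \<le> C * jbracket z powr (- 3)"
    using test_bound[OF p, of 3] by blast
  obtain E where E: "0 \<le> E" "\<And>z. cmod (cauchy \<psi> z) \<le> E * jbracket z powr (- 1)"
    using cauchy_decay[OF test_borel[OF p] C(1)] by blast
  obtain D where D: "0 \<le> D" "\<And>R z. 0 < R \<Longrightarrow> cmod (delbar (chi R) z) \<le> D / R * indicator {z. R \<le> cmod z \<and> cmod z \<le> 2 * R} z"
    using delbar_chi_bound by blast
  let ?c = "\<lambda>n. chi (real (Suc n))"
  have c: "?c n \<in> test_functions" for n by (intro chi_properties) simp
  have [measurable]: "?c n \<in> borel_measurable borel" for n by (rule test_borel[OF c])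
  have [measurable]: "delbar (?c n) \<in> borel_measurable borel" for n by (rule test_borel[OF test_dx(3)[OF c]])
  have [measurable]: "cauchy \<psi> \<in> borel_measurable borel" by measurable
  let ?g = "\<lambda>n z. delbar (?c n) z * cauchy \<psi> z"
  \<comment> \<open>On the annulus the weight <z> cancels the decay E <z>^-1 of the transform,
    leaving (D E / R)^2 times the area 4 pi R^2 of the disc of radius 2 R.\<close>
  have g2: "wnorm2 (- 1) (?g n) \<le> ennreal (4 * pi * (D * E)\<^sup>2)" for n
  proof -
    let ?R = "real (Suc n)"
    have "wnorm2 (- 1) (?g n) = wnorm2 0 (weight 1 (?g n))" by (simp add: wnorm2_weight)
    also have "\<dots> \<le> ennreal ((D * E / ?R)\<^sup>2 * measure lborel (cball (0::complex) (2 * ?R)))"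
    proof (rule wnorm2_0_cball)
      fix z
      have "cmod (weight 1 (?g n) z) = jbracket z * (cmod (delbar (?c n) z) * cmod (cauchy \<psi> z))"
        by (simp add: weight_def norm_mult)
      also have "\<dots> \<le> jbracket z * ((D / ?R * indicator {z. ?R \<le> cmod z \<and> cmod z \<le> 2 * ?R} z) * (E * jbracket z powr (- 1)))"
        using D(1) by (intro mult_left_mono mult_mono D(2) E) auto
      also have "\<dots> = D * E / ?R * indicator {z. ?R \<le> cmod z \<and> cmod z \<le> 2 * ?R} z"
        by (simp add: powr_minus)
      also have "\<dots> \<le> D * E / ?R * indicator (cball 0 (2 * ?R)) z"
        using D(1) E(1) by (intro mult_left_mono) (auto simp: indicator_def)
      finally show "cmod (weight 1 (?g n) z) \<le> \<dots>" .
    qed (use D(1) E(1) in simp)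
    also have "measure lborel (cball (0::complex) (2 * ?R)) = pi * (2 * ?R)\<^sup>2"
      by (subst content_cball) (simp_all add: unit_ball_vol_2)
    also have "(D * E / ?R)\<^sup>2 * (pi * (2 * ?R)\<^sup>2) = 4 * pi * (D * E)\<^sup>2"
      by (simp add: power_divide power_mult_distrib del: of_nat_Suc)
    finally show ?thesis .
  qed
  \<comment> \<open>The derivative of the cutoff vanishes inside the disc of radius n + 1, so W may
    be replaced by its outer part.\<close>
  let ?W = "\<lambda>n z. if real (Suc n) \<le> cmod z then W z else 0"
  have "(\<lambda>n. wnorm2 1 (\<lambda>z. 0 - ?W n z)) \<longlonglongrightarrow> 0"
  proof (rule wnorm2_dominated[where B=W])
    show "AE z in lborel. (\<lambda>n. ?W n z) \<longlonglongrightarrow> 0"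
    proof (rule AE_I2)
      fix z
      have "\<forall>\<^sub>F n in sequentially. \<not> real (Suc n) \<le> cmod z"
        using eventually_ge_at_top[of "nat \<lceil>cmod z\<rceil>"] by eventually_elim linarith
      then have "\<forall>\<^sub>F n in sequentially. ?W n z = 0" by eventually_elim simp
      then show "(\<lambda>n. ?W n z) \<longlonglongrightarrow> 0" by (rule tendsto_eventually)
    qed
  qed (use fin in auto)
  then have W0: "(\<lambda>n. wnorm2 1 (?W n)) \<longlonglongrightarrow> 0"
    by (simp add: wnorm2_def if_distrib[of uminus] cong: if_cong)
      (simp add: if_distrib[of cmod] cong: if_cong)
  have ig: "integrable lborel (\<lambda>z. W z * ?g n z)" for n
  proof -
    have t: "?g n \<in> test_functions"
      using test_mult[OF Cinf_cauchy_test[OF p] test_dx(3)[OF c]] by (simp add: mult.commute)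
    obtain C' where "C' \<ge> 0" and C': "\<And>z. cmod (?g n z) \<le> C' * jbracket z powr (- 3)"
      "\<And>z. cmod (dx (?g n) z) \<le> C' * jbracket z powr (- 3)" "\<And>z. cmod (dy (?g n) z) \<le> C' * jbracket z powr (- 3)"
      using test_bound[OF t, of 3] by blast
    show ?thesis by (rule integrable_wL2_mult[OF W test_borel[OF t], of C' 2]) (use C' in simp_all)
  qed
  have ip: "integrable lborel (\<lambda>z. W z * \<psi> z)"
    by (rule integrable_wL2_mult[OF W _ _, of _ C 2]) (use C in simp_all)
  have icp: "integrable lborel (\<lambda>z. W z * (?c n z * \<psi> z))" for n
  proof (rule Bochner_Integration.integrable_bound[OF ip])
    show "AE z in lborel. cmod (W z * (?c n z * \<psi> z)) \<le> cmod (W z * \<psi> z)"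
    proof (rule AE_I2)
      fix z
      have "cmod (?c n z) * cmod (\<psi> z) \<le> 1 * cmod (\<psi> z)" by (intro mult_right_mono chi_properties) auto
      then show "cmod (W z * (?c n z * \<psi> z)) \<le> cmod (W z * \<psi> z)" by (simp add: norm_mult mult_left_mono)
    qed
  qed measurable
  have eq: "of_real pi * (LINT z|lborel. W z * (?c n z * \<psi> z)) = - (LINT z|lborel. W z * ?g n z)" for n
  proof -
    let ?\<eta> = "\<lambda>z. ?c n z * cauchy \<psi> z"
    have t: "?\<eta> \<in> test_functions"
      using test_mult[OF Cinf_cauchy_test[OF p] c] by (simp add: mult.commute)
    have "delbar ?\<eta> = (\<lambda>z. ?g n z + ?c n z * (of_real pi * \<psi> z))"
      unfolding dx_fun_mult(4)[OF Cinf_differentiable[OF test_Cinf[OF c]] cauchy_test(1)[OF p]] cauchy_test(4)[OF p] ..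
    then have "0 = (LINT z|lborel. W z * ?g n z + of_real pi * (W z * (?c n z * \<psi> z)))"
      using 0[OF t] by (simp add: algebra_simps)
    also have "\<dots> = (LINT z|lborel. W z * ?g n z) + of_real pi * (LINT z|lborel. W z * (?c n z * \<psi> z))"
      using ig icp by simp
    finally show ?thesis by (simp add: eq_neg_iff_add_eq_0 add.commute)
  qed
  have bnd: "(ennreal (cmod (LINT z|lborel. W z * ?g n z)))\<^sup>2 \<le> wnorm2 1 (?W n) * ennreal (4 * pi * (D * E)\<^sup>2)" for n
  proof -
    have e: "W z * ?g n z = ?W n z * ?g n z" for z
    proof (cases "real (Suc n) \<le> cmod z")
      case False
      then have "cmod (delbar (?c n) z) \<le> 0" using D(2)[of "real (Suc n)" z] by simp
      then show ?thesis using False by simp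
    qed simp
    have "ennreal (cmod (LINT z|lborel. W z * ?g n z)) \<le> (\<integral>\<^sup>+z. ennreal (cmod (?W n z * ?g n z)) \<partial>lborel)"
      using integral_norm_bound_ennreal[OF ig[of n]] unfolding e .
    then have "(ennreal (cmod (LINT z|lborel. W z * ?g n z)))\<^sup>2 \<le> (\<integral>\<^sup>+z. ennreal (cmod (?W n z * ?g n z)) \<partial>lborel)\<^sup>2"
      by (rule power_mono) simp
    also have "\<dots> \<le> wnorm2 1 (?W n) * wnorm2 (- 1) (?g n)"
      by (rule pairing_bound) measurable
    also have "\<dots> \<le> wnorm2 1 (?W n) * ennreal (4 * pi * (D * E)\<^sup>2)"
      by (intro mult_left_mono g2) simp
    finally show ?thesis .
  qed
  have "(\<lambda>n. wnorm2 1 (?W n) * ennreal (4 * pi * (D * E)\<^sup>2)) \<longlonglongrightarrow> 0 * ennreal (4 * pi * (D * E)\<^sup>2)"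
    by (rule tendsto_mult_ennreal[OF W0 tendsto_const]) auto
  then have L: "(\<lambda>n. wnorm2 1 (?W n) * ennreal (4 * pi * (D * E)\<^sup>2)) \<longlonglongrightarrow> 0"
    by simp
  have "(\<lambda>n. (ennreal (cmod (LINT z|lborel. W z * ?g n z)))\<^sup>2) \<longlonglongrightarrow> 0"
    by (rule tendsto_sandwich[OF _ _ tendsto_const L]) (intro always_eventually allI zero_le bnd)+
  then have "(\<lambda>n. ennreal ((cmod (LINT z|lborel. W z * ?g n z))\<^sup>2)) \<longlonglongrightarrow> ennreal 0"
    by (simp add: ennreal_power)
  then have "(\<lambda>n. (cmod (LINT z|lborel. W z * ?g n z))\<^sup>2) \<longlonglongrightarrow> 0"
    by (subst (asm) tendsto_ennreal_iff) auto
  then have "(\<lambda>n. sqrt ((cmod (LINT z|lborel. W z * ?g n z))\<^sup>2)) \<longlonglongrightarrow> sqrt 0"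
    by (rule tendsto_real_sqrt)
  then have "(\<lambda>n. LINT z|lborel. W z * ?g n z) \<longlonglongrightarrow> 0"
    by (simp add: tendsto_norm_zero_iff)
  then have "(\<lambda>n. of_real pi * (LINT z|lborel. W z * (?c n z * \<psi> z))) \<longlonglongrightarrow> - 0"
    unfolding eq by (rule tendsto_minus)
  moreover have "(\<lambda>n. of_real pi * (LINT z|lborel. W z * (?c n z * \<psi> z))) \<longlonglongrightarrow> of_real pi * (LINT z|lborel. W z * \<psi> z)"
  proof (intro tendsto_mult tendsto_const integral_dominated_convergence[where w="\<lambda>z. cmod (W z * \<psi> z)"])
    show "AE z in lborel. (\<lambda>n. W z * (?c n z * \<psi> z)) \<longlonglongrightarrow> W z * \<psi> z"
    proof (rule AE_I2)
      fix z
      have "\<forall>\<^sub>F n in sequentially. cmod z \<le> real (Suc n)"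
        using eventually_ge_at_top[of "nat \<lceil>cmod z\<rceil>"] by eventually_elim linarith
      then have "\<forall>\<^sub>F n in sequentially. W z * (?c n z * \<psi> z) = W z * \<psi> z"
        by eventually_elim (simp add: chi_properties(2) del: of_nat_Suc)
      then show "(\<lambda>n. W z * (?c n z * \<psi> z)) \<longlonglongrightarrow> W z * \<psi> z" by (rule tendsto_eventually)
    qed
    show "AE z in lborel. cmod (W z * (?c n z * \<psi> z)) \<le> cmod (W z * \<psi> z)" for n
    proof (rule AE_I2)
      fix z
      have "cmod (?c n z) * cmod (\<psi> z) \<le> 1 * cmod (\<psi> z)" by (intro mult_right_mono chi_properties) auto
      then show "cmod (W z * (?c n z * \<psi> z)) \<le> cmod (W z * \<psi> z)" by (simp add: norm_mult mult_left_mono)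
    qed
    show "integrable lborel (\<lambda>z. cmod (W z * \<psi> z))" by (rule integrable_norm[OF ip])
    show "(\<lambda>z. W z * (?c n z * \<psi> z)) \<in> borel_measurable lborel" for n by measurable
  qed measurable
  ultimately have "of_real pi * (LINT z|lborel. W z * \<psi> z) = - 0"
    by (rule LIMSEQ_unique[rotated])
  then show "(LINT z|lborel. W z * \<psi> z) = 0" by simp
qed

section \<open>The oscillatory estimate\<close>

text \<open>pi times the inverse of del. Defining it by conjugation lets every estimate for
  \<open>cauchy\<close> carry over unchanged.\<close>

definition cauchy_bar :: "(complex \<Rightarrow> complex) \<Rightarrow> complex \<Rightarrow> complex" where
  "cauchy_bar v z = cnj (cauchy (\<lambda>w. cnj (v w)) z)"

lemma cauchy_bar_integral: "cauchy_bar v z = (LINT w|lborel. v w / (cnj z - cnj w))"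
proof -
  have "(LINT w|lborel. cnj (cnj (v w) / (z - w))) = cnj (LINT w|lborel. cnj (v w) / (z - w))"
    by (rule Bochner_Integration.integral_cnj)
  then show ?thesis by (simp add: cauchy_bar_def cauchy_def)
qed

lemma measurable_cauchy_bar [measurable]:
  "v \<in> borel_measurable borel \<Longrightarrow> cauchy_bar v \<in> borel_measurable borel"
  unfolding cauchy_bar_def[abs_def] by measurable

lemma wnorm2_cnj [simp]: "wnorm2 \<theta> (\<lambda>z. cnj (v z)) = wnorm2 \<theta> v"
  by (simp add: wnorm2_def)

lemma wnorm2_mono_weight:
  assumes "\<theta> \<le> \<theta>'"
  shows "wnorm2 \<theta>' v \<le> wnorm2 \<theta> v"
  unfolding wnorm2_def using assms
  by (intro nn_integral_mono ennreal_leI mult_right_mono jbracket_powr_mono) auto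

lemma cauchy_cong_AE:
  assumes "f \<in> borel_measurable borel" "g \<in> borel_measurable borel" "AE w in lborel. f w = g w"
  shows "cauchy f z = cauchy g z"
  unfolding cauchy_def
proof (rule integral_cong_AE)
  show "AE w in lborel. f w / (z - w) = g w / (z - w)"
    using assms(3) by eventually_elim simp
qed (use assms in auto)

lemma cauchy_cmult: "cauchy (\<lambda>w. c * v w) z = c * cauchy v z"
  unfolding cauchy_def using integral_mult_right_zero[of lborel c "\<lambda>w. v w / (z - w)"] by simp

lemma cauchy_bar_cmult: "cauchy_bar (\<lambda>w. c * v w) z = c * cauchy_bar v z"
  unfolding cauchy_bar_def using cauchy_cmult[of "cnj c" "\<lambda>w. cnj (v w)"] by simp

lemma cauchy_add_AE:
  assumes "0 < \<epsilon>" "\<epsilon> \<le> 1" and f: "f \<in> borel_measurable borel" "wnorm2 (\<epsilon> - 2) f < \<infinity>"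
    and g: "g \<in> borel_measurable borel" "wnorm2 (\<epsilon> - 2) g < \<infinity>"
  shows "AE z in lborel. cauchy (\<lambda>w. f w + g w) z = cauchy f z + cauchy g z"
  using AE_integrable_cauchy_kernel[OF assms(1,2) f] AE_integrable_cauchy_kernel[OF assms(1,2) g]
  by eventually_elim (simp add: cauchy_def add_divide_distrib)

lemma cauchy_bar_add_AE:
  assumes "0 < \<epsilon>" "\<epsilon> \<le> 1" and f: "f \<in> borel_measurable borel" "wnorm2 (\<epsilon> - 2) f < \<infinity>"
    and g: "g \<in> borel_measurable borel" "wnorm2 (\<epsilon> - 2) g < \<infinity>"
  shows "AE z in lborel. cauchy_bar (\<lambda>w. f w + g w) z = cauchy_bar f z + cauchy_bar g z"
proof -
  have m: "(\<lambda>w. cnj (f w)) \<in> borel_measurable borel" "(\<lambda>w. cnj (g w)) \<in> borel_measurable borel"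
    using f g by measurable
  have "AE z in lborel. cauchy (\<lambda>w. cnj (f w) + cnj (g w)) z = cauchy (\<lambda>w. cnj (f w)) z + cauchy (\<lambda>w. cnj (g w)) z"
    using cauchy_add_AE[OF assms(1,2) m(1) _ m(2)] f g by simp
  then show ?thesis
    unfolding cauchy_bar_def by eventually_elim simp
qed

section \<open>Derivatives of the weights and of \<open>cauchy_bar\<close>\<close>

lemma jbracket_powr_has_derivative:
  "((\<lambda>z. complex_of_real (jbracket z powr a)) has_derivative (\<lambda>h. of_real (a * jbracket z powr (a - 2) * (z \<bullet> h)))) (at z)"
proof -
  have p: "0 < 1 + z \<bullet> z" by (simp add: add_pos_nonneg)
  have D: "((\<lambda>w. 1 + w \<bullet> w) has_derivative (\<lambda>h. 2 * (z \<bullet> h))) (at z)"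
    by (rule has_derivative_eq_rhs[OF has_derivative_add[OF has_derivative_const
          has_derivative_inner[OF has_derivative_ident has_derivative_ident]]])
      (simp add: inner_commute fun_eq_iff)
  have "((\<lambda>x. x powr (a / 2)) has_real_derivative (a / 2) * (1 + z \<bullet> z) powr (a / 2 - 1)) (at (1 + z \<bullet> z))"
    by (rule has_real_derivative_powr[OF p])
  from has_derivative_compose[OF D has_field_derivative_imp_has_derivative[OF this]]
  have "((\<lambda>w. (1 + w \<bullet> w) powr (a / 2)) has_derivative (\<lambda>h. (a / 2) * (1 + z \<bullet> z) powr (a / 2 - 1) * (2 * (z \<bullet> h)))) (at z)" .
  from has_derivative_of_real[OF this, where 'a=complex]
  have "((\<lambda>w. complex_of_real ((1 + w \<bullet> w) powr (a / 2))) has_derivative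
      (\<lambda>h. of_real ((a / 2) * (1 + z \<bullet> z) powr (a / 2 - 1) * (2 * (z \<bullet> h))))) (at z)" .
  moreover have "jbracket w powr b = (1 + w \<bullet> w) powr (b / 2)" for w b
    by (simp add: jbracket_powr power2_norm_eq_inner)
  ultimately show ?thesis by (simp add: diff_divide_distrib mult.assoc)
qed

lemma jbracket_powr_derivative_bound:
  "cmod (dx (\<lambda>z. of_real (jbracket z powr a)) z) \<le> \<bar>a\<bar> * jbracket z powr (a - 1)"
  "cmod (dy (\<lambda>z. of_real (jbracket z powr a)) z) \<le> \<bar>a\<bar> * jbracket z powr (a - 1)"
proof -
  have b: "\<bar>a * jbracket z powr (a - 2) * x\<bar> \<le> \<bar>a\<bar> * jbracket z powr (a - 1)" if "\<bar>x\<bar> \<le> cmod z" for x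
  proof -
    have "\<bar>a * jbracket z powr (a - 2) * x\<bar> = \<bar>a\<bar> * (jbracket z powr (a - 2) * \<bar>x\<bar>)"
      by (simp add: abs_mult)
    also have "\<dots> \<le> \<bar>a\<bar> * (jbracket z powr (a - 2) * jbracket z powr 1)"
      using that norm_le_jbracket[of z] by (intro mult_left_mono) auto
    also have "jbracket z powr (a - 2) * jbracket z powr 1 = jbracket z powr (a - 1)"
      by (simp only: jbracket_powr_add) simp
    finally show ?thesis .
  qed
  note e = has_derivative_imp_dx_dy[OF jbracket_powr_has_derivative[of a z]]
  show "cmod (dx (\<lambda>z. of_real (jbracket z powr a)) z) \<le> \<bar>a\<bar> * jbracket z powr (a - 1)"
    unfolding e norm_of_real using b[OF abs_Re_le_cmod] by (simp add: inner_complex_def)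
  show "cmod (dy (\<lambda>z. of_real (jbracket z powr a)) z) \<le> \<bar>a\<bar> * jbracket z powr (a - 1)"
    unfolding e norm_of_real using b[OF abs_Im_le_cmod] by (simp add: inner_complex_def)
qed

lemma cauchy_bar_test:
  assumes v: "v \<in> test_functions"
  shows "cauchy_bar v \<in> Cinf" "del (cauchy_bar v) z = of_real pi * v z"
    "\<exists>D\<ge>0. \<forall>z. cmod (cauchy_bar v z) \<le> D * jbracket z powr (- 1) \<and>
      cmod (dx (cauchy_bar v) z) \<le> D * jbracket z powr (- 1) \<and> cmod (dy (cauchy_bar v) z) \<le> D * jbracket z powr (- 1)"
proof -
  let ?v = "\<lambda>z. cnj (v z)"
  have t: "?v \<in> test_functions" by (rule test_cnj[OF v])
  have C: "cauchy ?v \<in> Cinf" by (rule Cinf_cauchy_test[OF t])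
  note d = Cinf_differentiable[OF C]
  have e: "cauchy_bar v = (\<lambda>z. cnj (cauchy ?v z))" by (simp add: cauchy_bar_def fun_eq_iff)
  show "cauchy_bar v \<in> Cinf" unfolding e by (rule Cinf_cnj[OF C])
  show "del (cauchy_bar v) z = of_real pi * v z"
    unfolding e dx_fun_cnj(3)[OF d] cauchy_test(4)[OF t] by simp
  have dec: "\<exists>D\<ge>0. \<forall>z. cmod (cauchy f z) \<le> D * jbracket z powr (- 1)" if f: "f \<in> test_functions" for f
  proof -
    obtain C where "C \<ge> 0" and C: "\<And>z. cmod (f z) \<le> C * jbracket z powr (- 3)"
      "\<And>z. cmod (dx f z) \<le> C * jbracket z powr (- 3)" "\<And>z. cmod (dy f z) \<le> C * jbracket z powr (- 3)"
      using test_bound[OF f, of 3] by blast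
    show ?thesis using cauchy_decay[OF test_borel[OF f] C(1)] by blast
  qed
  obtain D1 D2 D3 where D: "D1 \<ge> 0" "D2 \<ge> 0" "D3 \<ge> 0" "\<And>z. cmod (cauchy ?v z) \<le> D1 * jbracket z powr (- 1)"
    "\<And>z. cmod (cauchy (dx ?v) z) \<le> D2 * jbracket z powr (- 1)" "\<And>z. cmod (cauchy (dy ?v) z) \<le> D3 * jbracket z powr (- 1)"
    using dec[OF t] dec[OF test_dx(1)[OF t]] dec[OF test_dx(2)[OF t]] by blast
  have "cmod (cauchy_bar v z) \<le> (D1 + D2 + D3) * jbracket z powr (- 1) \<and>
      cmod (dx (cauchy_bar v) z) \<le> (D1 + D2 + D3) * jbracket z powr (- 1) \<and>
      cmod (dy (cauchy_bar v) z) \<le> (D1 + D2 + D3) * jbracket z powr (- 1)" for z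
    unfolding e dx_fun_cnj(1,2)[OF d] cauchy_test(2,3)[OF t] complex_mod_cnj
    using D(1-3) by (intro conjI order_trans[OF D(4)] order_trans[OF D(5)] order_trans[OF D(6)] mult_right_mono) auto
  then show "\<exists>D\<ge>0. \<forall>z. cmod (cauchy_bar v z) \<le> D * jbracket z powr (- 1) \<and>
      cmod (dx (cauchy_bar v) z) \<le> D * jbracket z powr (- 1) \<and> cmod (dy (cauchy_bar v) z) \<le> D * jbracket z powr (- 1)"
    using D(1-3) by (intro exI[of _ "D1 + D2 + D3"]) auto
qed

lemma wnorm2_cauchy_bar:
  assumes C: "\<And>v. v \<in> borel_measurable borel \<Longrightarrow> wnorm2 \<epsilon> (cauchy v) \<le> ennreal C * wnorm2 (\<epsilon> - 2) v"
    and [measurable]: "v \<in> borel_measurable borel"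
  shows "wnorm2 \<epsilon> (cauchy_bar v) \<le> ennreal C * wnorm2 (\<epsilon> - 2) v"
proof -
  have "wnorm2 \<epsilon> (cauchy_bar v) = wnorm2 \<epsilon> (cauchy (\<lambda>w. cnj (v w)))"
    unfolding cauchy_bar_def[abs_def] by simp
  also have "\<dots> \<le> ennreal C * wnorm2 (\<epsilon> - 2) (\<lambda>w. cnj (v w))" by (rule C) measurable
  finally show ?thesis by simp
qed

lemma wnorm2_le_cmult:
  assumes "\<And>z. cmod (f z) \<le> c * (jbracket z powr a * cmod (g z))" and [measurable]: "g \<in> borel_measurable borel"
  shows "wnorm2 \<theta> f \<le> ennreal (c\<^sup>2) * wnorm2 (\<theta> - a) g"
proof -
  have "wnorm2 \<theta> f \<le> wnorm2 \<theta> (\<lambda>z. of_real c * weight a g z)"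
  proof (intro wnorm2_mono AE_I2)
    fix z
    have "cmod (f z) \<le> c * (jbracket z powr a * cmod (g z))" by (rule assms(1))
    also have "\<dots> \<le> \<bar>c\<bar> * (jbracket z powr a * cmod (g z))" by (intro mult_right_mono) auto
    also have "\<dots> = cmod (of_real c * weight a g z)" by (simp add: norm_mult weight_def)
    finally show "cmod (f z) \<le> cmod (of_real c * weight a g z)" .
  qed
  also have "\<dots> = ennreal (c\<^sup>2) * wnorm2 (\<theta> - a) g"
    by (subst wnorm2_cmult) (simp_all add: wnorm2_weight)
  finally show ?thesis .
qed

lemma wnorm2_add2:
  assumes "f \<in> borel_measurable borel" "g \<in> borel_measurable borel"
    "wnorm2 \<theta> f \<le> ennreal a * N" "wnorm2 \<theta> g \<le> ennreal b * N" "0 \<le> a" "0 \<le> b"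
  shows "wnorm2 \<theta> (\<lambda>z. f z + g z) \<le> ennreal (2 * (a + b)) * N"
proof -
  have "wnorm2 \<theta> (\<lambda>z. f z + g z) \<le> ennreal (1 + 1) * wnorm2 \<theta> f + ennreal (1 + 1 / 1) * wnorm2 \<theta> g"
    by (rule wnorm2_add_le) (use assms in auto)
  also have "\<dots> \<le> ennreal 2 * (ennreal a * N) + ennreal 2 * (ennreal b * N)"
    using assms by (intro add_mono mult_mono) auto
  also have "\<dots> = ennreal (2 * a) * N + ennreal (2 * b) * N"
    using assms by (simp add: ennreal_mult mult.assoc)
  also have "\<dots> = (ennreal (2 * a) + ennreal (2 * b)) * N" by (simp add: distrib_right)
  also have "ennreal (2 * a) + ennreal (2 * b) = ennreal (2 * (a + b))"
    using assms by (simp add: distrib_left del: ennreal_plus flip: ennreal_plus)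
  finally show ?thesis .
qed

text \<open>The Beurling transform \<open>\<partial>\<bar>\<partial>\<^sup>-\<^sup>1\<close> enters through the energy identity for \<open>H = \<langle>z\<rangle>\<^sup>-\<^sup>\<epsilon> g\<close>.\<close>

lemma wnorm2_delbar_cauchy_bar:
  assumes "0 < \<epsilon>" "\<epsilon> \<le> 1"
    and C: "C > 0" "\<And>v. v \<in> borel_measurable borel \<Longrightarrow> wnorm2 \<epsilon> (cauchy v) \<le> ennreal C * wnorm2 (\<epsilon> - 2) v"
    and v: "v \<in> test_functions"
  shows "wnorm2 (\<epsilon> - 2) (delbar (\<lambda>z. of_real (jbracket z powr (- 2)) * cauchy_bar v z)) \<le>
     ennreal (4 * (pi\<^sup>2 + C) + 8 * C) * wnorm2 (\<epsilon> - 2) v"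
proof -
  define g where "g = cauchy_bar v"
  define N where "N = wnorm2 (\<epsilon> - 2) v"
  obtain D where D: "0 \<le> D" and gb: "\<And>z. cmod (g z) \<le> D * jbracket z powr (- 1)"
    "\<And>z. cmod (dx g z) \<le> D * jbracket z powr (- 1)" "\<And>z. cmod (dy g z) \<le> D * jbracket z powr (- 1)"
    using cauchy_bar_test(3)[OF v] unfolding g_def by blast
  have gC: "g \<in> Cinf" unfolding g_def by (rule cauchy_bar_test(1)[OF v])
  have dg: "del g z = of_real pi * v z" for z unfolding g_def by (rule cauchy_bar_test(2)[OF v])
  have [measurable]: "v \<in> borel_measurable borel" by (rule test_borel[OF v])
  have gm [measurable]: "g \<in> borel_measurable borel" by (rule Cinf_borel[OF gC])
  have gN: "wnorm2 \<epsilon> g \<le> ennreal C * N"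
    unfolding g_def N_def by (rule wnorm2_cauchy_bar[OF C(2)]) auto
  \<comment> \<open>A derivative of a weight lowers its exponent by one, so both commutator terms
    below meet g in the weaker norm of exponent \<epsilon> + 1.\<close>
  then have gN1: "wnorm2 (\<epsilon> + 1) g \<le> ennreal C * N"
    using wnorm2_mono_weight[of \<epsilon> "\<epsilon> + 1" g] by simp
  define J where "J a z = complex_of_real (jbracket z powr a)" for a z
  have JC: "J a \<in> Cinf" for a unfolding J_def[abs_def] by (rule Cinf_jbracket_powr)
  have Jb: "cmod (J a z) \<le> 1 * jbracket z powr a" "cmod (dx (J a) z) \<le> \<bar>a\<bar> * jbracket z powr (a - 1)"
      "cmod (dy (J a) z) \<le> \<bar>a\<bar> * jbracket z powr (a - 1)" for a z
    using jbracket_powr_derivative_bound[of a z] by (simp_all add: J_def[abs_def])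
  note Jd = Cinf_differentiable[OF JC] and gd = Cinf_differentiable[OF gC]
  \<comment> \<open>The factor <z>^-\<epsilon> serves twice. Multiplication by
    \<open>J (\<epsilon> - 2)\<close> carries L2 exactly onto the exponent \<epsilon> - 2; and H
    with its first derivatives decays like <z>^-(1 + \<epsilon>), past the borderline <z>^-1 of g at
    which squares cease to be integrable.\<close>
  define H where "H z = J (- \<epsilon>) z * g z" for z
  have HC: "H \<in> Cinf" unfolding H_def[abs_def] by (intro Cinf_mult JC gC)
  have H1: "Ck 1 H" by (rule CinfD[OF HC])
  have Hdx: "dx H = (\<lambda>z. dx (J (- \<epsilon>)) z * g z + J (- \<epsilon>) z * dx g z)" "dy H = (\<lambda>z. dy (J (- \<epsilon>)) z * g z + J (- \<epsilon>) z * dy g z)"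
    "del H = (\<lambda>z. del (J (- \<epsilon>)) z * g z + J (- \<epsilon>) z * del g z)"
    unfolding H_def[abs_def] by (rule dx_fun_mult[OF Jd gd])+
  have Hb: "cmod (H z) \<le> (2 * D) * jbracket z powr (- (1 + \<epsilon>))" "cmod (dx H z) \<le> (2 * D) * jbracket z powr (- (1 + \<epsilon>))"
    "cmod (dy H z) \<le> (2 * D) * jbracket z powr (- (1 + \<epsilon>))" for z
  proof -
    have 1: "cmod (J (- \<epsilon>) z * x) \<le> D * jbracket z powr (- (1 + \<epsilon>))" if "cmod x \<le> D * jbracket z powr (- 1)" for x
      using norm_mult_jbracket[OF Jb(1) that, of "- \<epsilon>" "- (1 + \<epsilon>)"] by simp
    have 2: "cmod (y * g z) \<le> D * jbracket z powr (- (1 + \<epsilon>))" if "cmod y \<le> \<bar>- \<epsilon>\<bar> * jbracket z powr (- \<epsilon> - 1)" for y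
    proof -
      have "cmod (y * g z) \<le> \<bar>- \<epsilon>\<bar> * D * jbracket z powr (- (1 + \<epsilon>))"
        by (rule norm_mult_jbracket[OF that gb(1)]) simp
      also have "\<dots> \<le> 1 * D * jbracket z powr (- (1 + \<epsilon>))"
        using assms D by (intro mult_right_mono) auto
      finally show ?thesis by simp
    qed
    show "cmod (H z) \<le> (2 * D) * jbracket z powr (- (1 + \<epsilon>))"
    proof -
      have "D * jbracket z powr (- (1 + \<epsilon>)) \<le> (2 * D) * jbracket z powr (- (1 + \<epsilon>))"
        using D by (intro mult_right_mono) auto
      then show ?thesis unfolding H_def using 1[OF gb(1)] by linarith
    qed
    show "cmod (dx H z) \<le> (2 * D) * jbracket z powr (- (1 + \<epsilon>))" "cmod (dy H z) \<le> (2 * D) * jbracket z powr (- (1 + \<epsilon>))"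
      unfolding Hdx using norm_triangle_mono[OF 2[OF Jb(2)] 1[OF gb(2)]] norm_triangle_mono[OF 2[OF Jb(3)] 1[OF gb(3)]] by simp_all
  qed
  have [measurable]: "del H \<in> borel_measurable borel" "delbar H \<in> borel_measurable borel" "del (J a) \<in> borel_measurable borel"
    "delbar (J a) \<in> borel_measurable borel" "H \<in> borel_measurable borel" "J a \<in> borel_measurable borel" for a
    by (intro Cinf_borel Cinf_del Cinf_delbar HC JC)+
  \<comment> \<open>This trades delbar H, over which there is no direct control, for del H, which is
    explicit because \<open>del g\<close> is pi v.\<close>
  have energy: "wnorm2 0 (delbar H) = wnorm2 0 (del H)"
  proof -
    have "1 < 1 + \<epsilon>" using assms by simp
    note E = integral_del_delbar[OF H1 Hb this]
    have "wnorm2 0 f = ennreal (LINT z|lborel. (cmod (f z))\<^sup>2)" if "integrable lborel (\<lambda>z. (cmod (f z))\<^sup>2)" for f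
      using nn_integral_eq_integral[OF that] by (simp add: wnorm2_def)
    then show ?thesis using E by simp
  qed
  have delH: "wnorm2 0 (del H) \<le> ennreal (2 * (C + pi\<^sup>2)) * N"
    unfolding Hdx(3)
  proof (rule wnorm2_add2)
    have "wnorm2 0 (\<lambda>z. del (J (- \<epsilon>)) z * g z) \<le> ennreal (1\<^sup>2) * wnorm2 (0 - (- \<epsilon> - 1)) g"
    proof (rule wnorm2_le_cmult)
      fix z
      have "cmod (del (J (- \<epsilon>)) z) \<le> \<bar>- \<epsilon>\<bar> * jbracket z powr (- \<epsilon> - 1)"
        by (rule cmod_delbar_le(2)[OF Jb(2,3)])
      also have "\<dots> \<le> 1 * jbracket z powr (- \<epsilon> - 1)" using assms by (intro mult_right_mono) auto
      finally show "cmod (del (J (- \<epsilon>)) z * g z) \<le> 1 * (jbracket z powr (- \<epsilon> - 1) * cmod (g z))"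
        by (simp add: norm_mult mult_right_mono)
    qed measurable
    then show "wnorm2 0 (\<lambda>z. del (J (- \<epsilon>)) z * g z) \<le> ennreal C * N" using gN1 by (simp add: add.commute)
    have "wnorm2 0 (\<lambda>z. J (- \<epsilon>) z * del g z) \<le> ennreal (pi\<^sup>2) * wnorm2 (0 - (- \<epsilon>)) v"
      by (rule wnorm2_le_cmult) (simp_all add: dg J_def norm_mult)
    also have "\<dots> \<le> ennreal (pi\<^sup>2) * N"
      unfolding N_def by (intro mult_left_mono wnorm2_mono_weight) auto
    finally show "wnorm2 0 (\<lambda>z. J (- \<epsilon>) z * del g z) \<le> ennreal (pi\<^sup>2) * N" .
    show "(\<lambda>z. J (- \<epsilon>) z * del g z) \<in> borel_measurable borel" unfolding dg by measurable
  qed (use C in auto)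
  have e: "(\<lambda>z. of_real (jbracket z powr (- 2)) * cauchy_bar v z) = (\<lambda>z. J (\<epsilon> - 2) z * H z)"
  proof
    fix z
    have "jbracket z powr (- 2) = jbracket z powr (\<epsilon> - 2) * jbracket z powr (- \<epsilon>)"
      by (simp add: jbracket_powr_add)
    then show "of_real (jbracket z powr (- 2)) * cauchy_bar v z = J (\<epsilon> - 2) z * H z"
      by (simp only: J_def H_def g_def of_real_mult mult.assoc)
  qed
  have "wnorm2 (\<epsilon> - 2) (delbar (\<lambda>z. J (\<epsilon> - 2) z * H z)) \<le> ennreal (2 * (4 * C + 2 * (C + pi\<^sup>2))) * N"
    unfolding dx_fun_mult(4)[OF Jd Cinf_differentiable[OF HC]]
  proof (rule wnorm2_add2)
    have "wnorm2 (\<epsilon> - 2) (\<lambda>z. delbar (J (\<epsilon> - 2)) z * H z) \<le> ennreal (2\<^sup>2) * wnorm2 (\<epsilon> - 2 - (- 3)) g"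
    proof (rule wnorm2_le_cmult)
      fix z
      have "cmod (delbar (J (\<epsilon> - 2)) z) \<le> \<bar>\<epsilon> - 2\<bar> * jbracket z powr (\<epsilon> - 2 - 1)"
        by (rule cmod_delbar_le(1)[OF Jb(2,3)])
      also have "\<dots> \<le> 2 * jbracket z powr (\<epsilon> - 3)" using assms by (intro mult_mono) auto
      finally have "cmod (delbar (J (\<epsilon> - 2)) z) * cmod (H z) \<le> (2 * jbracket z powr (\<epsilon> - 3)) * cmod (H z)"
        by (intro mult_right_mono) auto
      also have "\<dots> = 2 * ((jbracket z powr (\<epsilon> - 3) * jbracket z powr (- \<epsilon>)) * cmod (g z))"
        by (simp add: H_def J_def norm_mult)
      also have "jbracket z powr (\<epsilon> - 3) * jbracket z powr (- \<epsilon>) = jbracket z powr (- 3)"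
        by (simp only: jbracket_powr_add) simp
      finally show "cmod (delbar (J (\<epsilon> - 2)) z * H z) \<le> 2 * (jbracket z powr (- 3) * cmod (g z))"
        by (simp add: norm_mult)
    qed measurable
    also have "\<dots> \<le> ennreal 4 * (ennreal C * N)"
      using gN1 by (intro mult_mono) (auto simp: algebra_simps)
    also have "\<dots> = ennreal (4 * C) * N"
      using C(1) by (simp add: ennreal_mult mult.assoc)
    finally show "wnorm2 (\<epsilon> - 2) (\<lambda>z. delbar (J (\<epsilon> - 2)) z * H z) \<le> ennreal (4 * C) * N" .
    have "wnorm2 (\<epsilon> - 2) (\<lambda>z. J (\<epsilon> - 2) z * delbar H z) \<le> ennreal (1\<^sup>2) * wnorm2 (\<epsilon> - 2 - (\<epsilon> - 2)) (delbar H)"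
      by (rule wnorm2_le_cmult) (simp_all add: J_def norm_mult)
    then show "wnorm2 (\<epsilon> - 2) (\<lambda>z. J (\<epsilon> - 2) z * delbar H z) \<le> ennreal (2 * (C + pi\<^sup>2)) * N"
      using energy delH by simp
  qed (use C in auto)
  then show ?thesis unfolding e N_def by (simp add: algebra_simps)
qed

text \<open>Only the sup norm M of V enters the estimate. The bound M' on its derivatives guarantees
  the decay under which the Cauchy-Pompeiu formula holds for V G and leaves no trace in the
  constant. Smoothness of v makes the integration by parts classical.\<close>

lemma oscillatory_test_bound:
  assumes "0 < \<epsilon>" "\<epsilon> \<le> 1"
    and C: "C > 0" "\<And>v. v \<in> borel_measurable borel \<Longrightarrow> wnorm2 \<epsilon> (cauchy v) \<le> ennreal C * wnorm2 (\<epsilon> - 2) v"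
    and V: "Ck 1 V" "\<And>z. cmod (V z) \<le> M" "\<And>z. cmod (dx V z) \<le> M'" "\<And>z. cmod (dy V z) \<le> M'"
    and v: "v \<in> test_functions"
  shows "wnorm2 \<epsilon> (cauchy (\<lambda>z. delbar V z * (of_real (jbracket z powr (- 2)) * cauchy_bar v z))) \<le>
     ennreal (2 * (pi\<^sup>2 * C + C * (4 * (pi\<^sup>2 + C) + 8 * C)) * M\<^sup>2) * wnorm2 (\<epsilon> - 2) v"
proof -
  define G where "G z = of_real (jbracket z powr (- 2)) * cauchy_bar v z" for z
  define N where "N = wnorm2 (\<epsilon> - 2) v"
  define K where "K = 4 * (pi\<^sup>2 + C) + 8 * C"
  have K: "0 \<le> K" using C(1) by (simp add: K_def)
  have M: "0 \<le> M" "0 \<le> M'" using order_trans[OF norm_ge_zero V(2)] order_trans[OF norm_ge_zero V(3)] by auto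
  have [measurable]: "v \<in> borel_measurable borel" by (rule test_borel[OF v])
  obtain D where D: "0 \<le> D" and gb: "\<And>z. cmod (cauchy_bar v z) \<le> D * jbracket z powr (- 1)"
    "\<And>z. cmod (dx (cauchy_bar v) z) \<le> D * jbracket z powr (- 1)" "\<And>z. cmod (dy (cauchy_bar v) z) \<le> D * jbracket z powr (- 1)"
    using cauchy_bar_test(3)[OF v] by blast
  have gC: "cauchy_bar v \<in> Cinf" by (rule cauchy_bar_test(1)[OF v])
  have GC: "G \<in> Cinf" unfolding G_def[abs_def] by (intro Cinf_mult Cinf_jbracket_powr gC)
  have G1: "Ck 1 G" by (rule CinfD[OF GC])
  have Gdx: "dx G = (\<lambda>z. dx (\<lambda>z. of_real (jbracket z powr (- 2))) z * cauchy_bar v z + of_real (jbracket z powr (- 2)) * dx (cauchy_bar v) z)"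
    "dy G = (\<lambda>z. dy (\<lambda>z. of_real (jbracket z powr (- 2))) z * cauchy_bar v z + of_real (jbracket z powr (- 2)) * dy (cauchy_bar v) z)"
    unfolding G_def[abs_def] by (rule dx_fun_mult[OF Cinf_differentiable[OF Cinf_jbracket_powr] Cinf_differentiable[OF gC]])+
  have j2: "cmod (complex_of_real (jbracket z powr (- 2))) \<le> 1 * jbracket z powr (- 2)" for z by simp
  have Gb: "cmod (G z) \<le> (3 * D) * jbracket z powr (- 2)" "cmod (dx G z) \<le> (3 * D) * jbracket z powr (- 2)" "cmod (dy G z) \<le> (3 * D) * jbracket z powr (- 2)" for z
  proof -
    have 1: "cmod (of_real (jbracket z powr (- 2)) * x) \<le> D * jbracket z powr (- 2)" if "cmod x \<le> D * jbracket z powr (- 1)" for x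
      using norm_mult_jbracket[OF j2 that, of "- 2"] by simp
    have 2: "cmod (y * cauchy_bar v z) \<le> 2 * D * jbracket z powr (- 2)" if "cmod y \<le> \<bar>- 2\<bar> * jbracket z powr (- 2 - 1)" for y
      using norm_mult_jbracket[OF that gb(1), of "- 2"] by simp
    have "D * jbracket z powr (- 2) \<le> (3 * D) * jbracket z powr (- 2)" using D by (intro mult_right_mono) auto
    then show "cmod (G z) \<le> (3 * D) * jbracket z powr (- 2)"
      unfolding G_def using 1[OF gb(1)] by linarith
    show "cmod (dx G z) \<le> (3 * D) * jbracket z powr (- 2)" "cmod (dy G z) \<le> (3 * D) * jbracket z powr (- 2)"
      unfolding Gdx using norm_triangle_mono[OF 2[OF jbracket_powr_derivative_bound(1)] 1[OF gb(2)]]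
        norm_triangle_mono[OF 2[OF jbracket_powr_derivative_bound(2)] 1[OF gb(3)]] by simp_all
  qed
  have Vd: "\<And>z. V differentiable (at z)" using V(1) Ck_differentiable[of 1] by simp
  have Vc: "continuous_on UNIV V" "continuous_on UNIV (delbar V)" "continuous_on UNIV (delbar G)"
    using V(1) G1 by (auto intro: Ck_continuous[of "Suc 0"] continuous_delbar)
  have [measurable]: "V \<in> borel_measurable borel" "delbar V \<in> borel_measurable borel" "delbar G \<in> borel_measurable borel" "G \<in> borel_measurable borel"
    using Vc by (auto intro: continuous_imp_borel Cinf_borel[OF GC])
  have Vb: "cmod (V z) \<le> (M + M') * jbracket z powr 0" "cmod (dx V z) \<le> (M + M') * jbracket z powr 0"
    "cmod (dy V z) \<le> (M + M') * jbracket z powr 0" for z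
    using V(2,3,4)[of z] M by simp_all
  let ?f = "\<lambda>z. V z * G z" and ?L = "(M + M') * (3 * D)"
  have fdx: "dx ?f = (\<lambda>z. dx V z * G z + V z * dx G z)" "dy ?f = (\<lambda>z. dy V z * G z + V z * dy G z)"
    "delbar ?f = (\<lambda>z. delbar V z * G z + V z * delbar G z)"
    by (rule dx_fun_mult[OF Vd Cinf_differentiable[OF GC]])+
  have pb: "cmod (x * y) \<le> ?L * jbracket z powr (- 2)" if "cmod x \<le> (M + M') * jbracket z powr 0" "cmod y \<le> (3 * D) * jbracket z powr (- 2)" for x y z
    by (rule norm_mult_jbracket[OF that]) simp
  have "cauchy (delbar ?f) z = of_real pi * ?f z" for z
  proof (rule cauchy_delbar)
    show "Ck 1 ?f" by (rule Ck_mult[OF V(1) G1])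
    have L: "0 \<le> ?L * jbracket z powr (- 2)" for z using M D by simp
    show "cmod (?f z) \<le> (?L + ?L) * jbracket z powr (- 2)" for z
      using pb[OF Vb(1) Gb(1), of z] L[of z] unfolding distrib_right[of ?L ?L] by linarith
    show "cmod (dx ?f z) \<le> (?L + ?L) * jbracket z powr (- 2)" "cmod (dy ?f z) \<le> (?L + ?L) * jbracket z powr (- 2)" for z
      unfolding fdx distrib_right[of ?L ?L]
      by (rule norm_triangle_mono[OF pb[OF Vb(2) Gb(1)] pb[OF Vb(1) Gb(2)]] norm_triangle_mono[OF pb[OF Vb(3) Gb(1)] pb[OF Vb(1) Gb(3)]])+
  qed
  moreover have "cauchy (delbar ?f) z = cauchy (\<lambda>z. delbar V z * G z) z + cauchy (\<lambda>z. V z * delbar G z) z" for z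
  proof -
    have "integrable lborel (\<lambda>w. delbar V w * G w / (z - w))" "integrable lborel (\<lambda>w. V w * delbar G w / (z - w))"
      by (rule integrable_cauchy_kernel[OF _ riesz_jbracket_finite[OF pb[OF cmod_delbar_le(1)[OF Vb(2,3)] Gb(1)]]]
        integrable_cauchy_kernel[OF _ riesz_jbracket_finite[OF pb[OF Vb(1) cmod_delbar_le(1)[OF Gb(2,3)]]]], measurable)+
    then show ?thesis unfolding fdx by (simp add: cauchy_def add_divide_distrib)
  qed
  ultimately have id: "cauchy (\<lambda>z. delbar V z * G z) = (\<lambda>z. of_real pi * (V z * G z) + (- 1) * cauchy (\<lambda>z. V z * delbar G z) z)"
    by (auto simp: fun_eq_iff algebra_simps)
  have "wnorm2 \<epsilon> (cauchy (\<lambda>z. delbar V z * G z)) \<le> ennreal (2 * ((pi * M)\<^sup>2 * C + C * (M\<^sup>2 * K))) * N"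
    unfolding id
  proof (rule wnorm2_add2)
    have "wnorm2 \<epsilon> (\<lambda>z. of_real pi * (V z * G z)) \<le> ennreal ((pi * M)\<^sup>2) * wnorm2 (\<epsilon> - 0) (cauchy_bar v)"
    proof (rule wnorm2_le_cmult)
      fix z
      have "cmod (V z) * (jbracket z powr (- 2) * cmod (cauchy_bar v z)) \<le> M * (1 * cmod (cauchy_bar v z))"
        using M by (intro mult_mono V(2) mult_right_mono jbracket_powr_le_1) auto
      then show "cmod (of_real pi * (V z * G z)) \<le> pi * M * (jbracket z powr 0 * cmod (cauchy_bar v z))"
        by (simp add: G_def norm_mult mult.assoc mult_left_mono)
    qed measurable
    also have "\<dots> \<le> ennreal ((pi * M)\<^sup>2) * (ennreal C * N)"
      unfolding N_def using wnorm2_cauchy_bar[OF C(2), of v] by (intro mult_left_mono) auto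
    also have "\<dots> = ennreal ((pi * M)\<^sup>2 * C) * N"
      using C(1) by (simp add: ennreal_mult mult.assoc)
    finally show "wnorm2 \<epsilon> (\<lambda>z. of_real pi * (V z * G z)) \<le> ennreal ((pi * M)\<^sup>2 * C) * N" .
    have "wnorm2 \<epsilon> (\<lambda>z. (- 1) * cauchy (\<lambda>z. V z * delbar G z) z) = wnorm2 \<epsilon> (cauchy (\<lambda>z. V z * delbar G z))"
      by (subst wnorm2_cmult) simp_all
    also have "\<dots> \<le> ennreal C * wnorm2 (\<epsilon> - 2) (\<lambda>z. V z * delbar G z)" by (rule C(2)) measurable
    also have "\<dots> \<le> ennreal C * (ennreal (M\<^sup>2) * wnorm2 (\<epsilon> - 2 - 0) (delbar G))"
      by (intro mult_left_mono wnorm2_le_cmult) (auto simp: norm_mult intro: mult_right_mono V(2))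
    also have "\<dots> \<le> ennreal C * (ennreal (M\<^sup>2) * (ennreal K * N))"
      using wnorm2_delbar_cauchy_bar[OF assms(1,2) C v] unfolding N_def K_def G_def[abs_def] by (intro mult_left_mono) auto
    also have "\<dots> = ennreal (C * (M\<^sup>2 * K)) * N"
      using C(1) K by (simp add: ennreal_mult mult.assoc)
    finally show "wnorm2 \<epsilon> (\<lambda>z. (- 1) * cauchy (\<lambda>z. V z * delbar G z) z) \<le> ennreal (C * (M\<^sup>2 * K)) * N" .
  qed (use C K in auto)
  also have "2 * ((pi * M)\<^sup>2 * C + C * (M\<^sup>2 * K)) = 2 * (pi\<^sup>2 * C + C * K) * M\<^sup>2"
    by (simp add: power_mult_distrib algebra_simps)
  finally show ?thesis unfolding G_def N_def K_def .
qed

text \<open>Passage from test functions to all of <z>^(\<epsilon> - 2) L2. The remainder v - \<psi>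
  is estimated crudely with M', but it can be made small after M' is fixed, so K depends on
  \<epsilon> alone. The factor 4 comes from splitting squared norms twice.\<close>

lemma oscillatory_bound:
  assumes "0 < \<epsilon>" "\<epsilon> \<le> 1"
  obtains K where "0 < K" "\<And>V M M' v. Ck 1 V \<Longrightarrow> (\<And>z. cmod (V z) \<le> M) \<Longrightarrow> (\<And>z. cmod (dx V z) \<le> M') \<Longrightarrow> (\<And>z. cmod (dy V z) \<le> M') \<Longrightarrow>
     v \<in> elems (wL2 (\<epsilon> - 2)) \<Longrightarrow>
     wnorm2 \<epsilon> (cauchy (\<lambda>z. delbar V z * (of_real (jbracket z powr (- 2)) * cauchy_bar v z))) \<le> ennreal (K * M\<^sup>2) * wnorm2 (\<epsilon> - 2) v"
proof -
  obtain C where C: "C > 0" "\<And>v. v \<in> borel_measurable borel \<Longrightarrow> wnorm2 \<epsilon> (cauchy v) \<le> ennreal C * wnorm2 (\<epsilon> - 2) v"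
    using wnorm2_cauchy[OF assms] by blast
  define K0 where "K0 = 2 * (pi\<^sup>2 * C + C * (4 * (pi\<^sup>2 + C) + 8 * C))"
  have K0: "0 < K0" using C(1) by (simp add: K0_def add_pos_pos)
  have main: "wnorm2 \<epsilon> (cauchy (\<lambda>z. delbar V z * (of_real (jbracket z powr (- 2)) * cauchy_bar v z))) \<le> ennreal (4 * K0 * M\<^sup>2) * wnorm2 (\<epsilon> - 2) v"
    if V: "Ck 1 V" "\<And>z. cmod (V z) \<le> M" "\<And>z. cmod (dx V z) \<le> M'" "\<And>z. cmod (dy V z) \<le> M'"
      and v: "v \<in> elems (wL2 (\<epsilon> - 2))" for V M M' v
  proof -
    have vm [measurable]: "v \<in> borel_measurable borel" and vfin: "wnorm2 (\<epsilon> - 2) v < \<infinity>" using v by (auto simp: wL2_mem_iff)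
    have Vm [measurable]: "delbar V \<in> borel_measurable borel"
      using V(1) by (auto intro!: continuous_imp_borel continuous_delbar)
    define T where "T w z = delbar V z * (of_real (jbracket z powr (- 2)) * cauchy_bar w z)" for w z
    have Tm: "T w \<in> borel_measurable borel" if [measurable]: "w \<in> borel_measurable borel" for w
      unfolding T_def[abs_def] by measurable
    \<comment> \<open>The crude bound, without any use of oscillation; it yields finiteness and
      makes the contribution of the remainder small.\<close>
    have TN: "wnorm2 (\<epsilon> - 2) (T w) \<le> ennreal (M'\<^sup>2 * C) * wnorm2 (\<epsilon> - 2) w" if wm [measurable]: "w \<in> borel_measurable borel" for w
    proof -
      have "wnorm2 (\<epsilon> - 2) (T w) \<le> ennreal (M'\<^sup>2) * wnorm2 (\<epsilon> - 2 - (- 2)) (cauchy_bar w)"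
        unfolding T_def[abs_def]
        by (rule wnorm2_le_cmult) (auto simp: norm_mult intro!: mult_right_mono cmod_delbar_le(1)[OF V(3,4)])
      also have "\<dots> \<le> ennreal (M'\<^sup>2) * (ennreal C * wnorm2 (\<epsilon> - 2) w)"
        using wnorm2_cauchy_bar[OF C(2) wm] by (intro mult_left_mono) auto
      finally show ?thesis using C(1) by (simp add: ennreal_mult mult.assoc)
    qed
    have le: "wnorm2 \<epsilon> (cauchy (T v)) \<le> ennreal (4 * K0 * M\<^sup>2) * wnorm2 (\<epsilon> - 2) v + ennreal d" if "0 < d" for d
    proof -
      \<comment> \<open>The coefficient that e collects in the final estimate; e = d / (B + 1) then
        makes that error at most d.\<close>
      define B where "B = 4 * K0 * M\<^sup>2 + 2 * (C * (M'\<^sup>2 * C))"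
      have B: "0 \<le> B" using K0 C(1) by (simp add: B_def)
      define e where "e = d / (B + 1)"
      have e: "0 < e" using B \<open>0 < d\<close> by (simp add: e_def)
      obtain \<psi> where p: "\<psi> \<in> test_functions" "wnorm2 (\<epsilon> - 2) (\<lambda>z. v z - \<psi> z) \<le> ennreal e"
        using wL2_dense[OF v e] by blast
      have pm [measurable]: "\<psi> \<in> borel_measurable borel" by (rule test_borel[OF p(1)])
      let ?r = "\<lambda>z. v z - \<psi> z"
      have rm: "?r \<in> borel_measurable borel" by measurable
      have rfin: "wnorm2 (\<epsilon> - 2) ?r < \<infinity>" using p(2) by (rule le_less_trans) simp
      have pN: "wnorm2 (\<epsilon> - 2) \<psi> \<le> ennreal 2 * wnorm2 (\<epsilon> - 2) v + ennreal 2 * ennreal e"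
      proof -
        have "wnorm2 (\<epsilon> - 2) \<psi> = wnorm2 (\<epsilon> - 2) (\<lambda>z. v z + (- 1) * ?r z)" by simp
        also have "\<dots> \<le> ennreal (1 + 1) * wnorm2 (\<epsilon> - 2) v + ennreal (1 + 1 / 1) * wnorm2 (\<epsilon> - 2) (\<lambda>z. (- 1) * ?r z)"
          by (rule wnorm2_add_le) auto
        also have "wnorm2 (\<epsilon> - 2) (\<lambda>z. (- 1) * ?r z) = wnorm2 (\<epsilon> - 2) ?r"
          by (subst wnorm2_cmult[OF rm]) simp
        also have "ennreal (1 + 1) * wnorm2 (\<epsilon> - 2) v + ennreal (1 + 1 / 1) * wnorm2 (\<epsilon> - 2) ?r \<le> ennreal 2 * wnorm2 (\<epsilon> - 2) v + ennreal 2 * ennreal e"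
          by (intro add_mono mult_mono p) auto
        finally show ?thesis .
      qed
      then have pfin: "wnorm2 (\<epsilon> - 2) \<psi> < \<infinity>"
        by (rule le_less_trans) (use vfin in \<open>simp add: ennreal_mult_less_top\<close>)
      have "AE z in lborel. cauchy_bar v z = cauchy_bar \<psi> z + cauchy_bar ?r z"
        using cauchy_bar_add_AE[OF assms pm pfin rm rfin] by simp
      then have "AE z in lborel. T v z = T \<psi> z + T ?r z"
        unfolding T_def by eventually_elim (simp add: distrib_left)
      then have c1: "cauchy (T v) z = cauchy (\<lambda>z. T \<psi> z + T ?r z) z" for z
        using Tm[OF vm] Tm[OF pm] Tm[OF rm] by (intro cauchy_cong_AE borel_measurable_add)
      have Tfin: "wnorm2 (\<epsilon> - 2) (T \<psi>) < \<infinity>" "wnorm2 (\<epsilon> - 2) (T ?r) < \<infinity>"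
        by (rule le_less_trans[OF TN[OF pm]] le_less_trans[OF TN[OF rm]], use pfin rfin in \<open>simp add: ennreal_mult_less_top\<close>)+
      have "AE z in lborel. cauchy (T v) z = cauchy (T \<psi>) z + cauchy (T ?r) z"
        unfolding c1 by (rule cauchy_add_AE[OF assms Tm[OF pm] Tfin(1) Tm[OF rm] Tfin(2)])
      then have "AE z in lborel. cmod (cauchy (T v) z) \<le> cmod (cauchy (T \<psi>) z + cauchy (T ?r) z)"
        by eventually_elim simp
      then have "wnorm2 \<epsilon> (cauchy (T v)) \<le> wnorm2 \<epsilon> (\<lambda>z. cauchy (T \<psi>) z + cauchy (T ?r) z)"
        by (rule wnorm2_mono)
      also have "\<dots> \<le> ennreal (1 + 1) * wnorm2 \<epsilon> (cauchy (T \<psi>)) + ennreal (1 + 1 / 1) * wnorm2 \<epsilon> (cauchy (T ?r))"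
        using Tm[OF pm] Tm[OF rm] by (intro wnorm2_add_le measurable_cauchy) auto
      also have "\<dots> \<le> ennreal 2 * (ennreal (K0 * M\<^sup>2) * (ennreal 2 * wnorm2 (\<epsilon> - 2) v + ennreal 2 * ennreal e)) +
          ennreal 2 * (ennreal C * (ennreal (M'\<^sup>2 * C) * ennreal e))"
      proof (intro add_mono mult_mono)
        have "wnorm2 \<epsilon> (cauchy (T \<psi>)) \<le> ennreal (K0 * M\<^sup>2) * wnorm2 (\<epsilon> - 2) \<psi>"
          unfolding T_def[abs_def] K0_def by (rule oscillatory_test_bound[OF assms C V p(1)])
        also have "\<dots> \<le> ennreal (K0 * M\<^sup>2) * (ennreal 2 * wnorm2 (\<epsilon> - 2) v + ennreal 2 * ennreal e)"
          by (intro mult_left_mono pN) simp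
        finally show "wnorm2 \<epsilon> (cauchy (T \<psi>)) \<le> \<dots>" .
        have "wnorm2 \<epsilon> (cauchy (T ?r)) \<le> ennreal C * wnorm2 (\<epsilon> - 2) (T ?r)" by (rule C(2)[OF Tm[OF rm]])
        also have "\<dots> \<le> ennreal C * (ennreal (M'\<^sup>2 * C) * ennreal e)"
          by (intro mult_left_mono order_trans[OF TN[OF rm]] p) auto
        finally show "wnorm2 \<epsilon> (cauchy (T ?r)) \<le> \<dots>" .
      qed auto
      also have "\<dots> = ennreal (4 * K0 * M\<^sup>2) * wnorm2 (\<epsilon> - 2) v + ennreal (B * e)"
      proof -
        obtain w where w: "wnorm2 (\<epsilon> - 2) v = ennreal w" "0 \<le> w"
          using vfin by (cases "wnorm2 (\<epsilon> - 2) v") auto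
        have "ennreal 2 * (ennreal (K0 * M\<^sup>2) * (ennreal 2 * ennreal w + ennreal 2 * ennreal e)) +
          ennreal 2 * (ennreal C * (ennreal (M'\<^sup>2 * C) * ennreal e)) = ennreal (2 * (K0 * M\<^sup>2 * (2 * w + 2 * e)) + 2 * (C * (M'\<^sup>2 * C * e)))"
          using w(2) e K0 C(1) by (simp add: ennreal_mult ennreal_plus)
        also have "2 * (K0 * M\<^sup>2 * (2 * w + 2 * e)) + 2 * (C * (M'\<^sup>2 * C * e)) = 4 * K0 * M\<^sup>2 * w + B * e"
          by (simp add: B_def algebra_simps)
        also have "ennreal \<dots> = ennreal (4 * K0 * M\<^sup>2) * ennreal w + ennreal (B * e)"
          using w(2) e K0 B by (simp add: ennreal_mult ennreal_plus)
        finally show ?thesis unfolding w(1) .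
      qed
      also have "\<dots> \<le> ennreal (4 * K0 * M\<^sup>2) * wnorm2 (\<epsilon> - 2) v + ennreal d"
      proof (intro add_mono order_refl ennreal_leI)
        show "B * e \<le> d" using B \<open>0 < d\<close> by (simp add: e_def field_simps)
      qed
      finally show ?thesis .
    qed
    have "wnorm2 \<epsilon> (cauchy (T v)) \<le> ennreal (4 * K0 * M\<^sup>2) * wnorm2 (\<epsilon> - 2) v"
      by (rule ennreal_le_epsilon) (rule le)
    then show ?thesis unfolding T_def[abs_def] .
  qed
  show ?thesis by (rule that[OF _ main]) (use K0 in auto)
qed

section \<open>Fourier inversion for Sobolev functions\<close>

lemma lborel_complex_eq:
  "lborel = Measure_Space.distr (lborel \<Otimes>\<^sub>M lborel) borel (\<lambda>(x, y). Complex x y)"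
proof (rule lborel_eqI)
  have meas: "(\<lambda>(x, y). Complex x y) \<in> borel_measurable (lborel \<Otimes>\<^sub>M lborel)"
  proof -
    have "(\<lambda>p. of_real (fst p) + \<i> * of_real (snd p)) \<in> borel_measurable (lborel \<Otimes>\<^sub>M lborel)"
      by measurable
    then show ?thesis by (simp add: case_prod_beta' complex_eq mult.commute Complex_eq)
  qed
  fix l u :: complex assume lu: "\<And>b. b \<in> Basis \<Longrightarrow> l \<bullet> b \<le> u \<bullet> b"
  then have le: "Re l \<le> Re u" "Im l \<le> Im u"
    using lu[of 1] lu[of \<i>] by (simp_all add: Basis_complex_def inner_complex_def)
  have "emeasure (Measure_Space.distr (lborel \<Otimes>\<^sub>M lborel) borel (\<lambda>(x, y). Complex x y)) (box l u) =
      emeasure (lborel \<Otimes>\<^sub>M lborel) ({Re l<..<Re u} \<times> {Im l<..<Im u})"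
    by (subst emeasure_distr[OF meas])
      (auto intro!: arg_cong[where f="emeasure (lborel \<Otimes>\<^sub>M lborel)"] simp: in_box_complex_iff space_pair_measure)
  also have "\<dots> = ennreal (Re u - Re l) * ennreal (Im u - Im l)"
    using le by (subst lborel.emeasure_pair_measure_Times) auto
  also have "\<dots> = ennreal (\<Prod>b\<in>Basis. (u - l) \<bullet> b)"
    using le by (simp add: Basis_complex_def inner_complex_def ennreal_mult)
  finally show "emeasure (Measure_Space.distr (lborel \<Otimes>\<^sub>M lborel) borel (\<lambda>(x, y). Complex x y)) (box l u) =
      ennreal (\<Prod>b\<in>Basis. (u - l) \<bullet> b)" .
qed simp

text \<open>Read off from the characteristic function of the standard normal law, whose density
  carries the factor 1 / sqrt(2 pi).\<close>

lemma gaussian_integral_1: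
  "(LINT x|lborel. complex_of_real (exp (- x\<^sup>2 / 2)) * exp (\<i> * of_real (t * x))) = of_real (sqrt (2 * pi) * exp (- t\<^sup>2 / 2))"
proof -
  have "complex_of_real (exp (- t\<^sup>2 / 2)) = char std_normal_distribution t"
    by (simp add: char_std_normal_distribution)
  also have "\<dots> = (LINT x|lborel. std_normal_density x *\<^sub>R iexp (t * x))"
    unfolding char_def by (subst integral_density) auto
  also have "\<dots> = (LINT x|lborel. of_real (1 / sqrt (2 * pi)) * (complex_of_real (exp (- x\<^sup>2 / 2)) * exp (\<i> * of_real (t * x))))"
    by (intro Bochner_Integration.integral_cong refl) (simp add: std_normal_density_def scaleR_conv_of_real)
  also have "\<dots> = of_real (1 / sqrt (2 * pi)) * (LINT x|lborel. complex_of_real (exp (- x\<^sup>2 / 2)) * exp (\<i> * of_real (t * x)))"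
    by (rule integral_mult_right_zero)
  finally have "of_real (sqrt (2 * pi)) * complex_of_real (exp (- t\<^sup>2 / 2)) =
      of_real (sqrt (2 * pi)) * (of_real (1 / sqrt (2 * pi)) * (LINT x|lborel. complex_of_real (exp (- x\<^sup>2 / 2)) * exp (\<i> * of_real (t * x))))"
    by simp
  then show ?thesis by (simp flip: mult.assoc of_real_mult)
qed

text \<open>A single term of the exponential series, x^N / N! <= exp x at x = c <z>^2. The factor
  exp c in the bound accounts for <z>^2 = 1 + |z|^2.\<close>

lemma jbracket_power_gaussian:
  assumes "0 < c"
  obtains B where "0 \<le> B" "\<And>z. jbracket z ^ N * exp (- c * (cmod z)\<^sup>2) \<le> B"
proof -
  have "jbracket z ^ N * exp (- c * (cmod z)\<^sup>2) \<le> exp c * (fact N / c ^ N)" for z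
  proof -
    have "(c * (jbracket z)\<^sup>2) ^ N / fact N \<le> exp (c * (jbracket z)\<^sup>2)"
    proof -
      have x: "0 \<le> c * (jbracket z)\<^sup>2" using assms by simp
      have "(\<Sum>n\<in>{N}. inverse (fact n) *\<^sub>R (c * (jbracket z)\<^sup>2) ^ n) \<le> (\<Sum>n. inverse (fact n) *\<^sub>R (c * (jbracket z)\<^sup>2) ^ n)"
        using x by (intro sum_le_suminf summable_exp_generic) auto
      then show ?thesis by (simp add: exp_def divide_inverse mult.commute)
    qed
    then have b: "c ^ N * (jbracket z ^ N)\<^sup>2 \<le> fact N * exp (c * (jbracket z)\<^sup>2)"
      by (simp add: power_mult_distrib divide_le_eq mult.commute flip: power_mult)
    have "jbracket z ^ N \<le> (jbracket z ^ N)\<^sup>2"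
      using one_le_power[OF jbracket_ge_1, of z N] by (simp add: power2_eq_square)
    then have "c ^ N * jbracket z ^ N \<le> c ^ N * (jbracket z ^ N)\<^sup>2"
      using assms by (intro mult_left_mono) auto
    also note b
    finally have "c ^ N * jbracket z ^ N \<le> fact N * exp (c * (jbracket z)\<^sup>2)" .
    then have "jbracket z ^ N \<le> (fact N / c ^ N) * exp (c * (jbracket z)\<^sup>2)"
      using assms by (simp add: field_simps)
    then have "jbracket z ^ N * exp (- c * (cmod z)\<^sup>2) \<le> (fact N / c ^ N) * exp (c * (jbracket z)\<^sup>2) * exp (- c * (cmod z)\<^sup>2)"
      by (intro mult_right_mono) auto
    also have "\<dots> = (fact N / c ^ N) * exp (c * (jbracket z)\<^sup>2 + - c * (cmod z)\<^sup>2)"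
      by (simp only: exp_add mult.assoc)
    also have "c * (jbracket z)\<^sup>2 + - c * (cmod z)\<^sup>2 = c" by (simp add: jbracket_square algebra_simps)
    finally show ?thesis by (simp add: mult.commute)
  qed
  then show ?thesis by (rule that[rotated]) (use assms in simp)
qed

lemma exp_i_norm [simp]: "cmod (exp (\<i> * complex_of_real x)) = 1"
  by (simp add: norm_exp_eq_Re)

lemma integrable_gaussian: "integrable lborel (\<lambda>z. complex_of_real (exp (- (cmod z)\<^sup>2 / 2)) * exp (\<i> * of_real (x \<bullet> z)))"
proof -
  obtain B where B: "\<And>z. jbracket z ^ 3 * exp (- (1/2) * (cmod z)\<^sup>2) \<le> B" using jbracket_power_gaussian[of "1/2" 3] by auto
  show ?thesis
  proof (rule integrable_jbracket_bound[of _ B 3])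
    fix z
    have "exp (- (cmod z)\<^sup>2 / 2) = (jbracket z ^ 3 * exp (- (1/2) * (cmod z)\<^sup>2)) * jbracket z powr (- 3)"
      by (simp add: powr_minus powr_numeral)
    also have "\<dots> \<le> B * jbracket z powr (- 3)" by (intro mult_right_mono B) simp
    finally show "cmod (complex_of_real (exp (- (cmod z)\<^sup>2 / 2)) * exp (\<i> * of_real (x \<bullet> z))) \<le> B * jbracket z powr (- 3)"
      by (simp add: norm_mult)
  qed auto
qed

lemma gaussian_fourier:
  "(LINT z|lborel. complex_of_real (exp (- (cmod z)\<^sup>2 / 2)) * exp (\<i> * of_real (x \<bullet> z))) = of_real (2 * pi * exp (- (cmod x)\<^sup>2 / 2))"
proof -
  let ?F = "\<lambda>z. complex_of_real (exp (- (cmod z)\<^sup>2 / 2)) * exp (\<i> * of_real (x \<bullet> z))"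
  have m: "(\<lambda>(x, y). Complex x y) \<in> borel_measurable (lborel \<Otimes>\<^sub>M lborel)"
  proof -
    have "(\<lambda>p. of_real (fst p) + \<i> * of_real (snd p)) \<in> borel_measurable (lborel \<Otimes>\<^sub>M lborel)"
      by measurable
    then show ?thesis by (simp add: case_prod_beta' complex_eq mult.commute Complex_eq)
  qed
  have Fm: "?F \<in> borel_measurable borel" by measurable
  have s: "?F (Complex a b) = (complex_of_real (exp (- a\<^sup>2 / 2)) * exp (\<i> * of_real (Re x * a))) * (complex_of_real (exp (- b\<^sup>2 / 2)) * exp (\<i> * of_real (Im x * b)))" for a b
  proof -
    have e1: "exp (- (cmod (Complex a b))\<^sup>2 / 2) = exp (- a\<^sup>2 / 2) * exp (- b\<^sup>2 / 2)"
      by (simp add: cmod_power2 add_divide_distrib flip: exp_add)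
    have e2: "exp (\<i> * of_real (x \<bullet> Complex a b)) = exp (\<i> * of_real (Re x * a)) * exp (\<i> * of_real (Im x * b))"
      by (simp add: inner_complex_def distrib_left flip: exp_add)
    show ?thesis unfolding e1 e2 by (simp add: mult_ac)
  qed
  have i: "integrable (lborel \<Otimes>\<^sub>M lborel) (\<lambda>(a, b). ?F (Complex a b))"
  proof -
    have "integrable (Measure_Space.distr (lborel \<Otimes>\<^sub>M lborel) borel (\<lambda>(x, y). Complex x y)) ?F"
      using integrable_gaussian[of x] by (simp only: lborel_complex_eq[symmetric])
    then show ?thesis by (subst (asm) integrable_distr_eq[OF m Fm]) (simp add: case_prod_beta')
  qed
  have "(LINT z|lborel. ?F z) = (LINT z|Measure_Space.distr (lborel \<Otimes>\<^sub>M lborel) borel (\<lambda>(x, y). Complex x y). ?F z)"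
    by (simp only: lborel_complex_eq[symmetric])
  also have "\<dots> = (LINT p|(lborel \<Otimes>\<^sub>M lborel). ?F (case p of (a, b) \<Rightarrow> Complex a b))"
    by (rule integral_distr[OF m Fm])
  also have "\<dots> = (LINT p|(lborel \<Otimes>\<^sub>M lborel). (case p of (a, b) \<Rightarrow> ?F (Complex a b)))"
    by (simp add: case_prod_beta')
  also have "\<dots> = (LINT a|lborel. LINT b|lborel. ?F (Complex a b))"
    by (rule lborel_pair.integral_fst[OF i, symmetric])
  also have "\<dots> = (LINT a|lborel. (complex_of_real (exp (- a\<^sup>2 / 2)) * exp (\<i> * of_real (Re x * a))) * of_real (sqrt (2 * pi) * exp (- (Im x)\<^sup>2 / 2)))"
    unfolding s integral_mult_right_zero gaussian_integral_1 ..
  also have "\<dots> = of_real (sqrt (2 * pi) * exp (- (Re x)\<^sup>2 / 2)) * of_real (sqrt (2 * pi) * exp (- (Im x)\<^sup>2 / 2))"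
    unfolding integral_mult_left_zero gaussian_integral_1 ..
  also have "\<dots> = of_real ((sqrt (2 * pi) * sqrt (2 * pi)) * (exp (- (Re x)\<^sup>2 / 2) * exp (- (Im x)\<^sup>2 / 2)))"
    by (simp only: of_real_mult mult_ac)
  also have "exp (- (Re x)\<^sup>2 / 2) * exp (- (Im x)\<^sup>2 / 2) = exp (- (cmod x)\<^sup>2 / 2)"
    by (simp add: cmod_power2 add_divide_distrib flip: exp_add)
  finally show ?thesis by simp
qed

text \<open>Polynomials in Re z and Im z, described by generators so that closure under
  \<open>dx\<close> and \<open>dy\<close> and polynomial growth follow by induction. Every
  derivative of a Gaussian is such a polynomial times the Gaussian, which is how
  \<open>gauss\<close> is seen to be a Schwartz function.\<close>

inductive_set complex_polys :: "(complex \<Rightarrow> complex) set" where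
  const: "(\<lambda>z. c) \<in> complex_polys"
| Re: "(\<lambda>z. of_real (Re z)) \<in> complex_polys"
| Im: "(\<lambda>z. of_real (Im z)) \<in> complex_polys"
| add: "p \<in> complex_polys \<Longrightarrow> q \<in> complex_polys \<Longrightarrow> (\<lambda>z. p z + q z) \<in> complex_polys"
| mult: "p \<in> complex_polys \<Longrightarrow> q \<in> complex_polys \<Longrightarrow> (\<lambda>z. p z * q z) \<in> complex_polys"

lemma dx_Re_Im: "dx (\<lambda>z. of_real (Re z)) = (\<lambda>z. 1)" "dy (\<lambda>z. of_real (Re z)) = (\<lambda>z. 0)"
    "dx (\<lambda>z. of_real (Im z)) = (\<lambda>z. 0)" "dy (\<lambda>z. of_real (Im z)) = (\<lambda>z. 1)"
proof -
  have D: "((\<lambda>z. complex_of_real (Re z)) has_derivative (\<lambda>h. of_real (Re h))) (at z)"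
    "((\<lambda>z. complex_of_real (Im z)) has_derivative (\<lambda>h. of_real (Im h))) (at z)" for z
    by (auto intro!: derivative_eq_intros)
  show "dx (\<lambda>z. of_real (Re z)) = (\<lambda>z. 1)" "dy (\<lambda>z. of_real (Re z)) = (\<lambda>z. 0)"
    "dx (\<lambda>z. of_real (Im z)) = (\<lambda>z. 0)" "dy (\<lambda>z. of_real (Im z)) = (\<lambda>z. 1)"
    using has_derivative_imp_dx_dy[OF D(1)] has_derivative_imp_dx_dy[OF D(2)] by (simp_all add: fun_eq_iff)
qed

lemma complex_polys_Cinf: "p \<in> complex_polys \<Longrightarrow> p \<in> Cinf"
  by (induction rule: complex_polys.induct) (auto intro: Cinf_const Cinf_Re Cinf_Im Cinf_add Cinf_mult)

lemma complex_polys_dx: "p \<in> complex_polys \<Longrightarrow> dx p \<in> complex_polys \<and> dy p \<in> complex_polys"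
proof (induction rule: complex_polys.induct)
  case (add p q)
  have "\<And>z. p differentiable (at z)" "\<And>z. q differentiable (at z)"
    using add by (simp_all add: Cinf_differentiable complex_polys_Cinf)
  then show ?case using add by (simp add: dx_fun_add complex_polys.add)
next
  case (mult p q)
  have "\<And>z. p differentiable (at z)" "\<And>z. q differentiable (at z)"
    using mult by (simp_all add: Cinf_differentiable complex_polys_Cinf)
  then show ?case using mult by (simp add: dx_fun_mult complex_polys.add complex_polys.mult)
qed (simp_all add: dx_const dx_Re_Im complex_polys.const)

lemma complex_polys_bound: "p \<in> complex_polys \<Longrightarrow> \<exists>C\<ge>0. \<exists>K. \<forall>z. cmod (p z) \<le> C * jbracket z ^ K"
proof (induction rule: complex_polys.induct)
  case (const c)
  show ?case by (rule exI[of _ "cmod c"], simp, rule exI[of _ 0], simp)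
next
  case Re
  have "\<bar>Re z\<bar> \<le> 1 * jbracket z ^ 1" for z using abs_Re_le_cmod[of z] norm_le_jbracket[of z] by simp
  then show ?case by (intro exI[of _ 1] conjI exI[of _ "1::nat"]) auto
next
  case Im
  have "\<bar>Im z\<bar> \<le> 1 * jbracket z ^ 1" for z using abs_Im_le_cmod[of z] norm_le_jbracket[of z] by simp
  then show ?case by (intro exI[of _ 1] conjI exI[of _ "1::nat"]) auto
next
  case (add p q)
  then obtain C K D L where *: "0 \<le> C" "0 \<le> D" "\<And>z. cmod (p z) \<le> C * jbracket z ^ K" "\<And>z. cmod (q z) \<le> D * jbracket z ^ L"
    by blast
  have "cmod (p z + q z) \<le> (C + D) * jbracket z ^ (K + L)" for z
  proof -
    have "cmod (p z + q z) \<le> C * jbracket z ^ K + D * jbracket z ^ L"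
      by (intro order_trans[OF norm_triangle_ineq] add_mono *)
    also have "\<dots> \<le> C * jbracket z ^ (K + L) + D * jbracket z ^ (K + L)"
      using * by (intro add_mono mult_left_mono power_increasing jbracket_ge_1) auto
    finally show ?thesis by (simp add: distrib_right)
  qed
  then show ?case using * by (intro exI[of _ "C + D"] conjI exI[of _ "K + L"]) auto
next
  case (mult p q)
  then obtain C K D L where *: "0 \<le> C" "0 \<le> D" "\<And>z. cmod (p z) \<le> C * jbracket z ^ K" "\<And>z. cmod (q z) \<le> D * jbracket z ^ L"
    by blast
  have "cmod (p z * q z) \<le> (C * D) * jbracket z ^ (K + L)" for z
  proof -
    have "cmod (p z * q z) \<le> (C * jbracket z ^ K) * (D * jbracket z ^ L)"
      unfolding norm_mult using * by (intro mult_mono) auto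
    then show ?thesis by (simp add: power_add mult_ac)
  qed
  then show ?case using * by (intro exI[of _ "C * D"] conjI exI[of _ "K + L"]) auto
qed

definition gauss :: "real \<Rightarrow> complex \<Rightarrow> complex \<Rightarrow> complex" where
  "gauss c a z = exp (- of_real (c * (cmod z)\<^sup>2) + \<i> * of_real (a \<bullet> z))"

lemma gauss_has_derivative:
  "(gauss c a has_derivative (\<lambda>h. gauss c a z * (- of_real (2 * c * (z \<bullet> h)) + \<i> * of_real (a \<bullet> h)))) (at z)"
proof -
  have 1: "((\<lambda>z. z \<bullet> z) has_derivative (\<lambda>h. 2 * (z \<bullet> h))) (at z)"
    by (rule has_derivative_eq_rhs[OF has_derivative_inner[OF has_derivative_ident has_derivative_ident]])
      (simp add: inner_commute fun_eq_iff)
  have 2: "((\<lambda>z. a \<bullet> z) has_derivative (\<lambda>h. a \<bullet> h)) (at z)"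
    by (rule has_derivative_inner_right[OF has_derivative_ident])
  have "((\<lambda>z. - (of_real c * of_real (z \<bullet> z)) + \<i> * complex_of_real (a \<bullet> z)) has_derivative
      (\<lambda>h. - (of_real c * of_real (2 * (z \<bullet> h))) + \<i> * of_real (a \<bullet> h))) (at z)"
    by (intro has_derivative_add has_derivative_minus has_derivative_mult_right has_derivative_of_real 1 2)
  from has_derivative_compose[OF this has_field_derivative_imp_has_derivative[OF DERIV_exp]]
  show ?thesis
    unfolding gauss_def[abs_def] by (simp add: power2_norm_eq_inner mult_ac)
qed

lemma gauss_poly:
  assumes p: "p \<in> complex_polys"
  shows "(\<lambda>z. p z * gauss c a z) differentiable (at z)"
    "\<exists>q\<in>complex_polys. dx (\<lambda>z. p z * gauss c a z) = (\<lambda>z. q z * gauss c a z)"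
    "\<exists>q\<in>complex_polys. dy (\<lambda>z. p z * gauss c a z) = (\<lambda>z. q z * gauss c a z)"
proof -
  have pd: "\<And>z. p differentiable (at z)" by (intro Cinf_differentiable complex_polys_Cinf p)
  have gd: "\<And>z. gauss c a differentiable (at z)" using gauss_has_derivative differentiable_def by blast
  show "(\<lambda>z. p z * gauss c a z) differentiable (at z)" by (intro differentiable_mult pd gd)
  have g: "dx (gauss c a) z = gauss c a z * (of_real (- 2 * c) * of_real (Re z) + \<i> * of_real (Re a))"
    "dy (gauss c a) z = gauss c a z * (of_real (- 2 * c) * of_real (Im z) + \<i> * of_real (Im a))" for z
    using has_derivative_imp_dx_dy[OF gauss_has_derivative[of c a z]] by (simp_all add: inner_complex_def)
  let ?l = "\<lambda>z. of_real (- 2 * c) * of_real (Re z) + \<i> * of_real (Re a)" and ?m = "\<lambda>z. of_real (- 2 * c) * of_real (Im z) + \<i> * of_real (Im a)"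
  have lm: "?l \<in> complex_polys" "?m \<in> complex_polys" by (intro complex_polys.intros)+
  have q: "(\<lambda>z. dx p z + p z * ?l z) \<in> complex_polys" "(\<lambda>z. dy p z + p z * ?m z) \<in> complex_polys"
    by (rule complex_polys.add[OF conjunct1[OF complex_polys_dx[OF p]] complex_polys.mult[OF p lm(1)]]
        complex_polys.add[OF conjunct2[OF complex_polys_dx[OF p]] complex_polys.mult[OF p lm(2)]])+
  have e: "dx (\<lambda>z. p z * gauss c a z) = (\<lambda>z. (dx p z + p z * ?l z) * gauss c a z)"
    "dy (\<lambda>z. p z * gauss c a z) = (\<lambda>z. (dy p z + p z * ?m z) * gauss c a z)"
    unfolding dx_fun_mult(1,2)[OF pd gd] g by (simp_all add: fun_eq_iff algebra_simps)
  show "\<exists>q\<in>complex_polys. dx (\<lambda>z. p z * gauss c a z) = (\<lambda>z. q z * gauss c a z)"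
    "\<exists>q\<in>complex_polys. dy (\<lambda>z. p z * gauss c a z) = (\<lambda>z. q z * gauss c a z)"
    by (rule bexI[where x="\<lambda>z. dx p z + p z * ?l z"], rule e(1), rule q(1))
      (rule bexI[where x="\<lambda>z. dy p z + p z * ?m z"], rule e(2), rule q(2))
qed

lemma gauss_schwartz:
  assumes "0 < c"
  shows "gauss c a \<in> schwartz"
proof -
  have "Ck n (\<lambda>z. p z * gauss c a z)" if "p \<in> complex_polys" for n p
    using that
  proof (induction n arbitrary: p)
    case 0
    then show ?case using continuous_differentiable[OF gauss_poly(1)] by simp
  next
    case (Suc n)
    obtain q1 q2 where q: "q1 \<in> complex_polys" "dx (\<lambda>z. p z * gauss c a z) = (\<lambda>z. q1 z * gauss c a z)"
      "q2 \<in> complex_polys" "dy (\<lambda>z. p z * gauss c a z) = (\<lambda>z. q2 z * gauss c a z)"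
      using gauss_poly(2,3)[OF Suc.prems] by blast
    show ?case using gauss_poly(1)[OF Suc.prems] Suc.IH[OF q(1)] Suc.IH[OF q(3)]
      by (simp add: differentiable_on_def q(2,4))
  qed
  from this[OF complex_polys.const[of 1]] have Cinf: "gauss c a \<in> Cinf" by (simp add: Cinf_def)
  have y: "\<exists>q\<in>complex_polys. (dy ^^ n) (gauss c a) = (\<lambda>z. q z * gauss c a z)" for n
  proof (induction n)
    case 0
    show ?case by (rule bexI[OF _ complex_polys.const[of 1]]) simp
  next
    case (Suc n)
    then obtain q where q: "q \<in> complex_polys" "(dy ^^ n) (gauss c a) = (\<lambda>z. q z * gauss c a z)" by blast
    then show ?case using gauss_poly(3)[OF q(1), of c a] by simp
  qed
  have x: "\<exists>q\<in>complex_polys. (dx ^^ m) ((dy ^^ n) (gauss c a)) = (\<lambda>z. q z * gauss c a z)" for m n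
  proof (induction m)
    case 0
    show ?case using y[of n] by simp
  next
    case (Suc m)
    then obtain q where q: "q \<in> complex_polys" "(dx ^^ m) ((dy ^^ n) (gauss c a)) = (\<lambda>z. q z * gauss c a z)" by blast
    then show ?case using gauss_poly(2)[OF q(1), of c a] by simp
  qed
  have "\<exists>C. \<forall>z. jbracket z ^ N * cmod ((dx ^^ m) ((dy ^^ n) (gauss c a)) z) \<le> C" for N m n
  proof -
    obtain q where q: "q \<in> complex_polys" "(dx ^^ m) ((dy ^^ n) (gauss c a)) = (\<lambda>z. q z * gauss c a z)"
      using x[of m n] by blast
    obtain C K where C: "0 \<le> C" "\<And>z. cmod (q z) \<le> C * jbracket z ^ K" using complex_polys_bound[OF q(1)] by blast
    obtain B where B: "0 \<le> B" "\<And>z. jbracket z ^ (N + K) * exp (- c * (cmod z)\<^sup>2) \<le> B"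
      using jbracket_power_gaussian[OF assms, of "N + K"] by blast
    have "jbracket z ^ N * cmod ((dx ^^ m) ((dy ^^ n) (gauss c a)) z) \<le> C * B" for z
    proof -
      have "cmod (gauss c a z) = exp (- c * (cmod z)\<^sup>2)"
        by (simp add: gauss_def norm_exp_eq_Re)
      then have "jbracket z ^ N * cmod ((dx ^^ m) ((dy ^^ n) (gauss c a)) z) = jbracket z ^ N * (cmod (q z) * exp (- c * (cmod z)\<^sup>2))"
        by (simp add: q(2) norm_mult)
      also have "\<dots> \<le> jbracket z ^ N * ((C * jbracket z ^ K) * exp (- c * (cmod z)\<^sup>2))"
        by (intro mult_left_mono mult_right_mono C) auto
      also have "\<dots> = C * (jbracket z ^ (N + K) * exp (- c * (cmod z)\<^sup>2))"
        by (simp add: power_add mult_ac)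
      also have "\<dots> \<le> C * B" by (intro mult_left_mono B C)
      finally show ?thesis .
    qed
    then show ?thesis by blast
  qed
  then show ?thesis using Cinf by (simp add: schwartz_def)
qed

text \<open>Modulation by a moves the centre of the transform to a, and a wide Gaussian has a narrow
  transform: as r grows these transforms form an approximate identity at a.\<close>

lemma fourier_gauss:
  assumes "0 < r"
  shows "fourier (gauss (1 / (2 * r\<^sup>2)) a) z = of_real (2 * pi * r\<^sup>2 * exp (- (cmod (of_real r * (z - a)))\<^sup>2 / 2))"
proof -
  let ?x = "of_real r * (a - z)"
  have m: "(\<lambda>\<zeta>. exp (- \<i> * of_real (\<zeta> \<bullet> z)) * gauss (1 / (2 * r\<^sup>2)) a \<zeta>) \<in> borel_measurable borel"
    unfolding gauss_def by measurable
  have "fourier (gauss (1 / (2 * r\<^sup>2)) a) z = (LINT t|lborel. of_real (r\<^sup>2) * (exp (- \<i> * of_real ((of_real r * t) \<bullet> z)) * gauss (1 / (2 * r\<^sup>2)) a (of_real r * t)))"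
    unfolding fourier_def by (rule integral_scale[OF m assms])
  also have "\<dots> = (LINT t|lborel. of_real (r\<^sup>2) * (complex_of_real (exp (- (cmod t)\<^sup>2 / 2)) * exp (\<i> * of_real (?x \<bullet> t))))"
  proof (intro Bochner_Integration.integral_cong refl arg_cong[where f="\<lambda>x. of_real (r\<^sup>2) * x"])
    fix t
    have 1: "1 / (2 * r\<^sup>2) * (cmod (of_real r * t))\<^sup>2 = (cmod t)\<^sup>2 / 2"
      using assms by (simp add: norm_mult power_mult_distrib)
    have "exp (- \<i> * of_real ((of_real r * t) \<bullet> z)) * gauss (1 / (2 * r\<^sup>2)) a (of_real r * t) =
        exp (- of_real ((cmod t)\<^sup>2 / 2) + (\<i> * of_real (a \<bullet> (of_real r * t)) + - \<i> * of_real ((of_real r * t) \<bullet> z)))"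
      unfolding gauss_def 1 by (simp only: exp_add[symmetric] add_ac)
    also have "\<i> * of_real (a \<bullet> (of_real r * t)) + - \<i> * of_real ((of_real r * t) \<bullet> z) = \<i> * complex_of_real (?x \<bullet> t)"
    proof -
      have eq: "?x \<bullet> t = a \<bullet> (of_real r * t) - (of_real r * t) \<bullet> z"
        by (simp add: inner_complex_def algebra_simps)
      show ?thesis unfolding eq unfolding of_real_diff right_diff_distrib by simp
    qed
    also have "exp (- of_real ((cmod t)\<^sup>2 / 2) + \<i> * complex_of_real (?x \<bullet> t)) = complex_of_real (exp (- (cmod t)\<^sup>2 / 2)) * exp (\<i> * of_real (?x \<bullet> t))"
      by (simp only: exp_add) (simp flip: exp_of_real)
    finally show "exp (- \<i> * of_real ((of_real r * t) \<bullet> z)) * gauss (1 / (2 * r\<^sup>2)) a (of_real r * t) = \<dots>" .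
  qed
  also have "\<dots> = of_real (r\<^sup>2) * of_real (2 * pi * exp (- (cmod ?x)\<^sup>2 / 2))"
    by (simp only: integral_mult_right_zero gaussian_fourier)
  finally show ?thesis by (simp add: norm_mult norm_minus_commute mult_ac)
qed

section \<open>Integrability and tails of the Fourier transform\<close>

lemma integrable_of_wL2:
  assumes "g \<in> elems (wL2 (- s))" "1 < s"
  shows "integrable lborel g"
  using integrable_wL2_mult[OF assms(1), of "\<lambda>z. 1" 1 s] assms(2) by simp

lemma wnorm2_tail:
  assumes "1 < s" "0 < R"
  shows "wnorm2 s (\<lambda>z. if R < cmod z then 1 else 0) \<le> ennreal (pi / (s - 1) * (R powr (1 - s))\<^sup>2)"
proof -
  let ?f = "\<lambda>t. ennreal (\<bar>1 + t\<bar> powr (- s)) * indicator {R\<^sup>2..} t"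
  have "wnorm2 s (\<lambda>z. if R < cmod z then 1 else 0) \<le> (\<integral>\<^sup>+z. ?f ((cmod z)\<^sup>2) \<partial>lborel)"
    unfolding wnorm2_def
  proof (rule nn_integral_mono)
    fix z
    have "jbracket z powr (- 2 * s) = \<bar>1 + (cmod z)\<^sup>2\<bar> powr (- s)" by (simp add: jbracket_powr)
    moreover have "R\<^sup>2 \<le> (cmod z)\<^sup>2" if "R < cmod z" using that assms by (intro power_mono) auto
    ultimately show "ennreal (jbracket z powr (- 2 * s) * (cmod (if R < cmod z then 1 else 0))\<^sup>2) \<le> ?f ((cmod z)\<^sup>2)"
      by (auto simp: indicator_def)
  qed
  also have "\<dots> = ennreal pi * (\<integral>\<^sup>+t. ?f t * indicator {0..} t \<partial>lborel)"
    by (rule nn_integral_radial) measurable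
  also have "(\<integral>\<^sup>+t. ?f t * indicator {0..} t \<partial>lborel) = (\<integral>\<^sup>+t. ennreal (\<bar>1 + t\<bar> powr (- s)) * indicator {R\<^sup>2..} t \<partial>lborel)"
    by (intro nn_integral_cong) (auto simp: indicator_def intro: order_trans[OF zero_le_power2])
  also have "\<dots> = ennreal (0 - (1 + R\<^sup>2) powr (1 - s) / (1 - s))"
  proof (rule nn_integral_FTC_atLeast)
    fix x :: real assume x: "R\<^sup>2 \<le> x"
    then have x0: "0 \<le> x" using zero_le_power2[of R] by linarith
    have "((\<lambda>t. (1 + t) powr (1 - s) / (1 - s)) has_real_derivative (1 - s) * (1 + x) powr (1 - s - 1) * 1 / (1 - s)) (at x)"
      using x0 assms by (auto intro!: derivative_eq_intros)
    moreover have "(1 - s) * (1 + x) powr (1 - s - 1) * 1 / (1 - s) = \<bar>1 + x\<bar> powr (- s)"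
      using x0 assms by simp
    ultimately show "((\<lambda>t. (1 + t) powr (1 - s) / (1 - s)) has_real_derivative \<bar>1 + x\<bar> powr (- s)) (at x)"
      by (rule DERIV_cong)
  next
    have "((\<lambda>t. (1 + t) powr (1 - s) / (1 - s)) \<longlongrightarrow> 0 / (1 - s)) at_top"
    proof (intro tendsto_divide tendsto_const)
      show "((\<lambda>t. (1 + t) powr (1 - s)) \<longlongrightarrow> 0) at_top" using assms by real_asymp
    qed (use assms in simp)
    then show "((\<lambda>t. (1 + t) powr (1 - s) / (1 - s)) \<longlongrightarrow> 0) at_top" by simp
  qed auto
  also have "\<dots> \<le> ennreal ((R powr (1 - s))\<^sup>2 / (s - 1))"
  proof (rule ennreal_leI)
    have "(1 + R\<^sup>2) powr (1 - s) \<le> (R\<^sup>2) powr (1 - s)"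
      using assms by (intro powr_mono2') auto
    also have "R\<^sup>2 = R powr 2" using assms by simp
    also have "(R powr 2) powr (1 - s) = (R powr (1 - s))\<^sup>2"
      by (simp add: powr_powr power2_eq_square flip: powr_add)
    finally have "(1 + R\<^sup>2) powr (1 - s) / (s - 1) \<le> (R powr (1 - s))\<^sup>2 / (s - 1)"
      using assms by (intro divide_right_mono) auto
    moreover have "0 - (1 + R\<^sup>2) powr (1 - s) / (1 - s) = (1 + R\<^sup>2) powr (1 - s) / (s - 1)"
      using assms by (simp add: field_simps)
    ultimately show "0 - (1 + R\<^sup>2) powr (1 - s) / (1 - s) \<le> (R powr (1 - s))\<^sup>2 / (s - 1)" by simp
  qed
  then have "ennreal pi * ennreal (0 - (1 + R\<^sup>2) powr (1 - s) / (1 - s)) \<le> ennreal pi * ennreal ((R powr (1 - s))\<^sup>2 / (s - 1))"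
    by (intro mult_left_mono) auto
  also have "\<dots> = ennreal (pi / (s - 1) * (R powr (1 - s))\<^sup>2)"
    using assms by (simp flip: ennreal_mult)
  finally show ?thesis .
qed

text \<open>Cauchy-Schwarz between <z>^s g in L2 and <z>^-s on {|z| > R}, whose L2 norm is O(R^(1 -
  s)) in two dimensions. With R = 1 / h this is the source of the rate h^(s - 1).\<close>

lemma integral_tail_bound:
  assumes g: "g \<in> elems (wL2 (- s))" and "1 < s"
  obtains C where "0 \<le> C" "\<And>R. 0 < R \<Longrightarrow> (LINT z|lborel. cmod (if R < cmod z then g z else 0)) \<le> C * R powr (1 - s)"
proof -
  have [measurable]: "g \<in> borel_measurable borel" using g by (simp add: wL2_mem_iff)
  define w where "w = nrm (wL2 (- s)) g"
  have w: "wnorm2 (- s) g = ennreal (w\<^sup>2)" "0 \<le> w"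
    unfolding w_def by (rule wnorm2_eq_nrm[OF g], rule wL2_nrm_nonneg)
  define C where "C = w * sqrt (pi / (s - 1))"
  have C: "0 \<le> C" using w \<open>1 < s\<close> by (simp add: C_def)
  have "(LINT z|lborel. cmod (if R < cmod z then g z else 0)) \<le> C * R powr (1 - s)" if "0 < R" for R
  proof -
    let ?I = "LINT z|lborel. cmod (if R < cmod z then g z else 0)"
    let ?i = "\<lambda>z. if R < cmod z then 1 else (0::complex)"
    have e: "g z * ?i z = (if R < cmod z then g z else 0)" for z by simp
    have i: "integrable lborel (\<lambda>z. if R < cmod z then g z else 0)"
      by (rule Bochner_Integration.integrable_bound[OF integrable_of_wL2[OF g \<open>1 < s\<close>]]) auto
    have "ennreal ?I = (\<integral>\<^sup>+z. ennreal (cmod (g z * ?i z)) \<partial>lborel)"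
      unfolding e by (rule nn_integral_eq_integral[symmetric]) (use integrable_norm[OF i] in auto)
    then have "(ennreal ?I)\<^sup>2 \<le> wnorm2 (- s) g * wnorm2 (- (- s)) ?i"
      by (simp only:) (rule pairing_bound, measurable)
    also have "\<dots> \<le> ennreal (w\<^sup>2) * ennreal (pi / (s - 1) * (R powr (1 - s))\<^sup>2)"
      unfolding w(1) using wnorm2_tail[OF \<open>1 < s\<close> that] by (intro mult_left_mono) auto
    also have "\<dots> = ennreal ((C * R powr (1 - s))\<^sup>2)"
      using w \<open>1 < s\<close> by (simp add: C_def power_mult_distrib mult_ac flip: ennreal_mult)
    finally have "ennreal (?I\<^sup>2) \<le> ennreal ((C * R powr (1 - s))\<^sup>2)" by (simp add: ennreal_power)
    then have "?I\<^sup>2 \<le> (C * R powr (1 - s))\<^sup>2" by (subst (asm) ennreal_le_iff) auto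
    then show ?thesis by (rule power2_le_imp_le) (use C in simp)
  qed
  then show ?thesis by (rule that[OF C])
qed

text \<open>\<open>fourier\<close> carries no prefactor, so the full (2 pi)^2 of two dimensions
  appears here.\<close>

definition inverse_fourier :: "(complex \<Rightarrow> complex) \<Rightarrow> complex \<Rightarrow> complex" where
  "inverse_fourier g z = (LINT \<zeta>|lborel. g \<zeta> * exp (\<i> * of_real (z \<bullet> \<zeta>))) / of_real ((2 * pi)\<^sup>2)"

lemma cmod_inverse_fourier_le:
  assumes "integrable lborel g"
  shows "cmod (inverse_fourier g z) \<le> (LINT \<zeta>|lborel. cmod (g \<zeta>))"
proof -
  have "cmod (LINT \<zeta>|lborel. g \<zeta> * exp (\<i> * of_real (z \<bullet> \<zeta>))) \<le> (LINT \<zeta>|lborel. cmod (g \<zeta> * exp (\<i> * of_real (z \<bullet> \<zeta>))))"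
    by (rule integral_norm_bound)
  also have "\<dots> = (LINT \<zeta>|lborel. cmod (g \<zeta>))" by (simp add: norm_mult)
  finally have "cmod (inverse_fourier g z) \<le> (LINT \<zeta>|lborel. cmod (g \<zeta>)) / (2 * pi)\<^sup>2"
    unfolding inverse_fourier_def norm_divide norm_of_real by (simp add: divide_right_mono)
  also have "\<dots> \<le> (LINT \<zeta>|lborel. cmod (g \<zeta>)) / 1"
  proof (rule divide_left_mono)
    have "1 \<le> 2 * pi" using pi_gt3 by simp
    then show "1 \<le> (2 * pi)\<^sup>2" by (rule one_le_power)
  qed auto
  finally show ?thesis by simp
qed

lemma measurable_inverse_fourier [measurable]:
  assumes [measurable]: "g \<in> borel_measurable borel"
  shows "inverse_fourier g \<in> borel_measurable borel"
  unfolding inverse_fourier_def[abs_def] by measurable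

section \<open>Gaussian mollification\<close>

lemma cmod_gauss_le_1: "0 \<le> c \<Longrightarrow> cmod (gauss c a z) \<le> 1"
  by (simp add: gauss_def norm_exp_eq_Re)

text \<open>The transform computed in \<open>fourier_gauss\<close>, as a kernel in z and a: a
  Gaussian of width 1 / r and total mass (2 pi)^2.\<close>

definition heat :: "real \<Rightarrow> complex \<Rightarrow> complex \<Rightarrow> complex" where
  "heat r z a = of_real (2 * pi * r\<^sup>2 * exp (- (cmod (of_real r * (z - a)))\<^sup>2 / 2))"

lemma measurable_heat [measurable]: "(\<lambda>(z, a). heat r z a) \<in> borel_measurable (borel \<Otimes>\<^sub>M borel)"
  unfolding heat_def by measurable

lemma heat_convolution:
  assumes [measurable]: "\<psi> \<in> borel_measurable borel" and r: "0 < r"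
  shows "(LINT a|lborel. \<psi> a * heat r z a) = (LINT t|lborel. \<psi> (z - of_real (1 / r) * t) * of_real (2 * pi * exp (- (cmod t)\<^sup>2 / 2)))"
proof -
  have "(LINT a|lborel. \<psi> a * heat r z a) = (LINT x|lborel. \<psi> (z - x) * heat r z (z - x))"
    by (rule integral_reflect[symmetric]) (simp add: heat_def)
  also have "\<dots> = (LINT t|lborel. of_real ((1 / r)\<^sup>2) * (\<psi> (z - of_real (1 / r) * t) * heat r z (z - of_real (1 / r) * t)))"
    by (rule integral_scale) (use r in \<open>auto simp: heat_def\<close>)
  also have "\<dots> = (LINT t|lborel. \<psi> (z - of_real (1 / r) * t) * of_real (2 * pi * exp (- (cmod t)\<^sup>2 / 2)))"
  proof (intro Bochner_Integration.integral_cong refl)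
    fix t
    have "of_real r * (z - (z - of_real (1 / r) * t)) = t" using r by simp
    then have "heat r z (z - of_real (1 / r) * t) = of_real (r\<^sup>2) * of_real (2 * pi * exp (- (cmod t)\<^sup>2 / 2))"
      unfolding heat_def by (simp only: of_real_mult mult_ac)
    then show "of_real ((1 / r)\<^sup>2) * (\<psi> (z - of_real (1 / r) * t) * heat r z (z - of_real (1 / r) * t)) =
        \<psi> (z - of_real (1 / r) * t) * of_real (2 * pi * exp (- (cmod t)\<^sup>2 / 2))"
      using r by (simp add: power_divide)
  qed
  finally show ?thesis .
qed

lemma jbracket_scale_le:
  assumes "0 \<le> c" "c \<le> 1"
  shows "jbracket (of_real c * z) \<le> jbracket z"
proof -
  have "cmod (of_real c * z) \<le> 1 * cmod z"
    unfolding norm_mult using assms by (intro mult_right_mono) auto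
  then show ?thesis unfolding jbracket_def by (intro real_sqrt_le_mono add_left_mono power_mono) auto
qed

lemma gaussian_jbracket:
  obtains B where "0 \<le> B" "\<And>t. exp (- (cmod t)\<^sup>2 / 2) \<le> B * jbracket t powr (- 6)"
proof -
  obtain B where B: "0 \<le> B" "\<And>z. jbracket z ^ 6 * exp (- (1/2) * (cmod z)\<^sup>2) \<le> B"
    using jbracket_power_gaussian[of "1/2" 6] by auto
  have "exp (- (cmod t)\<^sup>2 / 2) \<le> B * jbracket t powr (- 6)" for t
  proof -
    have "exp (- (cmod t)\<^sup>2 / 2) = (jbracket t ^ 6 * exp (- (1/2) * (cmod t)\<^sup>2)) * jbracket t powr (- 6)"
      by (simp add: powr_minus powr_numeral)
    also have "\<dots> \<le> B * jbracket t powr (- 6)" by (intro mult_right_mono B) simp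
    finally show ?thesis .
  qed
  then show ?thesis by (rule that[OF B(1)])
qed

lemma jbracket_shift_decay:
  assumes "0 \<le> c" "c \<le> 1"
  shows "jbracket (z - of_real c * t) powr (- 2) \<le> 4 * jbracket t powr 2 * jbracket z powr (- 2)"
proof -
  have "jbracket z \<le> 2 * jbracket (z - of_real c * t) * jbracket (of_real c * t)"
    using jbracket_Peetre[of z "z - of_real c * t"] by simp
  also have "\<dots> \<le> 2 * jbracket (z - of_real c * t) * jbracket t"
    by (intro mult_left_mono jbracket_scale_le assms) simp
  finally have "jbracket z powr 2 \<le> (2 * jbracket (z - of_real c * t) * jbracket t) powr 2"
    by (intro powr_mono2) auto
  also have "\<dots> = 4 * jbracket (z - of_real c * t) powr 2 * jbracket t powr 2"
    by (simp add: powr_mult)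
  finally show ?thesis by (simp add: powr_minus field_simps)
qed

text \<open>The defining identity is tested on modulated Gaussians only. It then equates a
  mollification of u at a with a Gaussian-damped inversion integral of g. Pairing in a with a test
  function and letting n grow identifies u and \<open>inverse_fourier g\<close> as distributions;
  both lie in a common weighted L2 space, where test functions separate elements.\<close>

lemma sobolev_representation:
  assumes u: "u \<in> sobolev s" and "1 < s"
  obtains g where "g \<in> elems (wL2 (- s))" "AE z in lborel. u z = inverse_fourier g z"
proof -
  obtain g where g: "g \<in> elems (wL2 (- s))"
    and test: "\<And>\<phi>. \<phi> \<in> schwartz \<Longrightarrow> (LINT \<zeta>|lborel. u \<zeta> * fourier \<phi> \<zeta>) = (LINT \<zeta>|lborel. g \<zeta> * \<phi> \<zeta>)"
    using u by (auto simp: sobolev_def)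
  have gm [measurable]: "g \<in> borel_measurable borel" using g by (simp add: wL2_mem_iff)
  have gi: "integrable lborel g" by (rule integrable_of_wL2[OF g \<open>1 < s\<close>])
  have um [measurable]: "u \<in> borel_measurable borel" and u2: "u \<in> elems (wL2 0)"
    using u by (simp_all add: sobolev_def L2_iff wL2_mem_iff)
  define G where "G = (LINT \<zeta>|lborel. cmod (g \<zeta>))"
  define U where "U = inverse_fourier g"
  have Um [measurable]: "U \<in> borel_measurable borel" unfolding U_def by measurable
  have UG: "cmod (U z) \<le> G" for z unfolding U_def G_def by (rule cmod_inverse_fourier_le[OF gi])
  have main: "(LINT z|lborel. u z * \<psi> z) = (LINT z|lborel. U z * \<psi> z)" if p: "\<psi> \<in> test_functions" for \<psi>
  proof -
    have pm [measurable]: "\<psi> \<in> borel_measurable borel" by (rule test_borel[OF p])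
    obtain C where C0: "C \<ge> 0" and C: "\<And>z. cmod (\<psi> z) \<le> C * jbracket z powr (- 2)"
      "\<And>z. cmod (dx \<psi> z) \<le> C * jbracket z powr (- 2)" "\<And>z. cmod (dy \<psi> z) \<le> C * jbracket z powr (- 2)"
      using test_bound[OF p, of 2] by blast
    obtain C3 where "C3 \<ge> 0" and C3: "\<And>z. cmod (\<psi> z) \<le> C3 * jbracket z powr (- 3)"
      "\<And>z. cmod (dx \<psi> z) \<le> C3 * jbracket z powr (- 3)" "\<And>z. cmod (dy \<psi> z) \<le> C3 * jbracket z powr (- 3)"
      using test_bound[OF p, of 3] by blast
    have pi: "integrable lborel \<psi>" by (rule integrable_jbracket_bound[OF pm C3(1)]) simp
    obtain B where B: "0 \<le> B" "\<And>t. exp (- (cmod t)\<^sup>2 / 2) \<le> B * jbracket t powr (- 6)"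
      using gaussian_jbracket by blast
    define r where "r n = real (Suc n)" for n
    have r: "0 < r n" "1 \<le> r n" for n by (simp_all add: r_def)
    have ri: "0 \<le> 1 / r n" "1 / r n \<le> 1" for n using r[of n] by (simp_all add: field_simps)
    have r0: "(\<lambda>n. 1 / r n) \<longlonglongrightarrow> 0"
      unfolding r_def using LIMSEQ_inverse_real_of_nat by (simp add: inverse_eq_divide)
    define R where "R n a = (LINT \<zeta>|lborel. g \<zeta> * gauss (1 / (2 * (r n)\<^sup>2)) a \<zeta>)" for n a
    have gaussm [measurable]: "(\<lambda>(a, \<zeta>). gauss c a \<zeta>) \<in> borel_measurable (borel \<Otimes>\<^sub>M borel)" for c
      unfolding gauss_def by measurable
    have Rm [measurable]: "R n \<in> borel_measurable borel" for n unfolding R_def by measurable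
    \<comment> \<open>The defining property of g, applied to the Gaussian with modulation a; this is
      the only place where it is used.\<close>
    have uR: "(LINT z|lborel. u z * heat (r n) z a) = R n a" for n a
      using test[OF gauss_schwartz[of "1 / (2 * (r n)\<^sup>2)" a]] r(1)[of n] unfolding R_def heat_def
      by (simp only: fourier_gauss[OF r(1)]) simp
    have RG: "cmod (R n a) \<le> G" for n a
    proof -
      have "cmod (R n a) \<le> (LINT \<zeta>|lborel. cmod (g \<zeta> * gauss (1 / (2 * (r n)\<^sup>2)) a \<zeta>))"
        unfolding R_def by (rule integral_norm_bound)
      also have "\<dots> \<le> G" unfolding G_def
      proof (rule integral_mono')
        show "integrable lborel (\<lambda>\<zeta>. cmod (g \<zeta>))" by (rule integrable_norm[OF gi])
        show "cmod (g \<zeta> * gauss (1 / (2 * (r n)\<^sup>2)) a \<zeta>) \<le> cmod (g \<zeta>)" for \<zeta>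
          using mult_left_mono[OF cmod_gauss_le_1, of "1 / (2 * (r n)\<^sup>2)" "cmod (g \<zeta>)" a \<zeta>] by (simp add: norm_mult)
      qed simp
      finally show ?thesis .
    qed
    have Rlim: "(\<lambda>n. R n a) \<longlonglongrightarrow> of_real ((2 * pi)\<^sup>2) * U a" for a
    proof -
      have "(\<lambda>n. R n a) \<longlonglongrightarrow> (LINT \<zeta>|lborel. g \<zeta> * exp (\<i> * of_real (a \<bullet> \<zeta>)))"
        unfolding R_def
      proof (rule integral_dominated_convergence[where w="\<lambda>\<zeta>. cmod (g \<zeta>)"])
        show "integrable lborel (\<lambda>\<zeta>. cmod (g \<zeta>))" by (rule integrable_norm[OF gi])
        show "AE \<zeta> in lborel. cmod (g \<zeta> * gauss (1 / (2 * (r n)\<^sup>2)) a \<zeta>) \<le> cmod (g \<zeta>)" for n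
          using mult_left_mono[OF cmod_gauss_le_1, of "1 / (2 * (r n)\<^sup>2)" _ a] by (simp add: norm_mult)
        show "AE \<zeta> in lborel. (\<lambda>n. g \<zeta> * gauss (1 / (2 * (r n)\<^sup>2)) a \<zeta>) \<longlonglongrightarrow> g \<zeta> * exp (\<i> * of_real (a \<bullet> \<zeta>))"
        proof (intro AE_I2 tendsto_mult tendsto_const)
          fix \<zeta>
          have "(\<lambda>n. (1 / r n)\<^sup>2 / 2 * (cmod \<zeta>)\<^sup>2) \<longlonglongrightarrow> 0\<^sup>2 / 2 * (cmod \<zeta>)\<^sup>2"
            by (intro tendsto_intros r0) simp
          then have l: "(\<lambda>n. 1 / (2 * (r n)\<^sup>2) * (cmod \<zeta>)\<^sup>2) \<longlonglongrightarrow> 0"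
            by (simp add: power_divide mult.commute)
          have "(\<lambda>n. exp (- complex_of_real (1 / (2 * (r n)\<^sup>2) * (cmod \<zeta>)\<^sup>2) + \<i> * of_real (a \<bullet> \<zeta>))) \<longlonglongrightarrow>
              exp (- complex_of_real 0 + \<i> * of_real (a \<bullet> \<zeta>))"
            by (intro tendsto_exp tendsto_add tendsto_minus tendsto_of_real l tendsto_const)
          then show "(\<lambda>n. gauss (1 / (2 * (r n)\<^sup>2)) a \<zeta>) \<longlonglongrightarrow> exp (\<i> * of_real (a \<bullet> \<zeta>))"
            unfolding gauss_def by simp
        qed
      qed measurable
      then show ?thesis by (simp add: U_def inverse_fourier_def)
    qed
    have lim1: "(\<lambda>n. LINT a|lborel. \<psi> a * R n a) \<longlonglongrightarrow> (LINT a|lborel. \<psi> a * (of_real ((2 * pi)\<^sup>2) * U a))"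
    proof (rule integral_dominated_convergence[where w="\<lambda>a. cmod (\<psi> a) * G"])
      show "integrable lborel (\<lambda>a. cmod (\<psi> a) * G)" by (intro integrable_mult_left integrable_norm pi)
      show "AE a in lborel. (\<lambda>n. \<psi> a * R n a) \<longlonglongrightarrow> \<psi> a * (of_real ((2 * pi)\<^sup>2) * U a)"
        by (intro AE_I2 tendsto_mult tendsto_const Rlim)
      show "AE a in lborel. cmod (\<psi> a * R n a) \<le> cmod (\<psi> a) * G" for n
        unfolding norm_mult by (intro AE_I2 mult_left_mono RG) simp
    qed measurable
    define P where "P n z = (LINT a|lborel. \<psi> a * heat (r n) z a)" for n z
    have Pm [measurable]: "P n \<in> borel_measurable borel" for n unfolding P_def by measurable
    have Pe: "P n z = (LINT t|lborel. \<psi> (z - of_real (1 / r n) * t) * of_real (2 * pi * exp (- (cmod t)\<^sup>2 / 2)))" for n z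
      unfolding P_def by (rule heat_convolution[OF pm r(1)])
    \<comment> \<open>Peetre's inequality charges <t>^2 for the shift, uniformly in n because 1 / r
      n <= 1; the Gaussian bound <t>^-6 leaves the integrable <t>^-4.\<close>
    have qb: "cmod (\<psi> (z - of_real (1 / r n) * t) * of_real (2 * pi * exp (- (cmod t)\<^sup>2 / 2))) \<le> (C * 8 * pi * B * jbracket z powr (- 2)) * jbracket t powr (- 4)" for n z t
    proof -
      have "cmod (\<psi> (z - of_real (1 / r n) * t)) \<le> C * (4 * jbracket t powr 2 * jbracket z powr (- 2))"
        by (rule order_trans[OF C(1) mult_left_mono[OF jbracket_shift_decay[OF ri] C0]])
      then have "cmod (\<psi> (z - of_real (1 / r n) * t)) * (2 * pi * exp (- (cmod t)\<^sup>2 / 2)) \<le>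
          (C * (4 * jbracket t powr 2 * jbracket z powr (- 2))) * (2 * pi * (B * jbracket t powr (- 6)))"
        using C0 by (intro mult_mono mult_left_mono B) auto
      also have "\<dots> = (C * 8 * pi * B * jbracket z powr (- 2)) * (jbracket t powr 2 * jbracket t powr (- 6))"
        by simp
      also have "jbracket t powr 2 * jbracket t powr (- 6) = jbracket t powr (- 4)"
        by (simp only: jbracket_powr_add) simp
      finally show ?thesis by (simp add: norm_mult)
    qed
    define J where "J = (LINT t|lborel. jbracket t powr (- 4))"
    have Ji: "integrable lborel (\<lambda>t. jbracket t powr (- 4))" by (rule integrable_jbracket_powr) simp
    have Pb: "cmod (P n z) \<le> (C * 8 * pi * B * J) * jbracket z powr (- 2)" for n z
    proof -
      have "cmod (P n z) \<le> (LINT t|lborel. (C * 8 * pi * B * jbracket z powr (- 2)) * jbracket t powr (- 4))"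
        unfolding Pe
        by (rule order_trans[OF integral_norm_bound integral_mono']) (use qb Ji C0 B(1) in \<open>auto intro!: mult_nonneg_nonneg\<close>)
      also have "\<dots> = (C * 8 * pi * B * J) * jbracket z powr (- 2)"
        by (simp add: J_def)
      finally show ?thesis .
    qed
    have Plim: "(\<lambda>n. P n z) \<longlonglongrightarrow> of_real ((2 * pi)\<^sup>2) * \<psi> z" for z
    proof -
      have "(\<lambda>n. P n z) \<longlonglongrightarrow> (LINT t|lborel. \<psi> z * of_real (2 * pi * exp (- (cmod t)\<^sup>2 / 2)))"
        unfolding Pe
      proof (rule integral_dominated_convergence[where w="\<lambda>t. (C * 8 * pi * B * jbracket z powr (- 2)) * jbracket t powr (- 4)"])
        show "integrable lborel (\<lambda>t. (C * 8 * pi * B * jbracket z powr (- 2)) * jbracket t powr (- 4))"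
          using Ji by (rule integrable_mult_right)
        show "AE t in lborel. cmod (\<psi> (z - of_real (1 / r n) * t) * of_real (2 * pi * exp (- (cmod t)\<^sup>2 / 2))) \<le> (C * 8 * pi * B * jbracket z powr (- 2)) * jbracket t powr (- 4)" for n
          by (intro AE_I2 qb)
        show "AE t in lborel. (\<lambda>n. \<psi> (z - of_real (1 / r n) * t) * of_real (2 * pi * exp (- (cmod t)\<^sup>2 / 2))) \<longlonglongrightarrow> \<psi> z * of_real (2 * pi * exp (- (cmod t)\<^sup>2 / 2))"
        proof (intro AE_I2 tendsto_mult tendsto_const)
          fix t
          have "(\<lambda>n. z - complex_of_real (1 / r n) * t) \<longlonglongrightarrow> z - complex_of_real 0 * t"
            by (intro tendsto_intros r0)
          then have l: "(\<lambda>n. z - complex_of_real (1 / r n) * t) \<longlonglongrightarrow> z" by simp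
          have "isCont \<psi> z" using Cinf_continuous[OF test_Cinf[OF p]] by (simp add: continuous_on_eq_continuous_at)
          then show "(\<lambda>n. \<psi> (z - of_real (1 / r n) * t)) \<longlonglongrightarrow> \<psi> z" by (rule isCont_tendsto_compose[OF _ l])
        qed
      qed measurable
      also have "(LINT t|lborel. \<psi> z * of_real (2 * pi * exp (- (cmod t)\<^sup>2 / 2))) = \<psi> z * (of_real (2 * pi) * (LINT t::complex|lborel. of_real (exp (- (cmod t)\<^sup>2 / 2))))"
        by (simp only: of_real_mult integral_mult_right_zero)
      also have "(LINT t::complex|lborel. complex_of_real (exp (- (cmod t)\<^sup>2 / 2))) = of_real (2 * pi)"
        using gaussian_fourier[of 0] by simp
      finally show ?thesis by (simp add: power2_eq_square mult_ac)
    qed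
    have lim2: "(\<lambda>n. LINT z|lborel. u z * P n z) \<longlonglongrightarrow> (LINT z|lborel. u z * (of_real ((2 * pi)\<^sup>2) * \<psi> z))"
    proof (rule integral_dominated_convergence[where w="\<lambda>z. cmod (u z * of_real ((C * 8 * pi * B * J) * jbracket z powr (- 2)))"])
      have J0: "0 \<le> J" unfolding J_def by (rule integral_nonneg_AE) simp
      show "integrable lborel (\<lambda>z. cmod (u z * of_real ((C * 8 * pi * B * J) * jbracket z powr (- 2))))"
      proof (rule integrable_norm, rule integrable_wL2_mult[OF u2, of _ "C * 8 * pi * B * J" 2])
        show "cmod (of_real ((C * 8 * pi * B * J) * jbracket z powr (- 2))) \<le> C * 8 * pi * B * J * jbracket z powr (- 0 - 2)" for z
          using C0 B(1) J0 unfolding norm_of_real by simp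
      qed auto
      show "AE z in lborel. (\<lambda>n. u z * P n z) \<longlonglongrightarrow> u z * (of_real ((2 * pi)\<^sup>2) * \<psi> z)"
        by (intro AE_I2 tendsto_mult tendsto_const Plim)
      show "AE z in lborel. cmod (u z * P n z) \<le> cmod (u z * of_real ((C * 8 * pi * B * J) * jbracket z powr (- 2)))" for n
      proof (rule AE_I2)
        fix z
        have "cmod (P n z) \<le> cmod (of_real ((C * 8 * pi * B * J) * jbracket z powr (- 2)) :: complex)"
          unfolding norm_of_real by (rule order_trans[OF Pb abs_ge_self])
        then show "cmod (u z * P n z) \<le> cmod (u z * of_real ((C * 8 * pi * B * J) * jbracket z powr (- 2)))"
          unfolding norm_mult by (rule mult_left_mono) simp
      qed
    qed measurable
    \<comment> \<open>The kernel is bounded by a multiple of <z>^-2 <z - a>^-4: the first factor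
      makes it integrable against u, which is merely L2, and the second is integrable in a. The
      constant may depend on n.\<close>
    have fub: "(LINT a|lborel. \<psi> a * R n a) = (LINT z|lborel. u z * P n z)" for n
    proof -
      let ?k = "\<lambda>z a. u z * (\<psi> a * heat (r n) z a)"
      have int: "integrable (lborel \<Otimes>\<^sub>M lborel) (\<lambda>(z, a). ?k z a)"
      proof (rule integrableI_bounded)
        show "(\<lambda>(z, a). ?k z a) \<in> borel_measurable (lborel \<Otimes>\<^sub>M lborel)" unfolding heat_def by measurable
        define D where "D = C * (2 * pi * (r n)\<^sup>2 * B) * 4"
        have D: "0 \<le> D" using C0 B(1) by (simp add: D_def)
        have kb: "cmod (\<psi> a * heat (r n) z a) \<le> (D * jbracket z powr (- 2)) * jbracket (z - a) powr (- 4)" for z a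
        proof -
          let ?x = "of_real (r n) * (z - a)"
          have "jbracket (z - a) = jbracket (of_real (1 / r n) * ?x)" using r(1)[of n] by simp
          also have "\<dots> \<le> jbracket ?x" by (rule jbracket_scale_le[OF ri])
          finally have "jbracket ?x powr (- 6) \<le> jbracket (z - a) powr (- 6)" by (intro powr_mono2') auto
          then have e: "exp (- (cmod ?x)\<^sup>2 / 2) \<le> B * jbracket (z - a) powr (- 6)"
            using order_trans[OF B(2)[of ?x] mult_left_mono[OF _ B(1)]] by blast
          have pz: "jbracket a powr (- 2) \<le> 4 * jbracket (z - a) powr 2 * jbracket z powr (- 2)"
            using jbracket_shift_decay[of 1 z "z - a"] by simp
          have "cmod (\<psi> a * heat (r n) z a) = cmod (\<psi> a) * (2 * pi * (r n)\<^sup>2 * exp (- (cmod ?x)\<^sup>2 / 2))"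
            unfolding heat_def norm_mult norm_of_real by simp
          also have "\<dots> \<le> (C * (4 * jbracket (z - a) powr 2 * jbracket z powr (- 2))) * (2 * pi * (r n)\<^sup>2 * (B * jbracket (z - a) powr (- 6)))"
            using C0 by (intro mult_mono mult_left_mono e order_trans[OF C(1) mult_left_mono[OF pz C0]]) auto
          also have "\<dots> = (D * jbracket z powr (- 2)) * (jbracket (z - a) powr 2 * jbracket (z - a) powr (- 6))"
            by (simp add: D_def)
          also have "jbracket (z - a) powr 2 * jbracket (z - a) powr (- 6) = jbracket (z - a) powr (- 4)"
            by (simp only: jbracket_powr_add) simp
          finally show ?thesis .
        qed
        have "(\<integral>\<^sup>+x. ennreal (norm (case x of (z, a) \<Rightarrow> ?k z a)) \<partial>(lborel \<Otimes>\<^sub>M lborel)) =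
            (\<integral>\<^sup>+z. \<integral>\<^sup>+a. ennreal (cmod (?k z a)) \<partial>lborel \<partial>lborel)"
          unfolding heat_def by (subst lborel.nn_integral_fst[symmetric]) (auto simp: case_prod_beta)
        also have "\<dots> \<le> (\<integral>\<^sup>+z. ennreal (cmod (u z) * (D * jbracket z powr (- 2))) * ennreal J \<partial>lborel)"
        proof (rule nn_integral_mono)
          fix z
          have "(\<integral>\<^sup>+a. ennreal (cmod (?k z a)) \<partial>lborel) \<le> (\<integral>\<^sup>+a. ennreal (cmod (u z) * (D * jbracket z powr (- 2))) * ennreal (jbracket (z - a) powr (- 4)) \<partial>lborel)"
          proof (rule nn_integral_mono)
            fix a
            have "cmod (?k z a) \<le> (cmod (u z) * (D * jbracket z powr (- 2))) * jbracket (z - a) powr (- 4)"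
              unfolding norm_mult[of "u z"] using mult_left_mono[OF kb, of "cmod (u z)"] by (simp add: mult.assoc)
            then show "ennreal (cmod (?k z a)) \<le> ennreal (cmod (u z) * (D * jbracket z powr (- 2))) * ennreal (jbracket (z - a) powr (- 4))"
              using D by (subst ennreal_mult[symmetric]) (auto intro: ennreal_leI)
          qed
          also have "\<dots> = ennreal (cmod (u z) * (D * jbracket z powr (- 2))) * (\<integral>\<^sup>+a. ennreal (jbracket (z - a) powr (- 4)) \<partial>lborel)"
            by (rule nn_integral_cmult) measurable
          also have "(\<integral>\<^sup>+a. ennreal (jbracket (z - a) powr (- 4)) \<partial>lborel) = (\<integral>\<^sup>+a. ennreal (jbracket a powr (- 4)) \<partial>lborel)"
            by (rule nn_integral_reflect[of "\<lambda>a. ennreal (jbracket a powr (- 4))"]) measurable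
          also have "\<dots> = ennreal J"
            unfolding J_def by (rule nn_integral_eq_integral[OF Ji]) simp
          finally show "(\<integral>\<^sup>+a. ennreal (cmod (?k z a)) \<partial>lborel) \<le> ennreal (cmod (u z) * (D * jbracket z powr (- 2))) * ennreal J" .
        qed
        also have "\<dots> = (\<integral>\<^sup>+z. ennreal (cmod (u z * of_real (D * jbracket z powr (- 2)))) \<partial>lborel) * ennreal J"
          using D by (subst nn_integral_multc) (auto simp: norm_mult abs_mult)
        also have "\<dots> < \<infinity>"
        proof -
          have "integrable lborel (\<lambda>z. u z * of_real (D * jbracket z powr (- 2)))"
            by (rule integrable_wL2_mult[OF u2, of _ D 2]) (use D in \<open>auto simp: norm_mult abs_mult\<close>)
          then show ?thesis by (simp add: integrable_iff_bounded ennreal_mult_less_top)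
        qed
        finally show "(\<integral>\<^sup>+x. ennreal (norm (case x of (z, a) \<Rightarrow> ?k z a)) \<partial>(lborel \<Otimes>\<^sub>M lborel)) < \<infinity>" .
      qed
      have "(LINT a|lborel. \<psi> a * R n a) = (LINT a|lborel. LINT z|lborel. ?k z a)"
        unfolding uR[symmetric] by (simp only: integral_mult_right_zero[symmetric] mult.left_commute)
      also have "\<dots> = (LINT z|lborel. LINT a|lborel. ?k z a)"
        by (rule lborel_pair.Fubini_integral[OF int])
      also have "\<dots> = (LINT z|lborel. u z * P n z)"
        unfolding P_def by (simp only: integral_mult_right_zero)
      finally show ?thesis .
    qed
    have "(LINT z|lborel. u z * (of_real ((2 * pi)\<^sup>2) * \<psi> z)) = (LINT a|lborel. \<psi> a * (of_real ((2 * pi)\<^sup>2) * U a))"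
      using LIMSEQ_unique[OF lim2] lim1 unfolding fub by blast
    moreover have "(LINT z|lborel. u z * (of_real ((2 * pi)\<^sup>2) * \<psi> z)) = of_real ((2 * pi)\<^sup>2) * (LINT z|lborel. u z * \<psi> z)"
      unfolding mult.left_commute[of "u _"] by (rule integral_mult_right_zero)
    moreover have "(LINT a|lborel. \<psi> a * (of_real ((2 * pi)\<^sup>2) * U a)) = of_real ((2 * pi)\<^sup>2) * (LINT z|lborel. U z * \<psi> z)"
      unfolding mult.left_commute[of "\<psi> _"] mult.commute[of "\<psi> _" "U _"] by (rule integral_mult_right_zero)
    ultimately have "of_real ((2 * pi)\<^sup>2) * (LINT z|lborel. u z * \<psi> z) = of_real ((2 * pi)\<^sup>2) * (LINT z|lborel. U z * \<psi> z)"
      by (simp only:)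
    then show ?thesis by (subst (asm) mult_cancel_left) simp
  qed
  \<comment> \<open>U is known only to be bounded, so u and U are compared in <z>^2 L2, which
    contains both.\<close>
  have U2: "U \<in> elems (wL2 2)"
  proof -
    have "wnorm2 2 U \<le> ennreal (G\<^sup>2) * wnorm2 (2 - 0) (\<lambda>z. 1)"
      by (rule wnorm2_le_cmult) (use UG in auto)
    also have "\<dots> < \<infinity>"
      using nn_integral_jbracket_powr[of 4] by (simp add: wnorm2_def ennreal_mult_less_top)
    finally show ?thesis by (simp add: wL2_mem_iff)
  qed
  have u2': "u \<in> elems (wL2 2)"
    using u2 wnorm2_mono_weight[of 0 2 u] by (auto simp: wL2_mem_iff)
  define W where "W z = u z + (- 1) * U z" for z
  have W: "W \<in> elems (wL2 2)"
    unfolding W_def[abs_def] by (intro wL2_add wL2_cmult u2' U2)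
  have "AE z in lborel. W z = 0"
  proof (rule wL2_eq_0_of_test[OF W])
    fix \<psi> assume p: "\<psi> \<in> test_functions"
    obtain C where "C \<ge> 0" and C: "\<And>z. cmod (\<psi> z) \<le> C * jbracket z powr (- 4)"
      "\<And>z. cmod (dx \<psi> z) \<le> C * jbracket z powr (- 4)" "\<And>z. cmod (dy \<psi> z) \<le> C * jbracket z powr (- 4)"
      using test_bound[OF p, of 4] by blast
    have "integrable lborel (\<lambda>z. u z * \<psi> z)" "integrable lborel (\<lambda>z. U z * \<psi> z)"
      by (rule integrable_wL2_mult[OF u2' test_borel[OF p], of C 2] integrable_wL2_mult[OF U2 test_borel[OF p], of C 2];
        use C in simp)+
    then show "(LINT z|lborel. W z * \<psi> z) = 0"
      using main[OF p] by (simp add: W_def left_diff_distrib)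
  qed
  then have "AE z in lborel. u z = inverse_fourier g z"
    by eventually_elim (simp add: W_def U_def)
  then show ?thesis by (rule that[OF g])
qed

section \<open>Low frequencies\<close>

lemma integrable_mult_bounded:
  fixes b :: "'a \<Rightarrow> complex"
  assumes g: "integrable M g" and [measurable]: "b \<in> borel_measurable M" and b: "\<And>x. cmod (b x) \<le> B"
  shows "integrable M (\<lambda>x. g x * b x)"
proof (rule Bochner_Integration.integrable_bound)
  have [measurable]: "g \<in> borel_measurable M" using g by auto
  show "integrable M (\<lambda>x. of_real B * g x)" by (intro integrable_mult_right g)
  show "AE x in M. cmod (g x * b x) \<le> cmod (of_real B * g x)"
  proof (rule AE_I2)
    fix x
    have "cmod (b x) \<le> \<bar>B\<bar>" using b[of x] by linarith
    then have "cmod (g x) * cmod (b x) \<le> cmod (g x) * \<bar>B\<bar>" by (rule mult_left_mono) simp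
    then show "cmod (g x * b x) \<le> cmod (of_real B * g x)" by (simp add: norm_mult mult.commute)
  qed
  show "(\<lambda>x. g x * b x) \<in> borel_measurable M" by measurable
qed

text \<open>Boundedness of the frequencies m by R makes the second order Taylor remainder of the
  exponential at most (R |h|)^2 uniformly, so the error is O(|h|^2) at once.\<close>

lemma oscillatory_integral:
  fixes m :: "complex \<Rightarrow> complex"
  assumes g: "integrable lborel \<gamma>" and [measurable]: "m \<in> borel_measurable borel" and m: "\<And>\<zeta>. cmod (m \<zeta>) \<le> R"
  defines "F \<equiv> \<lambda>\<gamma> z. LINT \<zeta>|lborel. \<gamma> \<zeta> * exp (\<i> * of_real (z \<bullet> m \<zeta>))"
  shows "(F \<gamma> has_derivative (\<lambda>h. of_real (Re h) * F (\<lambda>\<zeta>. \<gamma> \<zeta> * (\<i> * of_real (Re (m \<zeta>)))) z + of_real (Im h) * F (\<lambda>\<zeta>. \<gamma> \<zeta> * (\<i> * of_real (Im (m \<zeta>)))) z)) (at z)"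
proof -
  have gm [measurable]: "\<gamma> \<in> borel_measurable borel" using g by auto
  have R: "0 \<le> R" using order_trans[OF norm_ge_zero m[of 0]] .
  note bound = integrable_mult_bounded[OF g]
  let ?e = "\<lambda>z \<zeta>. exp (\<i> * of_real (z \<bullet> m \<zeta>))"
  have i0: "integrable lborel (\<lambda>\<zeta>. \<gamma> \<zeta> * ?e z \<zeta>)" for z
    by (rule bound[where B=1]) auto
  have i1: "integrable lborel (\<lambda>\<zeta>. \<gamma> \<zeta> * (\<i> * of_real (Re (m \<zeta>))) * ?e z \<zeta>)" for z
    unfolding mult.assoc by (rule bound[where B=R]) (auto simp: norm_mult intro: order_trans[OF abs_Re_le_cmod m])
  have i2: "integrable lborel (\<lambda>\<zeta>. \<gamma> \<zeta> * (\<i> * of_real (Im (m \<zeta>))) * ?e z \<zeta>)" for z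
    unfolding mult.assoc by (rule bound[where B=R]) (auto simp: norm_mult intro: order_trans[OF abs_Im_le_cmod m])
  let ?L = "\<lambda>h. of_real (Re h) * F (\<lambda>\<zeta>. \<gamma> \<zeta> * (\<i> * of_real (Re (m \<zeta>)))) z + of_real (Im h) * F (\<lambda>\<zeta>. \<gamma> \<zeta> * (\<i> * of_real (Im (m \<zeta>)))) z"
  have bl: "bounded_linear ?L"
    by (intro bounded_linear_add bounded_linear_mult_left bounded_linear_compose[OF bounded_linear_of_real]
      bounded_linear_compose[OF bounded_linear_mult_left] bounded_linear_Re bounded_linear_Im)
  define G where "G = (LINT \<zeta>|lborel. cmod (\<gamma> \<zeta>))"
  have le: "cmod (F \<gamma> (z + h) - F \<gamma> z - ?L h) \<le> G * R\<^sup>2 * (cmod h)\<^sup>2" for h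
  proof -
    let ?r = "\<lambda>\<zeta>. \<gamma> \<zeta> * (?e (z + h) \<zeta> - ?e z \<zeta> - \<i> * of_real (h \<bullet> m \<zeta>) * ?e z \<zeta>)"
    have eq1: "F \<gamma> (z + h) - F \<gamma> z - ?L h = (LINT \<zeta>|lborel. \<gamma> \<zeta> * ?e (z + h) \<zeta> - \<gamma> \<zeta> * ?e z \<zeta> -
        (of_real (Re h) * (\<gamma> \<zeta> * (\<i> * of_real (Re (m \<zeta>))) * ?e z \<zeta>) + of_real (Im h) * (\<gamma> \<zeta> * (\<i> * of_real (Im (m \<zeta>))) * ?e z \<zeta>)))"
      unfolding F_def
      by (simp only: Bochner_Integration.integral_diff Bochner_Integration.integral_add integral_mult_right_zero i0 i1 i2
        integrable_mult_right Bochner_Integration.integrable_diff Bochner_Integration.integrable_add)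
    have eq2: "(LINT \<zeta>|lborel. \<gamma> \<zeta> * ?e (z + h) \<zeta> - \<gamma> \<zeta> * ?e z \<zeta> -
        (of_real (Re h) * (\<gamma> \<zeta> * (\<i> * of_real (Re (m \<zeta>))) * ?e z \<zeta>) + of_real (Im h) * (\<gamma> \<zeta> * (\<i> * of_real (Im (m \<zeta>))) * ?e z \<zeta>))) =
        (LINT \<zeta>|lborel. ?r \<zeta>)"
      by (intro Bochner_Integration.integral_cong refl) (simp add: inner_complex_def algebra_simps)
    have "cmod (F \<gamma> (z + h) - F \<gamma> z - ?L h) \<le> (LINT \<zeta>|lborel. cmod (?r \<zeta>))"
      unfolding eq1 eq2 by (rule integral_norm_bound)
    also have "\<dots> \<le> (LINT \<zeta>|lborel. cmod (\<gamma> \<zeta>) * (R * cmod h)\<^sup>2)"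
    proof (rule integral_mono')
      show "integrable lborel (\<lambda>\<zeta>. cmod (\<gamma> \<zeta>) * (R * cmod h)\<^sup>2)"
        by (rule integrable_mult_left) (rule integrable_norm[OF g])
      fix \<zeta>
      let ?t = "h \<bullet> m \<zeta>"
      have "?e (z + h) \<zeta> - ?e z \<zeta> - \<i> * of_real ?t * ?e z \<zeta> = ?e z \<zeta> * (exp (\<i> * of_real ?t) - (1 + \<i> * of_real ?t))"
        by (simp add: inner_add_left distrib_left exp_add algebra_simps)
      then have "cmod (?e (z + h) \<zeta> - ?e z \<zeta> - \<i> * of_real ?t * ?e z \<zeta>) = cmod (exp (\<i> * of_real ?t) - (1 + \<i> * of_real ?t))"
        by (simp add: norm_mult)
      \<comment> \<open>Taylor's bound |exp(i t) - 1 - i t| <= t^2 / 2.\<close>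
      also have "\<dots> \<le> ?t\<^sup>2 / 2"
        using iexp_approx1[of ?t 1] by (simp add: power2_eq_square)
      also have "\<dots> \<le> \<bar>?t\<bar>\<^sup>2" by simp
      also have "\<dots> \<le> (R * cmod h)\<^sup>2"
      proof (rule power_mono)
        have "\<bar>?t\<bar> \<le> cmod h * cmod (m \<zeta>)" by (rule Cauchy_Schwarz_ineq2)
        also have "\<dots> \<le> cmod h * R" by (intro mult_left_mono m) simp
        finally show "\<bar>?t\<bar> \<le> R * cmod h" by (simp add: mult.commute)
      qed simp
      finally show "cmod (?r \<zeta>) \<le> cmod (\<gamma> \<zeta>) * (R * cmod h)\<^sup>2"
        unfolding norm_mult[of "\<gamma> \<zeta>"] by (rule mult_left_mono) simp
    qed simp
    also have "\<dots> = G * R\<^sup>2 * (cmod h)\<^sup>2"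
      by (simp add: G_def power_mult_distrib mult.assoc)
    finally show ?thesis .
  qed
  have "((\<lambda>h. norm (F \<gamma> (z + h) - F \<gamma> z - ?L h) / norm h) \<longlongrightarrow> 0) (at 0)"
  proof (rule Lim_null_comparison)
    show "\<forall>\<^sub>F h in at 0. norm (norm (F \<gamma> (z + h) - F \<gamma> z - ?L h) / norm h) \<le> G * R\<^sup>2 * cmod h"
    proof (rule eventually_at_filter[THEN iffD2], rule always_eventually, intro allI impI)
      fix h :: complex assume h: "h \<noteq> 0"
      have "norm (norm (F \<gamma> (z + h) - F \<gamma> z - ?L h) / norm h) = norm (F \<gamma> (z + h) - F \<gamma> z - ?L h) / norm h" by simp
      also have "\<dots> \<le> (G * R\<^sup>2 * (cmod h)\<^sup>2) / norm h" by (intro divide_right_mono le) simp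
      also have "\<dots> = G * R\<^sup>2 * cmod h" using h by (simp add: power2_eq_square)
      finally show "norm (norm (F \<gamma> (z + h) - F \<gamma> z - ?L h) / norm h) \<le> G * R\<^sup>2 * cmod h" .
    qed
    have "((\<lambda>h. G * R\<^sup>2 * cmod h) \<longlongrightarrow> G * R\<^sup>2 * cmod 0) (at (0::complex))"
      by (intro tendsto_intros)
    then show "((\<lambda>h. G * R\<^sup>2 * cmod h) \<longlongrightarrow> 0) (at (0::complex))" by simp
  qed
  then show ?thesis unfolding has_derivative_at using bl by blast
qed

text \<open>Both partial derivatives are integrals of the same kind, with \<gamma> multiplied by a
  bounded function. The differentiability result thus applies to them as well and supplies their
  continuity and their bounds.\<close>

lemma oscillatory_integral_Ck:
  fixes m :: "complex \<Rightarrow> complex"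
  assumes g: "integrable lborel \<gamma>" and mm [measurable]: "m \<in> borel_measurable borel" and m: "\<And>\<zeta>. cmod (m \<zeta>) \<le> R"
  defines "F \<equiv> \<lambda>\<gamma> z. LINT \<zeta>|lborel. \<gamma> \<zeta> * exp (\<i> * of_real (z \<bullet> m \<zeta>))"
  shows "Ck 1 (F \<gamma>)" "cmod (F \<gamma> z) \<le> (LINT \<zeta>|lborel. cmod (\<gamma> \<zeta>))"
    "delbar (F \<gamma>) z = (LINT \<zeta>|lborel. \<gamma> \<zeta> * (\<i> * m \<zeta> / 2) * exp (\<i> * of_real (z \<bullet> m \<zeta>)))"
    "\<exists>M'. \<forall>z. cmod (dx (F \<gamma>) z) \<le> M' \<and> cmod (dy (F \<gamma>) z) \<le> M'"
proof -
  have gm [measurable]: "\<gamma> \<in> borel_measurable borel" using g by auto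
  note bound = integrable_mult_bounded[OF g]
  let ?gx = "\<lambda>\<zeta>. \<gamma> \<zeta> * (\<i> * of_real (Re (m \<zeta>)))" and ?gy = "\<lambda>\<zeta>. \<gamma> \<zeta> * (\<i> * of_real (Im (m \<zeta>)))"
  have gx: "integrable lborel ?gx" by (rule bound[where B=R]) (auto simp: norm_mult intro: order_trans[OF abs_Re_le_cmod m])
  have gy: "integrable lborel ?gy" by (rule bound[where B=R]) (auto simp: norm_mult intro: order_trans[OF abs_Im_le_cmod m])
  have D: "(F \<gamma> has_derivative (\<lambda>h. of_real (Re h) * F (\<lambda>\<zeta>. \<gamma> \<zeta> * (\<i> * of_real (Re (m \<zeta>)))) z + of_real (Im h) * F (\<lambda>\<zeta>. \<gamma> \<zeta> * (\<i> * of_real (Im (m \<zeta>)))) z)) (at z)"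
    if "integrable lborel \<gamma>" for \<gamma> z
    unfolding F_def by (rule oscillatory_integral[OF that mm m])
  have d: "F \<gamma> differentiable (at z)" if "integrable lborel \<gamma>" for \<gamma> z
    using D[OF that] differentiable_def by blast
  have e: "dx (F \<gamma>) = F ?gx" "dy (F \<gamma>) = F ?gy"
    using has_derivative_imp_dx_dy[OF D[OF g]] by (simp_all add: fun_eq_iff)
  show "Ck 1 (F \<gamma>)"
    using d[OF g] continuous_differentiable[OF d[OF gx]] continuous_differentiable[OF d[OF gy]]
    by (simp add: e differentiable_on_def)
  have nb: "cmod (F \<gamma> z) \<le> (LINT \<zeta>|lborel. cmod (\<gamma> \<zeta>))" for \<gamma> z
  proof -
    have "cmod (F \<gamma> z) \<le> (LINT \<zeta>|lborel. cmod (\<gamma> \<zeta> * exp (\<i> * of_real (z \<bullet> m \<zeta>))))"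
      unfolding F_def by (rule integral_norm_bound)
    then show ?thesis by (simp add: norm_mult)
  qed
  show "cmod (F \<gamma> z) \<le> (LINT \<zeta>|lborel. cmod (\<gamma> \<zeta>))" by (rule nb)
  show "\<exists>M'. \<forall>z. cmod (dx (F \<gamma>) z) \<le> M' \<and> cmod (dy (F \<gamma>) z) \<le> M'"
    unfolding e
    by (intro exI[of _ "max (LINT \<zeta>|lborel. cmod (?gx \<zeta>)) (LINT \<zeta>|lborel. cmod (?gy \<zeta>))"] allI conjI)
      (rule order_trans[OF nb max.cobounded1] order_trans[OF nb max.cobounded2])+
  have i: "integrable lborel (\<lambda>\<zeta>. ?gx \<zeta> * exp (\<i> * of_real (z \<bullet> m \<zeta>)))" "integrable lborel (\<lambda>\<zeta>. \<i> * (?gy \<zeta> * exp (\<i> * of_real (z \<bullet> m \<zeta>))))"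
  proof -
    show "integrable lborel (\<lambda>\<zeta>. ?gx \<zeta> * exp (\<i> * of_real (z \<bullet> m \<zeta>)))"
      unfolding mult.assoc by (rule bound[where B=R]) (auto simp: norm_mult intro: order_trans[OF abs_Re_le_cmod m])
    have "integrable lborel (\<lambda>\<zeta>. ?gy \<zeta> * exp (\<i> * of_real (z \<bullet> m \<zeta>)))"
      unfolding mult.assoc by (rule bound[where B=R]) (auto simp: norm_mult intro: order_trans[OF abs_Im_le_cmod m])
    then show "integrable lborel (\<lambda>\<zeta>. \<i> * (?gy \<zeta> * exp (\<i> * of_real (z \<bullet> m \<zeta>))))" by (rule integrable_mult_right)
  qed
  have "delbar (F \<gamma>) z = (LINT \<zeta>|lborel. ?gx \<zeta> * exp (\<i> * of_real (z \<bullet> m \<zeta>)) + \<i> * (?gy \<zeta> * exp (\<i> * of_real (z \<bullet> m \<zeta>)))) / 2"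
    unfolding delbar_def e unfolding F_def Bochner_Integration.integral_add[OF i] integral_mult_right_zero ..
  also have "\<dots> = (LINT \<zeta>|lborel. (?gx \<zeta> * exp (\<i> * of_real (z \<bullet> m \<zeta>)) + \<i> * (?gy \<zeta> * exp (\<i> * of_real (z \<bullet> m \<zeta>)))) / 2)"
    by (rule integral_divide_zero[symmetric])
  also have "\<dots> = (LINT \<zeta>|lborel. \<gamma> \<zeta> * (\<i> * m \<zeta> / 2) * exp (\<i> * of_real (z \<bullet> m \<zeta>)))"
  proof (intro Bochner_Integration.integral_cong refl)
    fix \<zeta>
    have "m \<zeta> = of_real (Re (m \<zeta>)) + \<i> * of_real (Im (m \<zeta>))" by (rule complex_eq)
    moreover have "(\<gamma> \<zeta> * (\<i> * a) * e + \<i> * (\<gamma> \<zeta> * (\<i> * b) * e)) / 2 = \<gamma> \<zeta> * (\<i> * c / 2) * e"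
      if "c = a + \<i> * b" for a b c e :: complex
      unfolding that by (simp add: field_simps)
    ultimately show "(?gx \<zeta> * exp (\<i> * of_real (z \<bullet> m \<zeta>)) + \<i> * (?gy \<zeta> * exp (\<i> * of_real (z \<bullet> m \<zeta>)))) / 2 =
        \<gamma> \<zeta> * (\<i> * m \<zeta> / 2) * exp (\<i> * of_real (z \<bullet> m \<zeta>))"
      by blast
  qed
  finally show "delbar (F \<gamma>) z = (LINT \<zeta>|lborel. \<gamma> \<zeta> * (\<i> * m \<zeta> / 2) * exp (\<i> * of_real (z \<bullet> m \<zeta>)))" .
qed

text \<open>The unimodular multiplier of \<open>tau_minus\<close>; its conjugate is that of
  \<open>tau_plus\<close>. As a plane wave it has frequency - \<open>omega k\<close> / h, of modulus
  2 / h.\<close>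

definition phase :: "complex \<Rightarrow> complex \<Rightarrow> complex" where
  "phase k z = exp (- (\<i> / of_real (hpar k) * of_real (Re (z * cnj (omega k)))))"

lemma phase_eq: "phase k z = exp (\<i> * of_real (z \<bullet> (- of_real (1 / hpar k) * omega k)))"
proof -
  have "z \<bullet> (- of_real r * w) = - (r * Re (z * cnj w))" for r w
    by (simp add: inner_complex_def algebra_simps)
  then show ?thesis unfolding phase_def by (simp only:) simp
qed

lemma cnj_phase: "cnj (phase k z) = exp (\<i> / of_real (hpar k) * of_real (Re (z * cnj (omega k))))"
  by (simp add: phase_def exp_cnj)

lemma cmod_phase [simp]: "cmod (phase k z) = 1"
  unfolding phase_eq by (rule exp_i_norm)

lemma measurable_phase [measurable]: "phase k \<in> borel_measurable borel"
  unfolding phase_def[abs_def] by measurable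

lemma cmod_omega: "k \<noteq> 0 \<Longrightarrow> cmod (omega k) = 2"
  by (simp add: omega_def norm_mult norm_divide)

lemma hpar_pos_iff: "0 < hpar k \<longleftrightarrow> k \<noteq> 0"
  by (simp add: hpar_def)

text \<open>On frequencies at most \<open>1 / h\<close> the shifted frequency \<open>\<zeta> - \<omega> / h\<close> stays at distance \<open>1 / h\<close> from \<open>0\<close>.\<close>

lemma low_frequency_primitive:
  assumes g: "integrable lborel g" and k: "0 < hpar k"
  obtains V M' where "Ck 1 V" "\<And>z. cmod (V z) \<le> 2 * hpar k * (LINT \<zeta>|lborel. cmod (g \<zeta>))"
    "\<And>z. cmod (dx V z) \<le> M'" "\<And>z. cmod (dy V z) \<le> M'"
    "\<And>z. delbar V z = phase k z * inverse_fourier (\<lambda>\<zeta>. if 1 / hpar k < cmod \<zeta> then 0 else g \<zeta>) z"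
proof -
  have [measurable]: "g \<in> borel_measurable borel" using g by auto
  define h where "h = hpar k"
  have h: "0 < h" using k by (simp add: h_def)
  define \<kappa> where "\<kappa> = of_real (1 / h) * omega k"
  have \<kappa>: "cmod \<kappa> = 2 / h"
    using h k by (simp add: \<kappa>_def norm_mult norm_divide cmod_omega hpar_pos_iff)
  \<comment> \<open>Set to 0 beyond the cut to keep the frequency function bounded; \<gamma>
    vanishes there, so the integral does not notice.\<close>
  define m where "m \<zeta> = (if 1 / h < cmod \<zeta> then 0 else \<zeta> - \<kappa>)" for \<zeta>
  have mm: "m \<in> borel_measurable borel" unfolding m_def[abs_def] by measurable
  have mR: "cmod (m \<zeta>) \<le> 3 / h" for \<zeta>
    using norm_triangle_ineq4[of \<zeta> \<kappa>] \<kappa> h by (auto simp: m_def field_simps)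
  have ml: "1 / h \<le> cmod (\<zeta> - \<kappa>)" if "\<not> 1 / h < cmod \<zeta>" for \<zeta>
  proof -
    have "2 / h \<le> cmod \<zeta> + cmod (\<zeta> - \<kappa>)"
      using norm_triangle_sub[of \<kappa> \<zeta>] \<kappa> by (simp add: norm_minus_commute)
    moreover have "2 / h = 1 / h + 1 / h" by simp
    ultimately show ?thesis using that by linarith
  qed
  \<comment> \<open>i (\<zeta> - \<kappa>) / 2 is the symbol of dbar at the shifted frequency.
    Dividing by it costs at most 2 h, since |\<zeta> - \<kappa>| >= 1 / h on the support; the other
    divisor is the normalisation of \<open>inverse_fourier\<close>.\<close>
  define \<gamma> where "\<gamma> \<zeta> = (if 1 / h < cmod \<zeta> then 0 else g \<zeta> * (2 / (\<i> * (\<zeta> - \<kappa>))) / of_real ((2 * pi)\<^sup>2))" for \<zeta>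
  have \<gamma>m: "\<gamma> \<in> borel_measurable borel" unfolding \<gamma>_def[abs_def] by measurable
  have \<gamma>b: "cmod (\<gamma> \<zeta>) \<le> 2 * h * cmod (g \<zeta>)" for \<zeta>
  proof (cases "1 / h < cmod \<zeta>")
    case False
    have p1: "1 \<le> (2 * pi)\<^sup>2"
    proof (rule one_le_power)
      show "1 \<le> 2 * pi" using pi_gt3 by simp
    qed
    have l: "1 / h \<le> cmod (\<zeta> - \<kappa>)" by (rule ml[OF False])
    then have "2 / cmod (\<zeta> - \<kappa>) \<le> 2 / (1 / h)"
      using h by (intro divide_left_mono mult_pos_pos) (auto intro: less_le_trans)
    then have "2 / cmod (\<zeta> - \<kappa>) \<le> 2 * h" by simp
    then have "cmod (g \<zeta>) * (2 / cmod (\<zeta> - \<kappa>)) / (2 * pi)\<^sup>2 \<le> cmod (g \<zeta>) * (2 * h) / 1"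
      using p1 h by (intro frac_le mult_left_mono) auto
    moreover have "cmod (\<gamma> \<zeta>) = cmod (g \<zeta>) * (2 / cmod (\<zeta> - \<kappa>)) / (2 * pi)\<^sup>2"
      using False by (simp add: \<gamma>_def norm_mult norm_divide norm_power)
    ultimately show ?thesis by (simp add: mult_ac)
  qed (use h in \<open>simp add: \<gamma>_def\<close>)
  have \<gamma>i: "integrable lborel \<gamma>"
  proof (rule Bochner_Integration.integrable_bound[of _ "\<lambda>\<zeta>. of_real (2 * h) * g \<zeta>"])
    show "integrable lborel (\<lambda>\<zeta>. of_real (2 * h) * g \<zeta>)" by (intro integrable_mult_right g)
    show "AE \<zeta> in lborel. cmod (\<gamma> \<zeta>) \<le> cmod (of_real (2 * h) * g \<zeta>)"
      using \<gamma>b h by (simp add: norm_mult)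
  qed (use \<gamma>m in simp)
  define V where "V z = (LINT \<zeta>|lborel. \<gamma> \<zeta> * exp (\<i> * of_real (z \<bullet> m \<zeta>)))" for z
  note O = oscillatory_integral_Ck[OF \<gamma>i mm mR, folded V_def[abs_def]]
  obtain M' where M': "\<And>z. cmod (dx V z) \<le> M'" "\<And>z. cmod (dy V z) \<le> M'"
    using O(4) by blast
  have Vb: "cmod (V z) \<le> 2 * hpar k * (LINT \<zeta>|lborel. cmod (g \<zeta>))" for z
  proof -
    have "cmod (V z) \<le> (LINT \<zeta>|lborel. cmod (\<gamma> \<zeta>))"
      unfolding V_def by (rule oscillatory_integral_Ck(2)[OF \<gamma>i mm mR])
    also have "\<dots> \<le> (LINT \<zeta>|lborel. 2 * h * cmod (g \<zeta>))"
      by (intro integral_mono integrable_norm \<gamma>i integrable_mult_right g \<gamma>b)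
    also have "\<dots> = 2 * hpar k * (LINT \<zeta>|lborel. cmod (g \<zeta>))" by (simp add: h_def)
    finally show ?thesis .
  qed
  have Vd: "delbar V z = phase k z * inverse_fourier (\<lambda>\<zeta>. if 1 / hpar k < cmod \<zeta> then 0 else g \<zeta>) z" for z
  proof -
    have "delbar V z = (LINT \<zeta>|lborel. \<gamma> \<zeta> * (\<i> * m \<zeta> / 2) * exp (\<i> * of_real (z \<bullet> m \<zeta>)))" by (rule O(3))
    also have "\<dots> = (LINT \<zeta>|lborel. phase k z * (((if 1 / h < cmod \<zeta> then 0 else g \<zeta>) * exp (\<i> * of_real (z \<bullet> \<zeta>))) / of_real ((2 * pi)\<^sup>2)))"
    proof (intro Bochner_Integration.integral_cong refl)
      fix \<zeta>
      show "\<gamma> \<zeta> * (\<i> * m \<zeta> / 2) * exp (\<i> * of_real (z \<bullet> m \<zeta>)) =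
          phase k z * (((if 1 / h < cmod \<zeta> then 0 else g \<zeta>) * exp (\<i> * of_real (z \<bullet> \<zeta>))) / of_real ((2 * pi)\<^sup>2))"
      proof (cases "1 / h < cmod \<zeta>")
        case False
        have "0 < 1 / h" using h by simp
        then have nz: "\<zeta> - \<kappa> \<noteq> 0" using ml[OF False] by auto
        have "z \<bullet> (\<zeta> - \<kappa>) = z \<bullet> (- of_real (1 / h) * omega k) + z \<bullet> \<zeta>"
          by (simp add: \<kappa>_def inner_diff_right)
        then have "exp (\<i> * of_real (z \<bullet> (\<zeta> - \<kappa>))) = phase k z * exp (\<i> * of_real (z \<bullet> \<zeta>))"
          unfolding phase_eq h_def[symmetric] by (simp only: of_real_add distrib_left exp_add)
        moreover have "\<gamma> \<zeta> * (\<i> * m \<zeta> / 2) = g \<zeta> / of_real ((2 * pi)\<^sup>2)"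
          using False nz by (simp add: \<gamma>_def m_def)
        ultimately show ?thesis using False by (simp add: m_def)
      qed (simp add: \<gamma>_def)
    qed
    also have "\<dots> = phase k z * inverse_fourier (\<lambda>\<zeta>. if 1 / hpar k < cmod \<zeta> then 0 else g \<zeta>) z"
      unfolding inverse_fourier_def h_def[symmetric] by (simp only: integral_mult_right_zero integral_divide_zero)
    finally show ?thesis .
  qed
  show ?thesis by (rule that[OF O(1) Vb M' Vd])
qed

section \<open>The operators and the system\<close>

lemma wL2_le_multI:
  assumes "u \<in> elems (wL2 \<theta>)" "f \<in> borel_measurable borel" "wnorm2 \<theta>' f \<le> ennreal (D\<^sup>2) * wnorm2 \<theta> u" "0 \<le> D"
  shows "f \<in> elems (wL2 \<theta>')" "nrm (wL2 \<theta>') f \<le> D * nrm (wL2 \<theta>) u"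
proof -
  have "wnorm2 \<theta>' f \<le> ennreal ((D * nrm (wL2 \<theta>) u)\<^sup>2)"
    using assms(3) unfolding wnorm2_eq_nrm[OF assms(1)] by (simp add: ennreal_mult[symmetric] power_mult_distrib)
  from wL2_leI[OF assms(2) this mult_nonneg_nonneg[OF assms(4) wL2_nrm_nonneg]]
  show "f \<in> elems (wL2 \<theta>')" "nrm (wL2 \<theta>') f \<le> D * nrm (wL2 \<theta>) u" .
qed

lemma wL2_cnj [simp]: "nrm (wL2 \<theta>) (\<lambda>z. cnj (u z)) = nrm (wL2 \<theta>) u"
  by (simp add: wL2_def L2norm_def weight_def norm_mult)

lemma wL2_cnj_mem: "u \<in> elems (wL2 \<theta>) \<Longrightarrow> (\<lambda>z. cnj (u z)) \<in> elems (wL2 \<theta>)"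
  by (auto simp: wL2_mem_iff)

lemma opE_cauchy: "opE k v z = 1 / of_real (pi * hpar k) * cauchy v z"
  by (simp add: opE_def cauchy_def)

lemma opF_cauchy_bar: "opF k v z = 1 / of_real (pi * hpar k) * cauchy_bar v z"
  by (simp add: opF_def cauchy_bar_integral)

lemma opF_eq_cnj: "opF k v z = cnj (opE k (\<lambda>w. cnj (v w)) z)"
  by (simp add: opE_cauchy opF_cauchy_bar cauchy_bar_def)

lemma potA_phase: "potA q k u = (\<lambda>z. of_real (hpar k / 2) * (phase k z * q z * u z))"
  by (simp add: potA_def tau_minus_def phase_def fun_eq_iff)

lemma potB_cnj: "potB q k u = (\<lambda>z. cnj (potA q k (\<lambda>z. cnj (u z)) z))"
  unfolding potA_phase potB_def tau_plus_def by (simp add: cnj_phase fun_eq_iff)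

text \<open>The h / 2 of the potential meets the 1 / (pi h) of \<open>E\<close>: no power of h
  survives, so the size of \<open>A\<close> alone gives only O(1).\<close>

lemma opA_cauchy: "0 < hpar k \<Longrightarrow> opA q k u z = of_real (1 / (2 * pi)) * cauchy (\<lambda>z. phase k z * q z * u z) z"
  unfolding opA_def opE_cauchy potA_phase cauchy_cmult by simp

text \<open>Up to \<sigma>, \<open>B\<close> is \<open>A\<close> conjugated by complex conjugation,
  so bounds for \<open>A\<close> are bounds for \<open>B\<close>.\<close>

lemma opB_cnj: "opB \<sigma> q k u = (\<lambda>z. \<sigma> * cnj (opA q k (\<lambda>z. cnj (u z)) z))"
  unfolding opB_def opF_eq_cnj potB_cnj opA_def by simp

lemma opA_cmult: "opA q k (\<lambda>z. c * u z) z = c * opA q k u z"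
  unfolding opA_def opE_cauchy potA_phase
  using cauchy_cmult[of c "\<lambda>z. of_real (hpar k / 2) * (phase k z * q z * u z)" z] by (simp add: mult_ac)

text \<open>Reduces B A to a conjugated A B with \<sigma> replaced by its conjugate, so the
  oscillatory estimate is proved for one order of the factors only.\<close>

lemma opB_opA_cnj: "opB \<sigma> q k (opA q k u) = (\<lambda>z. cnj (opA q k (opB (cnj \<sigma>) q k (\<lambda>z. cnj (u z))) z))"
  unfolding opB_cnj opA_cmult by simp

text \<open>Conjugation is an antilinear isometry; applying it on both sides restores linearity and
  preserves the norm.\<close>

lemma bounded_operator_cnj:
  assumes T: "bounded_operator (wL2 \<theta>) T C" and \<sigma>: "cmod \<sigma> = 1"
  shows "bounded_operator (wL2 \<theta>) (\<lambda>u z. \<sigma> * cnj (T (\<lambda>z. cnj (u z)) z)) C"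
proof -
  interpret class_space "wL2 \<theta>" by (rule class_space_wL2)
  note M = bo_mem[OF T wL2_cnj_mem]
  show ?thesis
    unfolding bounded_operator_def
  proof (intro conjI ballI allI impI)
    fix u assume u: "u \<in> elems (wL2 \<theta>)"
    show "(\<lambda>z. \<sigma> * cnj (T (\<lambda>z. cnj (u z)) z)) \<in> elems (wL2 \<theta>)"
      by (rule wL2_cmult(1)[OF wL2_cnj_mem[OF M[OF u]]])
    have "nrm (wL2 \<theta>) (\<lambda>z. \<sigma> * cnj (T (\<lambda>z. cnj (u z)) z)) = nrm (wL2 \<theta>) (T (\<lambda>z. cnj (u z)))"
      using wL2_cmult(2)[OF wL2_cnj_mem[OF M[OF u]]] \<sigma> by simp
    then show "nrm (wL2 \<theta>) (\<lambda>z. \<sigma> * cnj (T (\<lambda>z. cnj (u z)) z)) \<le> C * nrm (wL2 \<theta>) u"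
      using bo_nrm[OF T wL2_cnj_mem[OF u]] by simp
    fix c
    show "eqv (wL2 \<theta>) (\<lambda>z. \<sigma> * cnj (T (\<lambda>z. cnj (smul (wL2 \<theta>) c u z)) z))
        (smul (wL2 \<theta>) c (\<lambda>z. \<sigma> * cnj (T (\<lambda>z. cnj (u z)) z)))"
      using bo_smul[OF T wL2_cnj_mem[OF u], of "cnj c"] unfolding wL2_record complex_cnj_mult
      by (rule eventually_mono) simp
  next
    fix u v assume u: "u \<in> elems (wL2 \<theta>)" and v: "v \<in> elems (wL2 \<theta>)"
    show "eqv (wL2 \<theta>) (\<lambda>z. \<sigma> * cnj (T (\<lambda>z. cnj ((u + v) z)) z))
        ((\<lambda>z. \<sigma> * cnj (T (\<lambda>z. cnj (u z)) z)) + (\<lambda>z. \<sigma> * cnj (T (\<lambda>z. cnj (v z)) z)))"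
      using bo_add[OF T wL2_cnj_mem[OF u] wL2_cnj_mem[OF v]]
      by (auto simp: plus_fun_def distrib_left elim!: eventually_mono)
  next
    fix u v assume u: "u \<in> elems (wL2 \<theta>)" and v: "v \<in> elems (wL2 \<theta>)" and e: "eqv (wL2 \<theta>) u v"
    have "eqv (wL2 \<theta>) (\<lambda>z. cnj (u z)) (\<lambda>z. cnj (v z))"
      using e by (auto elim!: eventually_mono)
    then show "eqv (wL2 \<theta>) (\<lambda>z. \<sigma> * cnj (T (\<lambda>z. cnj (u z)) z)) (\<lambda>z. \<sigma> * cnj (T (\<lambda>z. cnj (v z)) z))"
      using bo_cong[OF T wL2_cnj_mem[OF u] wL2_cnj_mem[OF v]] by (auto elim!: eventually_mono)
  qed
qed

lemma wnorm2_opE: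
  assumes "0 < \<epsilon>" "\<epsilon> \<le> 1"
  obtains C where "0 \<le> C"
    "\<And>k f. 0 < hpar k \<Longrightarrow> f \<in> elems (wL2 (\<epsilon> - 2)) \<Longrightarrow> opE k f \<in> elems (wL2 \<epsilon>)"
    "\<And>k f. 0 < hpar k \<Longrightarrow> f \<in> elems (wL2 (\<epsilon> - 2)) \<Longrightarrow> nrm (wL2 \<epsilon>) (opE k f) \<le> C / hpar k * nrm (wL2 (\<epsilon> - 2)) f"
proof -
  obtain C where C: "C > 0" "\<And>v. v \<in> borel_measurable borel \<Longrightarrow> wnorm2 \<epsilon> (cauchy v) \<le> ennreal C * wnorm2 (\<epsilon> - 2) v"
    using wnorm2_cauchy[OF assms] by blast
  have *: "opE k f \<in> elems (wL2 \<epsilon>) \<and> nrm (wL2 \<epsilon>) (opE k f) \<le> sqrt C / pi / hpar k * nrm (wL2 (\<epsilon> - 2)) f"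
    if k: "0 < hpar k" and f: "f \<in> elems (wL2 (\<epsilon> - 2))" for k f
  proof -
    have fm: "f \<in> borel_measurable borel" using f by (simp add: wL2_mem_iff)
    have "wnorm2 \<epsilon> (cauchy f) \<le> ennreal ((sqrt C)\<^sup>2) * wnorm2 (\<epsilon> - 2) f" using C by (simp add: fm)
    note c = wL2_le_multI[OF f measurable_cauchy[OF fm] this real_sqrt_ge_zero[OF less_imp_le[OF C(1)]]]
    note d = wL2_cmult[OF c(1), of "1 / of_real (pi * hpar k)", folded opE_cauchy]
    have "nrm (wL2 \<epsilon>) (opE k f) = 1 / (pi * hpar k) * nrm (wL2 \<epsilon>) (cauchy f)"
      using d(2) k by (simp add: norm_divide norm_mult)
    also have "\<dots> \<le> 1 / (pi * hpar k) * (sqrt C * nrm (wL2 (\<epsilon> - 2)) f)"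
      using k by (intro mult_left_mono c(2)) simp
    finally show ?thesis using d(1) by (simp add: field_simps)
  qed
  show ?thesis by (rule that[of "sqrt C / pi"]) (use * C in simp_all)
qed

text \<open>The regularity of q is used only through its representation by g. The constant G bounds
  <z>^2 |q| almost everywhere, while the weight s on g controls its tails.\<close>

locale potential =
  fixes q g :: "complex \<Rightarrow> complex" and s \<epsilon> G :: real
  assumes s: "1 < s" "s \<le> 2" and \<epsilon>: "0 < \<epsilon>" "\<epsilon> \<le> 1"
    and q [measurable]: "q \<in> borel_measurable borel" and g: "g \<in> elems (wL2 (- s))"
    and q_eq: "AE z in lborel. q z = of_real (jbracket z powr (- 2)) * inverse_fourier g z"
  defines "G \<equiv> (LINT \<zeta>|lborel. cmod (g \<zeta>))"
begin

lemma g_integrable: "integrable lborel g"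
  by (rule integrable_of_wL2[OF g s(1)])

lemma g_measurable [measurable]: "g \<in> borel_measurable borel"
  using g_integrable by auto

lemma G_nonneg: "0 \<le> G"
  unfolding G_def by (rule Bochner_Integration.integral_nonneg) simp

lemma inverse_fourier_g: "cmod (inverse_fourier g z) \<le> G"
  unfolding G_def by (rule cmod_inverse_fourier_le[OF g_integrable])

lemma wnorm2_potential:
  assumes [measurable]: "u \<in> borel_measurable borel"
  shows "wnorm2 (\<epsilon> - 2) (\<lambda>z. phase k z * q z * u z) \<le> ennreal (G\<^sup>2) * wnorm2 \<epsilon> u"
proof -
  have "wnorm2 (\<epsilon> - 2) (\<lambda>z. phase k z * q z * u z) = wnorm2 (\<epsilon> - 2) (\<lambda>z. of_real (jbracket z powr (- 2)) * inverse_fourier g z * u z)"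
    unfolding wnorm2_def
    by (rule nn_integral_cong_AE) (use q_eq in \<open>auto simp: norm_mult elim!: eventually_mono\<close>)
  also have "\<dots> \<le> ennreal (G\<^sup>2) * wnorm2 (\<epsilon> - 2 - (- 2)) u"
  proof (rule wnorm2_le_cmult)
    fix z
    have "cmod (inverse_fourier g z) * (jbracket z powr (- 2) * cmod (u z)) \<le> G * (jbracket z powr (- 2) * cmod (u z))"
      by (rule mult_right_mono[OF inverse_fourier_g]) simp
    then show "cmod (of_real (jbracket z powr (- 2)) * inverse_fourier g z * u z) \<le> G * (jbracket z powr (- 2) * cmod (u z))"
      by (simp add: norm_mult mult_ac)
  qed measurable
  finally show ?thesis by simp
qed

lemma potential_mem:
  assumes "u \<in> elems (wL2 \<epsilon>)"
  shows "(\<lambda>z. phase k z * q z * u z) \<in> elems (wL2 (\<epsilon> - 2))"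
proof -
  have [measurable]: "u \<in> borel_measurable borel" using assms by (simp add: wL2_mem_iff)
  show ?thesis
    by (rule wL2_le_multI(1)[OF assms _ wnorm2_potential G_nonneg]) measurable
qed

lemma potA_mem: "u \<in> elems (wL2 \<epsilon>) \<Longrightarrow> potA q k u \<in> elems (wL2 (\<epsilon> - 2))"
  unfolding potA_phase by (rule wL2_cmult(1)[OF potential_mem])

text \<open>C refers to squared norms, hence its square root; G is the bound of the potential, and
  the prefactor 1 / (2 pi) is estimated by 1. Additivity and compatibility with \<open>eqv\<close>
  use that the potential maps into exponent \<epsilon> - 2, where Cauchy integrals converge almost
  everywhere.\<close>

lemma bounded_opA:
  obtains C where "0 \<le> C" "\<And>k. 0 < hpar k \<Longrightarrow> bounded_operator (wL2 \<epsilon>) (opA q k) C"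
proof -
  obtain C where C: "C > 0" "\<And>v. v \<in> borel_measurable borel \<Longrightarrow> wnorm2 \<epsilon> (cauchy v) \<le> ennreal C * wnorm2 (\<epsilon> - 2) v"
    using wnorm2_cauchy[OF \<epsilon>] by blast
  have "bounded_operator (wL2 \<epsilon>) (opA q k) (sqrt C * G)" if k: "0 < hpar k" for k
    unfolding bounded_operator_def
  proof (intro conjI ballI allI impI)
    note A = opA_cauchy[OF k, of q]
    fix u assume u: "u \<in> elems (wL2 \<epsilon>)"
    have um [measurable]: "u \<in> borel_measurable borel" using u by (simp add: wL2_mem_iff)
    have um': "(\<lambda>z. phase k z * q z * u z) \<in> borel_measurable borel" by measurable
    have "wnorm2 \<epsilon> (cauchy (\<lambda>z. phase k z * q z * u z)) \<le> ennreal C * (ennreal (G\<^sup>2) * wnorm2 \<epsilon> u)"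
      by (rule order_trans[OF C(2)[OF um'] mult_left_mono[OF wnorm2_potential[OF um]]]) simp
    also have "\<dots> = ennreal ((sqrt C * G)\<^sup>2) * wnorm2 \<epsilon> u"
      using C(1) by (simp add: power_mult_distrib ennreal_mult mult.assoc)
    finally have le: "wnorm2 \<epsilon> (cauchy (\<lambda>z. phase k z * q z * u z)) \<le> ennreal ((sqrt C * G)\<^sup>2) * wnorm2 \<epsilon> u" .
    have CG: "0 \<le> sqrt C * G" using C(1) G_nonneg by simp
    note c = wL2_le_multI[OF u measurable_cauchy[OF um'] le CG]
    note d = wL2_cmult[OF c(1), of "of_real (1 / (2 * pi))", folded A]
    show "opA q k u \<in> elems (wL2 \<epsilon>)" by (rule d(1))
    have "1 / (2 * pi) * nrm (wL2 \<epsilon>) (cauchy (\<lambda>z. phase k z * q z * u z)) \<le> 1 * nrm (wL2 \<epsilon>) (cauchy (\<lambda>z. phase k z * q z * u z))"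
      using pi_gt3 by (intro mult_right_mono wL2_nrm_nonneg) (simp add: field_simps)
    then show "nrm (wL2 \<epsilon>) (opA q k u) \<le> sqrt C * G * nrm (wL2 \<epsilon>) u"
      using d(2) c(2) by (simp add: norm_divide norm_mult)
    show "eqv (wL2 \<epsilon>) (opA q k (smul (wL2 \<epsilon>) c u)) (smul (wL2 \<epsilon>) c (opA q k u))" for c
      by (simp add: opA_cmult)
    fix v assume v: "v \<in> elems (wL2 \<epsilon>)"
    have vm [measurable]: "v \<in> borel_measurable borel" using v by (simp add: wL2_mem_iff)
    have fin: "wnorm2 (\<epsilon> - 2) (\<lambda>z. phase k z * q z * w z) < \<infinity>" if "w \<in> elems (wL2 \<epsilon>)" for w
      using potential_mem[OF that] by (simp add: wL2_mem_iff)
    have "AE z in lborel. cauchy (\<lambda>w. phase k w * q w * u w + phase k w * q w * v w) z =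
        cauchy (\<lambda>w. phase k w * q w * u w) z + cauchy (\<lambda>w. phase k w * q w * v w) z"
      by (rule cauchy_add_AE[OF \<epsilon> um' fin[OF u] _ fin[OF v]]) measurable
    then show "eqv (wL2 \<epsilon>) (opA q k (u + v)) (opA q k u + opA q k v)"
      by (auto simp: A plus_fun_def distrib_left add_divide_distrib elim!: eventually_mono)
    show "eqv (wL2 \<epsilon>) (opA q k u) (opA q k v)" if e: "eqv (wL2 \<epsilon>) u v"
    proof -
      have "cauchy (\<lambda>z. phase k z * q z * u z) z = cauchy (\<lambda>z. phase k z * q z * v z) z" for z
        by (rule cauchy_cong_AE[OF um']) (use e in \<open>auto elim!: eventually_mono\<close>)
      then show ?thesis by (simp add: A)
    qed
  qed
  then show ?thesis using that[of "sqrt C * G"] C(1) G_nonneg by simp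
qed

lemma bounded_opB:
  assumes "bounded_operator (wL2 \<epsilon>) (opA q k) C" "cmod \<sigma> = 1"
  shows "bounded_operator (wL2 \<epsilon>) (opB \<sigma> q k) C"
  using bounded_operator_cnj[OF assms] unfolding opB_cnj[abs_def] .

text \<open>The two halves are treated by opposite means: the high frequencies by size alone, with
  the Cauchy transform bound applied twice; the low ones by \<open>oscillatory_bound\<close> with M
  = 2 h G. Estimates are made for unimodular \<sigma>, as conjugation exchanges \<sigma> with its
  conjugate.\<close>

lemma opA_opB_decay:
  obtains D where "0 \<le> D"
    "\<And>\<sigma> k u. cmod \<sigma> = 1 \<Longrightarrow> 0 < hpar k \<Longrightarrow> hpar k \<le> 1 \<Longrightarrow> u \<in> elems (wL2 \<epsilon>) \<Longrightarrow>
      nrm (wL2 \<epsilon>) (opA q k (opB \<sigma> q k u)) \<le> D * hpar k powr (s - 1) * nrm (wL2 \<epsilon>) u"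
proof -
  obtain K where K: "0 < K" "\<And>V M M' v. Ck 1 V \<Longrightarrow> (\<And>z. cmod (V z) \<le> M) \<Longrightarrow> (\<And>z. cmod (dx V z) \<le> M') \<Longrightarrow> (\<And>z. cmod (dy V z) \<le> M') \<Longrightarrow>
     v \<in> elems (wL2 (\<epsilon> - 2)) \<Longrightarrow>
     wnorm2 \<epsilon> (cauchy (\<lambda>z. delbar V z * (of_real (jbracket z powr (- 2)) * cauchy_bar v z))) \<le> ennreal (K * M\<^sup>2) * wnorm2 (\<epsilon> - 2) v"
    using oscillatory_bound[OF \<epsilon>] by blast
  obtain C where C: "C > 0" "\<And>v. v \<in> borel_measurable borel \<Longrightarrow> wnorm2 \<epsilon> (cauchy v) \<le> ennreal C * wnorm2 (\<epsilon> - 2) v"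
    using wnorm2_cauchy[OF \<epsilon>] by blast
  obtain T where T: "0 \<le> T" "\<And>R. 0 < R \<Longrightarrow> (LINT z|lborel. cmod (if R < cmod z then g z else 0)) \<le> T * R powr (1 - s)"
    using integral_tail_bound[OF g s(1)] by blast
  \<comment> \<open>In squared norms: 4 K G^2 from |V| <= 2 h G, C^2 T^2 from two Cauchy transforms
    and a potential of size T H, and the outer 2 from adding the halves. The further factor G in the
    final constant bounds w by u.\<close>
  define E where "E = sqrt (2 * (4 * K * G\<^sup>2 + C\<^sup>2 * T\<^sup>2))"
  have E: "0 \<le> E" "E\<^sup>2 = 2 * (4 * K * G\<^sup>2 + C\<^sup>2 * T\<^sup>2)" unfolding E_def using K(1) by simp_all
  have "nrm (wL2 \<epsilon>) (opA q k (opB \<sigma> q k u)) \<le> E * G * hpar k powr (s - 1) * nrm (wL2 \<epsilon>) u"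
    if \<sigma>: "cmod \<sigma> = 1" and k: "0 < hpar k" "hpar k \<le> 1" and u: "u \<in> elems (wL2 \<epsilon>)" for \<sigma> k u
  proof -
    define h where "h = hpar k"
    define H where "H = h powr (s - 1)"
    have h: "0 < h" "h \<le> 1" using k by (auto simp: h_def)
    \<comment> \<open>Here s <= 2 enters: the exponent s - 1 is at most 1 and h <= 1.\<close>
    have hH: "h \<le> H"
      using powr_mono'[of "s - 1" 1 h] h s by (simp add: H_def)
    have H0: "0 \<le> H" by (simp add: H_def)
    have RH: "(1 / h) powr (1 - s) = H"
      using h powr_minus_divide[of h "1 - s"] by (simp add: H_def powr_divide)
    \<comment> \<open>The source of the inner transform up to a constant. Its oscillation is never
      exploited: only its norm, at most G times that of u, is used.\<close>
    define w where "w = (\<lambda>z. cnj (phase k z * q z * cnj (u z)))"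
    have um [measurable]: "u \<in> borel_measurable borel" using u by (simp add: wL2_mem_iff)
    have wm [measurable]: "w \<in> borel_measurable borel" unfolding w_def by measurable
    have w: "w \<in> elems (wL2 (\<epsilon> - 2))"
      unfolding w_def by (rule wL2_cnj_mem[OF potential_mem[OF wL2_cnj_mem[OF u]]])
    have wu: "wnorm2 (\<epsilon> - 2) w \<le> ennreal (G\<^sup>2) * wnorm2 \<epsilon> u"
      using wnorm2_potential[of "\<lambda>z. cnj (u z)" k] unfolding w_def wnorm2_cnj by simp
    \<comment> \<open>A single phase and a single factor q remain in front of
      \<open>cauchy_bar w\<close>; it is this factor that is split into frequencies.\<close>
    have AB: "opA q k (opB \<sigma> q k u) z = \<sigma> / of_real (4 * pi\<^sup>2) * cauchy (\<lambda>z. phase k z * q z * cauchy_bar w z) z" for z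
    proof -
      have "opB \<sigma> q k u = (\<lambda>z. \<sigma> / of_real (2 * pi) * cauchy_bar w z)"
        unfolding opB_cnj opA_cauchy[OF k(1)] by (simp add: cauchy_bar_def w_def fun_eq_iff)
      then have "opA q k (opB \<sigma> q k u) z = \<sigma> / of_real (2 * pi) * opA q k (cauchy_bar w) z"
        by (simp only: opA_cmult)
      then show ?thesis unfolding opA_cauchy[OF k(1)] by (simp add: power2_eq_square)
    qed
    define gl where "gl = (\<lambda>\<zeta>. if 1 / h < cmod \<zeta> then 0 else g \<zeta>)"
    define gh where "gh = (\<lambda>\<zeta>. if 1 / h < cmod \<zeta> then g \<zeta> else 0)"
    have [measurable]: "gl \<in> borel_measurable borel" "gh \<in> borel_measurable borel"
      unfolding gl_def gh_def by measurable
    have gi: "integrable lborel gl" "integrable lborel gh"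
      by (rule Bochner_Integration.integrable_bound[OF g_integrable]; auto simp: gl_def gh_def)+
    have split: "inverse_fourier g z = inverse_fourier gl z + inverse_fourier gh z" for z
    proof -
      have i: "integrable lborel (\<lambda>\<zeta>. f \<zeta> * exp (\<i> * of_real (z \<bullet> \<zeta>)))" if f: "integrable lborel f" for f :: "complex \<Rightarrow> complex"
      proof (rule Bochner_Integration.integrable_bound[OF f])
        have [measurable]: "f \<in> borel_measurable borel" using f by auto
        show "(\<lambda>\<zeta>. f \<zeta> * exp (\<i> * of_real (z \<bullet> \<zeta>))) \<in> borel_measurable lborel" by measurable
      qed (simp add: norm_mult)
      have "(LINT \<zeta>|lborel. g \<zeta> * exp (\<i> * of_real (z \<bullet> \<zeta>))) =
          (LINT \<zeta>|lborel. gl \<zeta> * exp (\<i> * of_real (z \<bullet> \<zeta>)) + gh \<zeta> * exp (\<i> * of_real (z \<bullet> \<zeta>)))"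
        by (rule Bochner_Integration.integral_cong) (auto simp: gl_def gh_def)
      also have "\<dots> = (LINT \<zeta>|lborel. gl \<zeta> * exp (\<i> * of_real (z \<bullet> \<zeta>))) + (LINT \<zeta>|lborel. gh \<zeta> * exp (\<i> * of_real (z \<bullet> \<zeta>)))"
        by (rule Bochner_Integration.integral_add[OF i[OF gi(1)] i[OF gi(2)]])
      finally show ?thesis unfolding inverse_fourier_def by (simp add: add_divide_distrib)
    qed
    have glG: "cmod (inverse_fourier gl z) \<le> G" for z
    proof -
      have "(LINT \<zeta>|lborel. cmod (gl \<zeta>)) \<le> G"
        unfolding G_def by (rule integral_mono[OF integrable_norm[OF gi(1)] integrable_norm[OF g_integrable]]) (simp add: gl_def)
      then show ?thesis using cmod_inverse_fourier_le[OF gi(1), of z] by linarith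
    qed
    have ghH: "cmod (inverse_fourier gh z) \<le> T * H" for z
      using cmod_inverse_fourier_le[OF gi(2), of z] T(2)[of "1 / h"] h(1) unfolding gh_def RH by simp
    obtain V M' where V: "Ck 1 V" "\<And>z. cmod (V z) \<le> 2 * hpar k * (LINT \<zeta>|lborel. cmod (g \<zeta>))"
      "\<And>z. cmod (dx V z) \<le> M'" "\<And>z. cmod (dy V z) \<le> M'"
      "\<And>z. delbar V z = phase k z * inverse_fourier (\<lambda>\<zeta>. if 1 / hpar k < cmod \<zeta> then 0 else g \<zeta>) z"
      by (rule low_frequency_primitive[OF g_integrable k(1)]) (rule that)
    have Vd: "delbar V z = phase k z * inverse_fourier gl z" for z
      unfolding V(5) gl_def h_def ..
    define F1 where "F1 = (\<lambda>z. delbar V z * (of_real (jbracket z powr (- 2)) * cauchy_bar w z))"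
    define F2 where "F2 = (\<lambda>z. phase k z * inverse_fourier gh z * (of_real (jbracket z powr (- 2)) * cauchy_bar w z))"
    have Fm: "F1 \<in> borel_measurable borel" "F2 \<in> borel_measurable borel"
      unfolding F1_def F2_def Vd by measurable
    let ?N = "wnorm2 (\<epsilon> - 2) w"
    have cb: "wnorm2 \<epsilon> (cauchy_bar w) \<le> ennreal C * ?N"
      by (rule wnorm2_cauchy_bar[OF C(2) wm])
    have fin: "?N < \<infinity>" using w by (simp add: wL2_mem_iff)
    have pt: "wnorm2 (\<epsilon> - 2) (\<lambda>z. a z * (of_real (jbracket z powr (- 2)) * cauchy_bar w z)) \<le> ennreal (c\<^sup>2 * C) * ?N"
      if "\<And>z. cmod (a z) \<le> c" for a c
    proof -
      have "wnorm2 (\<epsilon> - 2) (\<lambda>z. a z * (of_real (jbracket z powr (- 2)) * cauchy_bar w z)) \<le> ennreal (c\<^sup>2) * wnorm2 (\<epsilon> - 2 - (- 2)) (cauchy_bar w)"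
      proof (rule wnorm2_le_cmult)
        show "cmod (a z * (of_real (jbracket z powr (- 2)) * cauchy_bar w z)) \<le> c * (jbracket z powr (- 2) * cmod (cauchy_bar w z))" for z
          using mult_right_mono[OF that[of z], of "jbracket z powr (- 2) * cmod (cauchy_bar w z)"] by (simp add: norm_mult)
      qed measurable
      also have "\<dots> \<le> ennreal (c\<^sup>2) * (ennreal C * ?N)" using cb by (simp add: mult_left_mono)
      also have "\<dots> = ennreal (c\<^sup>2 * C) * ?N" using C(1) by (simp add: ennreal_mult mult.assoc)
      finally show ?thesis .
    qed
    have f1: "wnorm2 (\<epsilon> - 2) F1 \<le> ennreal (G\<^sup>2 * C) * ?N"
      unfolding F1_def by (rule pt) (simp add: Vd norm_mult glG)
    have f2: "wnorm2 (\<epsilon> - 2) F2 \<le> ennreal ((T * H)\<^sup>2 * C) * ?N"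
      unfolding F2_def by (rule pt) (simp add: norm_mult ghH)
    have "ennreal x * ?N < \<infinity>" for x using fin by (simp add: ennreal_mult_less_top)
    then have fin1: "wnorm2 (\<epsilon> - 2) F1 < \<infinity>" and fin2: "wnorm2 (\<epsilon> - 2) F2 < \<infinity>"
      by (rule le_less_trans[OF f1], rule le_less_trans[OF f2])
    have c1: "wnorm2 \<epsilon> (cauchy F1) \<le> ennreal (K * (2 * hpar k * (LINT \<zeta>|lborel. cmod (g \<zeta>)))\<^sup>2) * ?N"
      unfolding F1_def by (rule K(2)[OF V(1-4) w])
    have c2: "wnorm2 \<epsilon> (cauchy F2) \<le> ennreal (C * ((T * H)\<^sup>2 * C)) * ?N"
    proof -
      have "wnorm2 \<epsilon> (cauchy F2) \<le> ennreal C * (ennreal ((T * H)\<^sup>2 * C) * ?N)"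
        by (rule order_trans[OF C(2)[OF Fm(2)] mult_left_mono[OF f2]]) simp
      then show ?thesis using C(1) by (simp add: ennreal_mult mult.assoc)
    qed
    let ?c = "\<lambda>z. cauchy (\<lambda>z. phase k z * q z * cauchy_bar w z) z"
    have sum: "AE z in lborel. ?c z = cauchy F1 z + cauchy F2 z"
    proof -
      have "?c z = cauchy (\<lambda>z. F1 z + F2 z) z" for z
      proof (rule cauchy_cong_AE)
        show "AE z in lborel. phase k z * q z * cauchy_bar w z = F1 z + F2 z"
          using q_eq by (rule eventually_mono) (simp add: F1_def F2_def Vd split algebra_simps)
      qed (use Fm in measurable)
      then show ?thesis using cauchy_add_AE[OF \<epsilon> Fm(1) fin1 Fm(2) fin2] by simp
    qed
    have "wnorm2 \<epsilon> ?c = wnorm2 \<epsilon> (\<lambda>z. cauchy F1 z + cauchy F2 z)"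
      unfolding wnorm2_def by (rule nn_integral_cong_AE) (use sum in \<open>auto elim!: eventually_mono\<close>)
    also have "\<dots> \<le> ennreal (2 * (K * (2 * hpar k * (LINT \<zeta>|lborel. cmod (g \<zeta>)))\<^sup>2 + C * ((T * H)\<^sup>2 * C))) * ?N"
      by (rule wnorm2_add2[OF measurable_cauchy[OF Fm(1)] measurable_cauchy[OF Fm(2)] c1 c2]) (use K(1) C(1) in auto)
    also have "\<dots> \<le> ennreal ((E * H)\<^sup>2) * (ennreal (G\<^sup>2) * wnorm2 \<epsilon> u)"
    proof (rule mult_mono[OF ennreal_leI wu])
      have "h\<^sup>2 \<le> H\<^sup>2" using hH h by (intro power_mono) auto
      then have "8 * K * G\<^sup>2 * h\<^sup>2 \<le> 8 * K * G\<^sup>2 * H\<^sup>2" using K(1) by (intro mult_left_mono) auto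
      then show "2 * (K * (2 * hpar k * (LINT \<zeta>|lborel. cmod (g \<zeta>)))\<^sup>2 + C * ((T * H)\<^sup>2 * C)) \<le> (E * H)\<^sup>2"
        unfolding G_def[symmetric] h_def[symmetric] power_mult_distrib E(2) by (simp add: algebra_simps power2_eq_square)
    qed simp_all
    also have "\<dots> = ennreal ((E * G * H)\<^sup>2) * wnorm2 \<epsilon> u"
      by (simp add: power_mult_distrib ennreal_mult mult_ac)
    finally have le: "wnorm2 \<epsilon> ?c \<le> ennreal ((E * G * H)\<^sup>2) * wnorm2 \<epsilon> u" .
    have EGH: "0 \<le> E * G * H" using E(1) G_nonneg H0 by simp
    have cm: "?c \<in> borel_measurable borel" by measurable
    note c = wL2_le_multI[OF u cm le EGH]
    have "nrm (wL2 \<epsilon>) (opA q k (opB \<sigma> q k u)) = cmod (\<sigma> / of_real (4 * pi\<^sup>2)) * nrm (wL2 \<epsilon>) ?c"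
      using wL2_cmult(2)[OF c(1), of "\<sigma> / of_real (4 * pi\<^sup>2)"] unfolding AB[symmetric] .
    also have "\<dots> \<le> 1 * nrm (wL2 \<epsilon>) ?c"
    proof (rule mult_right_mono[OF _ wL2_nrm_nonneg])
      have "1 \<le> pi\<^sup>2" using pi_gt3 by (intro one_le_power) simp
      then show "cmod (\<sigma> / of_real (4 * pi\<^sup>2)) \<le> 1"
        using \<sigma> by (simp add: norm_divide norm_mult norm_power)
    qed
    finally show ?thesis using c(2) by (simp add: H_def h_def)
  qed
  then show ?thesis using that[of "E * G"] E(1) G_nonneg by simp
qed

end

section \<open>The differential equations and their integral form\<close>

lemma AE_cong_eq:
  assumes "AE z in M. P z" "\<And>z. P z \<Longrightarrow> Q z \<longleftrightarrow> R z"
  shows "(AE z in M. Q z) \<longleftrightarrow> (AE z in M. R z)"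
  using assms(1) by (rule eventually_subst[OF eventually_mono]) (rule assms(2))

lemma integrable_wL2_test:
  assumes "W \<in> elems (wL2 \<theta>)" "\<eta> \<in> test_functions"
  shows "integrable lborel (\<lambda>z. W z * \<eta> z)"
proof -
  obtain C where "C \<ge> 0" and C: "\<And>z. cmod (\<eta> z) \<le> C * jbracket z powr (- (\<theta> + 2))"
    "\<And>z. cmod (dx \<eta> z) \<le> C * jbracket z powr (- (\<theta> + 2))" "\<And>z. cmod (dy \<eta> z) \<le> C * jbracket z powr (- (\<theta> + 2))"
    using test_bound[OF assms(2), of "\<theta> + 2"] by blast
  show ?thesis
  proof (rule integrable_wL2_mult[OF assms(1) test_borel[OF assms(2)], of C 2])
    show "cmod (\<eta> z) \<le> C * jbracket z powr (- \<theta> - 2)" for z using C(1)[of z] by simp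
  qed simp
qed

lemma distr_delbar_opE:
  assumes "v \<in> elems (wL2 (\<epsilon> - 2))" "\<epsilon> \<le> 1" "0 < hpar k" "\<eta> \<in> test_functions"
  shows "of_real (hpar k) * distr_delbar (distr (opE k v)) \<eta> = distr v \<eta>"
proof -
  have "(LINT z|lborel. opE k v z * delbar \<eta> z) = (LINT z|lborel. 1 / of_real (pi * hpar k) * (cauchy v z * delbar \<eta> z))"
    unfolding opE_cauchy mult.assoc ..
  also have "\<dots> = 1 / of_real (pi * hpar k) * (- of_real pi * (LINT z|lborel. v z * \<eta> z))"
    unfolding integral_mult_right_zero integral_cauchy_delbar[OF assms(1,2,4)] ..
  finally show ?thesis using assms(3) unfolding distr_delbar_def distr_def by simp
qed

text \<open>\<open>opE k v\<close> is one solution. The difference of two solutions lies in <z> L2,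
  because \<epsilon> <= 1, and is annihilated by dbar, so Liouville's theorem makes it a null
  function.\<close>

lemma delbar_eq_iff:
  assumes \<phi>: "\<phi> \<in> elems (wL2 \<epsilon>)" and v: "v \<in> elems (wL2 (\<epsilon> - 2))" and E: "opE k v \<in> elems (wL2 \<epsilon>)"
    and \<epsilon>: "\<epsilon> \<le> 1" and k: "0 < hpar k"
  shows "(\<forall>\<eta>\<in>test_functions. of_real (hpar k) * distr_delbar (distr \<phi>) \<eta> = distr v \<eta>) \<longleftrightarrow> (AE z in lborel. \<phi> z = opE k v z)"
proof
  assume L: "\<forall>\<eta>\<in>test_functions. of_real (hpar k) * distr_delbar (distr \<phi>) \<eta> = distr v \<eta>"
  have "(\<lambda>z. - 1 * opE k v z) \<in> elems (wL2 \<epsilon>)" by (rule wL2_cmult(1)[OF E])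
  from wL2_add(1)[OF \<phi> this] have W: "(\<lambda>z. \<phi> z - opE k v z) \<in> elems (wL2 \<epsilon>)" by simp
  have W1: "(\<lambda>z. \<phi> z - opE k v z) \<in> elems (wL2 1)"
    using W le_less_trans[OF wnorm2_mono_weight[OF \<epsilon>]] unfolding wL2_mem_iff by blast
  have "AE z in lborel. \<phi> z - opE k v z = 0"
  proof (rule distributional_uniqueness[OF W1])
    fix \<eta> assume \<eta>: "\<eta> \<in> test_functions"
    note d = test_dx(3)[OF \<eta>]
    have "of_real (hpar k) * distr_delbar (distr \<phi>) \<eta> = of_real (hpar k) * distr_delbar (distr (opE k v)) \<eta>"
      using L \<eta> distr_delbar_opE[OF v \<epsilon> k \<eta>] by simp
    then have e: "distr \<phi> (delbar \<eta>) = distr (opE k v) (delbar \<eta>)"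
      using k by (simp add: distr_delbar_def)
    have "(LINT z|lborel. (\<phi> z - opE k v z) * delbar \<eta> z) = distr \<phi> (delbar \<eta>) - distr (opE k v) (delbar \<eta>)"
      unfolding left_diff_distrib distr_def
      by (rule Bochner_Integration.integral_diff[OF integrable_wL2_test[OF \<phi> d] integrable_wL2_test[OF E d]])
    then show "(LINT z|lborel. (\<phi> z - opE k v z) * delbar \<eta> z) = 0" using e by simp
  qed
  then show "AE z in lborel. \<phi> z = opE k v z" by simp
next
  assume R: "AE z in lborel. \<phi> z = opE k v z"
  show "\<forall>\<eta>\<in>test_functions. of_real (hpar k) * distr_delbar (distr \<phi>) \<eta> = distr v \<eta>"
  proof
    fix \<eta> assume \<eta>: "\<eta> \<in> test_functions"
    have [measurable]: "\<phi> \<in> borel_measurable borel" "opE k v \<in> borel_measurable borel" "delbar \<eta> \<in> borel_measurable borel"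
      using \<phi> E test_borel[OF test_dx(3)[OF \<eta>]] by (simp_all add: wL2_mem_iff)
    have "distr \<phi> (delbar \<eta>) = distr (opE k v) (delbar \<eta>)"
      unfolding distr_def
    proof (rule Bochner_Integration.integral_cong_AE)
      show "AE z in lborel. \<phi> z * delbar \<eta> z = opE k v z * delbar \<eta> z"
        using R by (rule eventually_mono) simp
    qed measurable
    then show "of_real (hpar k) * distr_delbar (distr \<phi>) \<eta> = distr v \<eta>"
      using distr_delbar_opE[OF v \<epsilon> k \<eta>] by (simp add: distr_delbar_def)
  qed
qed

lemma distr_cnj: "distr (\<lambda>z. cnj (u z)) (\<lambda>z. cnj (\<eta> z)) = cnj (distr u \<eta>)"
  unfolding distr_def using Bochner_Integration.integral_cnj[of lborel "\<lambda>z. u z * \<eta> z"] by simp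

lemma distr_delbar_cnj:
  assumes "\<eta> \<in> test_functions"
  shows "distr_delbar (distr (\<lambda>z. cnj (u z))) (\<lambda>z. cnj (\<eta> z)) = cnj (distr_del (distr u) \<eta>)"
proof -
  have "Ck 1 \<eta>" using assms by (simp add: test_functions_def Cinf_def)
  then have "\<eta> differentiable (at z)" for z by (simp add: differentiable_on_def)
  then have "delbar (\<lambda>z. cnj (\<eta> z)) = (\<lambda>z. cnj (del \<eta> z))" by (rule dx_fun_cnj(4))
  then show ?thesis by (simp add: distr_delbar_def distr_del_def distr_cnj)
qed

text \<open>The conjugate of the dbar case: conjugation permutes the test functions and exchanges
  del with delbar, \<open>opF\<close> with \<open>opE\<close>.\<close>

lemma del_eq_iff:
  assumes \<phi>: "\<phi> \<in> elems (wL2 \<epsilon>)" and v: "v \<in> elems (wL2 (\<epsilon> - 2))" and F: "opF k v \<in> elems (wL2 \<epsilon>)"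
    and \<epsilon>: "\<epsilon> \<le> 1" and k: "0 < hpar k"
  shows "(\<forall>\<eta>\<in>test_functions. of_real (hpar k) * distr_del (distr \<phi>) \<eta> = distr v \<eta>) \<longleftrightarrow> (AE z in lborel. \<phi> z = opF k v z)"
proof -
  let ?\<phi> = "\<lambda>z. cnj (\<phi> z)" and ?v = "\<lambda>z. cnj (v z)"
  have e: "opE k ?v = (\<lambda>z. cnj (opF k v z))" by (simp add: opF_eq_cnj fun_eq_iff)
  have E: "opE k ?v \<in> elems (wL2 \<epsilon>)" unfolding e by (rule wL2_cnj_mem[OF F])
  have one: "of_real (hpar k) * distr_del (distr \<phi>) \<eta> = distr v \<eta> \<longleftrightarrow>
      of_real (hpar k) * distr_delbar (distr ?\<phi>) (\<lambda>z. cnj (\<eta> z)) = distr ?v (\<lambda>z. cnj (\<eta> z))"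
    if "\<eta> \<in> test_functions" for \<eta>
  proof -
    have "of_real (hpar k) * distr_delbar (distr ?\<phi>) (\<lambda>z. cnj (\<eta> z)) = cnj (of_real (hpar k) * distr_del (distr \<phi>) \<eta>)"
      by (simp add: distr_delbar_cnj[OF that])
    then show ?thesis unfolding distr_cnj by (metis complex_cnj_cancel_iff)
  qed
  have "(\<forall>\<eta>\<in>test_functions. of_real (hpar k) * distr_del (distr \<phi>) \<eta> = distr v \<eta>) \<longleftrightarrow>
      (\<forall>\<eta>\<in>test_functions. of_real (hpar k) * distr_delbar (distr ?\<phi>) \<eta> = distr ?v \<eta>)"
  proof
    assume L: "\<forall>\<eta>\<in>test_functions. of_real (hpar k) * distr_del (distr \<phi>) \<eta> = distr v \<eta>"
    show "\<forall>\<eta>\<in>test_functions. of_real (hpar k) * distr_delbar (distr ?\<phi>) \<eta> = distr ?v \<eta>"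
    proof
      fix \<eta> assume \<eta>: "\<eta> \<in> test_functions"
      from one[OF test_cnj[OF this]] L test_cnj[OF this]
      show "of_real (hpar k) * distr_delbar (distr ?\<phi>) \<eta> = distr ?v \<eta>" by simp
    qed
  next
    assume R: "\<forall>\<eta>\<in>test_functions. of_real (hpar k) * distr_delbar (distr ?\<phi>) \<eta> = distr ?v \<eta>"
    show "\<forall>\<eta>\<in>test_functions. of_real (hpar k) * distr_del (distr \<phi>) \<eta> = distr v \<eta>"
    proof
      fix \<eta> assume \<eta>: "\<eta> \<in> test_functions"
      show "of_real (hpar k) * distr_del (distr \<phi>) \<eta> = distr v \<eta>"
        unfolding one[OF \<eta>] by (rule bspec[OF R test_cnj[OF \<eta>]])
    qed
  qed
  also have "\<dots> \<longleftrightarrow> (AE z in lborel. ?\<phi> z = opE k ?v z)"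
    by (rule delbar_eq_iff[OF wL2_cnj_mem[OF \<phi>] wL2_cnj_mem[OF v] E \<epsilon> k])
  also have "\<dots> \<longleftrightarrow> (AE z in lborel. \<phi> z = opF k v z)" by (simp add: e)
  finally show ?thesis .
qed

lemma distr_add:
  assumes "u \<in> elems (wL2 \<theta>)" "v \<in> elems (wL2 \<theta>)" "\<eta> \<in> test_functions"
  shows "distr (\<lambda>z. u z + v z) \<eta> = distr u \<eta> + distr v \<eta>"
  unfolding distr_def distrib_right
  by (rule Bochner_Integration.integral_add[OF integrable_wL2_test[OF assms(1,3)] integrable_wL2_test[OF assms(2,3)]])

lemma opE_add_AE:
  assumes "0 < \<epsilon>" "\<epsilon> \<le> 1" and f: "f \<in> elems (wL2 (\<epsilon> - 2))" and g: "g \<in> elems (wL2 (\<epsilon> - 2))"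
  shows "AE z in lborel. opE k (\<lambda>z. f z + g z) z = opE k f z + opE k g z"
proof -
  have "AE z in lborel. cauchy (\<lambda>z. f z + g z) z = cauchy f z + cauchy g z"
    by (rule cauchy_add_AE[OF assms(1,2)]) (use f g in \<open>simp_all add: wL2_mem_iff\<close>)
  then show ?thesis by (rule eventually_mono) (simp add: opE_cauchy add_divide_distrib)
qed

lemma opF_add_AE:
  assumes "0 < \<epsilon>" "\<epsilon> \<le> 1" and f: "f \<in> elems (wL2 (\<epsilon> - 2))" and g: "g \<in> elems (wL2 (\<epsilon> - 2))"
  shows "AE z in lborel. opF k (\<lambda>z. f z + g z) z = opF k f z + opF k g z"
  using opE_add_AE[OF assms(1,2) wL2_cnj_mem[OF f] wL2_cnj_mem[OF g], of k]
  by (rule eventually_mono) (simp add: opF_eq_cnj)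

lemma opF_cmult: "opF k (\<lambda>z. c * v z) z = c * opF k v z"
  unfolding opF_cauchy_bar cauchy_bar_cmult by simp

section \<open>Pairs of functions and the coupled system\<close>

lemma nrm_square: "nrm (square X) (u, v) = sqrt ((nrm X u)\<^sup>2 + (nrm X v)\<^sup>2)"
  by (simp add: square_def)

lemma elems_square [simp]: "(u, v) \<in> elems (square X) \<longleftrightarrow> u \<in> elems X \<and> v \<in> elems X"
  by (simp add: square_def)

lemma eqv_square [simp]: "eqv (square X) (u, v) (u', v') \<longleftrightarrow> eqv X u u' \<and> eqv X v v'"
  by (simp add: square_def)

lemma bounded_operator_square_mono:
  assumes "bounded_operator (square X) T C" "C \<le> D"
  shows "bounded_operator (square X) T D"
proof -
  have "0 \<le> nrm (square X) u" for u by (cases u) (simp add: nrm_square)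
  then show ?thesis
    using assms unfolding bounded_operator_def by (meson mult_right_mono order_trans)
qed

lemma nrm_square_le:
  assumes "nrm X u \<le> c * nrm Y u'" "nrm X v \<le> c * nrm Y v'" "0 \<le> nrm X u" "0 \<le> nrm X v" "0 \<le> c"
  shows "nrm (square X) (u, v) \<le> c * nrm (square Y) (u', v')"
proof -
  have "(nrm X u)\<^sup>2 + (nrm X v)\<^sup>2 \<le> (c * nrm Y u')\<^sup>2 + (c * nrm Y v')\<^sup>2"
    by (rule add_mono[OF power_mono[OF assms(1,3)] power_mono[OF assms(2,4)]])
  also have "\<dots> = c\<^sup>2 * ((nrm Y u')\<^sup>2 + (nrm Y v')\<^sup>2)" by (simp add: power_mult_distrib distrib_left)
  finally have "sqrt ((nrm X u)\<^sup>2 + (nrm X v)\<^sup>2) \<le> sqrt (c\<^sup>2 * ((nrm Y u')\<^sup>2 + (nrm Y v')\<^sup>2))"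
    by (rule real_sqrt_le_mono)
  then show ?thesis using assms(5) by (simp add: nrm_square real_sqrt_mult)
qed

context potential
begin

lemma potB_mem: "u \<in> elems (wL2 \<epsilon>) \<Longrightarrow> potB q k u \<in> elems (wL2 (\<epsilon> - 2))"
  unfolding potB_cnj by (rule wL2_cnj_mem[OF potA_mem[OF wL2_cnj_mem]])

text \<open>With the coupling term moved to the right, each line is a single equation whose right
  side \<open>v1\<close> or \<open>v2\<close> lies in <z>^(\<epsilon> - 2) L2, since the potentials
  map exponent \<epsilon> there. Almost everywhere additivity of E and F then splits off the given
  data.\<close>

lemma solves_system_iff:
  assumes k: "0 < hpar k" and E: "\<And>v. v \<in> elems (wL2 (\<epsilon> - 2)) \<Longrightarrow> opE k v \<in> elems (wL2 \<epsilon>)"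
    and f: "f \<in> elems (square (wL2 (\<epsilon> - 2)))" and \<phi>: "\<phi> \<in> elems (square (wL2 \<epsilon>))"
  shows "solves_system \<sigma> q k f \<phi> \<longleftrightarrow> solves_integral_system \<sigma> q k f \<phi>"
proof -
  obtain f1 f2 \<phi>1 \<phi>2 where fe: "f = (f1, f2)" and \<phi>e: "\<phi> = (\<phi>1, \<phi>2)" by (metis surj_pair)
  have f1: "f1 \<in> elems (wL2 (\<epsilon> - 2))" and f2: "f2 \<in> elems (wL2 (\<epsilon> - 2))"
    and \<phi>1: "\<phi>1 \<in> elems (wL2 \<epsilon>)" and \<phi>2: "\<phi>2 \<in> elems (wL2 \<epsilon>)"
    using f \<phi> unfolding fe \<phi>e by simp_all
  define v1 where "v1 = (\<lambda>z. potA q k \<phi>2 z + f1 z)"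
  define v2 where "v2 = (\<lambda>z. \<sigma> * potB q k \<phi>1 z + f2 z)"
  note a1 = potA_mem[OF \<phi>2, of k] and a2 = wL2_cmult(1)[OF potB_mem[OF \<phi>1, of k], of \<sigma>]
  have v1: "v1 \<in> elems (wL2 (\<epsilon> - 2))" and v2: "v2 \<in> elems (wL2 (\<epsilon> - 2))"
    unfolding v1_def v2_def by (rule wL2_add(1)[OF a1 f1], rule wL2_add(1)[OF a2 f2])
  have F: "opF k v2 \<in> elems (wL2 \<epsilon>)"
    using wL2_cnj_mem[OF E[OF wL2_cnj_mem[OF v2]]] unfolding opF_eq_cnj[abs_def] .
  have d1: "distr v1 \<eta> = distr (potA q k \<phi>2) \<eta> + distr f1 \<eta>" if "\<eta> \<in> test_functions" for \<eta>
    unfolding v1_def by (rule distr_add[OF a1 f1 that])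
  have d2: "distr v2 \<eta> = \<sigma> * distr (potB q k \<phi>1) \<eta> + distr f2 \<eta>" if "\<eta> \<in> test_functions" for \<eta>
  proof -
    have "distr (\<lambda>z. \<sigma> * potB q k \<phi>1 z) \<eta> = \<sigma> * distr (potB q k \<phi>1) \<eta>"
      unfolding distr_def mult.assoc by (rule integral_mult_right_zero)
    then show ?thesis unfolding v2_def using distr_add[OF a2 f2 that] by simp
  qed
  have A1: "AE z in lborel. opE k v1 z = opA q k \<phi>2 z + opE k f1 z"
    unfolding v1_def opA_def by (rule opE_add_AE[OF \<epsilon> a1 f1])
  have A2: "AE z in lborel. opF k v2 z = opB \<sigma> q k \<phi>1 z + opF k f2 z"
    using opF_add_AE[OF \<epsilon> a2 f2] unfolding v2_def opB_def opF_cmult .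
  have "solves_system \<sigma> q k f \<phi> \<longleftrightarrow>
      (\<forall>\<eta>\<in>test_functions. of_real (hpar k) * distr_delbar (distr \<phi>1) \<eta> = distr v1 \<eta>) \<and>
      (\<forall>\<eta>\<in>test_functions. of_real (hpar k) * distr_del (distr \<phi>2) \<eta> = distr v2 \<eta>)"
    unfolding solves_system_def fe \<phi>e prod.case ball_conj_distrib[symmetric]
    by (rule ball_cong[OF refl]) (simp add: d1 d2 diff_eq_eq add.commute)
  also have "\<dots> \<longleftrightarrow> (AE z in lborel. \<phi>1 z = opE k v1 z) \<and> (AE z in lborel. \<phi>2 z = opF k v2 z)"
    unfolding delbar_eq_iff[OF \<phi>1 v1 E[OF v1] \<epsilon>(2) k] del_eq_iff[OF \<phi>2 v2 F \<epsilon>(2) k] ..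
  also have "(AE z in lborel. \<phi>1 z = opE k v1 z) \<longleftrightarrow> (AE z in lborel. \<phi>1 z - opA q k \<phi>2 z = opE k f1 z)"
    by (rule AE_cong_eq[OF A1]) (simp add: diff_eq_eq add.commute)
  also have "(AE z in lborel. \<phi>2 z = opF k v2 z) \<longleftrightarrow> (AE z in lborel. \<phi>2 z - opB \<sigma> q k \<phi>1 z = opF k f2 z)"
    by (rule AE_cong_eq[OF A2]) (simp add: diff_eq_eq add.commute)
  finally show ?thesis unfolding solves_integral_system_def fe \<phi>e prod.case .
qed

text \<open>The integral system is (1 - K) \<phi> = (E f1, F f2) read componentwise.\<close>

lemma opK_eqv_iff:
  "eqv (square (wL2 \<epsilon>)) ((id - opK \<sigma> q k) \<phi>) (opE k (fst f), opF k (snd f)) \<longleftrightarrow> solves_integral_system \<sigma> q k f \<phi>"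
  by (cases \<phi>; cases f) (simp add: solves_integral_system_def opK_def op_matrix_def)

end

context potential
begin

text \<open>Stated for all unimodular \<sigma> at once because the bound for B A is that for A B at
  the conjugate of \<sigma>.\<close>

lemma opK_square_bounds:
  obtains C D where "0 \<le> C" "0 \<le> D"
    "\<And>\<sigma> k. cmod \<sigma> = 1 \<Longrightarrow> 0 < hpar k \<Longrightarrow> bounded_operator (wL2 \<epsilon>) (opA q k) C \<and> bounded_operator (wL2 \<epsilon>) (opB \<sigma> q k) C"
    "\<And>\<sigma> k. cmod \<sigma> = 1 \<Longrightarrow> 0 < hpar k \<Longrightarrow> hpar k \<le> 1 \<Longrightarrow>
      bounded_operator (wL2 \<epsilon>) (opA q k \<circ> opB \<sigma> q k) (D * hpar k powr (s - 1)) \<and>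
      bounded_operator (wL2 \<epsilon>) (opB \<sigma> q k \<circ> opA q k) (D * hpar k powr (s - 1))"
proof -
  interpret class_space "wL2 \<epsilon>" by (rule class_space_wL2)
  obtain C where C: "0 \<le> C" and A: "\<And>k. 0 < hpar k \<Longrightarrow> bounded_operator (wL2 \<epsilon>) (opA q k) C"
    using bounded_opA by blast
  obtain D where D: "0 \<le> D" and decay: "\<And>\<sigma> k u. cmod \<sigma> = 1 \<Longrightarrow> 0 < hpar k \<Longrightarrow> hpar k \<le> 1 \<Longrightarrow> u \<in> elems (wL2 \<epsilon>) \<Longrightarrow>
      nrm (wL2 \<epsilon>) (opA q k (opB \<sigma> q k u)) \<le> D * hpar k powr (s - 1) * nrm (wL2 \<epsilon>) u"
    using opA_opB_decay by blast
  have B: "bounded_operator (wL2 \<epsilon>) (opB \<sigma> q k) C" if "cmod \<sigma> = 1" "0 < hpar k" for \<sigma> k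
    by (rule bounded_opB[OF A[OF that(2)] that(1)])
  have AB: "bounded_operator (wL2 \<epsilon>) (opA q k \<circ> opB \<sigma> q k) (D * hpar k powr (s - 1))"
    if "cmod \<sigma> = 1" "0 < hpar k" "hpar k \<le> 1" for \<sigma> k
    using bo_comp[OF A[OF that(2)] B[OF that(1,2)] C] decay[OF that]
    unfolding bounded_operator_def comp_def by blast
  have BA: "bounded_operator (wL2 \<epsilon>) (opB \<sigma> q k \<circ> opA q k) (D * hpar k powr (s - 1))"
    if "cmod \<sigma> = 1" "0 < hpar k" "hpar k \<le> 1" for \<sigma> k
  proof -
    have "cmod (cnj \<sigma>) = 1" using that(1) by simp
    from bounded_operator_cnj[OF AB[OF this that(2,3)], of 1]
    show ?thesis by (simp add: comp_def opB_opA_cnj[abs_def])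
  qed
  show ?thesis
    by (rule that[OF C D]) (rule conjI[OF A B] conjI[OF AB BA]; assumption)+
qed

text \<open>The solution is R applied to (E f1, F f2). The bound e on E and F is the sole source of
  the factor 1 / h in the a priori estimate; uniqueness comes from R as a left inverse, existence
  from R as a right inverse.\<close>

lemma solve_system:
  assumes k: "0 < hpar k" and c: "0 \<le> c" and e: "0 \<le> e"
    and E: "\<And>v. v \<in> elems (wL2 (\<epsilon> - 2)) \<Longrightarrow> opE k v \<in> elems (wL2 \<epsilon>)"
      "\<And>v. v \<in> elems (wL2 (\<epsilon> - 2)) \<Longrightarrow> nrm (wL2 \<epsilon>) (opE k v) \<le> e * nrm (wL2 (\<epsilon> - 2)) v"
    and A: "bounded_operator (wL2 \<epsilon>) (opA q k) a" and B: "bounded_operator (wL2 \<epsilon>) (opB \<sigma> q k) a"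
    and R: "is_inverse (square (wL2 \<epsilon>)) (id - opK \<sigma> q k) R" "bounded_operator (square (wL2 \<epsilon>)) R c"
    and f: "f \<in> elems (square (wL2 (\<epsilon> - 2)))"
  shows "\<exists>\<phi>\<in>elems (square (wL2 \<epsilon>)). solves_system \<sigma> q k f \<phi> \<and>
    (\<forall>\<psi>\<in>elems (square (wL2 \<epsilon>)). solves_system \<sigma> q k f \<psi> \<longrightarrow> eqv (square (wL2 \<epsilon>)) \<psi> \<phi>) \<and>
    solves_integral_system \<sigma> q k f \<phi> \<and>
    nrm (square (wL2 \<epsilon>)) \<phi> \<le> c * e * nrm (square (wL2 (\<epsilon> - 2))) f"
proof -
  interpret class_space "wL2 \<epsilon>" by (rule class_space_wL2)
  let ?X = "square (wL2 \<epsilon>)"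
  obtain f1 f2 where fe: "f = (f1, f2)" by (rule prod.exhaust)
  have f1: "f1 \<in> elems (wL2 (\<epsilon> - 2))" and f2: "f2 \<in> elems (wL2 (\<epsilon> - 2))" using f unfolding fe by simp_all
  have F: "opF k v = (\<lambda>z. cnj (opE k (\<lambda>z. cnj (v z)) z))" for v by (simp add: opF_eq_cnj fun_eq_iff)
  have F2: "opF k f2 \<in> elems (wL2 \<epsilon>)" "nrm (wL2 \<epsilon>) (opF k f2) \<le> e * nrm (wL2 (\<epsilon> - 2)) f2"
    unfolding F wL2_cnj using wL2_cnj_mem[OF E(1)[OF wL2_cnj_mem[OF f2]]] E(2)[OF wL2_cnj_mem[OF f2]] by simp_all
  define Ef where "Ef = (opE k f1, opF k f2)"
  have Ef: "Ef \<in> elems ?X" unfolding Ef_def using E(1)[OF f1] F2(1) by simp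
  have Efn: "nrm ?X Ef \<le> e * nrm (square (wL2 (\<epsilon> - 2))) f"
    unfolding Ef_def fe by (rule nrm_square_le[OF E(2)[OF f1] F2(2) nrm_nonneg nrm_nonneg e])
  define \<phi> where "\<phi> = R Ef"
  have \<phi>: "\<phi> \<in> elems ?X" unfolding \<phi>_def using R(2) Ef unfolding bounded_operator_def by blast
  have iff: "eqv ?X ((id - opK \<sigma> q k) \<psi>) Ef \<longleftrightarrow> solves_integral_system \<sigma> q k f \<psi>" for \<psi>
    using opK_eqv_iff[of \<sigma> k \<psi> f] by (simp add: Ef_def fe)
  have sys: "solves_system \<sigma> q k f \<psi> \<longleftrightarrow> solves_integral_system \<sigma> q k f \<psi>" if "\<psi> \<in> elems ?X" for \<psi>
    by (rule solves_system_iff[OF k _ f that]) (rule E(1))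
  have "eqv ?X ((id - opK \<sigma> q k) \<phi>) Ef"
    using R(1) Ef unfolding is_inverse_def operator_eq_def \<phi>_def by simp
  then have int: "solves_integral_system \<sigma> q k f \<phi>" unfolding iff .
  have uni: "eqv ?X \<psi> \<phi>" if \<psi>: "\<psi> \<in> elems ?X" and s: "solves_system \<sigma> q k f \<psi>" for \<psi>
  proof -
    have K: "(id - opK \<sigma> q k) \<psi> \<in> elems ?X"
      using \<psi> by (cases \<psi>) (simp add: opK_def op_matrix_def diff_mem bo_mem[OF A] bo_mem[OF B])
    have "eqv ?X ((id - opK \<sigma> q k) \<psi>) Ef" using s unfolding iff sys[OF \<psi>] .
    then have 1: "eqv ?X (R ((id - opK \<sigma> q k) \<psi>)) \<phi>"
      using R(2) K Ef unfolding bounded_operator_def \<phi>_def by blast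
    have 2: "eqv ?X (R ((id - opK \<sigma> q k) \<psi>)) \<psi>"
      using R(1) \<psi> unfolding is_inverse_def operator_eq_def by simp
    obtain r1 r2 \<psi>1 \<psi>2 \<phi>1 \<phi>2 where r: "R ((id - opK \<sigma> q k) \<psi>) = (r1, r2)" "\<psi> = (\<psi>1, \<psi>2)" "\<phi> = (\<phi>1, \<phi>2)"
      by (metis surj_pair)
    have "eqv (wL2 \<epsilon>) \<psi>1 \<phi>1" "eqv (wL2 \<epsilon>) \<psi>2 \<phi>2"
      using 1 2 unfolding r(1) unfolding r(2,3) eqv_square by (blast intro: eqv_trans[OF eqv_sym])+
    then show ?thesis unfolding r(2,3) eqv_square by blast
  qed
  have "nrm ?X \<phi> \<le> c * nrm ?X Ef" using R(2) Ef unfolding bounded_operator_def \<phi>_def by blast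
  also have "\<dots> \<le> c * (e * nrm (square (wL2 (\<epsilon> - 2))) f)" by (rule mult_left_mono[OF Efn c])
  finally have n: "nrm ?X \<phi> \<le> c * e * nrm (square (wL2 (\<epsilon> - 2))) f" by (simp add: mult.assoc)
  show ?thesis
    using int n uni by (intro bexI[OF _ \<phi>] conjI ballI impI) (simp_all add: sys[OF \<phi>])
qed

end

theorem proposition3p1:
  fixes q :: "complex \<Rightarrow> complex" and \<sigma> :: complex and s \<epsilon> :: real
  assumes "\<sigma> \<in> {1, -1}"
    and "1 < s" and "s \<le> 2"
    and "weight 2 q \<in> sobolev s"
    and "0 < \<epsilon>" and "\<epsilon> \<le> 1"
  shows "op_bigo (square (wL2 \<epsilon>)) (\<lambda>k. opK \<sigma> q k) (\<lambda>h. 1) \<and>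
    op_bigo (square (wL2 \<epsilon>)) (\<lambda>k. opK \<sigma> q k \<circ> opK \<sigma> q k) (\<lambda>h. h powr (s - 1)) \<and>
    (\<exists>h0>0. \<exists>C. \<forall>k. 0 < hpar k \<and> hpar k \<le> h0 \<longrightarrow>
      (\<exists>R S P Q.
        is_inverse (square (wL2 \<epsilon>)) (id - opK \<sigma> q k) R \<and>
        bounded_operator (square (wL2 \<epsilon>)) R C \<and>
        is_inverse (square (wL2 \<epsilon>)) (id - (opK \<sigma> q k \<circ> opK \<sigma> q k)) S \<and>
        is_inverse (wL2 \<epsilon>) (id - (opA q k \<circ> opB \<sigma> q k)) P \<and>
        is_inverse (wL2 \<epsilon>) (id - (opB \<sigma> q k \<circ> opA q k)) Q \<and>
        operator_eq (square (wL2 \<epsilon>)) R (S \<circ> (id + opK \<sigma> q k)) \<and>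
        operator_eq (square (wL2 \<epsilon>)) R
          (op_matrix P 0 0 Q \<circ> op_matrix id (opA q k) (opB \<sigma> q k) id)) \<and>
      (\<forall>f \<in> elems (square (wL2 (\<epsilon> - 2))).
        \<exists>\<phi> \<in> elems (square (wL2 \<epsilon>)).
          solves_system \<sigma> q k f \<phi> \<and>
          (\<forall>\<psi> \<in> elems (square (wL2 \<epsilon>)).
            solves_system \<sigma> q k f \<psi> \<longrightarrow> eqv (square (wL2 \<epsilon>)) \<psi> \<phi>) \<and>
          solves_integral_system \<sigma> q k f \<phi> \<and>
          nrm (square (wL2 \<epsilon>)) \<phi> \<le> C / hpar k * nrm (square (wL2 (\<epsilon> - 2))) f))"
proof -
  have \<sigma>: "cmod \<sigma> = 1" using assms(1) by auto
  interpret class_space "wL2 \<epsilon>" by (rule class_space_wL2)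
  obtain g where g: "g \<in> elems (wL2 (- s))" and qg: "AE z in lborel. weight 2 q z = inverse_fourier g z"
    using sobolev_representation[OF assms(4,2)] by blast
  have qw: "q = weight (- 2) (weight 2 q)" by (simp add: weight_weight)
  have "weight 2 q \<in> borel_measurable borel" using assms(4) by (simp add: sobolev_def L2_iff)
  then have qm: "q \<in> borel_measurable borel" by (subst qw) (rule measurable_weight)
  have "AE z in lborel. q z = of_real (jbracket z powr (- 2)) * inverse_fourier g z"
    using qg by (rule eventually_mono) (subst qw, simp add: weight_def[of "- 2"])
  with assms qm g interpret potential q g s \<epsilon> "LINT \<zeta>|lborel. cmod (g \<zeta>)"
    by unfold_locales auto
  obtain C D where C: "0 \<le> C" and D: "0 \<le> D"
    and ops: "\<And>\<sigma> k. cmod \<sigma> = 1 \<Longrightarrow> 0 < hpar k \<Longrightarrow> bounded_operator (wL2 \<epsilon>) (opA q k) C \<and> bounded_operator (wL2 \<epsilon>) (opB \<sigma> q k) C"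
    and sq: "\<And>\<sigma> k. cmod \<sigma> = 1 \<Longrightarrow> 0 < hpar k \<Longrightarrow> hpar k \<le> 1 \<Longrightarrow>
      bounded_operator (wL2 \<epsilon>) (opA q k \<circ> opB \<sigma> q k) (D * hpar k powr (s - 1)) \<and>
      bounded_operator (wL2 \<epsilon>) (opB \<sigma> q k \<circ> opA q k) (D * hpar k powr (s - 1))"
    by (rule opK_square_bounds) (rule that)
  obtain CE where CE: "0 \<le> CE"
    and E: "\<And>k f. 0 < hpar k \<Longrightarrow> f \<in> elems (wL2 (\<epsilon> - 2)) \<Longrightarrow> opE k f \<in> elems (wL2 \<epsilon>)"
      "\<And>k f. 0 < hpar k \<Longrightarrow> f \<in> elems (wL2 (\<epsilon> - 2)) \<Longrightarrow> nrm (wL2 \<epsilon>) (opE k f) \<le> CE / hpar k * nrm (wL2 (\<epsilon> - 2)) f"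
    by (rule wnorm2_opE[OF assms(5,6)]) (rule that)
  have A: "bounded_operator (wL2 \<epsilon>) (opA q k) C" and B: "bounded_operator (wL2 \<epsilon>) (opB \<sigma> q k) C"
    if "0 < hpar k" for k
    using ops[OF \<sigma> that] by simp_all
  have AB: "bounded_operator (wL2 \<epsilon>) (opA q k \<circ> opB \<sigma> q k) (D * hpar k powr (s - 1))"
    and BA: "bounded_operator (wL2 \<epsilon>) (opB \<sigma> q k \<circ> opA q k) (D * hpar k powr (s - 1))"
    if "0 < hpar k" "hpar k \<le> 1" for k
    using sq[OF \<sigma> that] by simp_all
  have K1: "op_bigo (square (wL2 \<epsilon>)) (\<lambda>k. opK \<sigma> q k) (\<lambda>h. 1)"
    unfolding op_bigo_def
  proof (rule exI[of _ "2 * C"], rule exI[of _ 1], intro conjI allI impI)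
    fix k assume "0 < hpar k \<and> hpar k \<le> 1"
    then have k: "0 < hpar k" by simp
    show "bounded_operator (square (wL2 \<epsilon>)) (opK \<sigma> q k) (2 * C * 1)"
      using bounded_op_matrix[OF bo_null A[OF k] B[OF k] bo_null order_refl C C order_refl] by (simp add: opK_def)
  qed simp
  have K2: "op_bigo (square (wL2 \<epsilon>)) (\<lambda>k. opK \<sigma> q k \<circ> opK \<sigma> q k) (\<lambda>h. h powr (s - 1))"
    unfolding op_bigo_def
  proof (rule exI[of _ "2 * D"], rule exI[of _ 1], intro conjI allI impI)
    fix k assume "0 < hpar k \<and> hpar k \<le> 1"
    then have k: "0 < hpar k" "hpar k \<le> 1" by simp_all
    have D0: "0 \<le> D * hpar k powr (s - 1)" using D by simp
    show "bounded_operator (square (wL2 \<epsilon>)) (opK \<sigma> q k \<circ> opK \<sigma> q k) (2 * D * hpar k powr (s - 1))"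
      using bounded_op_matrix[OF AB[OF k] bo_null bo_null BA[OF k] D0 order_refl order_refl D0]
      unfolding opK_def op_matrix_square by (simp add: mult.assoc)
  qed simp
  \<comment> \<open>Solves D h^(s - 1) <= 1/2, with D + 1 in place of D to cover D = 0; the minimum
    with 1 keeps h in the range of the decay estimate. Half suffices for the Neumann series of 1 - A
    B and 1 - B A with inverses of norm at most 2.\<close>
  define h0 where "h0 = min 1 ((1 / (2 * (D + 1))) powr (1 / (s - 1)))"
  have h0: "0 < h0" "h0 \<le> 1" using D by (auto simp: h0_def)
  have half: "D * h powr (s - 1) \<le> 1 / 2" if "0 < h" "h \<le> h0" for h
  proof -
    have "h powr (s - 1) \<le> ((1 / (2 * (D + 1))) powr (1 / (s - 1))) powr (s - 1)"
      using that assms(2) by (intro powr_mono2) (auto simp: h0_def)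
    also have "\<dots> = 1 / (2 * (D + 1))" using assms(2) D by (simp add: powr_powr)
    finally have "D * h powr (s - 1) \<le> D * (1 / (2 * (D + 1)))" by (rule mult_left_mono[OF _ D])
    also have "\<dots> \<le> 1 / 2" using D by (simp add: field_simps)
    finally show ?thesis .
  qed
  \<comment> \<open>The constant of \<open>antidiagonal_inverse\<close> for a = b = C.\<close>
  define c where "c = 4 + 2 * C + 2 * C"
  \<comment> \<open>The theorem asks for one constant: C' dominates both the norm c of the inverse
    and the factor c CE of the a priori estimate.\<close>
  define C' where "C' = c * (1 + CE)"
  have c: "0 \<le> c" using C by (simp add: c_def)
  have cC: "c \<le> C'" "c * CE \<le> C'" using c CE by (simp_all add: C'_def distrib_left)
  show ?thesis
  proof (intro conjI K1 K2, rule exI[of _ h0], intro conjI exI[of _ C'] allI impI)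
    fix k assume "0 < hpar k \<and> hpar k \<le> h0"
    then have k: "0 < hpar k" "hpar k \<le> h0" "hpar k \<le> 1" using h0 by auto
    note AB2 = bo_mono[OF AB[OF k(1,3)] half[OF k(1,2)]] and BA2 = bo_mono[OF BA[OF k(1,3)] half[OF k(1,2)]]
    have "0 < (1 / 2 :: real)" by simp
    note inv = antidiagonal_inverse[OF A[OF k(1)] B[OF k(1)] C C AB2 BA2 this order_refl, folded opK_def c_def]
    obtain R S P Q where RI: "is_inverse (square (wL2 \<epsilon>)) (id - opK \<sigma> q k) R"
      and Rc: "bounded_operator (square (wL2 \<epsilon>)) R c"
      and SPQ: "is_inverse (square (wL2 \<epsilon>)) (id - (opK \<sigma> q k \<circ> opK \<sigma> q k)) S"
        "is_inverse (wL2 \<epsilon>) (id - (opA q k \<circ> opB \<sigma> q k)) P"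
        "is_inverse (wL2 \<epsilon>) (id - (opB \<sigma> q k \<circ> opA q k)) Q"
        "operator_eq (square (wL2 \<epsilon>)) R (S \<circ> (id + opK \<sigma> q k))"
        "operator_eq (square (wL2 \<epsilon>)) R (op_matrix P 0 0 Q \<circ> op_matrix id (opA q k) (opB \<sigma> q k) id)"
      using inv by blast
    have RC: "bounded_operator (square (wL2 \<epsilon>)) R C'" by (rule bounded_operator_square_mono[OF Rc cC(1)])
    show "\<exists>R S P Q.
        is_inverse (square (wL2 \<epsilon>)) (id - opK \<sigma> q k) R \<and>
        bounded_operator (square (wL2 \<epsilon>)) R C' \<and>
        is_inverse (square (wL2 \<epsilon>)) (id - (opK \<sigma> q k \<circ> opK \<sigma> q k)) S \<and>
        is_inverse (wL2 \<epsilon>) (id - (opA q k \<circ> opB \<sigma> q k)) P \<and>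
        is_inverse (wL2 \<epsilon>) (id - (opB \<sigma> q k \<circ> opA q k)) Q \<and>
        operator_eq (square (wL2 \<epsilon>)) R (S \<circ> (id + opK \<sigma> q k)) \<and>
        operator_eq (square (wL2 \<epsilon>)) R
          (op_matrix P 0 0 Q \<circ> op_matrix id (opA q k) (opB \<sigma> q k) id)"
      by (rule exI[of _ R], rule exI[of _ S], rule exI[of _ P], rule exI[of _ Q]) (use RI RC SPQ in \<open>intro conjI\<close>)
    show "\<forall>f \<in> elems (square (wL2 (\<epsilon> - 2))).
        \<exists>\<phi> \<in> elems (square (wL2 \<epsilon>)).
          solves_system \<sigma> q k f \<phi> \<and>
          (\<forall>\<psi> \<in> elems (square (wL2 \<epsilon>)).
            solves_system \<sigma> q k f \<psi> \<longrightarrow> eqv (square (wL2 \<epsilon>)) \<psi> \<phi>) \<and>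
          solves_integral_system \<sigma> q k f \<phi> \<and>
          nrm (square (wL2 \<epsilon>)) \<phi> \<le> C' / hpar k * nrm (square (wL2 (\<epsilon> - 2))) f"
    proof
      fix f assume f: "f \<in> elems (square (wL2 (\<epsilon> - 2)))"
      have e: "0 \<le> CE / hpar k" using CE k(1) by simp
      have "0 \<le> nrm (square (wL2 (\<epsilon> - 2))) f" by (cases f) (simp add: nrm_square)
      moreover have "c * (CE / hpar k) \<le> C' / hpar k" using cC(2) k(1) by (simp add: divide_right_mono)
      ultimately have "c * (CE / hpar k) * nrm (square (wL2 (\<epsilon> - 2))) f \<le> C' / hpar k * nrm (square (wL2 (\<epsilon> - 2))) f"
        by (rule mult_right_mono[rotated])
      with solve_system[OF k(1) c e E(1)[OF k(1)] E(2)[OF k(1)] A[OF k(1)] B[OF k(1)] RI Rc f]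
      show "\<exists>\<phi> \<in> elems (square (wL2 \<epsilon>)).
          solves_system \<sigma> q k f \<phi> \<and>
          (\<forall>\<psi> \<in> elems (square (wL2 \<epsilon>)).
            solves_system \<sigma> q k f \<psi> \<longrightarrow> eqv (square (wL2 \<epsilon>)) \<psi> \<phi>) \<and>
          solves_integral_system \<sigma> q k f \<phi> \<and>
          nrm (square (wL2 \<epsilon>)) \<phi> \<le> C' / hpar k * nrm (square (wL2 (\<epsilon> - 2))) f"
        by (meson order_trans)
    qed
  qed (rule h0)
qed

end
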